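(* Let $J$ be an $m\times m$ signature matrix, $n\in\mathbb N_0$, $(A_j)_{j=0}^n$ a $J$-Potapov sequence, $f_{c,n}$ the $J$-central $J$-Potapov function corresponding to $(A_j)_{j=0}^n$, and $f_{c,n}^\diamondsuit$ its unique rational extension. The following are equivalent: (i) $f_{c,n}$ is the unique $f\in\mathcal P_{J,0}(\mathbb D)$ with $f^{(j)}(0)/j!=A_j$ for $j=0,\dots,n$; (ii) $f_{c,n}^\diamondsuit$ is a finite Blaschke–Potapov product with respect to $J$; (iii) $f_{c,n}$ is $J$-inner; (iv) there exists $z\in\mathbb T\setminus(\mathcal N_{\rho_{n,J}}\cap\mathcal N_{\tau_{n,J}})$ such that $f_{c,n}^\diamondsuit(z)$ is $J$-unitary, where $\rho_{n,J},\tau_{n,J}$ are associated polynomials built with some $V_n\in\mathcal Y_{n,J}$, $W_n\in\mathcal Z_{n,J}$ (if $n\ge1$).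
   Context: $\mathbb D=\{|z|<1\}$, $\mathbb T=\{|z|=1\}$. An $m\times m$ signature matrix is $J\in\mathbb C^{m\times m}$ with $J^*=J$, $J^2=I_m$. $A$ is $J$-contractive if $J-A^*JA\ge0$ and $J$-unitary if $A^*JA=J$. $\mathcal P_J(\mathbb D)$: $\mathbb C^{m\times m}$-valued $f$ meromorphic in $\mathbb D$ with $f(w)$ $J$-contractive at every point of holomorphy; $\mathcal P_{J,0}(\mathbb D)$: those holomorphic at $0$. Every $f\in\mathcal P_J(\mathbb D)$ has radial boundary values $\lim_{r\to1-}f(rz)$ for a.e. $z\in\mathbb T$ (Lebesgue measure); $f$ is $J$-inner if these are $J$-unitary a.e. on $\mathbb T$. For $k\in\mathbb N_0$, $S_k$ is the block lower triangular Toeplitz matrix with $(i,l)$ block $A_{i-l}$ ($i\ge l$), $0$ otherwise; $J_{[k]}:=\mathrm{diag}(J,\dots,J)$ ($k+1$ blocks). $(A_j)_{j=0}^n$ is a $J$-Potapov sequence if $J_{[n]}-S_n^*J_{[n]}S_n\ge0$. $P_{k,J}:=J_{[k]}-S_kJ_{[k]}S_k^*$, $Q_{k,J}:=J_{[k]}-S_k^*J_{[k]}S_k$, $y_k:=(A_1^*,\dots,A_k^* )^*$, $z_k:=(A_k,\dots,A_1)$, $X^+$ Moore–Penrose inverse; $M_{1,J}:=0$, $M_{k+1,J}:=-z_kJ_{[k-1]}S_{k-1}^*P_{k-1,J}^+y_k$ ($k\ge1$). The $J$-central sequence extends $(A_j)_{j=0}^n$ by $A_k:=M_{k,J}$ for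 $k\ge n+1$; the $J$-central $J$-Potapov function $f_{c,n}$ is the unique element of $\mathcal P_{J,0}(\mathbb D)$ with these Taylor coefficients. For $n\ge1$: $\mathcal Y_{n,J}:=\{V:Q_{n-1,J}V=S_{n-1}^*J_{[n-1]}y_n\}$, $\mathcal Z_{n,J}:=\{W:WP_{n-1,J}=z_nJ_{[n-1]}S_{n-1}^*\}$; with $e_{k,m}(w)=(I_m,\dots,w^kI_m)$, $\varepsilon_{k,m}(w)=$ block column $(w^kI_m;\dots;I_m)$: $\pi_{n,J}(w)=A_0+we_{n-1,m}(w)(y_n+S_{n-1}V_n)$, $\rho_{n,J}(w)=I_m+we_{n-1,m}(w)V_n$, $\sigma_{n,J}(w)=(W_nS_{n-1}+z_n)w\varepsilon_{n-1,m}(w)+A_0$, $\tau_{n,J}(w)=W_nw\varepsilon_{n-1,m}(w)+I_m$ ($\pi_{0,J}=\sigma_{0,J}=A_0$, $\rho_{0,J}=\tau_{0,J}=I_m$). It is known that $f_{c,n}=\pi_{n,J}\rho_{n,J}^{-1}=\tau_{n,J}^{-1}\sigma_{n,J}$ on $\mathbb D$; hence $f_{c,n}$ has a unique rational extension $f_{c,n}^\diamondsuit$ to $\mathbb C$ minus finitely many points. For a square matrix polynomial $\beta$, $\mathcal N_\beta:=\{w\in\mathbb C:\det\beta(w)=0\}$. Blaschke–Potapov factors: for $\alpha\in\mathbb D$, $b_\alpha(w):=w$ if $\alpha=0$, $b_\alpha(w):=\frac{|\alpha|}{\alpha}\frac{\alpha-w}{1-\bar\alpha w}$ otherwise. First kind: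 $B_{\alpha,P}(w):=I_m+(b_\alpha(w)-1)P$ with $P\ne0$, $JP\ge0$, $P^2=P$. Second kind: $C_{\alpha,Q}(w):=I_m+(1/b_\alpha(w)-1)Q$ with $Q\neq0$, $-JQ\ge0$, $Q^2=Q$. Third kind: $D_{u,R}(w):=I_m-\frac{u+w}{u-w}R$ with $u\in\mathbb T$, $R\ne0$, $JR\ge0$, $R^2=0$. A finite Blaschke–Potapov product with respect to $J$ is an $m\times m$ function meromorphic in $\mathbb C$ which is either constant with $J$-unitary value or of the form $B_1\cdots B_N$ ($N\in\mathbb N$), each $B_j=U_j\tilde B_jV_j$ with constant $J$-unitary $U_j,V_j$ and $\tilde B_j$ an elementary factor of first, second or third kind. *)

theory Defs
  imports "HOL-Analysis.Analysis" "Jordan_Normal_Form.Determinant"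
begin

definition adj :: "complex mat \<Rightarrow> complex mat" where
  "adj X = mat (dim_col X) (dim_row X) (\<lambda>(i,j). cnj (X $$ (j,i)))"

definition psd :: "complex mat \<Rightarrow> bool" where
  "psd X \<longleftrightarrow> dim_row X = dim_col X \<and>
     (\<forall>v :: nat \<Rightarrow> complex.
        let q = (\<Sum>i<dim_row X. \<Sum>j<dim_row X. cnj (v i) * X $$ (i,j) * v j)
        in Im q = 0 \<and> Re q \<ge> 0)"

definition mp_inv :: "complex mat \<Rightarrow> complex mat" where
  "mp_inv X = (THE Y. Y \<in> carrier_mat (dim_col X) (dim_row X) \<and>
       X * Y * X = X \<and> Y * X * Y = Y \<and> adj (X * Y) = X * Y \<and> adj (Y * X) = Y * X)"

definition signature_mat :: "nat \<Rightarrow> complex mat \<Rightarrow> bool" where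
  "signature_mat m J \<longleftrightarrow> J \<in> carrier_mat m m \<and> adj J = J \<and> J * J = 1\<^sub>m m"

definition J_contractive :: "complex mat \<Rightarrow> complex mat \<Rightarrow> bool" where
  "J_contractive J X \<longleftrightarrow> psd (J - adj X * J * X)"

definition J_unitary :: "complex mat \<Rightarrow> complex mat \<Rightarrow> bool" where
  "J_unitary J X \<longleftrightarrow> adj X * J * X = J"

definition S_blk :: "nat \<Rightarrow> (nat \<Rightarrow> complex mat) \<Rightarrow> nat \<Rightarrow> complex mat" where
  "S_blk m A k = mat ((k+1)*m) ((k+1)*m)
     (\<lambda>(a,b). if b div m \<le> a div m then A (a div m - b div m) $$ (a mod m, b mod m) else 0)"

definition J_blk :: "nat \<Rightarrow> complex mat \<Rightarrow> nat \<Rightarrow> complex mat" where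
  "J_blk m J k = mat ((k+1)*m) ((k+1)*m)
     (\<lambda>(a,b). if a div m = b div m then J $$ (a mod m, b mod m) else 0)"

definition P_mat :: "nat \<Rightarrow> complex mat \<Rightarrow> (nat \<Rightarrow> complex mat) \<Rightarrow> nat \<Rightarrow> complex mat" where
  "P_mat m J A k = J_blk m J k - S_blk m A k * J_blk m J k * adj (S_blk m A k)"

definition Q_mat :: "nat \<Rightarrow> complex mat \<Rightarrow> (nat \<Rightarrow> complex mat) \<Rightarrow> nat \<Rightarrow> complex mat" where
  "Q_mat m J A k = J_blk m J k - adj (S_blk m A k) * J_blk m J k * S_blk m A k"

definition y_vec :: "nat \<Rightarrow> (nat \<Rightarrow> complex mat) \<Rightarrow> nat \<Rightarrow> complex mat" where
  "y_vec m A k = mat (k*m) m (\<lambda>(a,b). A (a div m + 1) $$ (a mod m, b))"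

definition z_vec :: "nat \<Rightarrow> (nat \<Rightarrow> complex mat) \<Rightarrow> nat \<Rightarrow> complex mat" where
  "z_vec m A k = mat m (k*m) (\<lambda>(a,b). A (k - b div m) $$ (a, b mod m))"

definition M_mat :: "nat \<Rightarrow> complex mat \<Rightarrow> (nat \<Rightarrow> complex mat) \<Rightarrow> nat \<Rightarrow> complex mat" where
  "M_mat m J A k = (if k \<le> 1 then 0\<^sub>m m m else
     (let k' = k - 1 in
       - (z_vec m A k' * J_blk m J (k'-1) * adj (S_blk m A (k'-1))
           * mp_inv (P_mat m J A (k'-1)) * y_vec m A k')))"

definition J_Potapov_seq :: "nat \<Rightarrow> complex mat \<Rightarrow> (nat \<Rightarrow> complex mat) \<Rightarrow> nat \<Rightarrow> bool" where
  "J_Potapov_seq m J A n \<longleftrightarrow> (\<forall>j\<le>n. A j \<in> carrier_mat m m) \<and>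
     psd (J_blk m J n - adj (S_blk m A n) * J_blk m J n * S_blk m A n)"

abbreviation "DD \<equiv> ball (0::complex) 1"

definition mat_norm1 :: "complex mat \<Rightarrow> real" where
  "mat_norm1 X = (\<Sum>i<dim_row X. \<Sum>j<dim_col X. cmod (X $$ (i,j)))"

definition mero_disc :: "nat \<Rightarrow> (complex \<Rightarrow> complex mat) \<Rightarrow> complex set \<Rightarrow> bool" where
  "mero_disc m f S \<longleftrightarrow> S \<subseteq> DD \<and> (\<forall>z\<in>DD. \<not> z islimpt S) \<and>
     (\<forall>w\<in>DD - S. f w \<in> carrier_mat m m) \<and>
     (\<forall>i<m. \<forall>j<m. (\<lambda>w. f w $$ (i,j)) holomorphic_on (DD - S)) \<and>
     (\<forall>s\<in>S. filterlim (\<lambda>w. mat_norm1 (f w)) at_top (at s) \<and>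
        (\<forall>i<m. \<forall>j<m. \<exists>k::nat. \<exists>B. eventually (\<lambda>w. cmod ((w - s)^k * f w $$ (i,j)) \<le> B) (at s)))"

definition PJ :: "nat \<Rightarrow> complex mat \<Rightarrow> (complex \<Rightarrow> complex mat) \<Rightarrow> bool" where
  "PJ m J f \<longleftrightarrow> (\<exists>S. mero_disc m f S \<and> (\<forall>w\<in>DD - S. J_contractive J (f w)))"

definition PJ0 :: "nat \<Rightarrow> complex mat \<Rightarrow> (complex \<Rightarrow> complex mat) \<Rightarrow> bool" where
  "PJ0 m J f \<longleftrightarrow> (\<exists>S. mero_disc m f S \<and> 0 \<notin> S \<and> (\<forall>w\<in>DD - S. J_contractive J (f w)))"

definition mero_eq :: "(complex \<Rightarrow> complex mat) \<Rightarrow> (complex \<Rightarrow> complex mat) \<Rightarrow> bool" where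
  "mero_eq f g \<longleftrightarrow> (\<exists>S. (\<forall>z\<in>DD. \<not> z islimpt S) \<and> (\<forall>w\<in>DD - S. f w = g w))"

definition taylor0 :: "nat \<Rightarrow> (complex \<Rightarrow> complex mat) \<Rightarrow> nat \<Rightarrow> complex mat" where
  "taylor0 m f j = mat m m (\<lambda>(i,l). (deriv ^^ j) (\<lambda>w. f w $$ (i,l)) 0 / of_nat (fact j))"

definition J_central_fun :: "nat \<Rightarrow> complex mat \<Rightarrow> (nat \<Rightarrow> complex mat) \<Rightarrow> nat
     \<Rightarrow> (complex \<Rightarrow> complex mat) \<Rightarrow> bool" where
  "J_central_fun m J A n f \<longleftrightarrow> PJ0 m J f \<and>
     (\<forall>j\<le>n. taylor0 m f j = A j) \<and>
     (\<forall>k>n. taylor0 m f k = M_mat m J (taylor0 m f) k)"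

definition J_inner :: "nat \<Rightarrow> complex mat \<Rightarrow> (complex \<Rightarrow> complex mat) \<Rightarrow> bool" where
  "J_inner m J f \<longleftrightarrow> PJ m J f \<and>
     (\<exists>N. N \<in> null_sets lborel \<and> (\<forall>t. t \<notin> N \<longrightarrow>
        (\<exists>L\<in>carrier_mat m m. J_unitary J L \<and>
           (\<forall>i<m. \<forall>j<m. ((\<lambda>r::real. f (of_real r * cis t) $$ (i,j)) \<longlongrightarrow> L $$ (i,j)) (at_left 1)))))"

definition rational_ext :: "nat \<Rightarrow> (complex \<Rightarrow> complex mat) \<Rightarrow> (complex \<Rightarrow> complex mat) \<Rightarrow> bool" where
  "rational_ext m f F \<longleftrightarrow> (\<exists>E. finite E \<and>
     (\<forall>w. w \<notin> E \<longrightarrow> F w \<in> carrier_mat m m) \<and>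
     (\<forall>i<m. \<forall>j<m. (\<lambda>w. F w $$ (i,j)) holomorphic_on (- E)) \<and>
     (\<forall>i<m. \<forall>j<m. \<exists>p q :: complex poly. q \<noteq> 0 \<and>
         (\<forall>w. w \<notin> E \<longrightarrow> F w $$ (i,j) = poly p w / poly q w)) \<and>
     (\<forall>e\<in>E. filterlim (\<lambda>w. mat_norm1 (F w)) at_top (at e)) \<and>
     (\<forall>w\<in>DD - E. F w = f w))"

definition e_row :: "nat \<Rightarrow> nat \<Rightarrow> complex \<Rightarrow> complex mat" where
  "e_row m k w = mat m ((k+1)*m) (\<lambda>(a,b). if a = b mod m then w ^ (b div m) else 0)"

definition eps_col :: "nat \<Rightarrow> nat \<Rightarrow> complex \<Rightarrow> complex mat" where
  "eps_col m k w = mat ((k+1)*m) m (\<lambda>(a,b). if a mod m = b then w ^ (k - a div m) else 0)"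

definition Y_set :: "nat \<Rightarrow> complex mat \<Rightarrow> (nat \<Rightarrow> complex mat) \<Rightarrow> nat \<Rightarrow> complex mat set" where
  "Y_set m J A n = {V. V \<in> carrier_mat (n*m) m \<and>
      Q_mat m J A (n-1) * V = adj (S_blk m A (n-1)) * J_blk m J (n-1) * y_vec m A n}"

definition Z_set :: "nat \<Rightarrow> complex mat \<Rightarrow> (nat \<Rightarrow> complex mat) \<Rightarrow> nat \<Rightarrow> complex mat set" where
  "Z_set m J A n = {W. W \<in> carrier_mat m (n*m) \<and>
      W * P_mat m J A (n-1) = z_vec m A n * J_blk m J (n-1) * adj (S_blk m A (n-1))}"

definition rho_poly :: "nat \<Rightarrow> nat \<Rightarrow> complex mat \<Rightarrow> complex \<Rightarrow> complex mat" where
  "rho_poly m n V w = (if n = 0 then 1\<^sub>m m else 1\<^sub>m m + w \<cdot>\<^sub>m (e_row m (n-1) w * V))"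

definition tau_poly :: "nat \<Rightarrow> nat \<Rightarrow> complex mat \<Rightarrow> complex \<Rightarrow> complex mat" where
  "tau_poly m n W w = (if n = 0 then 1\<^sub>m m else W * (w \<cdot>\<^sub>m eps_col m (n-1) w) + 1\<^sub>m m)"

definition b_fac :: "complex \<Rightarrow> complex \<Rightarrow> complex" where
  "b_fac \<alpha> w = (if \<alpha> = 0 then w else (of_real (cmod \<alpha>) / \<alpha>) * ((\<alpha> - w) / (1 - cnj \<alpha> * w)))"

definition elem_factor :: "nat \<Rightarrow> complex mat \<Rightarrow> (complex \<Rightarrow> complex mat) \<Rightarrow> bool" where
  "elem_factor m J B \<longleftrightarrow>
     (\<exists>\<alpha> P. cmod \<alpha> < 1 \<and> P \<in> carrier_mat m m \<and> P \<noteq> 0\<^sub>m m m \<and> psd (J * P) \<and> P * P = P \<and>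
        B = (\<lambda>w. 1\<^sub>m m + (b_fac \<alpha> w - 1) \<cdot>\<^sub>m P)) \<or>
     (\<exists>\<alpha> Q. cmod \<alpha> < 1 \<and> Q \<in> carrier_mat m m \<and> Q \<noteq> 0\<^sub>m m m \<and> psd (- (J * Q)) \<and> Q * Q = Q \<and>
        B = (\<lambda>w. 1\<^sub>m m + (1 / b_fac \<alpha> w - 1) \<cdot>\<^sub>m Q)) \<or>
     (\<exists>u R. cmod u = 1 \<and> R \<in> carrier_mat m m \<and> R \<noteq> 0\<^sub>m m m \<and> psd (J * R) \<and> R * R = 0\<^sub>m m m \<and>
        B = (\<lambda>w. 1\<^sub>m m - ((u + w) / (u - w)) \<cdot>\<^sub>m R))"

definition BP_factor :: "nat \<Rightarrow> complex mat \<Rightarrow> (complex \<Rightarrow> complex mat) \<Rightarrow> bool" where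
  "BP_factor m J B \<longleftrightarrow> (\<exists>U V Bt. U \<in> carrier_mat m m \<and> V \<in> carrier_mat m m \<and>
      J_unitary J U \<and> J_unitary J V \<and> elem_factor m J Bt \<and> B = (\<lambda>w. U * Bt w * V))"

text \<open>Finite Blaschke--Potapov product w.r.t. J (as a function on C; values at its finitely
  many poles are irrelevant).\<close>
definition BP_product :: "nat \<Rightarrow> complex mat \<Rightarrow> (complex \<Rightarrow> complex mat) \<Rightarrow> bool" where
  "BP_product m J B \<longleftrightarrow>
     (\<exists>U. U \<in> carrier_mat m m \<and> J_unitary J U \<and> B = (\<lambda>w. U)) \<or>
     (\<exists>Bs. Bs \<noteq> [] \<and> (\<forall>b\<in>set Bs. BP_factor m J b) \<and>
        B = (\<lambda>w. foldr (\<lambda>b M. b w * M) Bs (1\<^sub>m m)))"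

end

theory Submission
  imports Defs "HOL-Complex_Analysis.Complex_Analysis" "Jordan_Normal_Form.Char_Poly"
begin

text \<open>A psd Toeplitz form \<open>Q\<close> is a Gram matrix, so the shift on it is an indefinite isometry and
  extends to a finite dimensional conservative realisation. Its transfer function interpolates the
  data, and splitting off one state dimension at a time along a triangularisation factors it into
  elementary Blaschke--Potapov factors. Hence, if the interpolant is unique, the central function
  is such a product, and these are \<open>J\<close>-unitary on the circle off a finite set.

  Conversely, the recursion defining the central sequence says that \<open>f \<rho>\<close> and \<open>\<tau> f\<close> are
  polynomials, so the rational extension has no pole at a point \<open>z\<close> of the circle where \<open>\<rho>\<close> or
  \<open>\<tau>\<close> is invertible. A Christoffel--Darboux identity computes the defect of \<open>J\<close>-unitarity
  along \<open>\<rho>(z)\<close> as the only nonzero block of \<open>Q\<close> times the coefficient column of \<open>\<rho>\<close>. If the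
  defect vanishes, this column lies in the kernel of \<open>Q\<close>, and since its first block is the identity
  it determines all further Taylor coefficients of any interpolant.\<close>

section \<open>Finitely supported matrices\<close>

text \<open>The remedy is always the Potapov-Ginzburg exchange: swapping the negative components of
  argument and value turns a \<open>J\<close>-contraction into an ordinary contraction. It yields
  the extension of the shift to a conservative realisation, the invertibility and rigidity
  statements for \<open>J\<close>-contractions, and a bounded Schur function in place of a function
  that may have poles in the disc. The last point is essential for uniqueness: a kernel column of
  one Toeplitz form constrains the later coefficients only because the Toeplitz forms of every order
  are positive semidefinite for every member of \<open>PJ0\<close>, which is a statement about
  meromorphic functions. The three kinds of elementary factors correspond to the three positions of
  an eigenvalue of the state matrix: inside, outside and on the unit circle.\<close>

text \<open>Matrices of all formats embed into the (non-unital) ring of finitely supported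
  infinite matrices. There the side conditions on dimensions disappear, so identities of
  rectangular matrices become identities in a ring and are decided by rewriting.\<close>

typedef fsm = "{f :: nat \<Rightarrow> nat \<Rightarrow> complex. \<exists>n. \<forall>i j. n \<le> i \<or> n \<le> j \<longrightarrow> f i j = 0}"
  by (rule exI[of _ "\<lambda>_ _. 0"]) auto

setup_lifting type_definition_fsm

text \<open>An infinite matrix carries no size, so the product below is a sum over the support of
  the summand. This replaces it by an ordinary sum up to any valid bound, after which the ring laws
  are the usual ones.\<close>

lemma fsm_sum_bound:
  fixes f :: "nat \<Rightarrow> complex"
  assumes "\<And>k. n \<le> k \<Longrightarrow> f k = 0"
  shows "(\<Sum>k\<in>{k. f k \<noteq> 0}. f k) = (\<Sum>k<n. f k)"
  by (rule sum.mono_neutral_left) (use assms in \<open>auto simp: not_le[symmetric]\<close>)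

instantiation fsm :: ring
begin

lift_definition zero_fsm :: fsm is "\<lambda>_ _. 0" by auto

lift_definition plus_fsm :: "fsm \<Rightarrow> fsm \<Rightarrow> fsm" is "\<lambda>f g i j. f i j + g i j"
proof -
  fix f g :: "nat \<Rightarrow> nat \<Rightarrow> complex"
  assume "\<exists>n. \<forall>i j. n \<le> i \<or> n \<le> j \<longrightarrow> f i j = 0" "\<exists>n. \<forall>i j. n \<le> i \<or> n \<le> j \<longrightarrow> g i j = 0"
  then obtain n k where "\<forall>i j. n \<le> i \<or> n \<le> j \<longrightarrow> f i j = 0" "\<forall>i j. k \<le> i \<or> k \<le> j \<longrightarrow> g i j = 0"
    by blast
  then show "\<exists>n. \<forall>i j. n \<le> i \<or> n \<le> j \<longrightarrow> f i j + g i j = 0"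
    by (intro exI[of _ "max n k"]) auto
qed

lift_definition minus_fsm :: "fsm \<Rightarrow> fsm \<Rightarrow> fsm" is "\<lambda>f g i j. f i j - g i j"
proof -
  fix f g :: "nat \<Rightarrow> nat \<Rightarrow> complex"
  assume "\<exists>n. \<forall>i j. n \<le> i \<or> n \<le> j \<longrightarrow> f i j = 0" "\<exists>n. \<forall>i j. n \<le> i \<or> n \<le> j \<longrightarrow> g i j = 0"
  then obtain n k where "\<forall>i j. n \<le> i \<or> n \<le> j \<longrightarrow> f i j = 0" "\<forall>i j. k \<le> i \<or> k \<le> j \<longrightarrow> g i j = 0"
    by blast
  then show "\<exists>n. \<forall>i j. n \<le> i \<or> n \<le> j \<longrightarrow> f i j - g i j = 0"
    by (intro exI[of _ "max n k"]) auto
qed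

lift_definition uminus_fsm :: "fsm \<Rightarrow> fsm" is "\<lambda>f i j. - f i j" by auto

lift_definition times_fsm :: "fsm \<Rightarrow> fsm \<Rightarrow> fsm"
  is "\<lambda>f g i j. \<Sum>k\<in>{k. f i k * g k j \<noteq> 0}. f i k * g k j"
proof -
  fix f g :: "nat \<Rightarrow> nat \<Rightarrow> complex"
  assume "\<exists>n. \<forall>i j. n \<le> i \<or> n \<le> j \<longrightarrow> f i j = 0" "\<exists>n. \<forall>i j. n \<le> i \<or> n \<le> j \<longrightarrow> g i j = 0"
  then obtain n k where "\<forall>i j. n \<le> i \<or> n \<le> j \<longrightarrow> f i j = 0" "\<forall>i j. k \<le> i \<or> k \<le> j \<longrightarrow> g i j = 0"
    by blast
  then show "\<exists>n. \<forall>i j. n \<le> i \<or> n \<le> j \<longrightarrow> (\<Sum>k\<in>{k. f i k * g k j \<noteq> 0}. f i k * g k j) = 0"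
    by (intro exI[of _ "max n k"]) auto
qed

instance
proof
  fix a b c :: fsm
  show "a + b + c = a + (b + c)" "a + b = b + a" "0 + a = a" "- a + a = 0" "a - b = a + - b"
    by (transfer; auto simp: algebra_simps)+
  show "a * b * c = a * (b * c)"
  proof (transfer, goal_cases)
    case (1 a b c)
    from 1(1) obtain n1 where n1: "\<And>i j. n1 \<le> i \<or> n1 \<le> j \<Longrightarrow> a i j = 0" by blast
    from 1(2) obtain n2 where n2: "\<And>i j. n2 \<le> i \<or> n2 \<le> j \<Longrightarrow> b i j = 0" by blast
    from 1(3) obtain n3 where n3: "\<And>i j. n3 \<le> i \<or> n3 \<le> j \<Longrightarrow> c i j = 0" by blast
    define n where "n = max n1 (max n2 n3)"
    have a: "\<And>i j. n \<le> i \<or> n \<le> j \<Longrightarrow> a i j = 0"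
      and b: "\<And>i j. n \<le> i \<or> n \<le> j \<Longrightarrow> b i j = 0" and c: "\<And>i j. n \<le> i \<or> n \<le> j \<Longrightarrow> c i j = 0"
      using n1 n2 n3 by (auto simp: n_def)
    have ab: "(\<Sum>k\<in>{k. a i k * b k j \<noteq> 0}. a i k * b k j) = (\<Sum>k<n. a i k * b k j)" for i j
      by (rule fsm_sum_bound) (simp add: a)
    have bc: "(\<Sum>k\<in>{k. b i k * c k j \<noteq> 0}. b i k * c k j) = (\<Sum>k<n. b i k * c k j)" for i j
      by (rule fsm_sum_bound) (simp add: b)
    show ?case unfolding ab bc
    proof (intro ext)
      fix i j
      have "(\<Sum>k\<in>{k. (\<Sum>l<n. a i l * b l k) * c k j \<noteq> 0}. (\<Sum>l<n. a i l * b l k) * c k j)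
         = (\<Sum>k<n. (\<Sum>l<n. a i l * b l k) * c k j)"
        by (rule fsm_sum_bound) (simp add: c)
      moreover have "(\<Sum>k\<in>{k. a i k * (\<Sum>l<n. b k l * c l j) \<noteq> 0}. a i k * (\<Sum>l<n. b k l * c l j))
         = (\<Sum>k<n. a i k * (\<Sum>l<n. b k l * c l j))"
        by (rule fsm_sum_bound) (simp add: a)
      moreover have "(\<Sum>k<n. (\<Sum>l<n. a i l * b l k) * c k j) = (\<Sum>k<n. a i k * (\<Sum>l<n. b k l * c l j))"
        unfolding sum_distrib_left sum_distrib_right
        by (subst sum.swap) (simp add: mult.assoc)
      ultimately show "(\<Sum>k\<in>{k. (\<Sum>l<n. a i l * b l k) * c k j \<noteq> 0}. (\<Sum>l<n. a i l * b l k) * c k j)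
        = (\<Sum>k\<in>{k. a i k * (\<Sum>l<n. b k l * c l j) \<noteq> 0}. a i k * (\<Sum>l<n. b k l * c l j))" by simp
    qed
  qed
  show "(a + b) * c = a * c + b * c"
  proof (transfer, goal_cases)
    case (1 a b c)
    then obtain n where c: "\<And>i j. n \<le> i \<or> n \<le> j \<Longrightarrow> c i j = 0" by blast
    have *: "(\<Sum>k\<in>{k. f k * c k j \<noteq> 0}. f k * c k j) = (\<Sum>k<n. f k * c k j)" for f j
      by (rule fsm_sum_bound) (simp add: c)
    show ?case unfolding * by (simp add: algebra_simps sum.distrib)
  qed
  show "a * (b + c) = a * b + a * c"
  proof (transfer, goal_cases)
    case (1 a b c)
    then obtain n where a: "\<And>i j. n \<le> i \<or> n \<le> j \<Longrightarrow> a i j = 0" by blast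
    have *: "(\<Sum>k\<in>{k. a i k * f k \<noteq> 0}. a i k * f k) = (\<Sum>k<n. a i k * f k)" for f i
      by (rule fsm_sum_bound) (simp add: a)
    show ?case unfolding * by (simp add: algebra_simps sum.distrib)
  qed
qed

end

lift_definition sc :: "complex \<Rightarrow> fsm \<Rightarrow> fsm" is "\<lambda>c f i j. c * f i j" by auto

lift_definition emb :: "complex mat \<Rightarrow> fsm"
  is "\<lambda>M i j. if i < dim_row M \<and> j < dim_col M then M $$ (i,j) else 0"
  by (rule_tac x="max (dim_row mat) (dim_col mat)" in exI) auto

lemma sc_add: "sc c (X + Y) = sc c X + sc c Y"
  and sc_diff: "sc c (X - Y) = sc c X - sc c Y"
  and sc_uminus: "sc c (- X) = sc (- c) X"
  and sc_uminus': "- sc c X = sc (- c) X"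
  and sc_sc: "sc c (sc d X) = sc (c * d) X"
  and sc_one: "sc 1 X = X"
  and sc_zero: "sc 0 X = 0"
  and sc_zero': "sc c 0 = 0"
  and sc_plus: "sc (c + d) X = sc c X + sc d X"
  and sc_minus: "sc (c - d) X = sc c X - sc d X"
  by (transfer; simp add: algebra_simps)+

lemma sc_mult_left: "sc c X * Y = sc c (X * Y)"
proof (transfer, goal_cases)
  case (1 c a b)
  then obtain n where a: "\<And>i j. n \<le> i \<or> n \<le> j \<Longrightarrow> a i j = 0" by blast
  have 1: "(\<Sum>k\<in>{k. c * a i k * f k \<noteq> 0}. c * a i k * f k) = (\<Sum>k<n. c * a i k * f k)" for f i
    by (rule fsm_sum_bound) (simp add: a)
  have 2: "(\<Sum>k\<in>{k. a i k * f k \<noteq> 0}. a i k * f k) = (\<Sum>k<n. a i k * f k)" for f i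
    by (rule fsm_sum_bound) (simp add: a)
  show ?case unfolding 1 2 by (simp add: sum_distrib_left mult.assoc)
qed

lemma sc_mult_right: "X * sc c Y = sc c (X * Y)"
proof (transfer, goal_cases)
  case (1 a c b)
  then obtain n where a: "\<And>i j. n \<le> i \<or> n \<le> j \<Longrightarrow> a i j = 0" by blast
  have 1: "(\<Sum>k\<in>{k. a i k * f k \<noteq> 0}. a i k * f k) = (\<Sum>k<n. a i k * f k)" for f i
    by (rule fsm_sum_bound) (simp add: a)
  show ?case unfolding 1 by (simp add: sum_distrib_left mult_ac)
qed

lemma emb_mult: "dim_col X = dim_row Y \<Longrightarrow> emb (X * Y) = emb X * emb Y"
proof (transfer, goal_cases)
  case (1 X Y)
  have *: "(\<Sum>k\<in>{k. (if i < dim_row X \<and> k < dim_col X then X $$ (i,k) else 0) *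
        (if k < dim_row Y \<and> j < dim_col Y then Y $$ (k,j) else 0) \<noteq> 0}.
        (if i < dim_row X \<and> k < dim_col X then X $$ (i,k) else 0) *
        (if k < dim_row Y \<and> j < dim_col Y then Y $$ (k,j) else 0))
     = (\<Sum>k<dim_row Y. (if i < dim_row X \<and> k < dim_col X then X $$ (i,k) else 0) *
        (if k < dim_row Y \<and> j < dim_col Y then Y $$ (k,j) else 0))" for i j
    by (rule fsm_sum_bound) simp
  show ?case unfolding *
    by (intro ext) (auto simp: 1 scalar_prod_def atLeast0LessThan intro!: sum.cong)
qed

lemma emb_add: "dim_row X = dim_row Y \<Longrightarrow> dim_col X = dim_col Y \<Longrightarrow> emb (X + Y) = emb X + emb Y"
  and emb_minus: "dim_row X = dim_row Y \<Longrightarrow> dim_col X = dim_col Y \<Longrightarrow> emb (X - Y) = emb X - emb Y"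
  by (transfer; intro ext; auto)+

lemma emb_uminus: "emb (- X) = - emb X"
  and emb_zero: "emb (0\<^sub>m n k) = 0"
  and emb_smult: "emb (c \<cdot>\<^sub>m X) = sc c (emb X)"
  by (transfer; intro ext; auto)+

text \<open>An embedded identity is an idempotent and not a unit of the ring, so it cancels only
  against a matrix of matching format.\<close>

lemma emb_one_left: "dim_row X = n \<Longrightarrow> emb (1\<^sub>m n) * emb X = emb X"
  and emb_one_right: "dim_col X = n \<Longrightarrow> emb X * emb (1\<^sub>m n) = emb X"
  by (auto simp: emb_mult[symmetric])

text \<open>Products are normalised to the right, so a rule for two adjacent factors is needed a
  second time with a trailing factor \<open>Z\<close>. The same pairing recurs in later rewrite
  rules.\<close>

lemma emb_one_left': "dim_row X = n \<Longrightarrow> emb (1\<^sub>m n) * (emb X * Z) = emb X * Z"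
  and emb_one_right': "dim_col X = n \<Longrightarrow> emb X * (emb (1\<^sub>m n) * Z) = emb X * Z"
  by (simp_all add: mult.assoc[symmetric] emb_one_left emb_one_right)

text \<open>Padding with zeros forgets the format, hence the two dimension premises. This is the way
  back from the ring to matrices.\<close>

lemma emb_eqD:
  assumes e: "emb X = emb Y" and d: "dim_row X = dim_row Y" "dim_col X = dim_col Y"
  shows "X = Y"
proof (rule eq_matI)
  fix i j assume ij: "i < dim_row Y" "j < dim_col Y"
  have "Rep_fsm (emb X) i j = Rep_fsm (emb Y) i j" using e by simp
  then show "X $$ (i,j) = Y $$ (i,j)"
    using ij d by (simp add: emb.rep_eq)
qed (use d in auto)

lemmas emb_ring = emb_mult emb_add emb_minus emb_uminus emb_zero emb_smult
  emb_one_left emb_one_right emb_one_left' emb_one_right'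
  sc_add sc_diff sc_uminus sc_uminus' sc_sc sc_one sc_zero sc_zero' sc_mult_left sc_mult_right
  distrib_left distrib_right left_diff_distrib right_diff_distrib mult.assoc

section \<open>Adjoints and quadratic forms\<close>

lemma adj_dim[simp]: "dim_row (adj X) = dim_col X" "dim_col (adj X) = dim_row X"
  by (auto simp: adj_def)

lemma adj_carrier[simp, intro]: "X \<in> carrier_mat n k \<Longrightarrow> adj X \<in> carrier_mat k n"
  by auto

lemma adj_index[simp]: "i < dim_col X \<Longrightarrow> j < dim_row X \<Longrightarrow> adj X $$ (i,j) = cnj (X $$ (j,i))"
  by (auto simp: adj_def)

lemma adj_adj[simp]: "adj (adj X) = X" by (auto simp: adj_def intro!: eq_matI)

lemma adj_add: "dim_row X = dim_row Y \<Longrightarrow> dim_col X = dim_col Y \<Longrightarrow> adj (X + Y) = adj X + adj Y"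
  and adj_minus: "dim_row X = dim_row Y \<Longrightarrow> dim_col X = dim_col Y \<Longrightarrow> adj (X - Y) = adj X - adj Y"
  and adj_uminus: "adj (- X) = - adj X"
  and adj_smult: "adj (c \<cdot>\<^sub>m X) = cnj c \<cdot>\<^sub>m adj X"
  and adj_one: "adj (1\<^sub>m n) = 1\<^sub>m n"
  and adj_zero: "adj (0\<^sub>m n k) = 0\<^sub>m k n"
  by (auto intro!: eq_matI)

lemma adj_mult: "dim_col X = dim_row Y \<Longrightarrow> adj (X * Y) = adj Y * adj X"
  by (rule eq_matI) (auto simp: scalar_prod_def mult.commute intro!: sum.cong)

lemma adj_four_block:
  assumes "A \<in> carrier_mat n1 k1" "B \<in> carrier_mat n1 k2" "C \<in> carrier_mat n2 k1" "D \<in> carrier_mat n2 k2"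
  shows "adj (four_block_mat A B C D) = four_block_mat (adj A) (adj C) (adj B) (adj D)"
  using assms by (intro eq_matI) auto

lemmas adj_simps = adj_mult adj_add adj_minus adj_uminus adj_smult adj_one adj_zero

text \<open>Vectors are matrices with one column, so that they live in the same ring as the matrices
  acting on them.\<close>

definition qf :: "complex mat \<Rightarrow> complex mat \<Rightarrow> complex" where
  "qf X v = (adj v * X * v) $$ (0,0)"

lemma mat11_index:
  fixes X :: "complex mat"
  assumes "X \<in> carrier_mat (Suc 0) (Suc 0)" shows "X = X $$ (0,0) \<cdot>\<^sub>m 1\<^sub>m (Suc 0)"
  using assms by (intro eq_matI) auto

lemma qf_eq_sum:
  assumes "X \<in> carrier_mat n n" "v \<in> carrier_mat n 1"
  shows "qf X v = (\<Sum>i<n. \<Sum>j<n. cnj (v $$ (i,0)) * X $$ (i,j) * v $$ (j,0))"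
proof -
  have "qf X v = (\<Sum>j<n. (\<Sum>i<n. cnj (v $$ (i,0)) * X $$ (i,j)) * v $$ (j,0))"
    using assms by (auto simp: qf_def scalar_prod_def atLeast0LessThan intro!: sum.cong)
  also have "\<dots> = (\<Sum>i<n. \<Sum>j<n. cnj (v $$ (i,0)) * X $$ (i,j) * v $$ (j,0))"
    unfolding sum_distrib_right by (rule sum.swap)
  finally show ?thesis .
qed

lemma psd_iff:
  assumes "X \<in> carrier_mat n n"
  shows "psd X \<longleftrightarrow> (\<forall>v\<in>carrier_mat n 1. Im (qf X v) = 0 \<and> Re (qf X v) \<ge> 0)"
proof
  assume p: "psd X"
  show "\<forall>v\<in>carrier_mat n 1. Im (qf X v) = 0 \<and> Re (qf X v) \<ge> 0"
  proof
    fix v :: "complex mat" assume v: "v \<in> carrier_mat n 1"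
    have *: "\<And>v :: nat \<Rightarrow> complex. (let q = (\<Sum>i<n. \<Sum>j<n. cnj (v i) * X $$ (i,j) * v j)
        in Im q = 0 \<and> Re q \<ge> 0)" using p assms unfolding psd_def by auto
    show "Im (qf X v) = 0 \<and> Re (qf X v) \<ge> 0"
      using *[of "\<lambda>i. v $$ (i,0)"] unfolding qf_eq_sum[OF assms v] Let_def .
  qed
next
  assume r: "\<forall>v\<in>carrier_mat n 1. Im (qf X v) = 0 \<and> Re (qf X v) \<ge> 0"
  show "psd X" unfolding psd_def Let_def
  proof (intro conjI allI)
    show "dim_row X = dim_col X" using assms by auto
  next
    fix v :: "nat \<Rightarrow> complex"
    let ?v = "mat n 1 (\<lambda>(i,j). v i)"
    have "qf X ?v = (\<Sum>i<n. \<Sum>j<n. cnj (v i) * X $$ (i,j) * v j)"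
      by (subst qf_eq_sum[OF assms]) auto
    with r[THEN bspec, of ?v] assms
    show "Im (\<Sum>i<dim_row X. \<Sum>j<dim_row X. cnj (v i) * X $$ (i,j) * v j) = 0"
      "0 \<le> Re (\<Sum>i<dim_row X. \<Sum>j<dim_row X. cnj (v i) * X $$ (i,j) * v j)" by auto
  qed
qed

lemma qf_hermitian_real:
  assumes "X \<in> carrier_mat n n" "v \<in> carrier_mat n 1" "adj X = X"
  shows "Im (qf X v) = 0"
proof -
  have "adj (adj v * X * v) = adj v * X * v"
    by (rule emb_eqD) (use assms in \<open>auto simp: adj_simps emb_ring\<close>)
  then have "cnj (qf X v) = qf X v" unfolding qf_def using assms
    by (metis adj_dim(2) adj_index carrier_matD(2) index_mult_mat(2,3) less_one)
  then show ?thesis by (metis Im_complex_of_real complex_cnj_cancel_iff Reals_cnj_iff Reals_cases)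
qed

lemma psd_hermitian_iff:
  assumes "X \<in> carrier_mat n n" "adj X = X"
  shows "psd X \<longleftrightarrow> (\<forall>v\<in>carrier_mat n 1. Re (qf X v) \<ge> 0)"
  using psd_iff[OF assms(1)] qf_hermitian_real[OF assms(1) _ assms(2)] by auto

text \<open>\<open>psd\<close> only asks for nonnegative real values of the form. Polarisation with
  the vectors e_i + c e_j, for c = 1 and for c the imaginary unit, turns real values into Hermitian
  symmetry.\<close>

lemma psd_imp_hermitian:
  assumes X: "X \<in> carrier_mat n n" and p: "psd X"
  shows "adj X = X"
proof (rule eq_matI)
  fix i j assume "i < dim_row X" "j < dim_col X"
  then have ij: "i < n" "j < n" using X by auto
  have gen: "Im (\<Sum>k<n. \<Sum>l<n. cnj (v k) * X $$ (k,l) * v l) = 0" for v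
  proof -
    have "dim_row X = n" using X by auto
    then show ?thesis using p unfolding psd_def Let_def by blast
  qed
  define d where "d c l = (if l = i then 1 else 0) + (if l = j then c else 0 :: complex)" for c l
  have d: "(\<Sum>l<n. f l * d c l) = f i + f j * c" for f c
    using ij unfolding d_def
    by (simp add: distrib_left sum.distrib if_distrib[where f="\<lambda>x. _ * x"] sum.delta cong: if_cong)
  have d': "(\<Sum>l<n. cnj (d c l) * f l) = f i + cnj c * f j" for f c
    using arg_cong[OF d[of "\<lambda>l. cnj (f l)" c], of cnj] by (simp add: mult.commute)
  define q where "q c = (\<Sum>k<n. \<Sum>l<n. cnj (d c k) * X $$ (k,l) * d c l)" for c
  have im: "Im (q c) = 0" for c unfolding q_def by (rule gen)
  have q: "q c = X $$ (i,i) + c * X $$ (i,j) + cnj c * X $$ (j,i) + cnj c * c * X $$ (j,j)" for c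
    unfolding q_def mult.assoc sum_distrib_left[symmetric] d' d by (simp add: algebra_simps)
  have q1: "Im (X $$ (a,a)) = 0" if "a < n" for a
    using gen[of "\<lambda>k. if k = a then 1 else 0"] that
    by (simp add: if_distrib[where f=cnj] if_distrib[where f="\<lambda>x. x * _"]
        if_distrib[where f="\<lambda>x. _ * x"] sum.delta cong: if_cong)
  have "Im (X $$ (i,i)) = 0" "Im (X $$ (j,j)) = 0" using q1 ij by auto
  with im[of 1] im[of \<i>] have "Im (X $$ (i,j)) + Im (X $$ (j,i)) = 0" "Re (X $$ (i,j)) - Re (X $$ (j,i)) = 0"
    unfolding q by auto
  then show "adj X $$ (i,j) = X $$ (i,j)" using ij X by (simp add: complex_eq_iff)
qed (use X in auto)

text \<open>The squared Euclidean norm, not the norm itself, of a single column.\<close>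

definition nrm :: "complex mat \<Rightarrow> real" where
  "nrm v = (\<Sum>i<dim_row v. (cmod (v $$ (i,0)))\<^sup>2)"

lemma adj_mult_self:
  assumes "v \<in> carrier_mat n 1"
  shows "adj v * v = of_real (nrm v) \<cdot>\<^sub>m 1\<^sub>m 1"
proof (rule eq_matI)
  fix i j assume "i < dim_row (of_real (nrm v) \<cdot>\<^sub>m 1\<^sub>m 1 :: complex mat)" "j < dim_col (of_real (nrm v) \<cdot>\<^sub>m 1\<^sub>m 1 :: complex mat)"
  then have [simp]: "i = 0" "j = 0" by auto
  show "(adj v * v) $$ (i,j) = (complex_of_real (nrm v) \<cdot>\<^sub>m 1\<^sub>m 1) $$ (i,j)"
    using assms by (auto simp: nrm_def scalar_prod_def atLeast0LessThan complex_norm_square mult.commute simp del: of_real_power intro!: sum.cong)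
qed (use assms in auto)

lemma nrm_ge_0: "0 \<le> nrm v" by (auto simp: nrm_def sum_nonneg)

lemma nrm_0_iff:
  assumes "v \<in> carrier_mat n 1" shows "nrm v = 0 \<longleftrightarrow> v = 0\<^sub>m n 1"
proof
  assume "nrm v = 0"
  then have "\<forall>i\<in>{..<n}. (cmod (v $$ (i,0)))\<^sup>2 = 0" using assms unfolding nrm_def
    by (subst (asm) sum_nonneg_eq_0_iff) auto
  then show "v = 0\<^sub>m n 1" using assms by (intro eq_matI) auto
qed (simp add: nrm_def)

section \<open>Unitary matrices\<close>

lemma emb_prod:
  assumes "X * Y = C" "dim_col X = dim_row Y"
  shows "emb X * emb Y = emb C" "emb X * (emb Y * Z) = emb C * Z"
  using assms by (auto simp: emb_mult mult.assoc)

lemma unitary_right: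
  fixes U :: "complex mat"
  assumes U: "U \<in> carrier_mat n n" and "adj U * U = 1\<^sub>m n"
  shows "U * adj U = 1\<^sub>m n"
  using mat_mult_left_right_inverse[of "adj U" n U] assms by auto

text \<open>A complex Householder map \<open>1 - (1/t) d d*\<close> with \<open>d = x - y\<close>.
  The real weight of a reflection would require the inner product of \<open>x\<close> and
  \<open>y\<close> to be real; the weight \<open>1 / t\<close> with \<open>t = adj d * x\<close>
  works in general because \<open>adj d * d = t + cnj t\<close>. Fixing the orthogonal complement of
  \<open>x - y\<close> is what allows such maps to be composed vector by vector.\<close>

lemma householder:
  fixes x y :: "complex mat"
  assumes x: "x \<in> carrier_mat k 1" and y: "y \<in> carrier_mat k 1" and eq: "adj x * x = adj y * y"
  shows "\<exists>H\<in>carrier_mat k k. adj H * H = 1\<^sub>m k \<and> H * x = y \<and>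
     (\<forall>z\<in>carrier_mat k 1. adj (x - y) * z = 0\<^sub>m 1 1 \<longrightarrow> H * z = z)"
proof (cases "x = y")
  case True
  with x y show ?thesis by (intro bexI[of _ "1\<^sub>m k"]) (auto simp: adj_one)
next
  case False
  define d where "d = x - y"
  have d: "d \<in> carrier_mat k 1" using x y by (auto simp: d_def)
  define t where "t = (adj d * x) $$ (0,0)"
  have dx: "adj d * x = t \<cdot>\<^sub>m 1\<^sub>m 1" using mat11_index[of "adj d * x"] d x unfolding t_def by auto
  have xd: "adj x * d = cnj t \<cdot>\<^sub>m 1\<^sub>m 1"
    using arg_cong[OF dx, of adj] d x by (simp add: adj_simps)
  have "adj d * d = adj d * x + adj x * d"
    by (rule emb_eqD) (use x y arg_cong[OF eq, of emb] in \<open>auto simp: d_def adj_simps emb_ring\<close>)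
  also have "\<dots> = (t + cnj t) \<cdot>\<^sub>m 1\<^sub>m 1" unfolding dx xd by (intro eq_matI) auto
  finally have dd: "adj d * d = (t + cnj t) \<cdot>\<^sub>m 1\<^sub>m 1" .
  have "d \<noteq> 0\<^sub>m k 1"
  proof
    assume d0: "d = 0\<^sub>m k 1"
    have "x = y"
    proof (rule eq_matI)
      fix i j assume ij: "i < dim_row y" "j < dim_col y"
      have "d $$ (i,j) = 0" using ij y d0 by auto
      then show "x $$ (i,j) = y $$ (i,j)" using ij x y by (auto simp: d_def)
    qed (use x y in auto)
    with False show False ..
  qed
  then have "nrm d \<noteq> 0" using nrm_0_iff[OF d] by simp
  moreover have "complex_of_real (nrm d) = t + cnj t"
    using arg_cong[OF trans[OF adj_mult_self[OF d, symmetric] dd], of "\<lambda>X. X $$ (0,0)"] by simp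
  ultimately have t: "t + cnj t \<noteq> 0" by (metis of_real_eq_0_iff)
  then have t0: "t \<noteq> 0" by auto
  define H where "H = 1\<^sub>m k - (1 / t) \<cdot>\<^sub>m (d * adj d)"
  have H: "H \<in> carrier_mat k k" using d by (auto simp: H_def)
  have edd: "emb (adj d) * (emb d * Z) = sc (t + cnj t) (emb (1\<^sub>m 1) * Z)" for Z
    using arg_cong[OF arg_cong[OF dd, of emb], of "\<lambda>X. X * Z"] d by (simp add: emb_ring)
  have edx: "emb (adj d) * emb x = sc t (emb (1\<^sub>m 1))"
    using arg_cong[OF dx, of emb] d x by (simp add: emb_ring)
  have sc0: "sc a X = 0 \<longleftrightarrow> a = 0 \<or> X = 0" for a X by (transfer) (auto simp: fun_eq_iff)
  have "adj H * H = 1\<^sub>m k"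
  proof (rule emb_eqD)
    have "1 / t * (1 / cnj t) * (t + cnj t) = 1 / t + 1 / cnj t"
      using t0 by (simp add: field_simps)
    then show "emb (adj H * H) = emb (1\<^sub>m k)" using d
      by (simp add: H_def adj_simps emb_ring edd sc_plus[symmetric] sc_minus[symmetric] add.commute)
  qed (use H in auto)
  moreover have "H * x = y"
  proof -
    have "H * x = x - d"
    proof (rule emb_eqD)
      show "emb (H * x) = emb (x - d)" using d x t0
        by (simp add: H_def adj_simps emb_ring edx)
    qed (use H d x in auto)
    also have "\<dots> = y" using x y by (intro eq_matI) (auto simp: d_def)
    finally show ?thesis .
  qed
  moreover have "H * z = z" if z: "z \<in> carrier_mat k 1" and dz: "adj (x - y) * z = 0\<^sub>m 1 1" for z
  proof (rule emb_eqD)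
    have "emb (adj d) * emb z = 0"
      using arg_cong[OF dz, of emb] d z unfolding d_def[symmetric] by (simp add: emb_ring)
    then show "emb (H * z) = emb z" using d z by (simp add: H_def emb_ring)
  qed (use H z in auto)
  ultimately show ?thesis using H by blast
qed

text \<open>Vectors are moved one at a time. The map that sends \<open>U * x l\<close> to
  \<open>y l\<close> leaves the earlier \<open>y i\<close> alone: equal Gram matrices make them
  orthogonal to \<open>U * x l - y l\<close>.\<close>

lemma equal_gram_unitary_family:
  fixes x y :: "nat \<Rightarrow> complex mat"
  assumes "\<And>i. i < l \<Longrightarrow> x i \<in> carrier_mat k 1" "\<And>i. i < l \<Longrightarrow> y i \<in> carrier_mat k 1"
    and "\<And>i j. i < l \<Longrightarrow> j < l \<Longrightarrow> adj (x i) * x j = adj (y i) * y j"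
  shows "\<exists>U\<in>carrier_mat k k. adj U * U = 1\<^sub>m k \<and> (\<forall>i<l. U * x i = y i)"
  using assms
proof (induction l)
  case 0
  show ?case by (intro bexI[of _ "1\<^sub>m k"]) (auto simp: adj_one)
next
  case (Suc l)
  from Suc.IH[OF Suc.prems] obtain U where U: "U \<in> carrier_mat k k" "adj U * U = 1\<^sub>m k"
    and Ux: "\<And>i. i < l \<Longrightarrow> U * x i = y i" by (auto simp: less_Suc_eq)
  have xc: "x i \<in> carrier_mat k 1" and yc: "y i \<in> carrier_mat k 1" if "i < Suc l" for i
    using Suc.prems that by auto
  have eU: "emb (adj U) * (emb U * Z) = emb (1\<^sub>m k) * Z" for Z
    by (rule emb_prod[OF U(2)]) (use U(1) in auto)
  have iso: "adj (U * x i) * (U * x j) = adj (x i) * x j" if "i < Suc l" "j < Suc l" for i j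
    by (rule emb_eqD) (use xc[OF that(1)] xc[OF that(2)] U(1) in \<open>auto simp: adj_simps emb_ring eU\<close>)
  have c: "U * x l \<in> carrier_mat k 1" "y l \<in> carrier_mat k 1" using U xc yc by auto
  have g: "adj (U * x l) * (U * x l) = adj (y l) * y l" using iso[of l l] Suc.prems(3)[of l l] by simp
  from householder[OF c g] obtain H where H: "H \<in> carrier_mat k k" "adj H * H = 1\<^sub>m k"
    "H * (U * x l) = y l"
    "\<And>z. z \<in> carrier_mat k 1 \<Longrightarrow> adj (U * x l - y l) * z = 0\<^sub>m 1 1 \<Longrightarrow> H * z = z" by blast
  show ?case
  proof (intro bexI[of _ "H * U"] conjI allI impI)
    show "H * U \<in> carrier_mat k k" using H U by auto
    have eH: "emb (adj H) * (emb H * Z) = emb (1\<^sub>m k) * Z" for Z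
      by (rule emb_prod[OF H(2)]) (use H(1) in auto)
    show "adj (H * U) * (H * U) = 1\<^sub>m k"
      by (rule emb_eqD) (use U(1) H(1) emb_prod(1)[OF U(2)] in \<open>auto simp: adj_simps emb_ring eH\<close>)
    fix i assume i: "i < Suc l"
    show "H * U * x i = y i"
    proof (cases "i = l")
      case True
      then show ?thesis using H(3) assoc_mult_mat[OF H(1) U(1) xc[OF i]] by simp
    next
      case False
      with i have il: "i < l" by auto
      have "adj (U * x l - y l) * y i = adj (U * x l) * (U * x i) - adj (y l) * y i"
        unfolding Ux[OF il]
        by (rule emb_eqD) (use yc[OF i] yc[of l] xc[of l] U(1) in \<open>auto simp: adj_simps emb_ring\<close>)
      also have "\<dots> = 0\<^sub>m 1 1" using iso[of l i] Suc.prems(3)[of l i] i yc[OF i] c by auto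
      finally have "H * y i = y i" using H(4)[OF yc[OF i]] by simp
      then show ?thesis using Ux[OF il] assoc_mult_mat[OF H(1) U(1) xc[OF i]] by simp
    qed
  qed
qed

lemma equal_gram_unitary:
  fixes X Y :: "complex mat"
  assumes X: "X \<in> carrier_mat k l" and Y: "Y \<in> carrier_mat k l" and eq: "adj X * X = adj Y * Y"
  shows "\<exists>U\<in>carrier_mat k k. adj U * U = 1\<^sub>m k \<and> U * X = Y"
proof -
  define e where "e M i = mat k 1 (\<lambda>(a,b). M $$ (a,i))" for M :: "complex mat" and i
  have ip: "(adj (e M i) * e M j) = (adj M * M) $$ (i,j) \<cdot>\<^sub>m 1\<^sub>m 1"
    if "M \<in> carrier_mat k l" "i < l" "j < l" for M i j
    using that by (intro eq_matI) (auto simp: e_def scalar_prod_def)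
  have "\<exists>U\<in>carrier_mat k k. adj U * U = 1\<^sub>m k \<and> (\<forall>i<l. U * e X i = e Y i)"
  proof (rule equal_gram_unitary_family)
    fix i j assume "i < l" "j < l"
    then show "adj (e X i) * e X j = adj (e Y i) * e Y j"
      by (simp only: ip[OF X] ip[OF Y] eq)
  qed (auto simp: e_def)
  then obtain U where U: "U \<in> carrier_mat k k" "adj U * U = 1\<^sub>m k" "\<And>i. i < l \<Longrightarrow> U * e X i = e Y i"
    by blast
  have "U * X = Y"
  proof (rule eq_matI)
    fix i j assume "i < dim_row Y" "j < dim_col Y"
    with Y have ij: "i < k" "j < l" by auto
    have "(U * X) $$ (i,j) = (U * e X j) $$ (i,0)"
      using ij U(1) X by (auto simp: e_def scalar_prod_def intro!: sum.cong)
    also have "\<dots> = Y $$ (i,j)" using ij U(3)[OF ij(2)] by (simp add: e_def)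
    finally show "(U * X) $$ (i,j) = Y $$ (i,j)" .
  qed (use U X Y in auto)
  with U show ?thesis by blast
qed

section \<open>Schur triangularisation, the spectral theorem and square roots\<close>

lemma unitary_eigen_split:
  fixes A :: "complex mat"
  assumes A: "A \<in> carrier_mat (Suc N) (Suc N)"
  shows "\<exists>H a r A'. H \<in> carrier_mat (Suc N) (Suc N) \<and> adj H * H = 1\<^sub>m (Suc N) \<and>
    r \<in> carrier_mat 1 N \<and> A' \<in> carrier_mat N N \<and>
    adj H * A * H = four_block_mat (a \<cdot>\<^sub>m 1\<^sub>m 1) r (0\<^sub>m N 1) A'"
proof -
  have "degree (char_poly A) = Suc N" using degree_monic_char_poly[OF A] by simp
  then have "\<not> constant (poly (char_poly A))" by (simp add: constant_degree)
  then obtain a where "poly (char_poly A) a = 0" using fundamental_theorem_of_algebra by blast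
  then have "eigenvalue A a" using eigenvalue_root_char_poly[OF A] by simp
  then obtain v where v: "v \<in> carrier_vec (Suc N)" "v \<noteq> 0\<^sub>v (Suc N)" "A *\<^sub>v v = a \<cdot>\<^sub>v v"
    unfolding eigenvalue_def eigenvector_def using A by auto
  define u where "u = mat (Suc N) 1 (\<lambda>(i,j). v $ i)"
  have u: "u \<in> carrier_mat (Suc N) 1" by (simp add: u_def)
  have Au: "A * u = a \<cdot>\<^sub>m u"
  proof (rule eq_matI)
    fix i j assume "i < dim_row (a \<cdot>\<^sub>m u)" "j < dim_col (a \<cdot>\<^sub>m u)"
    then have ij: "i < Suc N" "j = 0" by (auto simp: u_def)
    have "(A * u) $$ (i,j) = (A *\<^sub>v v) $ i" using ij A v(1) by (auto simp: u_def scalar_prod_def intro!: sum.cong)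
    also have "\<dots> = (a \<cdot>\<^sub>m u) $$ (i,j)" unfolding v(3) using ij v(1) by (auto simp: u_def)
    finally show "(A * u) $$ (i,j) = (a \<cdot>\<^sub>m u) $$ (i,j)" .
  qed (use A in \<open>auto simp: u_def\<close>)
  have "u \<noteq> 0\<^sub>m (Suc N) 1"
  proof
    assume u0: "u = 0\<^sub>m (Suc N) 1"
    have "v = 0\<^sub>v (Suc N)"
    proof (rule eq_vecI)
      fix i assume "i < dim_vec (0\<^sub>v (Suc N) :: complex vec)"
      then show "v $ i = 0\<^sub>v (Suc N) $ i" using arg_cong[OF u0, of "\<lambda>X. X $$ (i,0)"] by (simp add: u_def)
    qed (use v in auto)
    with v show False by simp
  qed
  then have n0: "nrm u > 0" using nrm_0_iff[OF u] nrm_ge_0[of u] by linarith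
  define c where "c = complex_of_real (1 / sqrt (nrm u))"
  have c0: "c \<noteq> 0" using n0 by (simp add: c_def)
  have cc: "cnj c * c * of_real (nrm u) = 1"
    using n0 by (simp add: c_def of_real_mult[symmetric] del: of_real_mult)
  define e where "e = c \<cdot>\<^sub>m u"
  define e1 :: "complex mat" where "e1 = mat (Suc N) 1 (\<lambda>(i,j). if i = 0 then 1 else 0)"
  have e: "e \<in> carrier_mat (Suc N) 1" and e1: "e1 \<in> carrier_mat (Suc N) 1" using u by (auto simp: e_def e1_def)
  have "adj e * e = (cnj c * c) \<cdot>\<^sub>m (adj u * u)"
    by (rule emb_eqD) (use u in \<open>auto simp: e_def adj_simps emb_ring mult.commute\<close>)
  also have "\<dots> = 1\<^sub>m 1" unfolding adj_mult_self[OF u] using cc by (intro eq_matI) (auto simp: mult.assoc)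
  finally have ee: "adj e * e = 1\<^sub>m 1" .
  have e1e1: "adj e1 * e1 = 1\<^sub>m 1"
    by (rule eq_matI) (auto simp: e1_def scalar_prod_def if_distrib[where f="\<lambda>x. _ * x"] sum.delta cong: if_cong)
  \<comment> \<open>A unitary carrying the first unit vector to \<open>e\<close> has
    \<open>e\<close> as its first column; this replaces the completion of \<open>e\<close> to an
    orthonormal basis.\<close>
  obtain H where H: "H \<in> carrier_mat (Suc N) (Suc N)" "adj H * H = 1\<^sub>m (Suc N)" "H * e1 = e"
    using equal_gram_unitary[OF e1 e] ee e1e1 by auto
  have Ae: "A * e = a \<cdot>\<^sub>m e"
    by (rule emb_eqD)
      (use arg_cong[OF Au, of emb] A u in \<open>auto simp: e_def emb_ring mult.commute\<close>)
  have "adj H * e = e1"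
    by (rule emb_eqD) (use arg_cong[OF H(2), of emb] H(1) e1 e in
      \<open>auto simp: H(3)[symmetric] emb_ring simp: mult.assoc[symmetric]\<close>)
  define T where "T = adj H * A * H"
  have T: "T \<in> carrier_mat (Suc N) (Suc N)" using A H by (auto simp: T_def)
  have "T * e1 = adj H * (A * (H * e1))"
    by (rule emb_eqD) (use A H(1) e1 in \<open>auto simp: T_def emb_ring\<close>)
  also have "\<dots> = a \<cdot>\<^sub>m e1" unfolding H(3) Ae
    by (rule emb_eqD) (use emb_prod(1)[OF \<open>adj H * e = e1\<close>] H(1) e e1 in \<open>auto simp: emb_ring\<close>)
  finally have Te: "T * e1 = a \<cdot>\<^sub>m e1" .
  have T0: "T $$ (i,0) = (if i = 0 then a else 0)" if "i < Suc N" for i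
  proof -
    have "T $$ (i,0) = (T * e1) $$ (i,0)" using that T
      by (auto simp: e1_def scalar_prod_def if_distrib[where f="\<lambda>x. _ * x"] sum.delta' sum.delta cong: if_cong)
    then show ?thesis unfolding Te using that by (simp add: e1_def)
  qed
  have "T = four_block_mat (a \<cdot>\<^sub>m 1\<^sub>m 1) (mat 1 N (\<lambda>(i,j). T $$ (0, Suc j))) (0\<^sub>m N 1)
     (mat N N (\<lambda>(i,j). T $$ (Suc i, Suc j)))"
    by (rule eq_matI) (use T T0 in \<open>auto simp: not_less less_Suc_eq_0_disj\<close>)
  then show ?thesis using H unfolding T_def
    by (intro exI[of _ H] exI[of _ a] exI[of _ "mat 1 N (\<lambda>(i,j). T $$ (0, Suc j))"]
         exI[of _ "mat N N (\<lambda>(i,j). T $$ (Suc i, Suc j))"]) (auto simp: T_def)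
qed

definition diagR :: "nat \<Rightarrow> (nat \<Rightarrow> real) \<Rightarrow> complex mat" where
  "diagR n d = mat n n (\<lambda>(i,j). if i = j then of_real (d i) else 0)"

lemma diagR_carrier[simp, intro]: "diagR n d \<in> carrier_mat n n"
  and diagR_dim[simp]: "dim_row (diagR n d) = n" "dim_col (diagR n d) = n"
  by (auto simp: diagR_def)

lemma diagR_mult: "diagR n d * diagR n e = diagR n (\<lambda>i. d i * e i)"
  by (rule eq_matI) (auto simp: diagR_def scalar_prod_def if_distrib[where f="\<lambda>x. x * _"]
      if_distrib[where f="\<lambda>x. _ * x"] sum.delta sum.delta' cong: if_cong)

lemma adj_diagR[simp]: "adj (diagR n d) = diagR n d"
  by (rule eq_matI) (auto simp: diagR_def)

text \<open>The triangular form inherits Hermitian symmetry: the zeros below the corner force the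
  row beside it to vanish, and the corner entry is real.\<close>

lemma hermitian_spectral:
  assumes "A \<in> carrier_mat n n" "adj A = A"
  shows "\<exists>U d. U \<in> carrier_mat n n \<and> adj U * U = 1\<^sub>m n \<and> A = U * diagR n d * adj U"
  using assms
proof (induction n arbitrary: A)
  case 0
  then show ?case by (intro exI[of _ "1\<^sub>m 0"] exI[of _ "\<lambda>_. 0"]) (auto simp: adj_one intro!: eq_matI)
next
  case (Suc N)
  from unitary_eigen_split[OF Suc.prems(1)] obtain H a r A' where
    H: "H \<in> carrier_mat (Suc N) (Suc N)" "adj H * H = 1\<^sub>m (Suc N)" and r: "r \<in> carrier_mat 1 N"
    and A': "A' \<in> carrier_mat N N"
    and T: "adj H * A * H = four_block_mat (a \<cdot>\<^sub>m 1\<^sub>m 1) r (0\<^sub>m N 1) A'" by blast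
  let ?T = "four_block_mat (a \<cdot>\<^sub>m 1\<^sub>m 1) r (0\<^sub>m N 1) A'"
  have Tc: "?T \<in> carrier_mat (Suc N) (Suc N)" using A' by auto
  have "adj (adj H * A * H) = adj H * A * H"
    by (rule emb_eqD) (use H(1) Suc.prems in \<open>auto simp: adj_simps emb_ring\<close>)
  then have hT: "adj ?T = ?T" unfolding T .
  have ent: "cnj (?T $$ (j,i)) = ?T $$ (i,j)" if "i < Suc N" "j < Suc N" for i j
    using arg_cong[OF hT, of "\<lambda>X. X $$ (i,j)"] that A' by simp
  have r0: "r = 0\<^sub>m 1 N"
  proof (rule eq_matI)
    fix i j assume "i < dim_row (0\<^sub>m 1 N :: complex mat)" "j < dim_col (0\<^sub>m 1 N :: complex mat)"
    then show "r $$ (i,j) = 0\<^sub>m 1 N $$ (i,j)" using ent[of 0 "Suc j"] A' by simp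
  qed (use r in auto)
  have a: "a = of_real (Re a)" using ent[of 0 0] by (simp add: complex_eq_iff)
  have "adj A' = A'"
  proof (rule eq_matI)
    fix i j assume "i < dim_row A'" "j < dim_col A'"
    then show "adj A' $$ (i,j) = A' $$ (i,j)" using ent[of "Suc i" "Suc j"] A' by simp
  qed (use A' in auto)
  from Suc.IH[OF A' this] obtain U d where U: "U \<in> carrier_mat N N" "adj U * U = 1\<^sub>m N"
    and A'U: "A' = U * diagR N d * adj U" by blast
  define F where "F = four_block_mat (1\<^sub>m 1) (0\<^sub>m 1 N) (0\<^sub>m N 1) U"
  have F: "F \<in> carrier_mat (Suc N) (Suc N)" using U by (auto simp: F_def)
  have aF: "adj F = four_block_mat (1\<^sub>m 1) (0\<^sub>m 1 N) (0\<^sub>m N 1) (adj U)"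
    unfolding F_def by (subst adj_four_block[of _ 1 1 _ N _ N]) (use U in \<open>auto simp: adj_simps\<close>)
  define d' where "d' i = (case i of 0 \<Rightarrow> Re a | Suc i \<Rightarrow> d i)" for i
  have D: "diagR (Suc N) d' = four_block_mat (a \<cdot>\<^sub>m 1\<^sub>m 1) (0\<^sub>m 1 N) (0\<^sub>m N 1) (diagR N d)"
    by (rule eq_matI) (use a in \<open>auto simp: diagR_def d'_def less_Suc_eq_0_disj\<close>)
  have FF: "adj F * F = 1\<^sub>m (Suc N)" unfolding aF unfolding F_def
    by (subst mult_four_block_mat[of _ 1 1 _ N _ N _ _ 1 _ N]) (use U in auto)
  have FD: "F * diagR (Suc N) d' * adj F = ?T" unfolding aF D unfolding F_def
    by (subst mult_four_block_mat[of _ 1 1 _ N _ N _ _ 1 _ N];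
        (subst mult_four_block_mat[of _ 1 1 _ N _ N _ _ 1 _ N])?) (use U A'U r0 in auto)
  show ?case
  proof (intro exI[of _ "H * F"] exI[of _ d'] conjI)
    show "H * F \<in> carrier_mat (Suc N) (Suc N)" using H F by auto
    show "adj (H * F) * (H * F) = 1\<^sub>m (Suc N)"
      by (rule emb_eqD) (use H(1) F emb_prod[OF H(2)] emb_prod[OF FF] in \<open>auto simp: adj_simps emb_ring\<close>)
    have HH: "H * adj H = 1\<^sub>m (Suc N)" using unitary_right[OF H] .
    have "A = H * (adj H * A * H) * adj H"
      by (rule emb_eqD) (use H(1) Suc.prems emb_prod[OF HH] in \<open>auto simp: adj_simps emb_ring\<close>)
    also have "\<dots> = H * F * diagR (Suc N) d' * adj (H * F)" unfolding T FD[symmetric]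
      by (rule emb_eqD) (use H(1) F in \<open>auto simp: adj_simps emb_ring\<close>)
    finally show "A = H * F * diagR (Suc N) d' * adj (H * F)" .
  qed
qed

lemma psd_sqrt_exists:
  assumes A: "A \<in> carrier_mat n n" and psd: "psd A"
  shows "\<exists>T\<in>carrier_mat n n. adj T * T = A"
proof -
  from hermitian_spectral[OF A psd_imp_hermitian[OF A psd]] obtain U d where
    U: "U \<in> carrier_mat n n" "adj U * U = 1\<^sub>m n" and AU: "A = U * diagR n d * adj U" by blast
  have d: "d i \<ge> 0" if i: "i < n" for i
  proof -
    define e :: "complex mat" where "e = mat n 1 (\<lambda>(k,_). if k = i then 1 else 0)"
    have e: "e \<in> carrier_mat n 1" by (simp add: e_def)
    have "adj (U * e) * A * (U * e) = adj e * diagR n d * e"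
      unfolding AU
      by (rule emb_eqD) (use U(1) e emb_prod[OF U(2)] in \<open>auto simp: adj_simps emb_ring\<close>)
    then have "qf A (U * e) = qf (diagR n d) e" by (simp add: qf_def)
    also have "\<dots> = of_real (d i)" using i
      by (subst qf_eq_sum[OF _ e]) (auto simp: e_def diagR_def if_distrib[where f="\<lambda>x. x * _"]
          if_distrib[where f="\<lambda>x. _ * x"] if_distrib[where f=cnj] sum.delta sum.delta' cong: if_cong)
    finally show ?thesis using psd_iff[OF A] psd U e by (metis Re_complex_of_real mult_carrier_mat)
  qed
  define T where "T = diagR n (\<lambda>i. sqrt (d i)) * adj U"
  have DD: "diagR n (\<lambda>i. sqrt (d i)) * diagR n (\<lambda>i. sqrt (d i)) = diagR n d"
    unfolding diagR_mult by (rule eq_matI) (auto simp: diagR_def d of_real_mult[symmetric] simp del: of_real_mult)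
  have "adj T * T = A"
    unfolding T_def AU by (intro emb_eqD) (use U(1) emb_prod(2)[OF DD] in \<open>auto simp: adj_simps emb_ring\<close>)
  moreover have "T \<in> carrier_mat n n" using U by (auto simp: T_def)
  ultimately show ?thesis by blast
qed

section \<open>Moore-Penrose inverses of Hermitian matrices\<close>

lemma mp_inv_unique:
  assumes A: "A \<in> carrier_mat n k" and Y: "Y \<in> carrier_mat k n" and Z: "Z \<in> carrier_mat k n"
    and y: "A * Y * A = A" "Y * A * Y = Y" "adj (A * Y) = A * Y" "adj (Y * A) = Y * A"
    and z: "A * Z * A = A" "Z * A * Z = Z" "adj (A * Z) = A * Z" "adj (Z * A) = Z * A"
  shows "Y = Z"
proof -
  have 1: "(A * Y) * (A * Z) = A * Z"
    by (rule emb_eqD) (use A Y Z emb_prod[OF y(1)] in \<open>auto simp: emb_mult mult.assoc\<close>)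
  have "A * Z * (A * Y) = A * Z" using arg_cong[OF 1, of adj] A Y Z y(3) z(3) by (simp add: adj_mult)
  then have "Y * (A * Z * (A * Y)) = Y * (A * Z)" by simp
  moreover have "Y * (A * Z * (A * Y)) = Y * A * Y"
    by (rule emb_eqD) (use A Y Z emb_prod[OF z(1)] in \<open>auto simp: emb_mult mult.assoc\<close>)
  ultimately have Yeq: "Y = Y * (A * Z)" using y(2) by simp
  have 2: "(Y * A) * (Z * A) = Y * A"
    by (rule emb_eqD) (use A Y Z arg_cong[OF z(1), of emb] in \<open>auto simp: emb_mult mult.assoc\<close>)
  have "(Z * A) * (Y * A) = Y * A" using arg_cong[OF 2, of adj] A Y Z y(4) z(4) by (simp add: adj_mult)
  then have "(Z * A) * (Y * A) * Z = Y * A * Z" by simp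
  moreover have "(Z * A) * (Y * A) * Z = Z * A * Z"
    by (rule emb_eqD) (use A Y Z emb_prod[OF y(1)] in \<open>auto simp: emb_mult mult.assoc\<close>)
  ultimately have "Z = Y * A * Z" using z(2) by simp
  then show ?thesis using Yeq A Y Z by (simp add: assoc_mult_mat[of _ k n _ k _ n])
qed

lemma mp_inv_hermitian:
  assumes A: "A \<in> carrier_mat n n" and h: "adj A = A"
  shows "mp_inv A \<in> carrier_mat n n" "A * mp_inv A * A = A" "adj (A * mp_inv A) = A * mp_inv A"
proof -
  from hermitian_spectral[OF A h] obtain U d where
    U: "U \<in> carrier_mat n n" "adj U * U = 1\<^sub>m n" and AU: "A = U * diagR n d * adj U" by blast
  \<comment> \<open>Since \<open>1 / 0 = 0\<close>, this inverts the nonzero eigenvalues and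
    vanishes on the kernel, as a Moore-Penrose inverse must.\<close>
  define Y where "Y = U * diagR n (\<lambda>i. 1 / d i) * adj U"
  have Y: "Y \<in> carrier_mat n n" using U by (auto simp: Y_def)
  have conj: "U * X * adj U * (U * X' * adj U) = U * (X * X') * adj U"
    if "X \<in> carrier_mat n n" "X' \<in> carrier_mat n n" for X X'
    by (rule emb_eqD) (use U(1) that emb_prod[OF U(2)] in \<open>auto simp: emb_ring\<close>)
  have hd: "adj (U * diagR n e * adj U) = U * diagR n e * adj U" for e
    by (rule emb_eqD) (use U(1) in \<open>auto simp: adj_simps emb_ring\<close>)
  have P: "A * Y * A = A \<and> Y * A * Y = Y \<and> adj (A * Y) = A * Y \<and> adj (Y * A) = Y * A"
  proof -
    have "(\<lambda>i. (if d i = 0 then 0 else 1) * d i) = d"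
      "(\<lambda>i. (if d i = 0 then 0 else 1) / d i) = (\<lambda>i. 1 / d i)" by auto
    then show ?thesis unfolding Y_def AU by (simp add: conj diagR_mult hd)
  qed
  have "\<exists>!Y. Y \<in> carrier_mat (dim_col A) (dim_row A) \<and>
       A * Y * A = A \<and> Y * A * Y = Y \<and> adj (A * Y) = A * Y \<and> adj (Y * A) = Y * A"
  proof (rule ex1I)
    show "Y \<in> carrier_mat (dim_col A) (dim_row A) \<and>
       A * Y * A = A \<and> Y * A * Y = Y \<and> adj (A * Y) = A * Y \<and> adj (Y * A) = Y * A" using P Y A by auto
  next
    fix Z assume "Z \<in> carrier_mat (dim_col A) (dim_row A) \<and>
       A * Z * A = A \<and> Z * A * Z = Z \<and> adj (A * Z) = A * Z \<and> adj (Z * A) = Z * A"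
    then show "Z = Y" using mp_inv_unique[OF A, of Z Y] A Y P by auto
  qed
  from theI'[OF this] show "mp_inv A \<in> carrier_mat n n" "A * mp_inv A * A = A"
    "adj (A * mp_inv A) = A * mp_inv A" unfolding mp_inv_def using A by auto
qed

section \<open>Signature matrices and the Potapov--Ginzburg transform\<close>

text \<open>For a signature matrix \<open>J\<close>, this and \<open>neg_proj\<close> are the
  orthogonal projections onto the eigenspaces of \<open>J\<close> for 1 and -1.\<close>

definition pos_proj :: "nat \<Rightarrow> complex mat \<Rightarrow> complex mat" where
  "pos_proj n J = (1/2) \<cdot>\<^sub>m (1\<^sub>m n + J)"

definition neg_proj :: "nat \<Rightarrow> complex mat \<Rightarrow> complex mat" where
  "neg_proj n J = (1/2) \<cdot>\<^sub>m (1\<^sub>m n - J)"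

lemma signature_projs:
  assumes "signature_mat n J"
  defines "P \<equiv> pos_proj n J" and "Q \<equiv> neg_proj n J"
  shows "J \<in> carrier_mat n n" "adj J = J" "J * J = 1\<^sub>m n"
    "P \<in> carrier_mat n n" "Q \<in> carrier_mat n n" "adj P = P" "adj Q = Q"
    "P * P = P" "Q * Q = Q" "P * Q = 0\<^sub>m n n" "Q * P = 0\<^sub>m n n" "P + Q = 1\<^sub>m n" "P - Q = J"
proof -
  show J: "J \<in> carrier_mat n n" "adj J = J" "J * J = 1\<^sub>m n" using assms(1) by (auto simp: signature_mat_def)
  show PQ: "P \<in> carrier_mat n n" "Q \<in> carrier_mat n n" using J by (auto simp: P_def Q_def pos_proj_def neg_proj_def)
  show "adj P = P" "adj Q = Q" using J(1) J(2) by (auto simp: P_def Q_def pos_proj_def neg_proj_def adj_simps)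
  have h: "sc (1/2) (sc c x) + sc (1/2) (sc c x) = sc c x" for c x
    by (simp add: sc_sc sc_plus[symmetric])
  have h2: "sc c x + sc c x = sc (2 * c) x" for c x by (simp add: sc_plus[symmetric])
  show "P * P = P" "Q * Q = Q" "P * Q = 0\<^sub>m n n" "Q * P = 0\<^sub>m n n"
    by (rule emb_eqD; use J(1) emb_prod(1)[OF J(3)] in
      \<open>auto simp: P_def Q_def pos_proj_def neg_proj_def emb_ring algebra_simps sc_plus[symmetric] sc_minus[symmetric]\<close>;
      simp add: h2 add.assoc[symmetric])+
  show "P + Q = 1\<^sub>m n" "P - Q = J" using J(1)
    by (auto simp: P_def Q_def pos_proj_def neg_proj_def field_simps intro!: eq_matI)
qed

text \<open>A Witt type extension theorem: exchanging the negative parts of domain and range turns an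
  isometry of the indefinite form into an isometry of Hilbert spaces. The hypothesis
  \<open>M1 * G = neg_proj n J\<close> (the domain contains the negative subspace) is what
  makes the exchange invertible.\<close>

lemma signature_isometry_extension:
  fixes J M1 M2 G :: "complex mat"
  assumes sig: "signature_mat n J"
    and M1: "M1 \<in> carrier_mat n l" and M2: "M2 \<in> carrier_mat n l" and G: "G \<in> carrier_mat l n"
    and iso: "adj M1 * J * M1 = adj M2 * J * M2" and MG: "M1 * G = neg_proj n J"
  shows "\<exists>\<Theta>\<in>carrier_mat n n. adj \<Theta> * J * \<Theta> = J \<and> \<Theta> * M1 = M2"
proof -
  define P where "P = pos_proj n J"
  define Q where "Q = neg_proj n J"
  note S = signature_projs[OF sig, folded P_def Q_def]
  note PQ = S(4,5)
    have ee: "emb P * emb P = emb P" "emb Q * emb Q = emb Q" "emb P * emb Q = 0" "emb Q * emb P = 0"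
    "emb P * (emb P * Z) = emb P * Z" "emb Q * (emb Q * Z) = emb Q * Z"
    "emb P * (emb Q * Z) = 0" "emb Q * (emb P * Z) = 0" for Z
    using emb_prod(1)[OF S(8)] emb_prod(2)[OF S(8), of Z] emb_prod(1)[OF S(9)] emb_prod(2)[OF S(9), of Z]
      emb_prod(1)[OF S(10)] emb_prod(2)[OF S(10), of Z] emb_prod(1)[OF S(11)] emb_prod(2)[OF S(11), of Z] PQ
    by (auto simp: emb_ring)
  have eP: "emb P = emb (1\<^sub>m n) - emb Q"
    using arg_cong[OF S(12), of emb] PQ by (simp add: emb_ring algebra_simps)
  have eJ: "emb J = emb P - emb Q"
    using arg_cong[OF S(13), of emb] PQ by (simp add: emb_ring)
  \<comment> \<open>The exchanged pair: the negative parts of \<open>M1\<close> and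
    \<open>M2\<close> trade places, and equality of the indefinite Gram matrices becomes equality of
    the ordinary ones.\<close>
  define N1 where "N1 = P * M1 + Q * M2"
  define N2 where "N2 = P * M2 + Q * M1"
  have N: "N1 \<in> carrier_mat n l" "N2 \<in> carrier_mat n l" using PQ M1 M2 by (auto simp: N1_def N2_def)
  have "adj N1 * N1 = adj N2 * N2"
  proof (rule emb_eqD)
    have "emb (adj M1) * (emb J * emb M1) = emb (adj M2) * (emb J * emb M2)"
      using arg_cong[OF iso, of emb] M1 M2 S(1) by (simp add: emb_ring)
    then have "emb (adj M1) * (emb P * emb M1) + emb (adj M2) * (emb Q * emb M2)
       = emb (adj M2) * (emb P * emb M2) + emb (adj M1) * (emb Q * emb M1)"
      unfolding eJ by (simp add: algebra_simps)
    then show "emb (adj N1 * N1) = emb (adj N2 * N2)"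
      using PQ M1 M2 S(6,7) by (simp add: N1_def N2_def adj_simps emb_ring ee)
  qed (use N in auto)
  from equal_gram_unitary[OF N this] obtain U where U: "U \<in> carrier_mat n n" "adj U * U = 1\<^sub>m n" "U * N1 = N2"
    by blast
  \<comment> \<open>\<open>K\<close> and \<open>Z\<close> undo the exchange,
    \<open>K * N1 = M1\<close> and \<open>Z * N1 = M2\<close>, so the extension must be
    \<open>Z\<close> times the inverse of \<open>K\<close>. That inverse \<open>R\<close> is built
    from \<open>G\<close>: \<open>K * N1 * G = M1 * G = Q\<close> supplies the negative part, and
    the correction \<open>N1 * G * U * P\<close> cancels the term \<open>Q * U * P\<close> of
    \<open>K * P\<close>.\<close>
  define K where "K = Q * U + P"
  define Z where "Z = P * U + Q"
  define R where "R = P - N1 * G * U * P + N1 * G"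
  have c: "K \<in> carrier_mat n n" "Z \<in> carrier_mat n n" "R \<in> carrier_mat n n"
    using PQ U(1) N G by (auto simp: K_def Z_def R_def)
  have eUN: "emb U * emb N1 = emb N2" "emb U * (emb N1 * X) = emb N2 * X" for X
    using emb_prod(1)[OF U(3)] emb_prod(2)[OF U(3), of X] U(1) N by auto
  have eMG: "emb M1 * emb G = emb Q" "emb M1 * (emb G * X) = emb Q * X" for X
    using emb_prod(1)[OF MG[folded Q_def]] emb_prod(2)[OF MG[folded Q_def], of X] M1 G by auto
  have eN: "emb N1 = emb P * emb M1 + emb Q * emb M2" "emb N2 = emb P * emb M2 + emb Q * emb M1"
    using PQ M1 M2 by (auto simp: N1_def N2_def emb_ring)
  have sumX: "emb P * emb X + emb Q * emb X = emb X" if "dim_row X = n" for X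
    unfolding eP using that by (simp add: emb_ring)
  have KN: "K * N1 = M1"
  proof (rule emb_eqD)
    have "emb (K * N1) = emb Q * emb N2 + emb P * emb N1"
      using PQ U(1) N by (simp add: K_def emb_ring eUN)
    also have "\<dots> = emb M1" using sumX[of M1] M1 by (simp add: eN distrib_left ee add.commute)
    finally show "emb (K * N1) = emb M1" .
  qed (use c N M1 in auto)
  have ZN: "Z * N1 = M2"
  proof (rule emb_eqD)
    have "emb (Z * N1) = emb P * emb N2 + emb Q * emb N1"
      using PQ U(1) N by (simp add: Z_def emb_ring eUN)
    also have "\<dots> = emb M2" using sumX[of M2] M2 by (simp add: eN distrib_left ee add.commute)
    finally show "emb (Z * N1) = emb M2" .
  qed (use c N M2 in auto)
  have eKN: "emb K * (emb N1 * X) = emb M1 * X" for X by (rule emb_prod[OF KN]) (use c N in auto)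
  have "K * R = 1\<^sub>m n"
  proof (rule emb_eqD)
    have "emb (K * R) = emb K * emb P - emb Q * (emb U * emb P) + emb Q"
      using c(1) PQ U(1) N G by (simp add: R_def emb_ring eKN eMG)
    also have "emb K * emb P = emb Q * (emb U * emb P) + emb P"
      using PQ U(1) by (simp add: K_def emb_ring ee)
    finally show "emb (K * R) = emb (1\<^sub>m n)" unfolding eP by simp
  qed (use c in auto)
  then have RK: "R * K = 1\<^sub>m n" using mat_mult_left_right_inverse[OF c(1) c(3)] by simp
  have eKR: "emb K * emb R = emb (1\<^sub>m n)" "emb (adj R) * (emb (adj K) * X) = emb (1\<^sub>m n) * X" for X
  proof -
    show "emb K * emb R = emb (1\<^sub>m n)" by (rule emb_prod[OF \<open>K * R = 1\<^sub>m n\<close>]) (use c in auto)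
    have "adj R * adj K = 1\<^sub>m n" using arg_cong[OF \<open>K * R = 1\<^sub>m n\<close>, of adj] c by (simp add: adj_simps)
    then show "emb (adj R) * (emb (adj K) * X) = emb (1\<^sub>m n) * X" by (rule emb_prod) (use c in auto)
  qed
  \<comment> \<open>Both sides reduce to \<open>P - adj U * Q * U\<close>, by unitarity of
    \<open>U\<close>.\<close>
  have ZJZ: "emb (adj Z) * (emb J * (emb Z * X)) = emb (adj K) * (emb J * (emb K * X))" for X
  proof -
    have "emb (adj Z) * (emb J * emb Z) = emb (adj K) * (emb J * emb K)"
    proof -
      have "emb (adj U) * (emb P * emb U) + emb (adj U) * (emb Q * emb U) = emb (1\<^sub>m n)"
        unfolding eP using U(1) emb_prod(1)[OF U(2)] by (simp add: emb_ring)
      then have h: "emb (adj U) * (emb P * emb U) = emb P + emb Q - emb (adj U) * (emb Q * emb U)"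
        unfolding eP by (simp add: algebra_simps)
      show ?thesis using PQ U(1) S(6,7)
        by (simp add: K_def Z_def eJ adj_simps emb_ring ee h)
    qed
    from arg_cong[OF this, of "\<lambda>y. y * X"] show ?thesis by (simp add: mult.assoc)
  qed
  show ?thesis
  proof (intro bexI[of _ "Z * R"] conjI)
    show "Z * R \<in> carrier_mat n n" using c by auto
    show "adj (Z * R) * J * (Z * R) = J"
      by (rule emb_eqD) (use c S(1) in \<open>auto simp: adj_simps emb_ring ZJZ eKR\<close>)
    have "Z * R * M1 = Z * (R * K) * N1"
      unfolding KN[symmetric] by (rule emb_eqD) (use c N in \<open>auto simp: emb_ring\<close>)
    then show "Z * R * M1 = M2" using RK ZN c by simp
  qed
qed

section \<open>Rank one factors\<close>

lemma J_unitary_iff_emb: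
  assumes "J \<in> carrier_mat m m" "X \<in> carrier_mat m m"
  shows "J_unitary J X \<longleftrightarrow> emb (adj X) * (emb J * emb X) = emb J"
proof -
  have "emb (adj X * J * X) = emb (adj X) * (emb J * emb X)" using assms by (simp add: emb_ring)
  then show ?thesis unfolding J_unitary_def using assms
    by (metis adj_dim(1) carrier_matD(1) carrier_matD(2) emb_eqD index_mult_mat(2) index_mult_mat(3))
qed

text \<open>The matrices \<open>Uc k\<close> are perturbations of the identity along
  \<open>c\<close>, and they are closed under products: the number \<open>1 + k * \<kappa>\<close>
  is multiplicative, and for \<open>\<kappa> = 0\<close> the parameter \<open>k\<close> itself is
  additive. This dichotomy separates the idempotent from the nilpotent elementary factors.\<close>

locale rank_one =
  fixes m :: nat and J c :: "complex mat" and \<kappa> :: real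
  assumes sig: "signature_mat m J" and c: "c \<in> carrier_mat m 1"
    and cJc: "adj c * J * c = of_real \<kappa> \<cdot>\<^sub>m 1\<^sub>m 1"
begin

definition G where "G = c * adj c * J"

definition Uc where "Uc k = 1\<^sub>m m + k \<cdot>\<^sub>m G"

lemma J: "J \<in> carrier_mat m m" "adj J = J" "J * J = 1\<^sub>m m"
  using sig by (auto simp: signature_mat_def)

lemma G_carrier: "G \<in> carrier_mat m m" using c J by (auto simp: G_def)

lemma Uc_carrier: "Uc k \<in> carrier_mat m m" using G_carrier by (auto simp: Uc_def)

lemma emb_cJc: "emb (adj c) * (emb J * emb c) = sc (of_real \<kappa>) (emb (1\<^sub>m 1))"
  "emb (adj c) * (emb J * (emb c * X)) = sc (of_real \<kappa>) (emb (1\<^sub>m 1) * X)"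
proof -
  show *: "emb (adj c) * (emb J * emb c) = sc (of_real \<kappa>) (emb (1\<^sub>m 1))"
    using arg_cong[OF cJc, of emb] c J by (simp add: emb_ring)
  show "emb (adj c) * (emb J * (emb c * X)) = sc (of_real \<kappa>) (emb (1\<^sub>m 1) * X)"
    using arg_cong[OF *, of "\<lambda>y. y * X"] by (simp add: emb_ring)
qed

lemma G_G: "G * G = of_real \<kappa> \<cdot>\<^sub>m G"
  by (rule emb_eqD) (use c J(1) in \<open>auto simp: G_def emb_ring emb_cJc\<close>)

lemma Uc_mult: "Uc k * Uc l = Uc (k + l + k * l * of_real \<kappa>)"
  by (rule emb_eqD) (use G_carrier emb_prod(1)[OF G_G] in \<open>auto simp: Uc_def emb_ring sc_plus algebra_simps\<close>)

lemma Uc_J: "adj (Uc k) * J * Uc k = J + (k + cnj k + k * cnj k * of_real \<kappa>) \<cdot>\<^sub>m (J * G)"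
proof -
  have JJ: "emb J * emb J = emb (1\<^sub>m m)" "emb J * (emb J * X) = emb (1\<^sub>m m) * X" for X
    using emb_prod(1)[OF J(3)] emb_prod(2)[OF J(3), of X] J by auto
  have aG: "emb (adj G) = emb J * (emb c * emb (adj c))" using c J(1,2) by (simp add: G_def adj_simps emb_ring)
  have eG: "emb G = emb c * (emb (adj c) * emb J)" using c J(1,2) by (simp add: G_def emb_ring)
  show ?thesis
    by (rule emb_eqD) (use G_carrier c J(1,2) in
      \<open>auto simp: Uc_def adj_simps emb_ring aG eG emb_cJc JJ sc_plus algebra_simps\<close>)
qed

text \<open>The condition means \<open>cmod (1 + k * \<kappa>) = 1\<close> if
  \<open>\<kappa> \<noteq> 0\<close>, and that \<open>k\<close> is purely imaginary if
  \<open>\<kappa> = 0\<close>.\<close>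

lemma Uc_J_unitary: "k + cnj k + k * cnj k * of_real \<kappa> = 0 \<Longrightarrow> J_unitary J (Uc k)"
  unfolding J_unitary_def Uc_J using J(1) G_carrier by (auto intro!: eq_matI)

lemma G_eq_0_imp: "G = 0\<^sub>m m m \<Longrightarrow> c = 0\<^sub>m m 1"
proof -
  assume G0: "G = 0\<^sub>m m m"
  have cc: "emb (adj c) * emb c = sc (of_real (nrm c)) (emb (1\<^sub>m 1))"
    "emb (adj c) * (emb c * X) = sc (of_real (nrm c)) (emb (1\<^sub>m 1) * X)" for X
    using emb_prod(1)[OF adj_mult_self[OF c]] emb_prod(2)[OF adj_mult_self[OF c], of X] c by (auto simp: emb_ring)
  have JJ: "emb J * emb J = emb (1\<^sub>m m)" "emb J * (emb J * X) = emb (1\<^sub>m m) * X" for X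
    using emb_prod(1)[OF J(3)] emb_prod(2)[OF J(3), of X] J by auto
  have "adj c * (G * (J * c)) = (of_real (nrm c * nrm c)) \<cdot>\<^sub>m 1\<^sub>m 1"
    by (rule emb_eqD) (use c J in \<open>auto simp: G_def emb_ring cc JJ\<close>)
  moreover have "adj c * (G * (J * c)) = 0\<^sub>m 1 1" using c J unfolding G0 by auto
  ultimately have "of_real (nrm c * nrm c) \<cdot>\<^sub>m 1\<^sub>m 1 = (0\<^sub>m 1 1 :: complex mat)" by simp
  from arg_cong[OF this, of "\<lambda>X. X $$ (0,0)"] have "nrm c = 0" by simp
  then show ?thesis using nrm_0_iff[OF c] by simp
qed

lemma qf_JG: "v \<in> carrier_mat m 1 \<Longrightarrow> qf (of_real x \<cdot>\<^sub>m (J * G)) v = of_real (x * (cmod ((adj c * J * v) $$ (0,0)))\<^sup>2)"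
proof -
  assume v: "v \<in> carrier_mat m 1"
  define w where "w = adj c * J * v"
  have w: "w \<in> carrier_mat 1 1" using c J v by (auto simp: w_def)
  have "adj v * (of_real x \<cdot>\<^sub>m (J * G)) * v = of_real x \<cdot>\<^sub>m (adj w * w)"
    by (rule emb_eqD) (use c J v G_carrier in \<open>auto simp: w_def G_def adj_simps emb_ring\<close>)
  also have "adj w * w = of_real (nrm w) \<cdot>\<^sub>m 1\<^sub>m 1" using adj_mult_self[OF w] .
  finally show ?thesis using w unfolding qf_def w_def[symmetric] by (simp add: nrm_def)
qed

text \<open>\<open>J * G\<close> equals \<open>w * adj w\<close> for \<open>w = J * c\<close>, so
  the sign of the scalar decides positivity.\<close>

lemma psd_JG: "x \<ge> 0 \<Longrightarrow> psd (of_real x \<cdot>\<^sub>m (J * G))"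
  using psd_iff[of "of_real x \<cdot>\<^sub>m (J * G)" m] J G_carrier qf_JG by auto

text \<open>The parameter of \<open>Uc\<close> is a Moebius function of \<open>w\<close> that
  vanishes at \<open>v\<close>. The multiplicative quantity \<open>1 + k * \<kappa>\<close> is a
  unimodular constant times \<open>b_fac (cnj a)\<close> if \<open>cmod a < 1\<close>, and times
  \<open>1 / b_fac (1 / a)\<close> if \<open>cmod a > 1\<close>. For \<open>cmod a = 1\<close> it
  degenerates to 1, and \<open>k\<close> itself is the kernel of the third kind up to scale and an
  imaginary constant.\<close>

lemma BP_factor_rank_one:
  assumes a: "\<kappa> = 1 - (cmod a)\<^sup>2" and v: "v = 1 \<or> v = -1" and va: "v * a \<noteq> 1" and c0: "c \<noteq> 0\<^sub>m m 1"
  shows "\<exists>b E. BP_factor m J b \<and> finite E \<and> (\<forall>w. w \<notin> E \<longrightarrow> b w = Uc ((w - v) / ((v - cnj a) * (1 - w * a))))"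
proof -
  have G0: "G \<noteq> 0\<^sub>m m m" using G_eq_0_imp c0 by auto
  have vv: "v * v = 1" "cnj v = v" "v \<noteq> 0" "v\<^sup>2 = 1" using v by auto
  have nva: "v - cnj a \<noteq> 0"
  proof
    assume "v - cnj a = 0"
    then have "cnj (cnj a) = cnj v" by simp
    then show False using va vv by simp
  qed
  have ua: "1 - v * a = v * cnj (v - cnj a)" using vv by (simp add: algebra_simps)
  have mod_ua: "cmod (1 - v * a) = cmod (v - cnj a)" unfolding ua norm_mult complex_mod_cnj using v by auto
  have kap: "complex_of_real \<kappa> = 1 - a * cnj a" unfolding a by (metis complex_norm_square of_real_1 of_real_diff)
  define k where "k w = (w - v) / ((v - cnj a) * (1 - w * a))" for w
  have phi: "1 + k w * of_real \<kappa> = (w - cnj a) * (1 - v * a) / ((v - cnj a) * (1 - w * a))" if "1 - w * a \<noteq> 0" for w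
  proof -
    have "1 + k w * of_real \<kappa> = ((v - cnj a) * (1 - w * a) + (w - v) * (1 - a * cnj a)) / ((v - cnj a) * (1 - w * a))"
      unfolding k_def kap using nva that by (simp add: add_divide_distrib)
    also have "(v - cnj a) * (1 - w * a) + (w - v) * (1 - a * cnj a) = (w - cnj a) * (1 - v * a)"
      by (simp add: algebra_simps)
    finally show ?thesis .
  qed
  \<comment> \<open>The unimodular constant left over when \<open>phi\<close> is written with
    \<open>(cnj a - w) / (1 - w * a)\<close>. The phases built into \<open>b_fac\<close> are
    compensated in \<open>\<eta>\<close> below.\<close>
  define \<eta>0 where "\<eta>0 = - (1 - v * a) / (v - cnj a)"
  have eta0: "cmod \<eta>0 = 1" unfolding \<eta>0_def norm_divide norm_minus_cancel mod_ua using nva by simp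
  have fin: "finite {w. 1 - w * a = 0}"
  proof (rule finite_subset)
    show "{w. 1 - w * a = 0} \<subseteq> {1 / a}"
      by (cases "a = 0") (auto simp: eq_divide_eq)
  qed simp
  have Veta: "J_unitary J (Uc ((\<eta> - 1) / of_real \<kappa>))" if "cmod \<eta> = 1" "\<kappa> \<noteq> 0" for \<eta>
  proof (rule Uc_J_unitary)
    have "\<eta> * cnj \<eta> = 1" using that(1) by (metis complex_norm_square of_real_1 one_power2)
    then show "(\<eta> - 1) / of_real \<kappa> + cnj ((\<eta> - 1) / of_real \<kappa>)
        + (\<eta> - 1) / of_real \<kappa> * cnj ((\<eta> - 1) / of_real \<kappa>) * of_real \<kappa> = 0"
      using that(2) by (simp add: field_simps)
  qed
  have one: "J_unitary J (1\<^sub>m m)" unfolding J_unitary_def using J(1) by (simp add: adj_simps)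
  have comb: "Uc ((\<beta> - 1) / of_real \<kappa>) * Uc ((\<eta> - 1) / of_real \<kappa>) = Uc l"
    if "\<kappa> \<noteq> 0" "1 + l * of_real \<kappa> = \<eta> * \<beta>" for \<beta> \<eta> l
  proof -
    have k0: "complex_of_real \<kappa> \<noteq> 0" using that(1) by simp
    have "x / k + y / k + x / k * (y / k) * k = ((x + 1) * (y + 1) - 1) / k" if "k \<noteq> 0" for x y k :: complex
      using that by (simp add: field_simps)
    from this[OF k0, of "\<beta> - 1" "\<eta> - 1"] that(2) k0
    have "(\<beta> - 1) / of_real \<kappa> + (\<eta> - 1) / of_real \<kappa> +
        (\<beta> - 1) / of_real \<kappa> * ((\<eta> - 1) / of_real \<kappa>) * of_real \<kappa> = l"
      by (simp add: mult.commute[of \<eta> \<beta>] eq_commute[of _ "\<beta> * \<eta>"])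
    then show ?thesis unfolding Uc_mult by simp
  qed
  have UcP: "1\<^sub>m m + x \<cdot>\<^sub>m ((1 / of_real \<kappa>) \<cdot>\<^sub>m G) = Uc (x / of_real \<kappa>)" for x
    unfolding Uc_def using G_carrier by (auto intro!: eq_matI)
  define Pr where "Pr = (1 / complex_of_real \<kappa>) \<cdot>\<^sub>m G"
  have Pr: "Pr \<in> carrier_mat m m" using G_carrier by (auto simp: Pr_def)
  have Pr0: "Pr \<noteq> 0\<^sub>m m m" if "\<kappa> \<noteq> 0"
  proof
    assume "Pr = 0\<^sub>m m m"
    then have "of_real \<kappa> \<cdot>\<^sub>m Pr = 0\<^sub>m m m" by simp
    moreover have "of_real \<kappa> \<cdot>\<^sub>m Pr = G" unfolding Pr_def using that G_carrier by (auto intro!: eq_matI)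
    ultimately show False using G0 by simp
  qed
  have PrPr: "Pr * Pr = Pr" if "\<kappa> \<noteq> 0"
    unfolding Pr_def by (rule emb_eqD) (use G_carrier that emb_prod(1)[OF G_G] in \<open>auto simp: emb_ring\<close>)
  have JPr: "J * Pr = of_real (1 / \<kappa>) \<cdot>\<^sub>m (J * G)" "- (J * Pr) = of_real (- 1 / \<kappa>) \<cdot>\<^sub>m (J * G)"
    unfolding Pr_def using J G_carrier by (auto intro!: eq_matI simp: mult_smult_distrib[of _ m m])
  consider "cmod a < 1" | "cmod a > 1" | "cmod a = 1" by linarith
  then show ?thesis
  proof cases
    case 1
    then have kp: "\<kappa> > 0" unfolding a using abs_square_less_1[of "cmod a"] by simp
    define \<alpha> where "\<alpha> = cnj a"
    define \<eta> where "\<eta> = (if a = 0 then v else \<eta>0 * (\<alpha> / of_real (cmod \<alpha>)))"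
    have eta: "cmod \<eta> = 1" using v eta0 by (auto simp: \<eta>_def \<alpha>_def norm_mult norm_divide)
    have phi2: "1 + k w * of_real \<kappa> = \<eta> * b_fac \<alpha> w" if "1 - w * a \<noteq> 0" for w
    proof (cases "a = 0")
      case True
      then show ?thesis unfolding phi[OF that] using v by (auto simp: \<eta>_def b_fac_def \<alpha>_def)
    next
      case False
      have "\<eta> * b_fac \<alpha> w = \<eta>0 * ((\<alpha> / of_real (cmod \<alpha>)) * (of_real (cmod \<alpha>) / \<alpha>)) * ((cnj a - w) / (1 - a * w))"
        using False by (simp only: \<eta>_def b_fac_def if_False) (simp add: \<alpha>_def)
      also have "(\<alpha> / of_real (cmod \<alpha>)) * (of_real (cmod \<alpha>) / \<alpha>) = 1" using False by (simp add: \<alpha>_def)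
      finally show ?thesis unfolding phi[OF that] using that nva
        by (simp add: \<eta>0_def field_simps)
    qed
    let ?B = "\<lambda>w. 1\<^sub>m m + (b_fac \<alpha> w - 1) \<cdot>\<^sub>m Pr"
    have "elem_factor m J ?B" unfolding elem_factor_def
      using 1 Pr Pr0 PrPr JPr psd_JG[of "1 / \<kappa>"] kp by (intro disjI1 exI[of _ \<alpha>] exI[of _ Pr]) (auto simp: \<alpha>_def)
    then have "BP_factor m J (\<lambda>w. 1\<^sub>m m * ?B w * Uc ((\<eta> - 1) / of_real \<kappa>))"
      unfolding BP_factor_def using one Veta[OF eta] kp Uc_carrier one_carrier_mat by blast
    moreover have "1\<^sub>m m * ?B w * Uc ((\<eta> - 1) / of_real \<kappa>) = Uc (k w)" if "1 - w * a \<noteq> 0" for w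
      using comb[OF _ phi2[OF that]] kp Pr UcP[of "b_fac \<alpha> w - 1", folded Pr_def]
      by (simp add: left_mult_one_mat[OF Uc_carrier])
    ultimately show ?thesis using fin unfolding k_def by blast
  next
    case 2
    then have kn: "\<kappa> < 0" unfolding a by (simp add: one_less_power)
    have a0: "a \<noteq> 0" using 2 by auto
    define \<alpha> where "\<alpha> = 1 / a"
    have al: "cmod \<alpha> < 1" using 2 a0 by (simp add: \<alpha>_def norm_divide divide_less_eq_1)
    define \<eta> where "\<eta> = \<eta>0 * ((of_real (cmod \<alpha>) / \<alpha>) * (cnj a / a))"
    have eta: "cmod \<eta> = 1" using eta0 a0 by (auto simp: \<eta>_def \<alpha>_def norm_mult norm_divide)
    have phi2: "1 + k w * of_real \<kappa> = \<eta> * (1 / b_fac \<alpha> w)" if "1 - w * a \<noteq> 0" for w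
    proof -
      have "1 / b_fac \<alpha> w = (\<alpha> / of_real (cmod \<alpha>)) * ((1 - cnj \<alpha> * w) / (\<alpha> - w))"
        using a0 by (simp add: b_fac_def \<alpha>_def)
      also have "(1 - cnj \<alpha> * w) / (\<alpha> - w) = (a / cnj a) * ((cnj a - w) / (1 - w * a))"
      proof -
        have "1 - cnj \<alpha> * w = (cnj a - w) / cnj a" "\<alpha> - w = (1 - w * a) / a" using a0 by (auto simp: \<alpha>_def field_simps)
        then show ?thesis using a0 that by simp
      qed
      finally have "\<eta> * (1 / b_fac \<alpha> w) = \<eta>0 * ((cnj a - w) / (1 - w * a))"
        using a0 by (simp add: \<eta>_def \<alpha>_def)
      then show ?thesis unfolding phi[OF that] using that nva by (simp add: \<eta>0_def field_simps)
    qed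
    let ?B = "\<lambda>w. 1\<^sub>m m + (1 / b_fac \<alpha> w - 1) \<cdot>\<^sub>m Pr"
    have "elem_factor m J ?B" unfolding elem_factor_def
      using al Pr Pr0 PrPr JPr psd_JG[of "- 1 / \<kappa>"] kn
      by (intro disjI2 disjI1 exI[of _ \<alpha>] exI[of _ Pr]) (auto simp: divide_nonpos_neg)
    then have "BP_factor m J (\<lambda>w. 1\<^sub>m m * ?B w * Uc ((\<eta> - 1) / of_real \<kappa>))"
      unfolding BP_factor_def using one Veta[OF eta] kn Uc_carrier one_carrier_mat by blast
    moreover have "1\<^sub>m m * ?B w * Uc ((\<eta> - 1) / of_real \<kappa>) = Uc (k w)" if "1 - w * a \<noteq> 0" for w
      using comb[OF _ phi2[OF that]] kn Pr UcP[of "1 / b_fac \<alpha> w - 1", folded Pr_def]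
      by (simp add: left_mult_one_mat[OF Uc_carrier])
    ultimately show ?thesis using fin unfolding k_def by blast
  next
    case 3
    then have k0: "\<kappa> = 0" unfolding a by simp
    have aa: "a * cnj a = 1" using 3 by (metis complex_norm_square of_real_1 one_power2)
    have a0: "a \<noteq> 0" using 3 by auto
    define u where "u = cnj a"
    have ua1: "u * a = 1" using aa by (simp add: u_def mult.commute)
    have u0: "u \<noteq> 0" "v - u \<noteq> 0" "u - v \<noteq> 0" using ua1 nva by (auto simp: u_def)
    \<comment> \<open>Half of the kernel \<open>(u + w) / (u - w)\<close> at \<open>w = v\<close>,
      so that the complete factor is the identity at \<open>v\<close>. It is purely imaginary, which
      is \<open>J\<close>-unitarity of \<open>Uc t\<close> when \<open>\<kappa> = 0\<close>.\<close>
    define t where "t = (u + v) / (2 * (u - v))"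
    define R where "R = (1/2 :: complex) \<cdot>\<^sub>m G"
    have R: "R \<in> carrier_mat m m" using G_carrier by (auto simp: R_def)
    have "R \<noteq> 0\<^sub>m m m"
    proof
      assume "R = 0\<^sub>m m m"
      then have "2 \<cdot>\<^sub>m R = 0\<^sub>m m m" by simp
      moreover have "2 \<cdot>\<^sub>m R = G" unfolding R_def using G_carrier by (auto intro!: eq_matI)
      ultimately show False using G0 by simp
    qed
    moreover have "R * R = 0\<^sub>m m m"
      unfolding R_def by (rule emb_eqD) (use G_carrier emb_prod(1)[OF G_G] k0 in \<open>auto simp: emb_ring\<close>)
    moreover have "J * R = of_real (1/2) \<cdot>\<^sub>m (J * G)"
      unfolding R_def using J G_carrier by (auto intro!: eq_matI simp: mult_smult_distrib[of _ m m])
    moreover have "cmod u = 1" using 3 by (simp add: u_def)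
    ultimately have "elem_factor m J (\<lambda>w. 1\<^sub>m m - ((u + w) / (u - w)) \<cdot>\<^sub>m R)"
      unfolding elem_factor_def using R psd_JG[of "1/2"] by (intro disjI2 exI[of _ u] exI[of _ R]) auto
    moreover have "J_unitary J (Uc t)"
    proof (rule Uc_J_unitary)
      have "cnj u = 1 / u" using ua1 u0 by (simp add: u_def field_simps)
      then have "cnj t = (1 + v * u) / (2 * (1 - v * u))"
      proof -
        assume cu: "cnj u = 1 / u"
        have "cnj t = (1 / u + v) / (2 * (1 / u - v))" unfolding t_def by (simp add: cu vv(2))
        also have "1 / u + v = (1 + v * u) / u" using u0 by (simp add: field_simps)
        also have "2 * (1 / u - v) = 2 * (1 - v * u) / u" using u0 by (simp add: field_simps)
        finally show ?thesis using u0 by simp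
      qed
      also have "1 + v * u = v * (u + v)" using vv by (simp add: algebra_simps)
      also have "1 - v * u = v * (v - u)" using vv by (simp add: algebra_simps)
      also have "v * (u + v) / (2 * (v * (v - u))) = (u + v) / (- (2 * (u - v)))"
        using vv(3) by (simp add: mult.left_commute[of 2 v])
      also have "\<dots> = - t" unfolding t_def by (rule minus_divide_right[symmetric])
      finally have "cnj t = - t" .
      then show "t + cnj t + t * cnj t * of_real \<kappa> = 0" using k0 by simp
    qed
    ultimately have "BP_factor m J (\<lambda>w. 1\<^sub>m m * (1\<^sub>m m - ((u + w) / (u - w)) \<cdot>\<^sub>m R) * Uc t)"
      unfolding BP_factor_def using one Uc_carrier one_carrier_mat by blast
    moreover have "1\<^sub>m m * (1\<^sub>m m - ((u + w) / (u - w)) \<cdot>\<^sub>m R) * Uc t = Uc (k w)" if "1 - w * a \<noteq> 0" for w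
    proof -
      have uw: "1 - w * a = (u - w) * a" using ua1 by (simp add: algebra_simps)
      then have uw0: "u - w \<noteq> 0" using that by auto
      have "1\<^sub>m m - ((u + w) / (u - w)) \<cdot>\<^sub>m R = Uc (- (u + w) / (2 * (u - w)))"
      proof -
        have "((u + w) / (u - w)) \<cdot>\<^sub>m R = ((u + w) / (2 * (u - w))) \<cdot>\<^sub>m G"
          unfolding R_def by (rule emb_eqD) (auto simp: emb_smult sc_sc right_diff_distrib mult.commute)
        then show ?thesis unfolding Uc_def minus_divide_left[symmetric]
          using G_carrier by (auto intro!: eq_matI)
      qed
      moreover have "- (u + w) / (2 * (u - w)) + t = k w"
      proof -
        have "k w = (w - v) * u / ((v - u) * (u - w))"
          unfolding k_def uw u_def[symmetric] using ua1 u0 a0 uw0 by (simp add: divide_simps)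
        moreover have "- (2 * u - x) / (2 * x) + (2 * u - y) / (2 * y) = (y - x) * u / ((- y) * x)"
          if "x \<noteq> 0" "y \<noteq> 0" for x y
          using that by (simp add: field_simps)
        from this[of "u - w" "u - v"] u0 uw0 have "- (u + w) / (2 * (u - w)) + t = (w - v) * u / ((v - u) * (u - w))"
          unfolding t_def by (simp add: algebra_simps)
        ultimately show ?thesis by simp
      qed
      ultimately show ?thesis using Uc_mult k0 by (simp add: left_mult_one_mat[OF Uc_carrier])
    qed
    ultimately show ?thesis using fin unfolding k_def by blast
  qed
qed

end

section \<open>Factorisation of conservative realisations\<close>

text \<open>The three identities say that the block matrix with rows \<open>A\<close>,
  \<open>B\<close> and \<open>C\<close>, \<open>D\<close> preserves the form with diagonal blocks
  \<open>1\<close> and \<open>J\<close>: the state carries a definite energy, and only inputs and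
  outputs are measured by \<open>J\<close>.\<close>

definition colligation :: "nat \<Rightarrow> complex mat \<Rightarrow> nat \<Rightarrow> complex mat \<Rightarrow> complex mat \<Rightarrow> complex mat \<Rightarrow> complex mat \<Rightarrow> bool" where
  "colligation m J N A B C D \<longleftrightarrow>
     A \<in> carrier_mat N N \<and> B \<in> carrier_mat N m \<and> C \<in> carrier_mat m N \<and> D \<in> carrier_mat m m \<and>
     adj A * A + adj C * J * C = 1\<^sub>m N \<and> adj A * B + adj C * J * D = 0\<^sub>m N m \<and>
     adj B * B + adj D * J * D = J"

lemma BP_factor_carrier:
  assumes "BP_factor m J b" shows "b w \<in> carrier_mat m m"
proof -
  have "Bt w \<in> carrier_mat m m" if "elem_factor m J Bt" for Bt
    using that by (auto simp: elem_factor_def)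
  then show ?thesis using assms unfolding BP_factor_def by (auto intro!: mult_carrier_mat)
qed

text \<open>A constant product is a case of its own and not an empty list of factors; it is absorbed
  into the right \<open>J\<close>-unitary matrix of the new factor.\<close>

lemma BP_product_mult_factor:
  assumes b: "BP_factor m J b" and F: "BP_product m J F" and J: "J \<in> carrier_mat m m"
  shows "BP_product m J (\<lambda>w. b w * F w)"
  using F unfolding BP_product_def
proof (elim disjE exE conjE)
  fix U assume U: "U \<in> carrier_mat m m" "J_unitary J U" "F = (\<lambda>w. U)"
  from b obtain U1 V1 Bt where 1: "U1 \<in> carrier_mat m m" "V1 \<in> carrier_mat m m"
      "J_unitary J U1" "J_unitary J V1" "elem_factor m J Bt" "b = (\<lambda>w. U1 * Bt w * V1)"
    unfolding BP_factor_def by blast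
  have Bt: "Bt w \<in> carrier_mat m m" for w using 1(5) by (auto simp: elem_factor_def)
  have "J_unitary J (V1 * U)"
  proof -
    have 2: "emb (adj V1) * (emb J * (emb V1 * X)) = emb J * X" for X
      using arg_cong[OF 1(4)[unfolded J_unitary_iff_emb[OF J 1(2)]], of "\<lambda>y. y * X"] by (simp add: mult.assoc)
    show ?thesis using U(2) unfolding J_unitary_iff_emb[OF J U(1)] J_unitary_iff_emb[OF J mult_carrier_mat[OF 1(2) U(1)]]
      using 1(2) U(1) by (simp add: adj_simps emb_ring 2)
  qed
  then have bf: "BP_factor m J (\<lambda>w. U1 * Bt w * (V1 * U))"
    unfolding BP_factor_def using 1 U(1) by (intro exI[of _ U1] exI[of _ "V1 * U"] exI[of _ Bt]) auto
  have eq: "(\<lambda>w. b w * F w) = (\<lambda>w. foldr (\<lambda>b M. b w * M) [\<lambda>w. U1 * Bt w * (V1 * U)] (1\<^sub>m m))"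
  proof
    fix w
    have "U1 * Bt w * V1 * U = U1 * Bt w * (V1 * U) * 1\<^sub>m m"
      by (rule emb_eqD) (use 1(1,2) U(1) Bt[of w] in \<open>auto simp: emb_ring\<close>)
    then show "b w * F w = foldr (\<lambda>b M. b w * M) [\<lambda>w. U1 * Bt w * (V1 * U)] (1\<^sub>m m)"
      unfolding 1(6) U(3) by simp
  qed
  show "(\<exists>U. U \<in> carrier_mat m m \<and> J_unitary J U \<and> (\<lambda>w. b w * F w) = (\<lambda>w. U)) \<or>
    (\<exists>Bs. Bs \<noteq> [] \<and> (\<forall>b\<in>set Bs. BP_factor m J b) \<and>
          (\<lambda>w. b w * F w) = (\<lambda>w. foldr (\<lambda>b M. b w * M) Bs (1\<^sub>m m)))"
    using bf eq by (intro disjI2 exI[of _ "[\<lambda>w. U1 * Bt w * (V1 * U)]"]) auto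
next
  fix Bs assume Bs: "Bs \<noteq> []" "\<forall>b\<in>set Bs. BP_factor m J b" "F = (\<lambda>w. foldr (\<lambda>b M. b w * M) Bs (1\<^sub>m m))"
  then show "(\<exists>U. U \<in> carrier_mat m m \<and> J_unitary J U \<and> (\<lambda>w. b w * F w) = (\<lambda>w. U)) \<or>
    (\<exists>Bs. Bs \<noteq> [] \<and> (\<forall>b\<in>set Bs. BP_factor m J b) \<and>
          (\<lambda>w. b w * F w) = (\<lambda>w. foldr (\<lambda>b M. b w * M) Bs (1\<^sub>m m)))"
    using b by (intro disjI2 exI[of _ "b # Bs"]) auto
qed

lemma BP_product_carrier:
  assumes "BP_product m J F" shows "F w \<in> carrier_mat m m"
proof -
  have "foldr (\<lambda>b M. b w * M) Bs (1\<^sub>m m) \<in> carrier_mat m m" if "\<forall>b\<in>set Bs. BP_factor m J b" for Bs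
    using that by (induction Bs) (auto intro!: mult_carrier_mat[OF BP_factor_carrier])
  then show ?thesis using assms unfolding BP_product_def by auto
qed

text \<open>The triangularisation step in terms of isometries onto an eigenvector and onto its
  orthogonal complement. The corners of a block matrix then become plain products such as
  \<open>adj E2 * A * E2\<close>, to which the ring rules apply.\<close>

lemma eigen_frame:
  fixes A :: "complex mat"
  assumes A: "A \<in> carrier_mat (Suc N) (Suc N)"
  obtains a E1 E2 where "E1 \<in> carrier_mat (Suc N) 1" "E2 \<in> carrier_mat (Suc N) N"
    "adj E1 * E1 = 1\<^sub>m 1" "adj E2 * E2 = 1\<^sub>m N" "adj E1 * E2 = 0\<^sub>m 1 N" "adj E2 * E1 = 0\<^sub>m N 1"
    "E1 * adj E1 + E2 * adj E2 = 1\<^sub>m (Suc N)" "A * E1 = a \<cdot>\<^sub>m E1"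
proof -
  from unitary_eigen_split[OF A] obtain H a r A' where
    H: "H \<in> carrier_mat (Suc N) (Suc N)" "adj H * H = 1\<^sub>m (Suc N)" and r: "r \<in> carrier_mat 1 N"
    and A': "A' \<in> carrier_mat N N"
    and T: "adj H * A * H = four_block_mat (a \<cdot>\<^sub>m 1\<^sub>m 1) r (0\<^sub>m N 1) A'" by blast
  define s1 :: "complex mat" where "s1 = mat (Suc N) 1 (\<lambda>(i,j). if i = 0 then 1 else 0)"
  define s2 :: "complex mat" where "s2 = mat (Suc N) N (\<lambda>(i,j). if i = Suc j then 1 else 0)"
  have s: "s1 \<in> carrier_mat (Suc N) 1" "s2 \<in> carrier_mat (Suc N) N" by (auto simp: s1_def s2_def)
  have ss: "adj s1 * s1 = 1\<^sub>m 1" "adj s1 * s2 = 0\<^sub>m 1 N" "adj s2 * s2 = 1\<^sub>m N"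
    by (rule eq_matI; auto simp: s1_def s2_def scalar_prod_def if_distrib[where f="\<lambda>x. _ * x"]
        if_distrib[where f=cnj] sum.delta cong: if_cong)+
  have s1s: "s1 * adj s1 + s2 * adj s2 = 1\<^sub>m (Suc N)"
  proof (rule eq_matI)
    fix i j assume "i < dim_row (1\<^sub>m (Suc N) :: complex mat)" "j < dim_col (1\<^sub>m (Suc N) :: complex mat)"
    then have ij: "i < Suc N" "j < Suc N" by auto
    have "(\<Sum>k = 0..<N. (if i = Suc k then 1 else 0) * cnj (if j = Suc k then 1 else 0)) = (if i = j \<and> i \<noteq> 0 then 1 else (0::complex))"
    proof (cases i)
      case (Suc i')
      then have "(\<Sum>k = 0..<N. (if i = Suc k then 1 else 0) * cnj (if j = Suc k then 1 else 0))
        = (\<Sum>k = 0..<N. if k = i' then (if i = j then 1 else 0) else (0::complex))"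
        by (intro sum.cong) auto
      then show ?thesis using Suc ij by (simp add: sum.delta)
    qed simp
    then show "(s1 * adj s1 + s2 * adj s2) $$ (i,j) = 1\<^sub>m (Suc N) $$ (i,j)"
      using ij by (auto simp: s1_def s2_def scalar_prod_def)
  qed (use s in auto)
  have T1: "adj H * A * H * s1 = a \<cdot>\<^sub>m s1" unfolding T
    by (rule eq_matI) (use A' in \<open>auto simp: s1_def scalar_prod_def if_distrib[where f="\<lambda>x. _ * x"] sum.delta cong: if_cong\<close>)
  note HH = unitary_right[OF H]
  note e = emb_prod(1)[OF H(2)] emb_prod(2)[OF H(2)] emb_prod(1)[OF HH] emb_prod(2)[OF HH]
  show thesis
  proof (rule that[of "H * s1" "H * s2" a])
    show "H * s1 \<in> carrier_mat (Suc N) 1" "H * s2 \<in> carrier_mat (Suc N) N" using H s by auto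
    show "adj (H * s1) * (H * s1) = 1\<^sub>m 1" "adj (H * s2) * (H * s2) = 1\<^sub>m N" "adj (H * s1) * (H * s2) = 0\<^sub>m 1 N"
      by (rule emb_eqD; use H(1) s e emb_prod(1)[OF ss(1)] emb_prod(1)[OF ss(2)] emb_prod(1)[OF ss(3)] in
        \<open>auto simp: adj_simps emb_ring\<close>)+
    show "adj (H * s2) * (H * s1) = 0\<^sub>m N 1"
    proof -
      have "adj s2 * s1 = 0\<^sub>m N 1" using arg_cong[OF ss(2), of adj] s by (simp add: adj_simps)
      from emb_prod(1)[OF this] show ?thesis
        by (intro emb_eqD) (use H(1) s e in \<open>auto simp: adj_simps emb_ring\<close>)
    qed
    have "H * s1 * adj (H * s1) + H * s2 * adj (H * s2) = H * (s1 * adj s1 + s2 * adj s2) * adj H"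
      by (rule emb_eqD) (use H(1) s in \<open>auto simp: adj_simps emb_ring\<close>)
    then show "H * s1 * adj (H * s1) + H * s2 * adj (H * s2) = 1\<^sub>m (Suc N)" unfolding s1s using HH H(1) by simp
    have "A * (H * s1) = H * (adj H * A * H * s1)"
      by (rule emb_eqD) (use A H(1) s e in \<open>auto simp: adj_simps emb_ring\<close>)
    also have "\<dots> = a \<cdot>\<^sub>m (H * s1)" unfolding T1 using H(1) s by (intro emb_eqD) (auto simp: emb_ring)
    finally show "A * (H * s1) = a \<cdot>\<^sub>m (H * s1)" .
  qed
qed

text \<open>Induction on the state dimension. An eigenvector of \<open>A\<close> spans an invariant
  subspace, and the transfer function acquires a left rank one factor that depends only on the
  eigenvalue and on the output \<open>cc\<close> of the eigenvector; what remains is the transfer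
  function of a colligation with one state less. The state equation is carried along through a
  solution \<open>X\<close> instead of a resolvent, and exceptional points accumulate in a finite
  set.\<close>

theorem colligation_BP_product:
  assumes sig: "signature_mat m J" and col: "colligation m J N A B C D"
  shows "\<exists>F E. BP_product m J F \<and> finite E \<and>
    (\<forall>z X. z \<notin> E \<longrightarrow> X \<in> carrier_mat N m \<longrightarrow> (1\<^sub>m N - z \<cdot>\<^sub>m A) * X = B \<longrightarrow> F z = D + z \<cdot>\<^sub>m (C * X))"
  using col
proof (induction N arbitrary: A B C D)
  case 0
  then have c: "B \<in> carrier_mat 0 m" "C \<in> carrier_mat m 0" "D \<in> carrier_mat m m" "adj B * B + adj D * J * D = J"
    by (auto simp: colligation_def)
  have J: "J \<in> carrier_mat m m" using sig by (auto simp: signature_mat_def)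
  have "adj B * B = 0\<^sub>m m m" using c(1) by (intro eq_matI) (auto simp: scalar_prod_def)
  then have "J_unitary J D" unfolding J_unitary_def using c J by (metis adj_carrier left_add_zero_mat mult_carrier_mat)
  moreover have "D = D + z \<cdot>\<^sub>m (C * X)" if "X \<in> carrier_mat 0 m" for z X
    using c that by (intro eq_matI) (auto simp: scalar_prod_def)
  ultimately show ?case using c
    by (intro exI[of _ "\<lambda>_. D"] exI[of _ "{}"]) (auto simp: BP_product_def)
next
  case (Suc N)
  then have c: "A \<in> carrier_mat (Suc N) (Suc N)" "B \<in> carrier_mat (Suc N) m" "C \<in> carrier_mat m (Suc N)" "D \<in> carrier_mat m m"
    and h1: "adj A * A + adj C * J * C = 1\<^sub>m (Suc N)" and h2: "adj A * B + adj C * J * D = 0\<^sub>m (Suc N) m"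
    and h3: "adj B * B + adj D * J * D = J"
    by (auto simp: colligation_def)
  have J: "J \<in> carrier_mat m m" "adj J = J" using sig by (auto simp: signature_mat_def)
  obtain a E1 E2 where E: "E1 \<in> carrier_mat (Suc N) 1" "E2 \<in> carrier_mat (Suc N) N"
    "adj E1 * E1 = 1\<^sub>m 1" "adj E2 * E2 = 1\<^sub>m N" "adj E1 * E2 = 0\<^sub>m 1 N" "adj E2 * E1 = 0\<^sub>m N 1"
    "E1 * adj E1 + E2 * adj E2 = 1\<^sub>m (Suc N)" "A * E1 = a \<cdot>\<^sub>m E1"
    by (rule eigen_frame[OF c(1)])
  note Ec = E(1,2)
  note dims = c Ec J(1)
  define r where "r = adj E1 * A * E2"
  define A' where "A' = adj E2 * A * E2"
  define cc where "cc = C * E1"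
  define C' where "C' = C * E2"
  define b where "b = adj E1 * B"
  define B' where "B' = adj E2 * B"
  have d': "r \<in> carrier_mat 1 N" "A' \<in> carrier_mat N N" "cc \<in> carrier_mat m 1" "C' \<in> carrier_mat m N"
    "b \<in> carrier_mat 1 m" "B' \<in> carrier_mat N m"
    using c Ec by (auto simp: r_def A'_def cc_def C'_def b_def B'_def)
  define \<kappa> where "\<kappa> = 1 - (cmod a)\<^sup>2"
  have kap: "complex_of_real \<kappa> = 1 - a * cnj a" unfolding \<kappa>_def by (metis complex_norm_square of_real_1 of_real_diff)
  have AE: "emb A * emb E1 = sc a (emb E1)" "emb A * (emb E1 * X) = sc a (emb E1 * X)" for X
    using emb_prod(1)[OF E(8)] emb_prod(2)[OF E(8), of X] c Ec by (auto simp: emb_ring)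
  have EA: "emb (adj E1) * (emb (adj A) * X) = sc (cnj a) (emb (adj E1) * X)" for X
  proof -
    have "adj E1 * adj A = cnj a \<cdot>\<^sub>m adj E1" using arg_cong[OF E(8), of adj] c Ec by (simp add: adj_simps)
    from emb_prod(2)[OF this, of X] show ?thesis using c Ec by (simp add: emb_ring)
  qed
  have EE: "emb (adj E1) * emb E1 = emb (1\<^sub>m 1)" "emb (adj E1) * (emb E1 * X) = emb (1\<^sub>m 1) * X"
    "emb (adj E2) * emb E2 = emb (1\<^sub>m N)" "emb (adj E2) * (emb E2 * X) = emb (1\<^sub>m N) * X"
    "emb (adj E1) * emb E2 = 0" "emb (adj E1) * (emb E2 * X) = 0"
    "emb (adj E2) * emb E1 = 0" "emb (adj E2) * (emb E1 * X) = 0" for X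
    using emb_prod(1)[OF E(3)] emb_prod(2)[OF E(3), of X] emb_prod(1)[OF E(4)] emb_prod(2)[OF E(4), of X]
      emb_prod(1)[OF E(5)] emb_prod(2)[OF E(5), of X] emb_prod(1)[OF E(6)] emb_prod(2)[OF E(6), of X] Ec
    by (auto simp: emb_zero)
  have sum1: "emb E1 * emb (adj E1) + emb E2 * emb (adj E2) = emb (1\<^sub>m (Suc N))"
    using arg_cong[OF E(7), of emb] Ec by (simp add: emb_ring)
  have res: "emb E1 * (emb (adj E1) * emb X) + emb E2 * (emb (adj E2) * emb X) = emb X" if "dim_row X = Suc N" for X
    using arg_cong[OF sum1, of "\<lambda>y. y * emb X"] that by (simp add: emb_ring)
  have H1: "emb (adj A) * emb A + emb (adj C) * (emb J * emb C) = emb (1\<^sub>m (Suc N))"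
    using arg_cong[OF h1, of emb] c J by (simp add: emb_ring)
  have H2: "emb (adj A) * emb B + emb (adj C) * (emb J * emb D) = 0"
    using arg_cong[OF h2, of emb] c J by (simp add: emb_ring)
  have H3: "emb (adj B) * emb B + emb (adj D) * (emb J * emb D) = emb J"
    using arg_cong[OF h3, of emb] c J by (simp add: emb_ring)
  \<comment> \<open>The unit eigenvector keeps the energy \<open>(cmod a)^2\<close> in the state, so
    its output carries the remaining \<open>\<kappa>\<close>.\<close>
  have cJc: "adj cc * J * cc = of_real \<kappa> \<cdot>\<^sub>m 1\<^sub>m 1"
  proof (rule emb_eqD)
    have "emb (adj E1) * ((emb (adj A) * emb A + emb (adj C) * (emb J * emb C)) * emb E1) = emb (1\<^sub>m 1)"
      unfolding H1 using Ec by (simp add: emb_ring EE)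
    then have "emb (adj E1) * (emb (adj C) * (emb J * (emb C * emb E1))) = emb (1\<^sub>m 1) - sc (cnj a * a) (emb (1\<^sub>m 1))"
      by (simp add: emb_ring EA AE EE algebra_simps eq_diff_eq)
    then show "emb (adj cc * J * cc) = emb (of_real \<kappa> \<cdot>\<^sub>m 1\<^sub>m 1)"
      using dims unfolding kap by (simp add: cc_def adj_simps emb_ring sc_minus mult.commute)
  qed (use d' J in auto)
  have cJC: "emb (adj cc) * (emb J * emb C') = sc (- cnj a) (emb r)"
  proof -
    have "emb (adj E1) * ((emb (adj A) * emb A + emb (adj C) * (emb J * emb C)) * emb E2) = 0"
      unfolding H1 using Ec by (simp add: emb_ring EE)
    then have "emb (adj E1) * (emb (adj C) * (emb J * (emb C * emb E2))) = - sc (cnj a) (emb (adj E1) * (emb A * emb E2))"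
      by (simp add: emb_ring EA add_eq_0_iff)
    then show ?thesis using dims by (simp add: cc_def C'_def r_def adj_simps emb_ring)
  qed
  have cJD: "emb (adj cc) * (emb J * emb D) = sc (- cnj a) (emb b)"
  proof -
    have "emb (adj E1) * (emb (adj A) * emb B + emb (adj C) * (emb J * emb D)) = 0"
      unfolding H2 by simp
    then have "emb (adj E1) * (emb (adj C) * (emb J * emb D)) = - sc (cnj a) (emb (adj E1) * emb B)"
      by (simp add: emb_ring EA add_eq_0_iff)
    then show ?thesis using dims by (simp add: cc_def b_def adj_simps emb_ring)
  qed
  have CJc: "emb (adj C') * (emb J * (emb cc * X)) = sc (- a) (emb (adj r) * X)" for X
  proof -
    have m: "adj cc * J * C' = (- cnj a) \<cdot>\<^sub>m r"
      by (rule emb_eqD) (use d' J cJC in \<open>auto simp: emb_ring\<close>)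
    have "adj C' * J * cc = (- a) \<cdot>\<^sub>m adj r"
      using arg_cong[OF m, of adj] d' J by (simp add: adj_simps) (metis adj_carrier assoc_mult_mat)
    from arg_cong[OF this, of "\<lambda>y. emb y * X"] show ?thesis using d' J by (simp add: emb_ring)
  qed
  have DJc: "emb (adj D) * (emb J * (emb cc * X)) = sc (- a) (emb (adj b) * X)" for X
  proof -
    have m: "adj cc * J * D = (- cnj a) \<cdot>\<^sub>m b"
      by (rule emb_eqD) (use d' J c cJD in \<open>auto simp: emb_ring\<close>)
    have "adj D * J * cc = (- a) \<cdot>\<^sub>m adj b"
      using arg_cong[OF m, of adj] d' J c by (simp add: adj_simps) (metis adj_carrier assoc_mult_mat)
    from arg_cong[OF this, of "\<lambda>y. emb y * X"] show ?thesis using d' J c by (simp add: emb_ring)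
  qed
  have K1: "emb (adj r) * emb r + emb (adj A') * emb A' + emb (adj C') * (emb J * emb C') = emb (1\<^sub>m N)"
  proof -
    have "emb (adj E2) * ((emb (adj A) * emb A + emb (adj C) * (emb J * emb C)) * emb E2) = emb (1\<^sub>m N)"
      unfolding H1 using Ec by (simp add: emb_ring EE)
    moreover have "emb (adj E2) * (emb (adj A) * (emb A * emb E2)) = emb (adj r) * emb r + emb (adj A') * emb A'"
    proof -
      have "emb A * emb E2 = emb E1 * emb r + emb E2 * emb A'"
        using res[of "A * E2"] dims by (simp add: r_def A'_def emb_ring)
      from arg_cong[OF this, of "\<lambda>y. emb (adj E2) * (emb (adj A) * y)"]
      show ?thesis using dims by (simp add: r_def A'_def adj_simps emb_ring)
    qed
    ultimately show ?thesis using dims by (simp add: C'_def adj_simps emb_ring)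
  qed
  have resB: "emb B = emb E1 * emb b + emb E2 * emb B'"
    using res[of B] dims by (simp add: b_def B'_def emb_ring)
  have K2: "emb (adj r) * emb b + emb (adj A') * emb B' + emb (adj C') * (emb J * emb D) = 0"
  proof -
    have "emb (adj E2) * (emb (adj A) * emb B + emb (adj C) * (emb J * emb D)) = 0"
      unfolding H2 by simp
    moreover have "emb (adj E2) * (emb (adj A) * emb B) = emb (adj r) * emb b + emb (adj A') * emb B'"
      unfolding resB using dims d' by (simp add: r_def A'_def adj_simps emb_ring)
    ultimately show ?thesis using dims by (simp add: C'_def adj_simps emb_ring)
  qed
  have K3: "emb (adj b) * emb b + emb (adj B') * emb B' + emb (adj D) * (emb J * emb D) = emb J"
  proof -
    have "emb (adj B) * emb B = emb (adj b) * emb b + emb (adj B') * emb B'"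
      using dims arg_cong[OF resB, of "\<lambda>y. emb (adj B) * y"] by (simp add: b_def B'_def adj_simps emb_ring)
    then show ?thesis using H3 by simp
  qed
  \<comment> \<open>The point of the circle at which the split-off factor will be the identity: 1,
    or -1 when 1 would be the pole of that factor.\<close>
  define v :: complex where "v = (if a = 1 then -1 else 1)"
  have v: "v = 1 \<or> v = -1" "v * a \<noteq> 1" by (auto simp: v_def)
  have vv: "v * v = 1" "cnj v = v" using v by auto
  have nva: "v - a \<noteq> 0"
    using v vv by auto
  have nva': "v - cnj a \<noteq> 0"
  proof
    assume "v - cnj a = 0"
    then have "cnj (v - cnj a) = 0" by simp
    then show False using nva vv by simp
  qed
  \<comment> \<open>Forced by the normalisation at \<open>v\<close>: there the smaller transfer
    function must equal the given one, and indeed \<open>\<gamma> * (1 - v * a) = v\<close> because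
    \<open>v * v = 1\<close>.\<close>
  define \<gamma> where "\<gamma> = 1 / (v - a)"
  define C2 where "C2 = C' + \<gamma> \<cdot>\<^sub>m (cc * r)"
  define D2 where "D2 = D + \<gamma> \<cdot>\<^sub>m (cc * b)"
  have d2: "C2 \<in> carrier_mat m N" "D2 \<in> carrier_mat m m" using d' c by (auto simp: C2_def D2_def)
  have cng: "cnj \<gamma> = 1 / (v - cnj a)" by (simp add: \<gamma>_def vv)
  have gam: "- (\<gamma> * a) - cnj \<gamma> * cnj a + cnj \<gamma> * \<gamma> * of_real \<kappa> = 1"
  proof -
    have "1 - v * a - v * cnj a + a * cnj a = (v - a) * (v - cnj a)" using vv by (simp add: algebra_simps)
    moreover have "(v - a) * (v - cnj a) * (- (\<gamma> * a) - cnj \<gamma> * cnj a + cnj \<gamma> * \<gamma> * of_real \<kappa>)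
      = - (v - cnj a) * a - (v - a) * cnj a + of_real \<kappa>"
    proof -
      have "x * y * (- (1 / x * a) - 1 / y * c + 1 / y * (1 / x) * K) = - y * a - x * c + K"
        if "x \<noteq> 0" "y \<noteq> 0" for x y c K :: complex
        using that by (simp add: field_simps)
      from this[OF nva nva'] show ?thesis unfolding cng unfolding \<gamma>_def .
    qed
    ultimately have "(v - a) * (v - cnj a) * (- (\<gamma> * a) - cnj \<gamma> * cnj a + cnj \<gamma> * \<gamma> * of_real \<kappa>) = (v - a) * (v - cnj a)"
      unfolding kap by (simp add: algebra_simps)
    then show ?thesis using nva nva' by (metis mult_cancel_left1 no_zero_divisors)
  qed
  interpret R1: rank_one m J cc \<kappa> by unfold_locales (use sig d' cJc in auto)
  \<comment> \<open>One polarised identity serves all three colligation equations, with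
    \<open>(X, x)\<close> and \<open>(Y, y)\<close> ranging over \<open>(C', r)\<close> and
    \<open>(D, b)\<close>: the correction along \<open>cc\<close> restores exactly the energy
    \<open>adj x * y\<close> of the removed state.\<close>
  have main: "emb (adj (X + \<gamma> \<cdot>\<^sub>m (cc * x))) * (emb J * emb (Y + \<gamma> \<cdot>\<^sub>m (cc * y)))
      = emb (adj X) * (emb J * emb Y) + emb (adj x) * emb y"
    if "X \<in> carrier_mat m n" "x \<in> carrier_mat 1 n" "Y \<in> carrier_mat m k" "y \<in> carrier_mat 1 k"
      "\<And>Z. emb (adj X) * (emb J * (emb cc * Z)) = sc (- a) (emb (adj x) * Z)"
      "emb (adj cc) * (emb J * emb Y) = sc (- cnj a) (emb y)" for X x Y y n k
  proof -
    have g: "sc (- (\<gamma> * a)) Z + (sc (- (cnj \<gamma> * cnj a)) Z + sc (cnj \<gamma> * \<gamma> * of_real \<kappa>) Z) = Z" for Z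
    proof -
      have "- (\<gamma> * a) + (- (cnj \<gamma> * cnj a) + cnj \<gamma> * \<gamma> * of_real \<kappa>) = 1"
        using gam by (simp add: algebra_simps)
      then show ?thesis by (simp only: sc_plus[symmetric] sc_one)
    qed
    show ?thesis using that(1-4) d' J g[of "emb (adj x) * emb y"]
      by (simp add: adj_simps emb_ring that(5,6) R1.emb_cJc mult_ac add_ac)
  qed
  have "colligation m J N A' B' C2 D2" unfolding colligation_def
  proof (intro conjI)
    show "adj A' * A' + adj C2 * J * C2 = 1\<^sub>m N"
    proof (rule emb_eqD)
      have "emb (adj C2) * (emb J * emb C2) = emb (adj C') * (emb J * emb C') + emb (adj r) * emb r"
        unfolding C2_def by (rule main) (use d' CJc cJC in auto)
      then show "emb (adj A' * A' + adj C2 * J * C2) = emb (1\<^sub>m N)"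
        using K1 d' d2 J by (simp add: emb_ring add_ac)
    qed (use d' d2 J in auto)
    show "adj A' * B' + adj C2 * J * D2 = 0\<^sub>m N m"
    proof (rule emb_eqD)
      have "emb (adj C2) * (emb J * emb D2) = emb (adj C') * (emb J * emb D) + emb (adj r) * emb b"
        unfolding C2_def D2_def by (rule main) (use d' c CJc cJD in auto)
      then show "emb (adj A' * B' + adj C2 * J * D2) = emb (0\<^sub>m N m)"
        using K2 d' d2 J by (simp add: emb_ring add_ac)
    qed (use d' d2 J in auto)
    show "adj B' * B' + adj D2 * J * D2 = J"
    proof (rule emb_eqD)
      have "emb (adj D2) * (emb J * emb D2) = emb (adj D) * (emb J * emb D) + emb (adj b) * emb b"
        unfolding D2_def by (rule main) (use d' c DJc cJD in auto)
      then show "emb (adj B' * B' + adj D2 * J * D2) = emb J"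
        using K3 d' d2 J by (simp add: emb_ring add_ac)
    qed (use d' d2 J in auto)
  qed (use d' d2 in auto)
  from Suc.IH[OF this] obtain F2 E' where F2: "BP_product m J F2" "finite E'"
    "\<And>z X. z \<notin> E' \<Longrightarrow> X \<in> carrier_mat N m \<Longrightarrow> (1\<^sub>m N - z \<cdot>\<^sub>m A') * X = B' \<Longrightarrow> F2 z = D2 + z \<cdot>\<^sub>m (C2 * X)"
    by blast
  define k where "k w = (w - v) / ((v - cnj a) * (1 - w * a))" for w
  have step: "D + z \<cdot>\<^sub>m (C * X) = R1.Uc (k z) * F2 z"
    if z: "z \<notin> E'" "1 - z * a \<noteq> 0" and X: "X \<in> carrier_mat (Suc N) m" and eq: "(1\<^sub>m (Suc N) - z \<cdot>\<^sub>m A) * X = B" for z X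
  proof -
    define x where "x = adj E1 * X"
    define X' where "X' = adj E2 * X"
    have dX: "x \<in> carrier_mat 1 m" "X' \<in> carrier_mat N m" using X Ec by (auto simp: x_def X'_def)
    have resX: "emb X = emb E1 * emb x + emb E2 * emb X'"
      using res[of X] X Ec by (simp add: x_def X'_def emb_ring)
    have eqe: "emb X - sc z (emb A * emb X) = emb B"
      using arg_cong[OF eq, of emb] c X by (simp add: emb_ring)
    have "emb (adj E2) * (emb X - sc z (emb A * emb X)) = emb B'" unfolding eqe using dims by (simp add: B'_def emb_ring)
    then have eqX': "emb X' - sc z (emb A' * emb X') = emb B'"
      unfolding resX using dX dims by (simp add: A'_def emb_ring AE EE)
    have "(1\<^sub>m N - z \<cdot>\<^sub>m A') * X' = B'"
      by (rule emb_eqD) (use d' dX eqX' in \<open>auto simp: emb_ring\<close>)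
    then have F2z: "F2 z = D2 + z \<cdot>\<^sub>m (C2 * X')" using F2(3) z dX by blast
    have "emb (adj E1) * (emb X - sc z (emb A * emb X)) = emb b" unfolding eqe using dims by (simp add: b_def emb_ring)
    then have s: "emb b + sc z (emb r * emb X') = sc (1 - z * a) (emb x)"
      unfolding resX using dX dims by (simp add: r_def emb_ring AE EE sc_minus sc_one algebra_simps)
    have CX: "emb C * emb X = emb cc * emb x + emb C' * emb X'" unfolding resX
      using dims dX by (simp add: cc_def C'_def emb_ring)
    define w where "w = 1 - z * a"
    have F2e: "emb (F2 z) = emb D + sc z (emb C' * emb X') + sc (\<gamma> * w) (emb cc * emb x)"
    proof -
      have "emb (F2 z) = emb D + sc z (emb C' * emb X') + sc \<gamma> (emb cc * (emb b + sc z (emb r * emb X')))"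
        unfolding F2z using dX d' d2 c by (simp add: D2_def C2_def emb_ring mult_ac add_ac)
      then show ?thesis unfolding s w_def by (simp add: emb_ring)
    qed
    have GF: "emb (adj cc) * (emb J * emb (F2 z)) = sc ((\<gamma> * of_real \<kappa> - cnj a) * w) (emb x)"
    proof -
      have "emb (adj cc) * (emb J * emb (F2 z)) = sc (- cnj a) (emb b + sc z (emb r * emb X')) + sc (\<gamma> * w * of_real \<kappa>) (emb x)"
        unfolding F2e using arg_cong[OF cJC, of "\<lambda>y. y * emb X'"] dX
        by (simp add: emb_ring cJD R1.emb_cJc mult_ac)
      also have "\<dots> = sc ((\<gamma> * of_real \<kappa> - cnj a) * w) (emb x)" unfolding s w_def
        by (simp add: sc_sc sc_plus[symmetric] algebra_simps)
      finally show ?thesis .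
    qed
    have dF: "F2 z \<in> carrier_mat m m" unfolding F2z using d2 dX by auto
    \<comment> \<open>The smaller product contains \<open>cc * x\<close> with weight
      \<open>\<gamma> * w\<close>; the rank one factor has to raise this to the weight
      \<open>z\<close> that it has in the original transfer function.\<close>
    have sca: "\<gamma> * w + k z * ((\<gamma> * of_real \<kappa> - cnj a) * w) = z"
    proof -
      have w0: "w \<noteq> 0" using z by (simp add: w_def)
      have "\<gamma> * of_real \<kappa> - cnj a = (1 - v * cnj a) / (v - a)"
        unfolding \<gamma>_def kap using nva by (simp add: field_simps)
      also have "1 - v * cnj a = v * (v - cnj a)" using vv by (simp add: algebra_simps)
      finally have 1: "\<gamma> * of_real \<kappa> - cnj a = v * (v - cnj a) / (v - a)" .
      have "k z * ((\<gamma> * of_real \<kappa> - cnj a) * w) = (z - v) * v / (v - a)"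
        unfolding 1 k_def w_def[symmetric] using w0 nva nva' by simp
      then have "\<gamma> * w + k z * ((\<gamma> * of_real \<kappa> - cnj a) * w) = (w + (z - v) * v) / (v - a)"
        unfolding \<gamma>_def by (simp add: add_divide_distrib)
      also have "w + (z - v) * v = z * (v - a)" using vv by (simp add: w_def algebra_simps)
      finally show ?thesis using nva by simp
    qed
    show ?thesis
    proof (rule emb_eqD)
      have "emb (R1.Uc (k z) * F2 z) = emb (F2 z) + sc (k z) (emb cc * (emb (adj cc) * (emb J * emb (F2 z))))"
        using dF d' J by (simp add: R1.Uc_def R1.G_def emb_ring)
      also have "\<dots> = emb D + sc z (emb C' * emb X') + sc (\<gamma> * w + k z * ((\<gamma> * of_real \<kappa> - cnj a) * w)) (emb cc * emb x)"
        unfolding GF unfolding F2e by (simp add: emb_ring sc_plus)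
      also have "\<dots> = emb (D + z \<cdot>\<^sub>m (C * X))" unfolding sca
        using c X by (simp add: emb_ring CX add_ac)
      finally show "emb (D + z \<cdot>\<^sub>m (C * X)) = emb (R1.Uc (k z) * F2 z)" ..
    qed (use dF c X R1.Uc_carrier[of "k z"] in auto)
  qed
  have fin: "finite {w. 1 - w * a = 0}"
  proof (rule finite_subset)
    show "{w. 1 - w * a = 0} \<subseteq> {1 / a}"
      by (cases "a = 0") (auto simp: eq_divide_eq)
  qed simp
  show ?case
  \<comment> \<open>An eigenvector without output contributes the identity, which is not an
    elementary factor since those require \<open>P \<noteq> 0\<close>. Nothing is split off in that
    case.\<close>
  proof (cases "cc = 0\<^sub>m m 1")
    case True
    have U1: "R1.Uc k = 1\<^sub>m m" for k
      unfolding R1.Uc_def R1.G_def unfolding True using J by (intro eq_matI) (auto simp: scalar_prod_def)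
    have "F2 z = D + z \<cdot>\<^sub>m (C * X)"
      if "z \<notin> E' \<union> {w. 1 - w * a = 0}" "X \<in> carrier_mat (Suc N) m" "(1\<^sub>m (Suc N) - z \<cdot>\<^sub>m A) * X = B" for z X
    proof -
      have "R1.Uc (k z) * F2 z = D + z \<cdot>\<^sub>m (C * X)" using step[of z X] that by simp
      then show ?thesis unfolding U1 using BP_product_carrier[OF F2(1), of z] by simp
    qed
    then show ?thesis using F2 fin by (intro exI[of _ F2] exI[of _ "E' \<union> {w. 1 - w * a = 0}"]) auto
  next
    case False
    from R1.BP_factor_rank_one[OF \<kappa>_def v False] obtain bf Eb where bf: "BP_factor m J bf" "finite Eb"
      "\<And>w. w \<notin> Eb \<Longrightarrow> bf w = R1.Uc (k w)" unfolding k_def by blast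
    show ?thesis
    proof (intro exI[of _ "\<lambda>w. bf w * F2 w"] exI[of _ "E' \<union> {w. 1 - w * a = 0} \<union> Eb"] conjI allI impI)
      show "BP_product m J (\<lambda>w. bf w * F2 w)" using BP_product_mult_factor[OF bf(1) F2(1) J(1)] .
      show "finite (E' \<union> {w. 1 - w * a = 0} \<union> Eb)" using F2 fin bf by auto
      fix z X assume "z \<notin> E' \<union> {w. 1 - w * a = 0} \<union> Eb" "X \<in> carrier_mat (Suc N) m" "(1\<^sub>m (Suc N) - z \<cdot>\<^sub>m A) * X = B"
      then show "bf z * F2 z = D + z \<cdot>\<^sub>m (C * X)" using step[of z X] bf(3)[of z] by auto
    qed
  qed
qed

section \<open>Block Toeplitz matrices\<close>

text \<open>All block injections and the block shift are matrices of the form \<open>sel N M s\<close>, which map the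
  \<open>b\<close>-th unit vector to the \<open>(b + s)\<close>-th one (or to zero).\<close>

definition sel :: "nat \<Rightarrow> nat \<Rightarrow> nat \<Rightarrow> complex mat" where
  "sel N M s = mat N M (\<lambda>(a,b). if a = b + s then 1 else 0)"

lemma sel_dim[simp]: "dim_row (sel N M s) = N" "dim_col (sel N M s) = M"
  and sel_carrier[simp, intro]: "sel N M s \<in> carrier_mat N M"
  by (auto simp: sel_def)

lemma mult_sel:
  assumes "X \<in> carrier_mat n N"
  shows "X * sel N M s = mat n M (\<lambda>(a,b). if b + s < N then X $$ (a, b + s) else 0)"
  by (rule eq_matI) (use assms in \<open>auto simp: sel_def scalar_prod_def if_distrib[where f="\<lambda>x. _ * x"] sum.delta cong: if_cong\<close>)

lemma adj_sel_mult:
  assumes "X \<in> carrier_mat N n"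
  shows "adj (sel N M s) * X = mat M n (\<lambda>(a,b). if a + s < N then X $$ (a + s, b) else 0)"
  by (rule eq_matI) (use assms in \<open>auto simp: sel_def scalar_prod_def if_distrib[where f="\<lambda>x. x * _"]
      if_distrib[where f=cnj] sum.delta cong: if_cong\<close>)

lemma sel_mult:
  assumes "X \<in> carrier_mat M n"
  shows "sel N M s * X = mat N n (\<lambda>(a,b). if s \<le> a \<and> a - s < M then X $$ (a - s, b) else 0)"
proof (rule eq_matI)
  fix a b assume "a < dim_row (mat N n (\<lambda>(a,b). if s \<le> a \<and> a - s < M then X $$ (a - s, b) else 0))"
    "b < dim_col (mat N n (\<lambda>(a,b). if s \<le> a \<and> a - s < M then X $$ (a - s, b) else 0))"
  then have ab: "a < N" "b < n" by auto
  have "(sel N M s * X) $$ (a,b) = (\<Sum>c = 0..<M. (if a = c + s then 1 else 0) * X $$ (c,b))"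
    using ab assms by (auto simp: sel_def scalar_prod_def intro!: sum.cong)
  also have "\<dots> = (\<Sum>c = 0..<M. if c = a - s then (if s \<le> a then X $$ (c,b) else 0) else 0)"
    by (intro sum.cong) auto
  also have "\<dots> = (if s \<le> a \<and> a - s < M then X $$ (a - s, b) else 0)" by (simp add: sum.delta)
  finally show "(sel N M s * X) $$ (a,b) = mat N n (\<lambda>(a,b). if s \<le> a \<and> a - s < M then X $$ (a - s, b) else 0) $$ (a,b)"
    using ab by simp
qed (use assms in auto)

lemma sel_sel: "sel N K t * sel K M s = mat N M (\<lambda>(a,b). if b + s < K \<and> a = b + s + t then 1 else 0)"
  by (subst mult_sel[of _ N]) (auto simp: sel_def intro!: eq_matI)

lemma adj_sel_sel: "adj (sel N K t) * sel N M s = mat K M (\<lambda>(a,b). if a + t < N \<and> a + t = b + s then 1 else 0)"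
  by (subst adj_sel_mult[of _ N M]) (auto simp: sel_def intro!: eq_matI)

lemma sel_split:
  assumes "N = K + M"
  shows "adj (sel N K 0) * sel N K 0 = 1\<^sub>m K" "adj (sel N M K) * sel N M K = 1\<^sub>m M"
    "adj (sel N K 0) * sel N M K = 0\<^sub>m K M" "adj (sel N M K) * sel N K 0 = 0\<^sub>m M K"
    "sel N K 0 * adj (sel N K 0) + sel N M K * adj (sel N M K) = 1\<^sub>m N"
proof -
  show "adj (sel N K 0) * sel N K 0 = 1\<^sub>m K" "adj (sel N M K) * sel N M K = 1\<^sub>m M"
    "adj (sel N K 0) * sel N M K = 0\<^sub>m K M" "adj (sel N M K) * sel N K 0 = 0\<^sub>m M K"
    unfolding adj_sel_sel using assms by (auto intro!: eq_matI)
  show "sel N K 0 * adj (sel N K 0) + sel N M K * adj (sel N M K) = 1\<^sub>m N"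
    by (subst sel_mult[of _ _ N], simp, subst sel_mult[of _ _ N], simp)
      (use assms in \<open>auto simp: sel_def intro!: eq_matI\<close>)
qed

lemma sel_split_emb:
  assumes "N = K + M"
  defines "F \<equiv> sel N K 0" and "R \<equiv> sel N M K"
  shows "emb (adj F) * emb F = emb (1\<^sub>m K)" "emb (adj F) * (emb F * X) = emb (1\<^sub>m K) * X"
    "emb (adj R) * emb R = emb (1\<^sub>m M)" "emb (adj R) * (emb R * X) = emb (1\<^sub>m M) * X"
    "emb (adj F) * emb R = 0" "emb (adj F) * (emb R * X) = 0"
    "emb (adj R) * emb F = 0" "emb (adj R) * (emb F * X) = 0"
    "emb F * emb (adj F) + emb R * emb (adj R) = emb (1\<^sub>m N)"
    "dim_row Y = N \<Longrightarrow> emb F * (emb (adj F) * emb Y) + emb R * (emb (adj R) * emb Y) = emb Y"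
proof -
  note s = sel_split[OF assms(1), folded F_def R_def]
  have d: "dim_row F = N" "dim_col F = K" "dim_row R = N" "dim_col R = M" by (auto simp: F_def R_def)
  show "emb (adj F) * emb F = emb (1\<^sub>m K)" "emb (adj F) * (emb F * X) = emb (1\<^sub>m K) * X"
    "emb (adj R) * emb R = emb (1\<^sub>m M)" "emb (adj R) * (emb R * X) = emb (1\<^sub>m M) * X"
    "emb (adj F) * emb R = 0" "emb (adj F) * (emb R * X) = 0"
    "emb (adj R) * emb F = 0" "emb (adj R) * (emb F * X) = 0"
    using emb_prod(1)[OF s(1)] emb_prod(2)[OF s(1), of X] emb_prod(1)[OF s(2)] emb_prod(2)[OF s(2), of X]
      emb_prod(1)[OF s(3)] emb_prod(2)[OF s(3), of X] emb_prod(1)[OF s(4)] emb_prod(2)[OF s(4), of X] d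
    by (simp_all add: emb_zero)
  show 1: "emb F * emb (adj F) + emb R * emb (adj R) = emb (1\<^sub>m N)"
    using arg_cong[OF s(5), of emb] d by (simp add: emb_ring)
  show "emb F * (emb (adj F) * emb Y) + emb R * (emb (adj R) * emb Y) = emb Y" if "dim_row Y = N"
    using arg_cong[OF 1, of "\<lambda>y. y * emb Y"] that by (simp add: emb_ring)
qed

section \<open>Bordering of block Toeplitz matrices\<close>

lemma S_blk_carrier[simp, intro]: "S_blk m A k \<in> carrier_mat ((k+1)*m) ((k+1)*m)"
  and S_blk_dim: "dim_row (S_blk m A k) = (k+1)*m" "dim_col (S_blk m A k) = (k+1)*m"
  and J_blk_carrier[simp, intro]: "J_blk m J k \<in> carrier_mat ((k+1)*m) ((k+1)*m)"
  and J_blk_dim: "dim_row (J_blk m J k) = (k+1)*m" "dim_col (J_blk m J k) = (k+1)*m"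
  and y_vec_carrier[simp, intro]: "y_vec m A k \<in> carrier_mat (k*m) m"
  and y_vec_dim: "dim_row (y_vec m A k) = k*m" "dim_col (y_vec m A k) = m"
  and z_vec_carrier[simp, intro]: "z_vec m A k \<in> carrier_mat m (k*m)"
  and z_vec_dim: "dim_row (z_vec m A k) = m" "dim_col (z_vec m A k) = k*m"
  by (auto simp: S_blk_def J_blk_def y_vec_def z_vec_def)

lemma P_mat_carrier[simp, intro]: "P_mat m J A k \<in> carrier_mat ((k+1)*m) ((k+1)*m)"
  and Q_mat_carrier[simp, intro]: "Q_mat m J A k \<in> carrier_mat ((k+1)*m) ((k+1)*m)"
  unfolding P_mat_def Q_mat_def by (rule carrier_matI; simp add: S_blk_dim J_blk_dim)+

lemma div_mod_lt:
  assumes "(a::nat) < Suc k * m" shows "a div m \<le> k" "a mod m < m" "m > 0"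
proof -
  show m: "m > 0" using assms by (cases m) auto
  show "a div m \<le> k" using assms m by (metis less_Suc_eq_le less_mult_imp_div_less)
  show "a mod m < m" using m by simp
qed

lemma div_shift: "(m::nat) \<le> a \<Longrightarrow> m > 0 \<Longrightarrow> a div m = Suc ((a - m) div m)"
  and mod_shift: "(m::nat) \<le> a \<Longrightarrow> a mod m = (a - m) mod m"
  by (simp_all add: le_div_geq le_mod_geq)

lemma S_blk_0: "A 0 \<in> carrier_mat m m \<Longrightarrow> S_blk m A 0 = A 0"
  and J_blk_0: "J \<in> carrier_mat m m \<Longrightarrow> J_blk m J 0 = J"
  by (auto simp: S_blk_def J_blk_def intro!: eq_matI)

text \<open>Column and row decompositions of \<open>S_blk m A (Suc k)\<close>, written with the injections
  \<open>F\<close> (first block), \<open>R\<close> (remaining blocks), \<open>L\<close> (leading blocks) and \<open>E\<close> (last block).\<close>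

lemma S_blk_step:
  fixes A :: "nat \<Rightarrow> complex mat" and k m :: nat
  assumes A: "\<And>j. j \<le> Suc k \<Longrightarrow> A j \<in> carrier_mat m m"
  defines "N \<equiv> (k+2)*m" and "M \<equiv> (k+1)*m"
  defines "S' \<equiv> S_blk m A (Suc k)" and "S \<equiv> S_blk m A k" and "y \<equiv> y_vec m A (Suc k)" and "z \<equiv> z_vec m A (Suc k)"
  shows "S' * sel N m 0 = sel N m 0 * A 0 + sel N M m * y" "S' * sel N M m = sel N M m * S"
    "S' * sel N M 0 = sel N M 0 * S + sel N m M * z" "S' * sel N m M = sel N m M * A 0"
proof -
  have NM: "N = m + M" "N = M + m" "N = Suc (Suc k) * m" "M = Suc k * m" by (auto simp: N_def M_def)
  have S': "S' \<in> carrier_mat N N" using S_blk_carrier[of m A "Suc k"] by (simp add: S'_def N_def)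
  have S: "S \<in> carrier_mat M M" using S_blk_carrier[of m A k] by (simp add: S_def M_def)
  have y: "y \<in> carrier_mat M m" and z: "z \<in> carrier_mat m M"
    using y_vec_carrier[of m A "Suc k"] z_vec_carrier[of m A "Suc k"] by (simp_all add: y_def z_def M_def)
  have A0: "A 0 \<in> carrier_mat m m" using A by auto
  note sm = mult_sel[OF S'] sel_mult[OF S] sel_mult[OF y] sel_mult[OF z] sel_mult[OF A0]
  have S'e: "S' $$ (a,b) = (if b div m \<le> a div m then A (a div m - b div m) $$ (a mod m, b mod m) else 0)"
    if "a < N" "b < N" for a b using that by (simp add: S'_def S_blk_def N_def)
  have Se: "S $$ (a,b) = (if b div m \<le> a div m then A (a div m - b div m) $$ (a mod m, b mod m) else 0)"
    if "a < M" "b < M" for a b using that by (simp add: S_def S_blk_def M_def)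
  have ye: "y $$ (a,b) = A (a div m + 1) $$ (a mod m, b)" if "a < M" "b < m" for a b
    using that by (simp add: y_def y_vec_def M_def)
  have ze: "z $$ (a,b) = A (Suc k - b div m) $$ (a, b mod m)" if "a < m" "b < M" for a b
    using that by (simp add: z_def z_vec_def M_def)
  have top: "a div m = Suc k" "a mod m = a - M" if "M \<le> a" "a < N" for a
  proof -
    have "m > 0" using that NM by (cases m) auto
    moreover have "a = Suc k * m + (a - M)" "a - M < m" using that NM by auto
    ultimately show "a div m = Suc k" "a mod m = a - M"
      by (metis div_mult_self3 add.commute div_less add.right_neutral not_gr0, metis mod_mult_self3 mod_less)
  qed
  show "S' * sel N m 0 = sel N m 0 * A 0 + sel N M m * y"
  proof (rule eq_matI)
    fix a b assume "a < dim_row (sel N m 0 * A 0 + sel N M m * y)" "b < dim_col (sel N m 0 * A 0 + sel N M m * y)"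
    then have ab: "a < N" "b < m" using y by auto
    then have "b < N" "m \<le> a \<Longrightarrow> a - m < M" using NM(1) by auto
    with ab show "(S' * sel N m 0) $$ (a,b) = (sel N m 0 * A 0 + sel N M m * y) $$ (a,b)"
      using A0 y by (auto simp: sm S'e ye div_shift mod_shift)
  qed (use S' A0 y in auto)
  show "S' * sel N M m = sel N M m * S"
  proof (rule eq_matI)
    fix a b assume "a < dim_row (sel N M m * S)" "b < dim_col (sel N M m * S)"
    then have ab: "a < N" "b < M" using S by auto
    then have m: "m > 0" using NM(4) by (cases m) auto
    have "b + m < N" "m \<le> a \<Longrightarrow> a - m < M" using NM(1) ab by auto
    then show "(S' * sel N M m) $$ (a,b) = (sel N M m * S) $$ (a,b)"
      using ab S m by (auto simp: sm S'e Se div_shift[of m a] mod_shift[of m a])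
  qed (use S' S in auto)
  show "S' * sel N M 0 = sel N M 0 * S + sel N m M * z"
  proof (rule eq_matI)
    fix a b assume "a < dim_row (sel N M 0 * S + sel N m M * z)" "b < dim_col (sel N M 0 * S + sel N m M * z)"
    then have ab: "a < N" "b < M" using z by auto
    moreover have "b div m \<le> k" using div_mod_lt[of b k m] ab NM by auto
    moreover have "b < N" "M \<le> a \<Longrightarrow> a - M < m" using NM(2) ab by auto
    ultimately show "(S' * sel N M 0) $$ (a,b) = (sel N M 0 * S + sel N m M * z) $$ (a,b)"
      using S z top[of a] by (auto simp: sm S'e Se ze)
  qed (use S' S z in auto)
  show "S' * sel N m M = sel N m M * A 0"
  proof (rule eq_matI)
    fix a b assume "a < dim_row (sel N m M * A 0)" "b < dim_col (sel N m M * A 0)"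
    then have ab: "a < N" "b < m" using A0 by auto
    then have m: "m > 0" by auto
    have "a div m \<le> k" if "a < M" using div_mod_lt[of a k m] that NM by auto
    moreover have "b + M < N" "M \<le> a \<Longrightarrow> a - M < m" using NM(2) ab by auto
    ultimately show "(S' * sel N m M) $$ (a,b) = (sel N m M * A 0) $$ (a,b)"
      using ab A0 top[of a] top[of "b + M"] m by (auto simp: sm S'e)
  qed (use S' A0 in auto)
qed

lemma J_blk_step:
  fixes J :: "complex mat" and k m :: nat
  assumes J: "J \<in> carrier_mat m m"
  defines "N \<equiv> (k+2)*m" and "M \<equiv> (k+1)*m"
  shows "J_blk m J (Suc k) * sel N m 0 = sel N m 0 * J" "J_blk m J (Suc k) * sel N M m = sel N M m * J_blk m J k"
    "J_blk m J (Suc k) * sel N M 0 = sel N M 0 * J_blk m J k" "J_blk m J (Suc k) * sel N m M = sel N m M * J"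
proof -
  \<comment> \<open>\<open>J_blk\<close> is the Toeplitz matrix of the sequence \<open>J\<close>, 0,
    0, ..., so its decompositions are instances of those of \<open>S_blk\<close>.\<close>
  define A where "A i = (if i = (0::nat) then J else 0\<^sub>m m m)" for i
  have A: "A j \<in> carrier_mat m m" for j using J by (auto simp: A_def)
  have JS: "J_blk m J i = S_blk m A i" for i
  proof (rule eq_matI)
    fix a b assume "a < dim_row (S_blk m A i)" "b < dim_col (S_blk m A i)"
    then have ab: "a < Suc i * m" "b < Suc i * m" by (auto simp: S_blk_dim)
    then show "J_blk m J i $$ (a,b) = S_blk m A i $$ (a,b)"
      using div_mod_lt(2)[OF ab(1)] div_mod_lt(2)[OF ab(2)] by (auto simp: J_blk_def S_blk_def A_def)
  qed (auto simp: S_blk_dim J_blk_dim)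
  have y: "y_vec m A i = 0\<^sub>m (i*m) m" and z: "z_vec m A i = 0\<^sub>m m (i*m)" for i
  proof -
    show "y_vec m A i = 0\<^sub>m (i*m) m"
    proof (rule eq_matI)
      fix a b assume "a < dim_row (0\<^sub>m (i*m) m :: complex mat)" "b < dim_col (0\<^sub>m (i*m) m :: complex mat)"
      then show "y_vec m A i $$ (a,b) = 0\<^sub>m (i*m) m $$ (a,b)" by (auto simp: y_vec_def A_def)
    qed (auto simp: y_vec_dim)
    show "z_vec m A i = 0\<^sub>m m (i*m)"
    proof (rule eq_matI)
      fix a b assume "a < dim_row (0\<^sub>m m (i*m) :: complex mat)" "b < dim_col (0\<^sub>m m (i*m) :: complex mat)"
      then have ab: "a < m" "b < i * m" by auto
      then have "b div m < i" by (metis less_mult_imp_div_less)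
      then show "z_vec m A i $$ (a,b) = 0\<^sub>m m (i*m) $$ (a,b)" using ab by (auto simp: z_vec_def A_def)
    qed (auto simp: z_vec_dim)
  qed
  have yz: "y_vec m A (Suc k) = 0\<^sub>m M m" "z_vec m A (Suc k) = 0\<^sub>m m M"
    using y[of "Suc k"] z[of "Suc k"] by (simp_all add: M_def)
  have A0: "A 0 = J" by (simp add: A_def)
  note st = S_blk_step[of k A m, OF A, folded JS N_def M_def, unfolded yz A0]
  have c: "J_blk m J k \<in> carrier_mat M M" using J_blk_carrier[of m J k] by (simp add: M_def)
  have "sel N m 0 * J + sel N M m * 0\<^sub>m M m = sel N m 0 * J"
    by (rule emb_eqD) (use J in \<open>auto simp: emb_ring\<close>)
  moreover have "sel N M 0 * J_blk m J k + sel N m M * 0\<^sub>m m M = sel N M 0 * J_blk m J k"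
    by (rule emb_eqD) (use c in \<open>auto simp: emb_ring\<close>)
  ultimately show "J_blk m J (Suc k) * sel N m 0 = sel N m 0 * J" "J_blk m J (Suc k) * sel N M m = sel N M m * J_blk m J k"
    "J_blk m J (Suc k) * sel N M 0 = sel N M 0 * J_blk m J k" "J_blk m J (Suc k) * sel N m M = sel N m M * J"
    using st by simp_all
qed

lemma J_blk_signature:
  assumes "signature_mat m J" shows "signature_mat ((k+1)*m) (J_blk m J k)"
proof -
  have J: "J \<in> carrier_mat m m" "adj J = J" "J * J = 1\<^sub>m m" using assms by (auto simp: signature_mat_def)
  have Je: "cnj (J $$ (b,a)) = J $$ (a,b)" if "a < m" "b < m" for a b
    using arg_cong[OF J(2), of "\<lambda>X. X $$ (a,b)"] that J(1) by simp
  have "J_blk m J k * J_blk m J k = 1\<^sub>m ((k+1)*m)"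
  proof (induction k)
    case 0
    then show ?case using J by (simp add: J_blk_0)
  next
    case (Suc k)
    define N M where "N = (k+2)*m" and "M = (k+1)*m"
    have NM: "N = m + M" by (auto simp: N_def M_def)
    note st = J_blk_step[OF J(1), of k, folded N_def M_def]
    note sp = sel_split_emb[OF NM]
    note IH = Suc[folded M_def]
    let ?J = "J_blk m J (Suc k)"
    have d: "?J \<in> carrier_mat N N" "J_blk m J k \<in> carrier_mat M M"
      using J_blk_carrier[of m J "Suc k"] J_blk_carrier[of m J k] by (simp_all add: N_def M_def)
    have "?J * ?J = 1\<^sub>m N"
    proof (rule emb_eqD)
      have "emb (?J * ?J) = emb ?J * (emb ?J * (emb (sel N m 0) * emb (adj (sel N m 0)) + emb (sel N M m) * emb (adj (sel N M m))))"
        unfolding sp(9) using d by (simp add: emb_ring)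
      also have "\<dots> = emb (sel N m 0) * emb (adj (sel N m 0)) + emb (sel N M m) * emb (adj (sel N M m))"
        using emb_prod(2)[OF st(1)] emb_prod(2)[OF st(2)] emb_prod(2)[OF IH] emb_prod(2)[OF J(3)] d J(1)
        by (simp only: distrib_left) (simp add: emb_ring)
      also have "\<dots> = emb (1\<^sub>m N)" by (rule sp(9))
      finally show "emb (?J * ?J) = emb (1\<^sub>m N)" .
    qed (use d in auto)
    then show ?case by (simp add: N_def)
  qed
  moreover have "adj (J_blk m J k) = J_blk m J k"
  proof (rule eq_matI)
    fix a b assume "a < dim_row (J_blk m J k)" "b < dim_col (J_blk m J k)"
    then have "a < Suc k * m" "b < Suc k * m" by (auto simp: J_blk_dim)
    moreover from this have "a mod m < m" "b mod m < m" using div_mod_lt[of a k m] by auto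
    ultimately show "adj (J_blk m J k) $$ (a,b) = J_blk m J k $$ (a,b)" using Je
      by (auto simp: J_blk_def)
  qed (auto simp: J_blk_dim)
  ultimately show ?thesis unfolding signature_mat_def using J_blk_carrier by blast
qed

section \<open>Indefinite contractions\<close>

lemma qf_emb_eq:
  assumes "X \<in> carrier_mat n n" "v \<in> carrier_mat n 1" "Y \<in> carrier_mat k k" "w \<in> carrier_mat k 1"
    "emb (adj v) * (emb X * emb v) = emb (adj w) * (emb Y * emb w)"
  shows "qf X v = qf Y w"
proof -
  have "adj v * X * v = adj w * Y * w"
    by (rule emb_eqD) (use assms in \<open>auto simp: emb_ring\<close>)
  then show ?thesis by (simp add: qf_def)
qed

lemma qf_add_eq:
  assumes "adj v * X * v = adj w * Y * w + adj u * Z * u" "u \<in> carrier_mat n 1" "Z \<in> carrier_mat n n"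
    "w \<in> carrier_mat k 1" "Y \<in> carrier_mat k k"
  shows "qf X v = qf Y w + qf Z u"
  unfolding qf_def assms(1) using assms by auto

lemma mat11_of_emb:
  assumes "adj v * X * v \<in> carrier_mat 1 1" "emb (adj v * X * v) = sc a (emb (1\<^sub>m 1))"
  shows "qf X v = a"
proof -
  have "adj v * X * v = a \<cdot>\<^sub>m 1\<^sub>m 1" by (rule emb_eqD) (use assms in \<open>auto simp: emb_smult\<close>)
  then show ?thesis by (simp add: qf_def)
qed

lemma qf_signature:
  assumes sig: "signature_mat n J" and v: "v \<in> carrier_mat n 1"
  shows "qf J v = of_real (nrm (pos_proj n J * v) - nrm (neg_proj n J * v))"
    "nrm v = nrm (pos_proj n J * v) + nrm (neg_proj n J * v)"
proof -
  note S = signature_projs[OF sig]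
  let ?P = "pos_proj n J" and ?Q = "neg_proj n J"
  have nn: "adj (X * v) * (X * v) = of_real (nrm (X * v)) \<cdot>\<^sub>m 1\<^sub>m 1" if "X \<in> carrier_mat n n" for X
    using adj_mult_self[of "X * v" n] that v by auto
  have e: "emb (adj v) * (emb X * emb v) = sc (of_real (nrm (X * v))) (emb (1\<^sub>m 1))"
    if "X \<in> carrier_mat n n" "adj X = X" "X * X = X" for X
    using arg_cong[OF nn[OF that(1)], of emb] that(1,2) v emb_prod(2)[OF that(3)]
    by (simp add: adj_simps emb_ring)
  note eP = e[OF S(4,6,8)] and eQ = e[OF S(5,7,9)]
  have eJ: "emb J = emb ?P - emb ?Q" using arg_cong[OF S(13), of emb] S(4,5) by (simp add: emb_minus)
  have e1: "emb (1\<^sub>m n) = emb ?P + emb ?Q" using arg_cong[OF S(12), of emb] S(4,5) by (simp add: emb_add)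
  show "qf J v = of_real (nrm (?P * v) - nrm (?Q * v))"
    by (rule mat11_of_emb) (use S(1) v in \<open>auto simp: emb_mult mult.assoc eJ distrib_left left_diff_distrib right_diff_distrib eP eQ sc_minus\<close>)
  have "emb (adj v) * (emb (1\<^sub>m n) * emb v) = sc (of_real (nrm (?P * v) + nrm (?Q * v))) (emb (1\<^sub>m 1))"
    unfolding e1 by (simp add: distrib_left distrib_right eP eQ sc_plus)
  moreover have "emb (adj v) * (emb (1\<^sub>m n) * emb v) = sc (of_real (nrm v)) (emb (1\<^sub>m 1))"
    using arg_cong[OF adj_mult_self[OF v], of emb] v by (simp add: emb_ring)
  ultimately have "of_real (nrm v) \<cdot>\<^sub>m 1\<^sub>m 1 = (of_real (nrm (?P * v) + nrm (?Q * v)) \<cdot>\<^sub>m 1\<^sub>m 1 :: complex mat)"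
    by (intro emb_eqD) (auto simp: emb_smult)
  from arg_cong[OF this, of "\<lambda>X. X $$ (0,0)"] show "nrm v = nrm (?P * v) + nrm (?Q * v)"
    by (simp del: of_real_add)
qed

lemma injective_imp_inverse:
  fixes K :: "complex mat"
  assumes K: "K \<in> carrier_mat n n" and inj: "\<And>v. v \<in> carrier_mat n 1 \<Longrightarrow> K * v = 0\<^sub>m n 1 \<Longrightarrow> v = 0\<^sub>m n 1"
  shows "\<exists>R\<in>carrier_mat n n. K * R = 1\<^sub>m n \<and> R * K = 1\<^sub>m n"
proof -
  have "det K \<noteq> 0"
  proof
    assume "det K = 0"
    then obtain v where v: "v \<in> carrier_vec n" "v \<noteq> 0\<^sub>v n" "K *\<^sub>v v = 0\<^sub>v n" using det_0_iff_vec_prod_zero[OF K] by auto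
    define u where "u = mat n 1 (\<lambda>(i,j). v $ i)"
    have "K * u = 0\<^sub>m n 1"
    proof (rule eq_matI)
      fix i j assume "i < dim_row (0\<^sub>m n 1 :: complex mat)" "j < dim_col (0\<^sub>m n 1 :: complex mat)"
      then have ij: "i < n" "j = 0" by auto
      have "(K * u) $$ (i,j) = (K *\<^sub>v v) $ i" using ij K v(1) by (auto simp: u_def scalar_prod_def intro!: sum.cong)
      then show "(K * u) $$ (i,j) = 0\<^sub>m n 1 $$ (i,j)" unfolding v(3) using ij by simp
    qed (use K in \<open>auto simp: u_def\<close>)
    then have u0: "u = 0\<^sub>m n 1" using inj by (simp add: u_def)
    have "v = 0\<^sub>v n"
    proof (rule eq_vecI)
      fix i assume "i < dim_vec (0\<^sub>v n :: complex vec)"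
      then show "v $ i = 0\<^sub>v n $ i" using arg_cong[OF u0, of "\<lambda>X. X $$ (i,0)"] by (simp add: u_def)
    qed (use v in auto)
    with v show False by simp
  qed
  from det_non_zero_imp_unit[OF K \<open>det K \<noteq> 0\<close>] obtain R where "R \<in> carrier_mat n n" "R * K = 1\<^sub>m n" "K * R = 1\<^sub>m n"
    unfolding Units_def ring_mat_def by auto
  then show ?thesis by blast
qed

text \<open>This is the denominator of the Potapov-Ginzburg transform. A kernel vector
  \<open>v\<close> lies in the negative subspace and \<open>X * v\<close> in the positive one, so
  contractivity squeezes the norm of \<open>v\<close> to 0.\<close>

lemma J_contractive_block_inverse:
  assumes sig: "signature_mat n J" and X: "X \<in> carrier_mat n n"
    and con: "\<And>v. v \<in> carrier_mat n 1 \<Longrightarrow> Re (qf J v) \<ge> Re (qf J (X * v))"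
  shows "\<exists>R\<in>carrier_mat n n. (neg_proj n J * X + pos_proj n J) * R = 1\<^sub>m n \<and> R * (neg_proj n J * X + pos_proj n J) = 1\<^sub>m n"
proof (rule injective_imp_inverse)
  note S = signature_projs[OF sig]
  let ?P = "pos_proj n J" and ?Q = "neg_proj n J"
  show "?Q * X + ?P \<in> carrier_mat n n" using S X by auto
  fix v :: "complex mat" assume v: "v \<in> carrier_mat n 1" and 0: "(?Q * X + ?P) * v = 0\<^sub>m n 1"
  note z = emb_prod(1)[OF 0]
  have z0: "emb ?Q * (emb X * emb v) + emb ?P * emb v = 0"
    using arg_cong[OF 0, of emb] S(4,5) X v by (simp add: emb_ring)
  have "emb ?P * (emb ?Q * (emb X * emb v) + emb ?P * emb v) = emb ?P * emb v"
    using S(4,5) emb_prod(2)[OF S(10)] emb_prod(2)[OF S(8)] by (simp add: emb_ring)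
  then have "emb ?P * emb v = 0" unfolding z0 by simp
  moreover from this z0 have "emb ?Q * (emb X * emb v) = 0" by simp
  ultimately have Pv: "?P * v = 0\<^sub>m n 1" and QXv: "?Q * (X * v) = 0\<^sub>m n 1"
    using S(4,5) X v by (auto intro!: emb_eqD simp: emb_ring)
  have "Xv": "X * v \<in> carrier_mat n 1" using X v by auto
  have "Re (qf J v) = - nrm (?Q * v)" using qf_signature(1)[OF sig v] Pv nrm_0_iff[of "?P * v" n] by simp
  moreover have "Re (qf J (X * v)) = nrm (?P * (X * v))"
    using qf_signature(1)[OF sig Xv] QXv nrm_0_iff[of "?Q * (X * v)" n] by simp
  ultimately have "nrm (?Q * v) = 0" using con[OF v] nrm_ge_0[of "?Q * v"] nrm_ge_0[of "?P * (X * v)"] by linarith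
  then have "nrm v = 0" using qf_signature(2)[OF sig v] Pv nrm_0_iff[of "?P * v" n] by simp
  then show "v = 0\<^sub>m n 1" using nrm_0_iff[OF v] by simp
qed

text \<open>The rigidity behind uniqueness: an affine image of the negative subspace that stays
  \<open>J\<close>-below it has no translation part. Choose \<open>\<xi>\<close> negative with
  \<open>X \<xi> + \<eta>\<close> positive.\<close>

lemma J_contractive_affine:
  assumes sig: "signature_mat n J" and X: "X \<in> carrier_mat n n" and \<eta>: "\<eta> \<in> carrier_mat n 1"
    and con: "\<And>v. v \<in> carrier_mat n 1 \<Longrightarrow> Re (qf J v) \<ge> Re (qf J (X * v))"
    and aff: "\<And>v. v \<in> carrier_mat n 1 \<Longrightarrow> Re (qf J v) \<ge> Re (qf J (X * v + \<eta>))"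
  shows "\<eta> = 0\<^sub>m n 1"
proof -
  note S = signature_projs[OF sig]
  let ?P = "pos_proj n J" and ?Q = "neg_proj n J"
  from J_contractive_block_inverse[OF sig X con] obtain R where R: "R \<in> carrier_mat n n"
    "(?Q * X + ?P) * R = 1\<^sub>m n" by blast
  \<comment> \<open>Solves \<open>(Q * X + P) * v = - Q * \<eta>\<close>. Its two components say
    that \<open>v\<close> lies in the negative and \<open>X * v + \<eta>\<close> in the positive
    subspace.\<close>
  define v where "v = - (R * (?Q * \<eta>))"
  have v: "v \<in> carrier_mat n 1" using R S \<eta> by (auto simp: v_def)
  have "emb ?Q * (emb X * (emb R * Z)) + emb ?P * (emb R * Z) = emb (1\<^sub>m n) * Z" for Z
    using arg_cong[OF arg_cong[OF R(2), of emb], of "\<lambda>y. y * Z"] S(4,5) X R(1) by (simp add: emb_ring)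
  from this[of "emb ?Q * emb \<eta>"]
  have z0: "emb ?Q * (emb X * emb v) + emb ?P * emb v = - (emb ?Q * emb \<eta>)"
    using S(4,5) X R(1) \<eta> by (simp add: v_def emb_ring) (simp add: algebra_simps)
  have "emb ?P * (emb ?Q * (emb X * emb v) + emb ?P * emb v) = emb ?P * emb v"
    using S(4,5) emb_prod(2)[OF S(10)] emb_prod(2)[OF S(8)] by (simp add: emb_ring)
  then have Pv0: "emb ?P * emb v = 0" unfolding z0 using S(4,5) emb_prod(2)[OF S(10)] by (simp add: emb_ring)
  with z0 have "emb ?Q * (emb X * emb v) = - (emb ?Q * emb \<eta>)" by simp
  with Pv0 have Pv: "?P * v = 0\<^sub>m n 1" and QX: "?Q * (X * v + \<eta>) = 0\<^sub>m n 1"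
    using S(4,5) X v \<eta> by (auto intro!: emb_eqD simp: emb_ring)
  have w: "X * v + \<eta> \<in> carrier_mat n 1" using X v \<eta> by auto
  have "Re (qf J v) = - nrm (?Q * v)" using qf_signature(1)[OF sig v] Pv nrm_0_iff[of "?P * v" n] by simp
  moreover have "Re (qf J (X * v + \<eta>)) = nrm (?P * (X * v + \<eta>))"
    using qf_signature(1)[OF sig w] QX nrm_0_iff[of "?Q * (X * v + \<eta>)" n] by simp
  ultimately have "nrm (?Q * v) = 0" "nrm (?P * (X * v + \<eta>)) = 0"
    using aff[OF v] nrm_ge_0[of "?Q * v"] nrm_ge_0[of "?P * (X * v + \<eta>)"] by linarith+
  then have "nrm v = 0" "nrm (X * v + \<eta>) = 0"
    using qf_signature(2)[OF sig v] qf_signature(2)[OF sig w] Pv QX nrm_0_iff[of "?P * v" n]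
      nrm_0_iff[of "?Q * (X * v + \<eta>)" n] by auto
  then have "v = 0\<^sub>m n 1" "X * v + \<eta> = 0\<^sub>m n 1" using nrm_0_iff[OF v] nrm_0_iff[OF w] by auto
  then show ?thesis using X \<eta> by auto
qed

lemma zero_by_columns:
  assumes X: "X \<in> carrier_mat n k" and 0: "\<And>j. j < k \<Longrightarrow> X * sel k 1 j = 0\<^sub>m n 1"
  shows "X = 0\<^sub>m n k"
proof (rule eq_matI)
  fix i j assume "i < dim_row (0\<^sub>m n k :: complex mat)" "j < dim_col (0\<^sub>m n k :: complex mat)"
  then have ij: "i < n" "j < k" by auto
  have "(X * sel k 1 j) $$ (i,0) = X $$ (i,j)" unfolding mult_sel[OF X] using ij by simp
  then show "X $$ (i,j) = 0\<^sub>m n k $$ (i,j)" unfolding 0[OF ij(2)] using ij by simp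
qed (use X in auto)

lemma Re_adj_mult_le:
  assumes "a \<in> carrier_mat n 1" "b \<in> carrier_mat n 1"
  shows "2 * Re ((adj a * b) $$ (0,0)) \<le> nrm a + nrm b"
proof -
  have "(adj a * b) $$ (0,0) = (\<Sum>i<n. cnj (a $$ (i,0)) * b $$ (i,0))"
    using assms by (auto simp: scalar_prod_def atLeast0LessThan intro!: sum.cong)
  then have "2 * Re ((adj a * b) $$ (0,0)) = (\<Sum>i<n. 2 * Re (cnj (a $$ (i,0)) * b $$ (i,0)))"
    by (simp add: sum_distrib_left)
  also have "\<dots> \<le> (\<Sum>i<n. (cmod (a $$ (i,0)))\<^sup>2 + (cmod (b $$ (i,0)))\<^sup>2)"
  proof (rule sum_mono)
    fix i
    have "(cmod (a $$ (i,0)))\<^sup>2 + (cmod (b $$ (i,0)))\<^sup>2 - 2 * Re (cnj (a $$ (i,0)) * b $$ (i,0))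
      = (cmod (a $$ (i,0) - b $$ (i,0)))\<^sup>2" by (simp only: cmod_power2) (simp add: power2_eq_square algebra_simps)
    moreover have "(cmod (a $$ (i,0) - b $$ (i,0)))\<^sup>2 \<ge> 0" by simp
    ultimately show "2 * Re (cnj (a $$ (i,0)) * b $$ (i,0)) \<le> (cmod (a $$ (i,0)))\<^sup>2 + (cmod (b $$ (i,0)))\<^sup>2" by linarith
  qed
  also have "\<dots> = nrm a + nrm b" using assms by (simp add: nrm_def sum.distrib)
  finally show ?thesis .
qed

lemma qf_minus_conj:
  assumes "J \<in> carrier_mat k k" "J' \<in> carrier_mat n n" "X \<in> carrier_mat k n" "v \<in> carrier_mat n 1"
  shows "qf (J' - adj X * J * X) v = qf J' v - qf J (X * v)"
proof -
  have "adj v * (J' - adj X * J * X) * v = adj v * J' * v - adj (X * v) * J * (X * v)"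
    by (rule emb_eqD) (use assms in \<open>auto simp: adj_simps emb_ring\<close>)
  then show ?thesis using assms by (simp add: qf_def)
qed

lemma psd_minus_conj_iff:
  assumes "J \<in> carrier_mat n n" "adj J = J" "X \<in> carrier_mat n n"
  shows "psd (J - adj X * J * X) \<longleftrightarrow> (\<forall>v\<in>carrier_mat n 1. Re (qf J v) \<ge> Re (qf J (X * v)))"
proof -
  have h: "adj (J - adj X * J * X) = J - adj X * J * X"
    by (rule emb_eqD) (use assms in \<open>auto simp: adj_simps emb_ring\<close>)
  have c: "J - adj X * J * X \<in> carrier_mat n n" using assms by auto
  show ?thesis unfolding psd_hermitian_iff[OF c h]
    using qf_minus_conj[OF assms(1,1,3)] by auto
qed

text \<open>The graph of a \<open>J\<close>-contraction is maximal among the subspaces on which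
  \<open>[u, u] - [X u, X u]\<close> is nonnegative, so its orthogonal companion, the graph of the adjoint,
  is nonpositive.\<close>

lemma J_contractive_adj:
  assumes sig: "signature_mat n J" and X: "X \<in> carrier_mat n n"
    and con: "\<And>v. v \<in> carrier_mat n 1 \<Longrightarrow> Re (qf J v) \<ge> Re (qf J (X * v))"
    and x: "x \<in> carrier_mat n 1"
  shows "Re (qf J x) \<ge> Re (qf J (adj X * x))"
proof -
  note S = signature_projs[OF sig]
  define P Q where "P = pos_proj n J" and "Q = neg_proj n J"
  note S = S[folded P_def Q_def]
  note sq = qf_signature[OF sig, folded P_def Q_def]
  from J_contractive_block_inverse[OF sig X con, folded P_def Q_def] obtain R where R: "R \<in> carrier_mat n n"
    "(Q * X + P) * R = 1\<^sub>m n" by blast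
  have eJ: "emb J = emb P - emb Q" using arg_cong[OF S(13), of emb] S(4,5) by (simp add: emb_minus)
  have e1: "emb P + emb Q = emb (1\<^sub>m n)" using arg_cong[OF S(12), of emb] S(4,5) by (simp add: emb_add)
  have JJ: "emb J * (emb J * Z) = emb (1\<^sub>m n) * Z" for Z by (rule emb_prod(2)[OF S(3)]) (use S(1) in auto)
  have PP: "emb P * (emb P * Z) = emb P * Z" "emb Q * (emb Q * Z) = emb Q * Z"
    "emb P * (emb Q * Z) = 0" "emb Q * (emb P * Z) = 0" for Z
    using emb_prod(2)[OF S(8)] emb_prod(2)[OF S(9)] emb_prod(2)[OF S(10)] emb_prod(2)[OF S(11)] S(4,5)
    by (simp_all add: emb_zero)
  define q where "q = J * x"
  define p where "p = J * (adj X * x)"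
  \<comment> \<open>In \<open>[u, u] - [X u, X u]\<close> the parts \<open>P u\<close> and
    \<open>Q X u\<close> count positively. Invertibility of \<open>Q * X + P\<close> yields a point
    of the graph that shares exactly these parts with the pair \<open>(p, q)\<close>, which belongs
    to the orthogonal companion.\<close>
  define u where "u = R * (P * p + Q * q)"
  have c: "q \<in> carrier_mat n 1" "p \<in> carrier_mat n 1" "u \<in> carrier_mat n 1" "X * u \<in> carrier_mat n 1"
    using S(1,4,5) x X R(1) by (auto simp: q_def p_def u_def)
  have u1: "emb Q * (emb X * emb u) + emb P * emb u = emb P * emb p + emb Q * emb q"
  proof -
    have "emb Q * (emb X * (emb R * Z)) + emb P * (emb R * Z) = emb (1\<^sub>m n) * Z" for Z
      using arg_cong[OF arg_cong[OF R(2), of emb], of "\<lambda>y. y * Z"] S(4,5) X R(1) by (simp add: emb_ring)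
    from this[of "emb P * emb p + emb Q * emb q"] show ?thesis
      using S(4,5) R(1) c by (simp add: u_def emb_ring)
  qed
  have Pu: "P * u = P * p"
    by (rule emb_eqD) (use arg_cong[OF u1, of "\<lambda>y. emb P * y"] S(4,5) c in \<open>auto simp: emb_mult distrib_left PP\<close>)
  have Qu: "Q * (X * u) = Q * q"
    by (rule emb_eqD) (use arg_cong[OF u1, of "\<lambda>y. emb Q * y"] S(4,5) c X in \<open>auto simp: emb_mult distrib_left PP\<close>)
  have orth: "adj q * J * (X * u) = adj p * J * u"
    by (rule emb_eqD) (use S(1,2) x X c(3) in \<open>auto simp: q_def p_def adj_simps emb_ring JJ\<close>)
  have split: "adj a * J * b = adj (P * a) * (P * b) - adj (Q * a) * (Q * b)"
    if "a \<in> carrier_mat n 1" "b \<in> carrier_mat n 1" for a b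
    by (rule emb_eqD) (use S(1,4,5,6,7) that in \<open>auto simp: adj_simps emb_mult emb_minus mult.assoc PP eJ left_diff_distrib right_diff_distrib\<close>)
  have nn: "(adj a * a) $$ (0,0) = of_real (nrm a)" if "a \<in> carrier_mat n 1" for a
    using adj_mult_self[OF that] by simp
  have ci: "P * a \<in> carrier_mat n 1" "Q * a \<in> carrier_mat n 1" if "a \<in> carrier_mat n 1" for a using S(4,5) that by auto
  \<comment> \<open>Orthogonality of the two pairs expresses the shared positive parts through cross
    terms. Those are bounded by half the sum of the squares, and contractivity at \<open>u\<close>
    controls the squares that involve \<open>u\<close>.\<close>
  have "adj (P * q) * (P * (X * u)) - adj (Q * q) * (Q * q) = adj (P * p) * (P * p) - adj (Q * p) * (Q * u)"
    using orth unfolding split[OF c(1,4)] split[OF c(2,3)] Pu Qu .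
  from arg_cong[OF this, of "\<lambda>X. Re (X $$ (0,0))"]
  have "Re ((adj (P * q) * (P * (X * u))) $$ (0,0)) - nrm (Q * q) = nrm (P * p) - Re ((adj (Q * p) * (Q * u)) $$ (0,0))"
  proof -
    have dm: "(Y - Z) $$ (0,0) = Y $$ (0,0) - Z $$ (0,0)" if "Y \<in> carrier_mat 1 1" "Z \<in> carrier_mat 1 1" for Y Z :: "complex mat"
      using that by auto
    have pc: "adj a * b \<in> carrier_mat 1 1" if "a \<in> carrier_mat n 1" "b \<in> carrier_mat n 1" for a b
      using that by auto
    note pcs = pc[OF ci(1)[OF c(1)] ci(1)[OF c(4)]] pc[OF ci(2)[OF c(1)] ci(2)[OF c(1)]]
      pc[OF ci(1)[OF c(2)] ci(1)[OF c(2)]] pc[OF ci(2)[OF c(2)] ci(2)[OF c(3)]]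
    assume "Re ((adj (P * q) * (P * (X * u)) - adj (Q * q) * (Q * q)) $$ (0, 0)) =
      Re ((adj (P * p) * (P * p) - adj (Q * p) * (Q * u)) $$ (0, 0))"
    then show ?thesis
      unfolding dm[OF pcs(1,2)] dm[OF pcs(3,4)] nn[OF ci(2)[OF c(1)]] nn[OF ci(1)[OF c(2)]] by simp
  qed
  moreover have "nrm (P * (X * u)) + nrm (Q * u) \<le> nrm (P * p) + nrm (Q * q)"
    using con[OF c(3)] unfolding sq(1)[OF c(3)] sq(1)[OF c(4)] Pu Qu by simp
  ultimately have "nrm (Q * q) + nrm (P * p) \<le> nrm (P * q) + nrm (Q * p)"
    using Re_adj_mult_le[OF ci(1)[OF c(1)] ci(1)[OF c(4)]] Re_adj_mult_le[OF ci(2)[OF c(2)] ci(2)[OF c(3)]] by linarith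
  then have "Re (qf J p) \<le> Re (qf J q)" unfolding sq(1)[OF c(1)] sq(1)[OF c(2)] by simp
  moreover have qJ: "qf J (J * a) = qf J a" if "a \<in> carrier_mat n 1" for a
    by (rule qf_emb_eq) (use S(1,2) that in \<open>auto simp: adj_simps emb_ring JJ\<close>)
  moreover have "adj X * x \<in> carrier_mat n 1" using x X by auto
  ultimately show ?thesis unfolding p_def q_def qJ[OF x] by simp
qed

text \<open>\<open>P_mat\<close> is the same form for the adjoint Toeplitz matrix, so this is the
  passage from a \<open>J\<close>-contraction to its adjoint.\<close>

lemma psd_P_of_psd_Q:
  assumes sig: "signature_mat m J" and "psd (Q_mat m J A k)"
  shows "psd (P_mat m J A k)"
proof -
  note sg = J_blk_signature[OF sig, of k]
  have J: "J_blk m J k \<in> carrier_mat ((k+1)*m) ((k+1)*m)" "adj (J_blk m J k) = J_blk m J k"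
    using sg by (auto simp: signature_mat_def)
  have con: "\<And>v. v \<in> carrier_mat ((k+1)*m) 1 \<Longrightarrow> Re (qf (J_blk m J k) v) \<ge> Re (qf (J_blk m J k) (S_blk m A k * v))"
    using assms(2) psd_minus_conj_iff[OF J S_blk_carrier] unfolding Q_mat_def by blast
  have "psd (J_blk m J k - adj (adj (S_blk m A k)) * J_blk m J k * adj (S_blk m A k))"
    unfolding psd_minus_conj_iff[OF J adj_carrier[OF S_blk_carrier]]
    using J_contractive_adj[OF sg S_blk_carrier con] by blast
  then show ?thesis unfolding P_mat_def by simp
qed

section \<open>One step extensions\<close>

text \<open>Notation for the growth from \<open>k + 1\<close> to \<open>k + 2\<close> blocks, with
  primes on the larger matrices. \<open>F\<close>, \<open>R\<close> split off the first block and
  \<open>L\<close>, \<open>E\<close> the last one: columns of coefficients extend downwards, rows of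
  coefficients extend at the front.\<close>

locale toeplitz_step =
  fixes m k :: nat and J :: "complex mat" and A :: "nat \<Rightarrow> complex mat"
  assumes sig: "signature_mat m J" and A: "\<And>j. j \<le> Suc k \<Longrightarrow> A j \<in> carrier_mat m m"
begin

definition N where "N = (k+2)*m"
definition M where "M = (k+1)*m"
definition S' where "S' = S_blk m A (Suc k)"
definition S where "S = S_blk m A k"
definition y where "y = y_vec m A (Suc k)"
definition z where "z = z_vec m A (Suc k)"
definition J' where "J' = J_blk m J (Suc k)"
definition Jk where "Jk = J_blk m J k"
definition F where "F = sel N m 0"
definition R where "R = sel N M m"
definition L where "L = sel N M 0"
definition E where "E = sel N m M"

lemma carriers: "S' \<in> carrier_mat N N" "S \<in> carrier_mat M M" "y \<in> carrier_mat M m" "z \<in> carrier_mat m M"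
  "J' \<in> carrier_mat N N" "Jk \<in> carrier_mat M M" "F \<in> carrier_mat N m" "R \<in> carrier_mat N M"
  "L \<in> carrier_mat N M" "E \<in> carrier_mat N m" "J \<in> carrier_mat m m" "A 0 \<in> carrier_mat m m"
  using S_blk_carrier[of m A "Suc k"] S_blk_carrier[of m A k] y_vec_carrier[of m A "Suc k"]
    z_vec_carrier[of m A "Suc k"] J_blk_carrier[of m J "Suc k"] J_blk_carrier[of m J k] sig A[of 0]
  by (simp_all add: N_def M_def S'_def S_def y_def z_def J'_def Jk_def F_def R_def L_def E_def signature_mat_def)

lemma dims: "dim_row S' = N" "dim_col S' = N" "dim_row S = M" "dim_col S = M" "dim_row y = M" "dim_col y = m"
  "dim_row z = m" "dim_col z = M" "dim_row J' = N" "dim_col J' = N" "dim_row Jk = M" "dim_col Jk = M"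
  "dim_row F = N" "dim_col F = m" "dim_row R = N" "dim_col R = M" "dim_row L = N" "dim_col L = M"
  "dim_row E = N" "dim_col E = m" "dim_row J = m" "dim_col J = m" "dim_row (A 0) = m" "dim_col (A 0) = m"
  using carriers by auto

lemma NM: "N = m + M" "N = M + m" by (auto simp: N_def M_def)

lemmas FR = sel_split_emb[OF NM(1), folded F_def R_def]
lemmas LE = sel_split_emb[OF NM(2), folded L_def E_def]

lemma J_adj: "adj J = J" "adj J' = J'" "adj Jk = Jk"
  using sig J_blk_signature[OF sig, of "Suc k"] J_blk_signature[OF sig, of k]
  by (auto simp: signature_mat_def J'_def Jk_def)

lemma JkJk: "emb Jk * (emb Jk * X) = emb (1\<^sub>m M) * X"
proof -
  have "Jk * Jk = 1\<^sub>m M" using J_blk_signature[OF sig, of k] by (simp add: signature_mat_def Jk_def M_def)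
  from emb_prod(2)[OF this] show ?thesis by (simp add: dims)
qed

lemma cols:
  "emb S' * (emb F * X) = emb F * (emb (A 0) * X) + emb R * (emb y * X)"
  "emb S' * (emb R * X) = emb R * (emb S * X)"
  "emb S' * (emb L * X) = emb L * (emb S * X) + emb E * (emb z * X)"
  "emb S' * (emb E * X) = emb E * (emb (A 0) * X)"
  "emb J' * (emb F * X) = emb F * (emb J * X)" "emb J' * (emb R * X) = emb R * (emb Jk * X)"
  "emb J' * (emb L * X) = emb L * (emb Jk * X)" "emb J' * (emb E * X) = emb E * (emb J * X)"
proof -
  note st = S_blk_step[of k A m, OF A, folded N_def M_def, folded S'_def S_def y_def z_def F_def R_def L_def E_def]
  note js = J_blk_step[OF carriers(11), of k, folded N_def M_def, folded J'_def Jk_def F_def R_def L_def E_def]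
  show "emb S' * (emb F * X) = emb F * (emb (A 0) * X) + emb R * (emb y * X)"
    "emb S' * (emb R * X) = emb R * (emb S * X)"
    "emb S' * (emb L * X) = emb L * (emb S * X) + emb E * (emb z * X)"
    "emb S' * (emb E * X) = emb E * (emb (A 0) * X)"
    "emb J' * (emb F * X) = emb F * (emb J * X)" "emb J' * (emb R * X) = emb R * (emb Jk * X)"
    "emb J' * (emb L * X) = emb L * (emb Jk * X)" "emb J' * (emb E * X) = emb E * (emb J * X)"
    using emb_prod(2)[OF st(1), of X] emb_prod(2)[OF st(2), of X] emb_prod(2)[OF st(3), of X] emb_prod(2)[OF st(4), of X]
      emb_prod(2)[OF js(1), of X] emb_prod(2)[OF js(2), of X] emb_prod(2)[OF js(3), of X] emb_prod(2)[OF js(4), of X]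
    by (simp_all add: dims emb_ring)
qed

text \<open>The row relations follow from the column relations by inserting a resolution of the
  identity on the right.\<close>

lemma rows:
  "emb (adj F) * emb S' = emb (A 0) * emb (adj F)" "emb (adj R) * emb S' = emb y * emb (adj F) + emb S * emb (adj R)"
  "emb (adj L) * emb S' = emb S * emb (adj L)" "emb (adj E) * emb S' = emb z * emb (adj L) + emb (A 0) * emb (adj E)"
proof -
  have 1: "X * emb S' = X * (emb S' * (emb F * emb (adj F))) + X * (emb S' * (emb R * emb (adj R)))"
    and 2: "X * emb S' = X * (emb S' * (emb L * emb (adj L))) + X * (emb S' * (emb E * emb (adj E)))" for X
    unfolding distrib_left[symmetric] FR(9) LE(9) by (simp_all add: emb_ring dims)
  show "emb (adj F) * emb S' = emb (A 0) * emb (adj F)" "emb (adj R) * emb S' = emb y * emb (adj F) + emb S * emb (adj R)"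
    by (subst 1, simp add: cols distrib_left FR(1-8) emb_ring dims)+
  show "emb (adj L) * emb S' = emb S * emb (adj L)" "emb (adj E) * emb S' = emb z * emb (adj L) + emb (A 0) * emb (adj E)"
    by (subst 2, simp add: cols distrib_left LE(1-8) emb_ring dims)+
qed

lemma adj_cols:
  "emb (adj S') * (emb F * X) = emb F * (emb (adj (A 0)) * X)"
  "emb (adj S') * (emb R * X) = emb F * (emb (adj y) * X) + emb R * (emb (adj S) * X)"
  "emb (adj S') * (emb L * X) = emb L * (emb (adj S) * X)"
  "emb (adj S') * (emb E * X) = emb L * (emb (adj z) * X) + emb E * (emb (adj (A 0)) * X)"
proof -
  have m: "adj F * S' = A 0 * adj F" "adj R * S' = y * adj F + S * adj R"
    "adj L * S' = S * adj L" "adj E * S' = z * adj L + A 0 * adj E"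
    by (rule emb_eqD; simp add: emb_ring dims rows)+
  show "emb (adj S') * (emb F * X) = emb F * (emb (adj (A 0)) * X)"
    "emb (adj S') * (emb R * X) = emb F * (emb (adj y) * X) + emb R * (emb (adj S) * X)"
    "emb (adj S') * (emb L * X) = emb L * (emb (adj S) * X)"
    "emb (adj S') * (emb E * X) = emb L * (emb (adj z) * X) + emb E * (emb (adj (A 0)) * X)"
    using arg_cong[OF m(1), of "\<lambda>Y. emb (adj Y) * X"] arg_cong[OF m(2), of "\<lambda>Y. emb (adj Y) * X"]
      arg_cong[OF m(3), of "\<lambda>Y. emb (adj Y) * X"] arg_cong[OF m(4), of "\<lambda>Y. emb (adj Y) * X"]
    by (simp_all add: adj_simps emb_ring dims)
qed

lemma qf_J'_FR:
  assumes "a \<in> carrier_mat m 1" "b \<in> carrier_mat M 1"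
  shows "qf J' (F * a + R * b) = qf J a + qf Jk b"
proof (rule qf_add_eq)
  show "adj (F * a + R * b) * J' * (F * a + R * b) = adj a * J * a + adj b * Jk * b"
    by (rule emb_eqD) (use assms in \<open>auto simp: adj_simps emb_ring dims cols FR(1-8)\<close>)
qed (use assms carriers in auto)

lemma qf_J'_LE:
  assumes "a \<in> carrier_mat m 1" "b \<in> carrier_mat M 1"
  shows "qf J' (L * b + E * a) = qf Jk b + qf J a"
proof (rule qf_add_eq)
  show "adj (L * b + E * a) * J' * (L * b + E * a) = adj b * Jk * b + adj a * J * a"
    by (rule emb_eqD) (use assms in \<open>auto simp: adj_simps emb_ring dims cols LE(1-8)\<close>)
qed (use assms carriers in auto)

text \<open>A kernel vector \<open>x\<close> of the smaller form can be added in the lower blocks at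
  no cost, while it shifts the first block of the image by \<open>adj y * x\<close>. By
  \<open>J_contractive_affine\<close> this shift must vanish.\<close>

lemma kernel_P_orth_y:
  assumes psd: "psd (P_mat m J A (Suc k))" and x: "x \<in> carrier_mat M 1" and Px: "P_mat m J A k * x = 0\<^sub>m M 1"
  shows "adj y * x = 0\<^sub>m m 1"
proof -
  have P': "P_mat m J A (Suc k) = J' - adj (adj S') * J' * adj S'" by (simp add: P_mat_def J'_def S'_def)
  have Pk: "P_mat m J A k = Jk - adj (adj S) * Jk * adj S" by (simp add: P_mat_def Jk_def S_def)
  have con: "Re (qf J' v) \<ge> Re (qf J' (adj S' * v))" if "v \<in> carrier_mat N 1" for v
    using psd psd_minus_conj_iff[OF carriers(5) J_adj(2) adj_carrier[OF carriers(1)]] that unfolding P' by blast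
  have zero: "qf Jk x - qf Jk (adj S * x) = 0"
  proof -
    have "qf (P_mat m J A k) x = qf Jk x - qf Jk (adj S * x)"
      unfolding Pk by (rule qf_minus_conj) (use carriers x in auto)
    moreover have "adj x * P_mat m J A k * x = adj x * (P_mat m J A k * x)"
      by (rule assoc_mult_mat[of _ 1 M _ M]) (use x P_mat_carrier[of m J A k] in \<open>auto simp: M_def\<close>)
    ultimately show ?thesis unfolding qf_def[of "P_mat m J A k"] Px using x by simp
  qed
  have main: "Re (qf J v) \<ge> Re (qf J (adj (A 0) * v + adj y * b)) - Re (qf Jk b - qf Jk (adj S * b))"
    if v: "v \<in> carrier_mat m 1" and b: "b \<in> carrier_mat M 1" for v b
  proof -
    have "adj S' * (F * v + R * b) = F * (adj (A 0) * v + adj y * b) + R * (adj S * b)"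
      by (rule emb_eqD) (use v b in \<open>auto simp: adj_simps emb_ring dims adj_cols\<close>)
    moreover have "F * v + R * b \<in> carrier_mat N 1" using v b carriers by auto
    moreover have "adj (A 0) * v + adj y * b \<in> carrier_mat m 1" "adj S * b \<in> carrier_mat M 1"
      using v b carriers by auto
    ultimately show ?thesis using con[of "F * v + R * b"] qf_J'_FR[OF v b] qf_J'_FR by simp
  qed
  show ?thesis
  proof (rule J_contractive_affine[OF sig adj_carrier[OF carriers(12)]])
    show "adj y * x \<in> carrier_mat m 1" using carriers x by auto
    fix v :: "complex mat" assume v: "v \<in> carrier_mat m 1"
    show "Re (qf J v) \<ge> Re (qf J (adj (A 0) * v + adj y * x))" using main[OF v x] zero by simp
    have z0: "qf Jk (0\<^sub>m M 1) = 0" using carriers by (simp add: qf_def)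
    have "adj S * 0\<^sub>m M 1 = 0\<^sub>m M 1" "adj (A 0) * v + adj y * 0\<^sub>m M 1 = adj (A 0) * v" using carriers v by auto
    then show "Re (qf J v) \<ge> Re (qf J (adj (A 0) * v))" using main[OF v, of "0\<^sub>m M 1"] z0 by simp
  qed
qed

text \<open>Orthogonality to the kernel places the columns of \<open>y\<close> in the range of the
  Hermitian matrix \<open>P\<close>, on which \<open>P * mp_inv P\<close> acts as the
  identity.\<close>

lemma P_mp_inv_y:
  assumes psd: "psd (P_mat m J A (Suc k))"
  shows "P_mat m J A k * (mp_inv (P_mat m J A k) * y) = y"
proof -
  define P where "P = P_mat m J A k"
  have P: "P \<in> carrier_mat M M" using P_mat_carrier[of m J A k] by (simp add: P_def M_def)
  have hP: "adj P = P" unfolding P_def P_mat_def Jk_def[symmetric] S_def[symmetric]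
    by (rule emb_eqD) (simp_all add: adj_simps emb_ring dims J_adj)
  note mp = mp_inv_hermitian[OF P hP]
  \<comment> \<open>The orthogonal projection onto the kernel of \<open>P\<close>; its columns are
    the kernel vectors to be tested.\<close>
  define X where "X = 1\<^sub>m M - P * mp_inv P"
  have X: "X \<in> carrier_mat M M" using P mp by (auto simp: X_def)
  have aX: "adj X = X" using P mp by (simp add: X_def adj_simps)
  have "X * P = 0\<^sub>m M M"
    by (rule emb_eqD) (use P mp(1) arg_cong[OF mp(2), of emb] in \<open>auto simp: X_def emb_ring\<close>)
  from arg_cong[OF this, of adj] have PX: "P * X = 0\<^sub>m M M" using P X hP aX by (simp add: adj_simps)
  have "adj y * X = 0\<^sub>m m M"
  proof (rule zero_by_columns)
    fix j assume "j < M"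
    have x: "X * sel M 1 j \<in> carrier_mat M 1" using X by auto
    have "P * (X * sel M 1 j) = P * X * sel M 1 j" using P X by (simp add: assoc_mult_mat[of _ M M _ M _ 1])
    also have "\<dots> = 0\<^sub>m M 1" unfolding PX by simp
    finally have "P_mat m J A k * (X * sel M 1 j) = 0\<^sub>m M 1" by (simp add: P_def)
    from kernel_P_orth_y[OF psd x this] show "adj y * X * sel M 1 j = 0\<^sub>m m 1"
      using carriers X by (simp add: assoc_mult_mat[of _ m M _ M _ 1])
  qed (use carriers X in auto)
  from arg_cong[OF this, of adj] have Xy: "X * y = 0\<^sub>m M m" using carriers X aX by (simp add: adj_simps)
  have "emb y - emb P * (emb (mp_inv P) * emb y) = 0"
    using arg_cong[OF Xy, of emb] P mp(1) by (simp add: X_def emb_ring dims)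
  then show ?thesis unfolding P_def[symmetric]
    by (intro emb_eqD) (use P mp(1) in \<open>auto simp: emb_ring dims\<close>)
qed

text \<open>Links the row and the column description of the central value: \<open>M_mat\<close> will
  reduce to \<open>- (W * y)\<close> for a row solution \<open>W\<close>, and any column solution
  \<open>V\<close> gives the same matrix. The computation inserts \<open>Jk * Jk = 1\<close> and
  uses each equation once to eliminate the Toeplitz terms.\<close>

lemma zV_eq_Wy:
  assumes V: "V \<in> carrier_mat M m" "Q_mat m J A k * V = adj S * Jk * y"
    and W: "W \<in> carrier_mat m M" "W * P_mat m J A k = z * Jk * adj S"
  shows "z * V = W * y"
proof (rule emb_eqD)
  have 1: "emb Jk * emb V = emb (adj S) * (emb Jk * (emb S * emb V)) + emb (adj S) * (emb Jk * emb y)"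
    using arg_cong[OF V(2), of emb] V(1) unfolding Q_mat_def Jk_def[symmetric] S_def[symmetric]
    by (simp add: emb_ring dims diff_eq_eq add.commute)
  have 2: "emb z * (emb Jk * (emb (adj S) * X)) = emb W * (emb Jk * X) - emb W * (emb S * (emb Jk * (emb (adj S) * X)))" for X
    using arg_cong[OF arg_cong[OF W(2), of emb], of "\<lambda>Y. Y * X"] W(1) unfolding P_mat_def Jk_def[symmetric] S_def[symmetric]
    by (simp add: emb_ring dims)
  have "emb z * emb V = emb z * (emb Jk * (emb Jk * emb V))" using V(1) by (simp add: JkJk emb_ring dims)
  also have "\<dots> = emb W * (emb S * emb V) + emb W * emb y
      - emb W * (emb S * (emb Jk * (emb (adj S) * (emb Jk * (emb S * emb V)) + emb (adj S) * (emb Jk * emb y))))"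
    unfolding 1 using V(1) by (simp add: distrib_left 2 JkJk emb_ring dims)
  also have "\<dots> = emb W * emb y" unfolding 1[symmetric] using V(1) by (simp add: JkJk emb_ring dims)
  finally show "emb (z * V) = emb (W * y)" using V(1) W(1) by (simp add: emb_mult dims)
qed (use V W in \<open>auto simp: dims\<close>)

lemma y_vec_Suc: "A (Suc (Suc k)) \<in> carrier_mat m m \<Longrightarrow> y_vec m A (Suc (Suc k)) = L * y + E * A (Suc (Suc k))"
  and z_vec_Suc: "A (Suc (Suc k)) \<in> carrier_mat m m \<Longrightarrow> z_vec m A (Suc (Suc k)) = A (Suc (Suc k)) * adj F + z * adj R"
proof -
  assume A': "A (Suc (Suc k)) \<in> carrier_mat m m"
  have MN: "M = Suc k * m" "N = Suc (Suc k) * m" by (auto simp: M_def N_def)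
  show "y_vec m A (Suc (Suc k)) = L * y + E * A (Suc (Suc k))"
    unfolding L_def E_def sel_mult[OF carriers(3)] sel_mult[OF A']
  proof (rule eq_matI)
    fix a b assume "a < dim_row (mat N m (\<lambda>(a,b). if 0 \<le> a \<and> a - 0 < M then y $$ (a - 0, b) else 0) +
        mat N m (\<lambda>(a,b). if M \<le> a \<and> a - M < m then A (Suc (Suc k)) $$ (a - M, b) else 0))"
      "b < dim_col (mat N m (\<lambda>(a,b). if 0 \<le> a \<and> a - 0 < M then y $$ (a - 0, b) else 0) +
        mat N m (\<lambda>(a,b). if M \<le> a \<and> a - M < m then A (Suc (Suc k)) $$ (a - M, b) else 0))"
    then have ab: "a < N" "b < m" by auto
    have "a div m = Suc k \<and> a mod m = a - M" if "M \<le> a"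
    proof -
      have "a = Suc k * m + (a - M)" "a - M < m" using that MN ab by auto
      then show ?thesis using ab by (metis div_mult_self3 add.commute div_less add.right_neutral mod_mult_self3 mod_less not_less_zero)
    qed
    moreover have "M \<le> a \<Longrightarrow> a - M < m" using ab NM by auto
    ultimately show "y_vec m A (Suc (Suc k)) $$ (a,b) = (mat N m (\<lambda>(a,b). if 0 \<le> a \<and> a - 0 < M then y $$ (a - 0, b) else 0) +
        mat N m (\<lambda>(a,b). if M \<le> a \<and> a - M < m then A (Suc (Suc k)) $$ (a - M, b) else 0)) $$ (a,b)"
      using ab unfolding MN y_def y_vec_def by auto
  qed (auto simp: y_vec_dim N_def)
  have "adj (z_vec m A (Suc (Suc k))) = F * adj (A (Suc (Suc k))) + R * adj z"
    unfolding F_def R_def sel_mult[OF adj_carrier[OF carriers(4)]] sel_mult[OF adj_carrier[OF A']]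
  proof (rule eq_matI)
    fix a b assume "a < dim_row (mat N m (\<lambda>(a,b). if 0 \<le> a \<and> a - 0 < m then adj (A (Suc (Suc k))) $$ (a - 0, b) else 0) +
        mat N m (\<lambda>(a,b). if m \<le> a \<and> a - m < M then adj z $$ (a - m, b) else 0))"
      "b < dim_col (mat N m (\<lambda>(a,b). if 0 \<le> a \<and> a - 0 < m then adj (A (Suc (Suc k))) $$ (a - 0, b) else 0) +
        mat N m (\<lambda>(a,b). if m \<le> a \<and> a - m < M then adj z $$ (a - m, b) else 0))"
    then have ab: "a < N" "b < m" by auto
    have h: "m \<le> a \<Longrightarrow> a - m < M" using ab NM by auto
    have zv: "adj z $$ (c,b) = cnj (A (Suc k - c div m) $$ (b, c mod m))" if "c < M" for c
      using that ab carriers(4) by (auto simp: z_def z_vec_def M_def)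
    have l: "adj (z_vec m A (Suc (Suc k))) $$ (a,b) = cnj (A (Suc (Suc k) - a div m) $$ (b, a mod m))"
      using ab by (auto simp: z_vec_def N_def)
    show "adj (z_vec m A (Suc (Suc k))) $$ (a,b) = (mat N m (\<lambda>(a,b). if 0 \<le> a \<and> a - 0 < m then adj (A (Suc (Suc k))) $$ (a - 0, b) else 0) +
        mat N m (\<lambda>(a,b). if m \<le> a \<and> a - m < M then adj z $$ (a - m, b) else 0)) $$ (a,b)"
      unfolding l using ab h A' zv[of "a - m"] by (auto simp: div_shift mod_shift)
  qed (auto simp: z_vec_dim N_def)
  from arg_cong[OF this, of adj] show "z_vec m A (Suc (Suc k)) = A (Suc (Suc k)) * adj F + z * adj R"
    using A' by (simp add: adj_simps dims)
qed

text \<open>The central value is the one for which an old solution padded by a zero block keeps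
  solving the system: the new last block of \<open>S' * L * V + y_vec\<close> is
  \<open>z * V + A (Suc (Suc k))\<close>, which is 0. The row version is proved for the adjoint,
  with the zero block in front.\<close>

lemma extend_solutions:
  assumes A': "A (Suc (Suc k)) \<in> carrier_mat m m"
    and V: "V \<in> carrier_mat M m" "Q_mat m J A k * V = adj S * Jk * y" "A (Suc (Suc k)) = - (z * V)"
    and W: "W \<in> carrier_mat m M" "W * P_mat m J A k = z * Jk * adj S" "A (Suc (Suc k)) = - (W * y)"
  shows "Q_mat m J A (Suc k) * (L * V) = adj S' * J' * y_vec m A (Suc (Suc k))"
    and "W * adj R * P_mat m J A (Suc k) = z_vec m A (Suc (Suc k)) * J' * adj S'"
proof -
  let ?A = "A (Suc (Suc k))"
  have 1: "emb Jk * emb V = emb (adj S) * (emb Jk * (emb S * emb V)) + emb (adj S) * (emb Jk * emb y)"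
    using arg_cong[OF V(2), of emb] V(1) unfolding Q_mat_def Jk_def[symmetric] S_def[symmetric]
    by (simp add: emb_ring dims diff_eq_eq add.commute)
  have eA: "emb ?A = - (emb z * emb V)" "emb ?A = - (emb W * emb y)"
    using arg_cong[OF V(3), of emb] arg_cong[OF W(3), of emb] V(1) W(1) by (simp_all add: emb_mult emb_uminus dims)
  have eQ: "emb (Q_mat m J A (Suc k)) = emb J' - emb (adj S') * (emb J' * emb S')"
    "emb (P_mat m J A (Suc k)) = emb J' - emb S' * (emb J' * emb (adj S'))"
    unfolding Q_mat_def P_mat_def J'_def[symmetric] S'_def[symmetric] by (simp_all add: emb_mult emb_minus dims mult.assoc)
  have Qc: "Q_mat m J A (Suc k) \<in> carrier_mat N N" "P_mat m J A (Suc k) \<in> carrier_mat N N"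
    using Q_mat_carrier[of m J A "Suc k"] P_mat_carrier[of m J A "Suc k"] by (simp_all add: N_def)
  have dA: "dim_row ?A = m" "dim_col ?A = m" using A' by auto
  show "Q_mat m J A (Suc k) * (L * V) = adj S' * J' * y_vec m A (Suc (Suc k))"
  proof (rule emb_eqD)
    have "emb (Q_mat m J A (Suc k) * (L * V)) = emb L * (emb Jk * emb V) - emb (adj S') * (emb J' * (emb L * (emb S * emb V) + emb E * (emb z * emb V)))"
      using Qc V(1) by (simp add: eQ emb_mult dims mult.assoc left_diff_distrib cols)
    also have "\<dots> = emb L * (emb (adj S) * (emb Jk * emb y)) - (emb L * (emb (adj z) * (emb J * (emb z * emb V))) + emb E * (emb (adj (A 0)) * (emb J * (emb z * emb V))))"
      unfolding 1 by (simp add: distrib_left cols adj_cols)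
    also have "\<dots> = emb (adj S' * J' * y_vec m A (Suc (Suc k)))"
      unfolding y_vec_Suc[OF A'] using dA by (simp add: emb_mult emb_add dims mult.assoc distrib_left right_diff_distrib cols adj_cols eA(1))
    finally show "emb (Q_mat m J A (Suc k) * (L * V)) = emb (adj S' * J' * y_vec m A (Suc (Suc k)))" .
  qed (use Qc V(1) in \<open>auto simp: dims y_vec_dim\<close>)
  have 2: "emb W * (emb Jk * X) = emb z * (emb Jk * (emb (adj S) * X)) + emb W * (emb S * (emb Jk * (emb (adj S) * X)))" for X
    using arg_cong[OF arg_cong[OF W(2), of emb], of "\<lambda>Y. Y * X"] W(1) unfolding P_mat_def Jk_def[symmetric] S_def[symmetric]
    by (simp add: emb_ring dims diff_eq_eq)
  have h: "adj (P_mat m J A (Suc k)) = P_mat m J A (Suc k)"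
    unfolding P_mat_def J'_def[symmetric] S'_def[symmetric]
    by (rule emb_eqD) (simp_all add: adj_simps emb_ring dims J_adj)
  have 3: "emb Jk * emb (adj W) = emb S * (emb Jk * emb (adj z)) + emb S * (emb Jk * (emb (adj S) * emb (adj W)))"
  proof -
    have "W * Jk = z * Jk * adj S + W * S * Jk * adj S"
      by (rule emb_eqD) (use 2[of "emb (1\<^sub>m M)"] W(1) in \<open>auto simp: emb_ring dims\<close>)
    from arg_cong[OF this, of "\<lambda>X. emb (adj X)"] show ?thesis using W(1) by (simp add: adj_simps emb_ring dims J_adj)
  qed
  have aA: "emb (adj ?A) = - (emb (adj y) * emb (adj W))"
    using arg_cong[OF W(3), of "\<lambda>X. emb (adj X)"] W(1) by (simp add: adj_simps emb_mult emb_uminus dims)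
  have PRW: "P_mat m J A (Suc k) * (R * adj W) = S' * J' * adj (z_vec m A (Suc (Suc k)))"
  proof (rule emb_eqD)
    have "emb (P_mat m J A (Suc k) * (R * adj W)) = emb R * (emb Jk * emb (adj W)) - emb S' * (emb J' * (emb F * (emb (adj y) * emb (adj W)) + emb R * (emb (adj S) * emb (adj W))))"
      using Qc W(1) by (simp add: eQ emb_mult dims mult.assoc left_diff_distrib cols adj_cols)
    also have "\<dots> = emb R * (emb S * (emb Jk * emb (adj z))) - (emb F * (emb (A 0) * (emb J * (emb (adj y) * emb (adj W)))) + emb R * (emb y * (emb J * (emb (adj y) * emb (adj W)))))"
      unfolding 3 by (simp add: distrib_left cols)
    also have "\<dots> = emb (S' * J' * adj (z_vec m A (Suc (Suc k))))"
      unfolding z_vec_Suc[OF A'] using dA by (simp add: adj_simps emb_mult emb_add dims mult.assoc distrib_left right_diff_distrib cols aA)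
    finally show "emb (P_mat m J A (Suc k) * (R * adj W)) = emb (S' * J' * adj (z_vec m A (Suc (Suc k))))" .
  qed (use Qc W(1) in \<open>auto simp: dims z_vec_dim\<close>)
  have dz: "dim_row (z_vec m A (Suc (Suc k))) = m" "dim_col (z_vec m A (Suc (Suc k))) = N" by (simp_all add: z_vec_dim N_def)
  have "W * adj R * P_mat m J A (Suc k) = adj (P_mat m J A (Suc k) * (R * adj W))"
    by (rule emb_eqD) (use Qc W(1) h in \<open>auto simp: adj_mult emb_mult mult.assoc dims\<close>)
  also have "\<dots> = z_vec m A (Suc (Suc k)) * J' * adj S'"
    unfolding PRW by (rule emb_eqD) (use dz J_adj in \<open>auto simp: adj_mult emb_mult mult.assoc dims\<close>)
  finally show "W * adj R * P_mat m J A (Suc k) = z_vec m A (Suc (Suc k)) * J' * adj S'" .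
qed

text \<open>The column counterpart of \<open>kernel_P_orth_y\<close>: a kernel column stays a kernel
  column after padding, and the new row \<open>z\<close> annihilates it. Once the head of
  \<open>\<rho>\<close> is the identity, \<open>z * \<rho> = 0\<close> determines the newest
  coefficient from the earlier ones.\<close>

lemma isotropic_step:
  assumes psd: "psd (Q_mat m J A (Suc k))" and \<rho>: "\<rho> \<in> carrier_mat M m" and Q\<rho>: "Q_mat m J A k * \<rho> = 0\<^sub>m M m"
  shows "z * \<rho> = 0\<^sub>m m m" "Q_mat m J A (Suc k) * (L * \<rho>) = 0\<^sub>m N m"
proof -
  have Q': "Q_mat m J A (Suc k) = J' - adj S' * J' * S'" by (simp add: Q_mat_def J'_def S'_def)
  have Qk: "Q_mat m J A k = Jk - adj S * Jk * S" by (simp add: Q_mat_def Jk_def S_def)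
  have con: "Re (qf J' v) \<ge> Re (qf J' (S' * v))" if "v \<in> carrier_mat N 1" for v
    using psd psd_minus_conj_iff[OF carriers(5) J_adj(2) carriers(1)] that unfolding Q' by blast
  have main: "Re (qf J v) \<ge> Re (qf J (A 0 * v + z * b)) - Re (qf Jk b - qf Jk (S * b))"
    if v: "v \<in> carrier_mat m 1" and b: "b \<in> carrier_mat M 1" for v b
  proof -
    have "S' * (L * b + E * v) = L * (S * b) + E * (A 0 * v + z * b)"
      by (rule emb_eqD) (use v b in \<open>auto simp: adj_simps emb_ring dims cols\<close>)
    moreover have "L * b + E * v \<in> carrier_mat N 1" using v b carriers by auto
    moreover have "A 0 * v + z * b \<in> carrier_mat m 1" "S * b \<in> carrier_mat M 1"
      using v b carriers by auto
    ultimately show ?thesis using con[of "L * b + E * v"] qf_J'_LE[OF v b] qf_J'_LE by simp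
  qed
  show z\<rho>: "z * \<rho> = 0\<^sub>m m m"
  proof (rule zero_by_columns)
    fix j assume "j < m"
    define b where "b = \<rho> * sel m 1 j"
    have b: "b \<in> carrier_mat M 1" using \<rho> by (auto simp: b_def)
    have "Q_mat m J A k * b = Q_mat m J A k * \<rho> * sel m 1 j" unfolding b_def
      by (rule assoc_mult_mat[symmetric, of _ M M _ m _ 1]) (use \<rho> Q_mat_carrier[of m J A k] in \<open>auto simp: M_def\<close>)
    then have Qb: "Q_mat m J A k * b = 0\<^sub>m M 1" unfolding Q\<rho> by simp
    have zero: "qf Jk b - qf Jk (S * b) = 0"
    proof -
      have "qf (Q_mat m J A k) b = qf Jk b - qf Jk (S * b)"
        unfolding Qk by (rule qf_minus_conj) (use carriers b in auto)
      moreover have "adj b * Q_mat m J A k * b = adj b * (Q_mat m J A k * b)"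
        by (rule assoc_mult_mat[of _ 1 M _ M]) (use b Q_mat_carrier[of m J A k] in \<open>auto simp: M_def\<close>)
      ultimately show ?thesis unfolding qf_def[of "Q_mat m J A k"] Qb using b by simp
    qed
    have "z * b = 0\<^sub>m m 1"
    proof (rule J_contractive_affine[OF sig carriers(12)])
      show "z * b \<in> carrier_mat m 1" using carriers b by auto
      fix v :: "complex mat" assume v: "v \<in> carrier_mat m 1"
      show "Re (qf J v) \<ge> Re (qf J (A 0 * v + z * b))" using main[OF v b] zero by simp
      have z0: "qf Jk (0\<^sub>m M 1) = 0" using carriers by (simp add: qf_def)
      have "S * 0\<^sub>m M 1 = 0\<^sub>m M 1" "A 0 * v + z * 0\<^sub>m M 1 = A 0 * v" using carriers v by auto
      then show "Re (qf J v) \<ge> Re (qf J (A 0 * v))" using main[OF v, of "0\<^sub>m M 1"] z0 by simp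
    qed
    then show "z * \<rho> * sel m 1 j = 0\<^sub>m m 1" unfolding b_def
      using carriers \<rho> by (simp add: assoc_mult_mat[of _ m M _ m _ 1])
  qed (use carriers \<rho> in auto)
  have ez: "emb z * emb \<rho> = 0" using arg_cong[OF z\<rho>, of emb] \<rho> by (simp add: emb_ring dims)
  have eq: "emb Jk * emb \<rho> - emb (adj S) * (emb Jk * (emb S * emb \<rho>)) = 0"
    using arg_cong[OF Q\<rho>, of emb] \<rho> unfolding Qk by (simp add: emb_ring dims)
  show "Q_mat m J A (Suc k) * (L * \<rho>) = 0\<^sub>m N m"
    unfolding Q' by (rule emb_eqD)
      (use \<rho> eq in \<open>auto simp: emb_ring dims cols adj_cols ez right_diff_distrib[symmetric]\<close>)
qed

end

section \<open>The central sequence\<close>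

lemma sel_same: "sel n n 0 = 1\<^sub>m n"
  by (auto simp: sel_def intro!: eq_matI)

text \<open>The pseudoinverse in \<open>M_mat\<close> grows with \<open>k\<close>; here it is traded
  for the fixed matrices \<open>V\<close> and \<open>W\<close>. Padding \<open>V\<close> with zeros
  below and \<open>W\<close> with zeros in front gives solutions of all later systems, so the
  central sequence obeys a linear recursion of length \<open>n\<close>. The pseudoinverse drops out
  because \<open>y\<close> lies in the range of \<open>P\<close>.\<close>

lemma central_recursion:
  fixes A :: "nat \<Rightarrow> complex mat"
  assumes sig: "signature_mat m J" and A: "\<And>j. A j \<in> carrier_mat m m"
    and psd: "\<And>k. psd (Q_mat m J A k)"
    and central: "\<And>k. k > n \<Longrightarrow> A k = M_mat m J A k"
    and V: "V \<in> carrier_mat (n*m) m" and W: "W \<in> carrier_mat m (n*m)"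
    and VW: "n \<ge> 1 \<Longrightarrow> V \<in> Y_set m J A n \<and> W \<in> Z_set m J A n"
    and kn: "k \<ge> n"
  shows "A (Suc k) = - (z_vec m A k * (sel (k*m) (n*m) 0 * V))"
    and "A (Suc k) = - (W * adj (sel (k*m) (n*m) ((k-n)*m)) * y_vec m A k)"
proof -
  define Vk where "Vk k = sel (k*m) (n*m) 0 * V" for k
  define Wk where "Wk k = W * adj (sel (k*m) (n*m) ((k-n)*m))" for k
  have Vc: "Vk k \<in> carrier_mat (k*m) m" and Wc: "Wk k \<in> carrier_mat m (k*m)" for k
    using V W by (auto simp: Vk_def Wk_def)
  have A1: "A (Suc 0) = 0\<^sub>m m m" if "n = 0"
    using central[of "Suc 0"] that by (simp add: M_mat_def)
  have step: "A (Suc (Suc j)) = - (z_vec m A (Suc j) * Vk (Suc j)) \<and> A (Suc (Suc j)) = - (Wk (Suc j) * y_vec m A (Suc j))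
     \<and> Vk (Suc (Suc j)) \<in> Y_set m J A (Suc (Suc j)) \<and> Wk (Suc (Suc j)) \<in> Z_set m J A (Suc (Suc j))"
    if jn: "Suc j \<ge> n" and Y: "Vk (Suc j) \<in> Y_set m J A (Suc j)" and Z: "Wk (Suc j) \<in> Z_set m J A (Suc j)" for j
  proof -
    interpret toeplitz_step m j J A by unfold_locales (use sig A in auto)
    have Mj: "Suc j * m = M" "Suc (Suc j) * m = N" by (auto simp: M_def N_def)
    have V1: "Vk (Suc j) \<in> carrier_mat M m" "Q_mat m J A j * Vk (Suc j) = adj S * Jk * y"
      using Y unfolding Y_set_def by (simp_all add: Mj S_def Jk_def y_def del: mult_Suc)
    have W1: "Wk (Suc j) \<in> carrier_mat m M" "Wk (Suc j) * P_mat m J A j = z * Jk * adj S"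
      using Z unfolding Z_set_def by (simp_all add: Mj S_def Jk_def z_def del: mult_Suc)
    have P: "P_mat m J A j \<in> carrier_mat M M" using P_mat_carrier[of m J A j] by (simp add: M_def)
    have hP: "adj (P_mat m J A j) = P_mat m J A j" unfolding P_mat_def Jk_def[symmetric] S_def[symmetric]
      by (rule emb_eqD) (simp_all add: adj_simps emb_ring dims J_adj)
    note mp = mp_inv_hermitian(1)[OF P hP]
    have Py: "P_mat m J A j * (mp_inv (P_mat m J A j) * y) = y" using P_mp_inv_y[OF psd_P_of_psd_Q[OF sig psd]] .
    have "A (Suc (Suc j)) = - (z * Jk * adj S * mp_inv (P_mat m J A j) * y)"
      using central[of "Suc (Suc j)"] jn by (simp add: M_mat_def Let_def z_def Jk_def S_def y_def)
    also have "z * Jk * adj S * mp_inv (P_mat m J A j) * y = Wk (Suc j) * y"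
      unfolding W1(2)[symmetric]
      by (rule emb_eqD) (use W1(1) P mp arg_cong[OF Py, of emb] in \<open>auto simp: emb_mult mult.assoc dims\<close>)
    finally have AW: "A (Suc (Suc j)) = - (Wk (Suc j) * y)" .
    then have AV: "A (Suc (Suc j)) = - (z * Vk (Suc j))" using zV_eq_Wy[OF V1 W1] by simp
    have ext: "Q_mat m J A (Suc j) * (L * Vk (Suc j)) = adj S' * J' * y_vec m A (Suc (Suc j))"
      "Wk (Suc j) * adj R * P_mat m J A (Suc j) = z_vec m A (Suc (Suc j)) * J' * adj S'"
      by (rule extend_solutions[OF assms(2) V1 AV W1 AW])+
    have nj: "n * m \<le> M" "n * m + (Suc j - n) * m = M" using jn unfolding M_def
      by (simp_all add: mult_le_mono1 add_mult_distrib[symmetric] del: mult_Suc)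
    have "L * sel M (n*m) 0 = sel N (n*m) 0"
      unfolding L_def sel_sel using nj by (auto simp: sel_def intro!: eq_matI)
    then have "L * Vk (Suc j) = Vk (Suc (Suc j))" unfolding Vk_def Mj
      using assoc_mult_mat[of L N M "sel M (n*m) 0" "n*m" V m] carriers V by simp
    moreover
    have "R * sel M (n*m) ((Suc j - n)*m) = sel N (n*m) ((Suc (Suc j) - n)*m)"
    proof -
      have "(Suc (Suc j) - n)*m = (Suc j - n)*m + m" using jn by (simp add: Suc_diff_le)
      then show ?thesis unfolding R_def sel_sel using nj by (auto simp: sel_def intro!: eq_matI)
    qed
    then have RS: "adj (sel M (n*m) ((Suc j - n)*m)) * adj R = adj (sel N (n*m) ((Suc (Suc j) - n)*m))"
      using arg_cong[of "R * sel M (n*m) ((Suc j - n)*m)" _ adj] dims by (metis adj_mult sel_dim(1))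
    have "Wk (Suc j) * adj R = Wk (Suc (Suc j))" unfolding Wk_def Mj
      by (rule emb_eqD) (use W emb_prod(1)[OF RS] in \<open>auto simp: emb_mult mult.assoc dims\<close>)
    ultimately show ?thesis using AW AV ext Vc[of "Suc (Suc j)"] Wc[of "Suc (Suc j)"]
      unfolding Y_set_def Z_set_def by (simp add: z_def y_def S'_def J'_def)
  qed
  have sets: "Vk (Suc j) \<in> Y_set m J A (Suc j) \<and> Wk (Suc j) \<in> Z_set m J A (Suc j)" if "Suc j \<ge> n" for j
    using that
  proof (induction j)
    case 0
    show ?case
    \<comment> \<open>For \<open>n = 0\<close> the empty matrices pad to 0, and this solves the
      first system because the central value of \<open>A (Suc 0)\<close> is 0.\<close>
    proof (cases "n = 0")
      case True
      have y0: "y_vec m A (Suc 0) = 0\<^sub>m m m" "z_vec m A (Suc 0) = 0\<^sub>m m m" using A1[OF True]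
        by (auto simp: y_vec_def z_vec_def intro!: eq_matI)
      have v0: "Vk (Suc 0) = 0\<^sub>m m m" "Wk (Suc 0) = 0\<^sub>m m m"
        using V W True by (auto simp: Vk_def Wk_def scalar_prod_def intro!: eq_matI)
      have c: "Q_mat m J A 0 \<in> carrier_mat m m" "P_mat m J A 0 \<in> carrier_mat m m" "S_blk m A 0 \<in> carrier_mat m m" "J_blk m J 0 \<in> carrier_mat m m"
        using Q_mat_carrier[of m J A 0] P_mat_carrier[of m J A 0] S_blk_carrier[of m A 0] J_blk_carrier[of m J 0] by simp_all
      show ?thesis unfolding Y_set_def Z_set_def using c by (simp add: y0 v0)
    next
      case False
      with 0 have n: "n = Suc 0" by simp
      have "Vk (Suc 0) = V" "Wk (Suc 0) = W" using V W by (simp_all add: Vk_def Wk_def n sel_same adj_one)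
      then show ?thesis using VW n by simp
    qed
  next
    case (Suc j)
    show ?case
    proof (cases "n = Suc (Suc j)")
      case True
      have "Vk n = V" "Wk n = W" using V W by (simp_all add: Vk_def Wk_def sel_same adj_one)
      then show ?thesis using VW True by simp
    next
      case False
      then have "Suc j \<ge> n" using Suc.prems by simp
      then show ?thesis using step Suc.IH by blast
    qed
  qed
  have "A (Suc k) = - (z_vec m A k * Vk k) \<and> A (Suc k) = - (Wk k * y_vec m A k)"
  proof (cases k)
    case 0
    then have n: "n = 0" using kn by simp
    have "z_vec m A k * Vk k = 0\<^sub>m m m" "Wk k * y_vec m A k = 0\<^sub>m m m"
      using 0 Vc[of 0] Wc[of 0] by (auto simp: scalar_prod_def z_vec_dim y_vec_dim intro!: eq_matI)
    then show ?thesis using A1[OF n] 0 by (auto intro!: eq_matI)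
  next
    case (Suc j)
    then have "Suc j \<ge> n" using kn by simp
    then show ?thesis unfolding Suc using step sets by blast
  qed
  then show "A (Suc k) = - (z_vec m A k * (sel (k*m) (n*m) 0 * V))"
    "A (Suc k) = - (W * adj (sel (k*m) (n*m) ((k-n)*m)) * y_vec m A k)" by (auto simp: Vk_def Wk_def)
qed

text \<open>The coefficients of \<open>rho_poly\<close> stacked in one column: the identity on top
  of \<open>V\<close>.\<close>

definition rhohat :: "nat \<Rightarrow> nat \<Rightarrow> complex mat \<Rightarrow> complex mat" where
  "rhohat m n V = sel ((n+1)*m) m 0 + sel ((n+1)*m) (n*m) m * V"

lemma rhohat_carrier: "V \<in> carrier_mat (n*m) m \<Longrightarrow> rhohat m n V \<in> carrier_mat ((n+1)*m) m"
  by (auto simp: rhohat_def)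

lemma rhohat_head:
  assumes V: "V \<in> carrier_mat (n*m) m"
  shows "adj (sel ((n+1)*m) m 0) * rhohat m n V = 1\<^sub>m m"
proof (rule emb_eqD)
  define N where "N = (n+1)*m"
  have NM: "N = m + n*m" by (simp add: N_def)
  show "emb (adj (sel ((n+1)*m) m 0) * rhohat m n V) = emb (1\<^sub>m m)"
    unfolding rhohat_def N_def[symmetric] using V by (simp add: emb_ring sel_split_emb(1-8)[OF NM])
qed (use V in \<open>auto simp: rhohat_def\<close>)

text \<open>The blocks below the first are \<open>Q_mat m J A (n-1) * V - adj S * Jk * y\<close>,
  whose vanishing is the equation that defines \<open>Y_set\<close>.\<close>

lemma Q_rhohat:
  assumes sig: "signature_mat m J" and A: "\<And>j. j \<le> n \<Longrightarrow> A j \<in> carrier_mat m m"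
    and V: "V \<in> carrier_mat (n*m) m" and VY: "n \<ge> 1 \<Longrightarrow> V \<in> Y_set m J A n"
  shows "\<exists>C\<in>carrier_mat m m. Q_mat m J A n * rhohat m n V = sel ((n+1)*m) m 0 * C"
proof (cases n)
  case 0
  have "Q_mat m J A n * rhohat m n V \<in> carrier_mat m m"
    using Q_mat_carrier[of m J A n] rhohat_carrier[OF V] 0 by auto
  then show ?thesis using 0 by (intro bexI[of _ "Q_mat m J A n * rhohat m n V"]) (auto simp: sel_same)
next
  case (Suc j)
  interpret toeplitz_step m j J A by unfold_locales (use sig A Suc in auto)
  have Mj: "Suc j * m = M" "Suc (Suc j) * m = N" "(n+1)*m = N" "n*m = M" by (auto simp: M_def N_def Suc)
  have V1: "V \<in> carrier_mat M m" "Q_mat m J A j * V = adj S * Jk * y"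
    using VY Suc unfolding Y_set_def by (simp_all add: Mj S_def Jk_def y_def del: mult_Suc)
  have 1: "emb Jk * emb V = emb (adj S) * (emb Jk * (emb S * emb V)) + emb (adj S) * (emb Jk * emb y)"
    using arg_cong[OF V1(2), of emb] V1(1) unfolding Q_mat_def Jk_def[symmetric] S_def[symmetric]
    by (simp add: emb_ring dims diff_eq_eq add.commute)
  have r: "rhohat m n V = F + R * V" by (simp only: rhohat_def Mj F_def R_def)
  have Q': "Q_mat m J A n = J' - adj S' * J' * S'" by (simp add: Q_mat_def J'_def S'_def Suc)
  define C where "C = adj F * (Q_mat m J A n * rhohat m n V)"
  have Qc: "Q_mat m J A n \<in> carrier_mat N N" using Q_mat_carrier[of m J A n] unfolding Mj .
  have C: "C \<in> carrier_mat m m" using carriers V1(1) Qc by (auto simp: C_def r)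
  have cF: "emb S' * emb F = emb F * emb (A 0) + emb R * emb y" "emb J' * emb F = emb F * emb J"
    using cols(1)[of "emb (1\<^sub>m m)"] cols(5)[of "emb (1\<^sub>m m)"] by (simp_all add: emb_ring dims)
  have "emb (adj R) * emb (Q_mat m J A n * rhohat m n V) = 0"
    unfolding r Q' using V1(1)
    by (simp add: emb_ring dims cols cF adj_cols FR(1-8)) (simp add: 1)
  then have "emb (Q_mat m J A n * rhohat m n V) = emb F * emb C"
    using FR(10)[of "Q_mat m J A n * rhohat m n V"] V1(1) Qc carriers unfolding C_def r
    by (simp add: emb_mult dims)
  then have "Q_mat m J A n * rhohat m n V = F * C"
    by (intro emb_eqD) (use C Qc V1(1) carriers in \<open>auto simp: r emb_mult\<close>)
  then show ?thesis using C unfolding Mj F_def by blast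
qed

section \<open>The block shift\<close>

text \<open>In contrast to \<open>toeplitz_step\<close> the order stays fixed. \<open>Z\<close> is
  the block shift on \<open>n + 1\<close> blocks, \<open>F\<close> and \<open>E\<close> inject the
  first and the last block.\<close>

locale toeplitz_shift =
  fixes m n :: nat and J :: "complex mat" and A :: "nat \<Rightarrow> complex mat"
  assumes sig: "signature_mat m J" and A: "\<And>j. j \<le> n \<Longrightarrow> A j \<in> carrier_mat m m"
begin

definition N where "N = (n+1)*m"
definition S where "S = S_blk m A n"
definition Jn where "Jn = J_blk m J n"
definition Z where "Z = sel N N m"
definition E where "E = sel N m (n*m)"
definition F where "F = sel N m 0"
definition Q where "Q = Q_mat m J A n"

lemma carriers: "S \<in> carrier_mat N N" "Jn \<in> carrier_mat N N" "Z \<in> carrier_mat N N" "E \<in> carrier_mat N m"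
  "F \<in> carrier_mat N m" "Q \<in> carrier_mat N N" "J \<in> carrier_mat m m"
  using S_blk_carrier[of m A n] J_blk_carrier[of m J n] Q_mat_carrier[of m J A n] sig
  by (simp_all add: N_def S_def Jn_def Z_def E_def F_def Q_def signature_mat_def)

lemma dims: "dim_row S = N" "dim_col S = N" "dim_row Jn = N" "dim_col Jn = N" "dim_row Z = N" "dim_col Z = N"
  "dim_row E = N" "dim_col E = m" "dim_row F = N" "dim_col F = m" "dim_row Q = N" "dim_col Q = N" "dim_row J = m" "dim_col J = m"
  using carriers by auto

lemma J_adj: "adj J = J" "adj Jn = Jn"
  using sig J_blk_signature[OF sig, of n] by (auto simp: signature_mat_def Jn_def)

lemma Q_eq: "Q = Jn - adj S * Jn * S" by (simp add: Q_def Q_mat_def Jn_def S_def)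

lemma Q_adj: "adj Q = Q" unfolding Q_eq by (rule emb_eqD) (simp_all add: adj_simps emb_ring dims J_adj)

lemma shift:
  "emb (adj Z) * (emb Jn * emb Z) = emb Jn - emb E * (emb J * emb (adj E))"
  "emb S * emb Z = emb Z * emb S" "emb (adj F) * emb Z = 0" "emb Z * emb E = 0"
  "emb (adj E) * emb E = emb (1\<^sub>m m)" "emb (adj E) * (emb E * X) = emb (1\<^sub>m m) * X"
proof -
  have "adj E * E = 1\<^sub>m m" unfolding E_def adj_sel_sel by (auto simp: N_def intro!: eq_matI)
  from emb_prod(1)[OF this] emb_prod(2)[OF this, of X]
  show "emb (adj E) * emb E = emb (1\<^sub>m m)" "emb (adj E) * (emb E * X) = emb (1\<^sub>m m) * X" by (simp_all add: dims)
  have "adj F * Z = 0\<^sub>m m N" unfolding F_def Z_def adj_sel_sel by (auto intro!: eq_matI)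
  from arg_cong[OF this, of emb] show "emb (adj F) * emb Z = 0" by (simp add: emb_mult dims emb_zero)
  have "Z * E = 0\<^sub>m N m" unfolding E_def Z_def sel_sel by (auto simp: N_def intro!: eq_matI)
  from arg_cong[OF this, of emb] show "emb Z * emb E = 0" by (simp add: emb_mult dims emb_zero)
  show "emb (adj Z) * (emb Jn * emb Z) = emb Jn - emb E * (emb J * emb (adj E))" "emb S * emb Z = emb Z * emb S"
  proof -
    have "emb (adj Z) * (emb Jn * emb Z) = emb Jn - emb E * (emb J * emb (adj E)) \<and> emb S * emb Z = emb Z * emb S"
    proof (cases n)
      case 0
      have "Z = 0\<^sub>m m m" "E = 1\<^sub>m m" "Jn = J"
        unfolding Z_def E_def N_def Jn_def unfolding 0 using J_blk_0[OF carriers(7)]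
        by (auto simp: sel_def intro!: eq_matI)
      then show ?thesis using carriers(7) by (simp add: emb_zero adj_zero adj_one emb_ring)
    next
      case (Suc j)
      interpret T: toeplitz_step m j J A by unfold_locales (use sig A Suc in auto)
      have N: "T.N = N" "n * m = T.M" unfolding T.N_def N_def T.M_def unfolding Suc by simp_all
      have eqs: "T.S' = S" "T.J' = Jn" unfolding T.S'_def S_def T.J'_def Jn_def unfolding Suc by simp_all
      have eqE: "T.E = E" unfolding T.E_def E_def N ..
      have lt: "a - m < T.M" if "a < N" "m \<le> a" for a using that T.NM N by auto
      note eqs = eqs eqE
      \<comment> \<open>The shift drops the last block and moves the leading ones down, so both
        block decompositions of one step apply to it.\<close>
      have "Z = T.R * adj T.L" unfolding Z_def T.R_def T.L_def N
        by (subst sel_mult[of _ _ N]) (use lt in \<open>auto simp: sel_def intro!: eq_matI\<close>)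
      then have eZ: "emb Z = emb T.R * emb (adj T.L)" by (simp add: emb_mult T.dims)
      have aZ: "emb (adj Z) = emb T.L * emb (adj T.R)"
        using \<open>Z = T.R * adj T.L\<close> by (simp add: emb_mult adj_mult T.dims)
      have "emb (adj Z) * (emb Jn * emb Z) = emb T.L * (emb T.Jk * emb (adj T.L))"
        unfolding eZ aZ eqs(2)[symmetric] by (simp add: emb_ring T.dims T.cols T.FR(1-8))
      moreover have "emb Jn = emb Jn * emb T.L * emb (adj T.L) + emb Jn * emb E * emb (adj E)"
        unfolding mult.assoc distrib_left[symmetric] eqs(3)[symmetric] T.LE(9) using T.dims eqs by (simp add: emb_ring dims N)
      moreover have "emb Jn * emb T.L * emb (adj T.L) = emb T.L * (emb T.Jk * emb (adj T.L))"
        "emb Jn * emb E * emb (adj E) = emb E * (emb J * emb (adj E))"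
        unfolding eqs[symmetric] by (simp_all add: mult.assoc T.cols)
      moreover have "emb S * emb Z = emb Z * emb S"
        unfolding eZ eqs(1)[symmetric] by (simp add: mult.assoc T.cols T.rows)
      ultimately show ?thesis by (simp add: algebra_simps)
    qed
    then show "emb (adj Z) * (emb Jn * emb Z) = emb Jn - emb E * (emb J * emb (adj E))" "emb S * emb Z = emb Z * emb S" by auto
  qed
qed

text \<open>The displacement identity: since \<open>S\<close> commutes with the shift,
  \<open>Q - adj Z * Q * Z\<close> is the input energy minus the output energy of the last block. It
  provides the isometry behind the realisation as well as the telescoping on the circle.\<close>

lemma shift_Q: "emb (adj Z) * (emb Q * emb Z) = emb Q - emb E * (emb J * emb (adj E))
    + emb (adj S) * (emb E * (emb J * (emb (adj E) * emb S)))"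
proof -
  have aSZ: "emb (adj Z) * (emb (adj S) * X) = emb (adj S) * (emb (adj Z) * X)" for X
  proof -
    have "S * Z = Z * S" by (rule emb_eqD) (simp_all add: emb_mult dims shift(2))
    from arg_cong[OF this, of "\<lambda>Y. emb (adj Y) * X"] show ?thesis by (simp add: adj_mult emb_mult dims mult.assoc)
  qed
  have JZ: "emb (adj Z) * (emb Jn * (emb Z * X)) = emb Jn * X - emb E * (emb J * (emb (adj E) * X))" for X
    using arg_cong[OF shift(1), of "\<lambda>Y. Y * X"] by (simp add: mult.assoc left_diff_distrib)
  have eQ: "emb Q = emb Jn - emb (adj S) * (emb Jn * emb S)" unfolding Q_eq by (simp add: emb_mult emb_minus dims mult.assoc)
  show ?thesis unfolding eQ
    by (simp add: left_diff_distrib right_diff_distrib mult.assoc shift(1,2) aSZ JZ)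
qed

text \<open>The row of powers is a left eigenvector of the shift with eigenvalue \<open>z\<close> up
  to its last block, and \<open>cnj z\<close> inverts \<open>z\<close> on the circle.\<close>

lemma e_row_shift:
  assumes z: "cmod z = 1"
  shows "emb (e_row m n z) - sc (cnj z) (emb (e_row m n z) * emb Z) = sc (z ^ n) (emb (adj E))"
proof -
  have er: "e_row m n z \<in> carrier_mat m N" by (auto simp: e_row_def N_def)
  have zz: "cnj z * z = 1" using z by (metis complex_norm_square mult.commute of_real_1 one_power2)
  have "e_row m n z - cnj z \<cdot>\<^sub>m (e_row m n z * Z) = z ^ n \<cdot>\<^sub>m adj E"
  proof (rule eq_matI)
    fix a b assume "a < dim_row (z ^ n \<cdot>\<^sub>m adj E)" "b < dim_col (z ^ n \<cdot>\<^sub>m adj E)"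
    then have ab: "a < m" "b < N" by (auto simp: dims)
    then have m: "m > 0" and bn: "b div m \<le> n" using div_mod_lt[of b n m] by (auto simp: N_def)
    have l: "e_row m n z $$ (a,c) = (if a = c mod m then z ^ (c div m) else 0)" if "c < N" for c
      using ab that by (auto simp: e_row_def N_def)
    have r: "adj E $$ (a,b) = (if b = a + n * m then 1 else 0)" using ab by (auto simp: E_def sel_def)
    have lz: "(e_row m n z * Z) $$ (a,b) = (if b + m < N then e_row m n z $$ (a, b + m) else 0)"
      unfolding Z_def mult_sel[OF er] using ab by simp
    have lt: "b + m < N \<longleftrightarrow> b div m < n"
    proof
      assume "b + m < N"
      then have "b < n * m" by (simp add: N_def)
      then show "b div m < n" by (rule less_mult_imp_div_less)
    next
      assume "b div m < n"
      then have "b < n * m" using div_less_iff_less_mult[OF m] by simp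
      then show "b + m < N" by (simp add: N_def)
    qed
    have bdm: "b = b div m * m + b mod m" by simp
    show "(e_row m n z - cnj z \<cdot>\<^sub>m (e_row m n z * Z)) $$ (a,b) = (z ^ n \<cdot>\<^sub>m adj E) $$ (a,b)"
    proof (cases "b div m < n")
      case True
      then have "b \<noteq> a + n * m" using div_mult_self3[of m n a] ab m by auto
      then show ?thesis using ab er carriers True lt m zz
        by (simp add: l lz r mult.assoc[symmetric])
    next
      case False
      then have bn': "b div m = n" using bn by simp
      then have "b = n * m + b mod m" using bdm by simp
      then have "a = b mod m \<longleftrightarrow> b = a + n * m" by auto
      then show ?thesis using ab er carriers False lt bn' by (simp add: l lz r)
    qed
  qed (use er carriers in auto)
  from arg_cong[OF this, of emb] show ?thesis using er carriers by (simp add: emb_ring)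
qed

text \<open>The Christoffel--Darboux step: \<open>\<psi>\<close> solves \<open>\<psi> = \<rho> + cnj z Z \<psi>\<close>, so that
  its last block is \<open>\<rho>(z)\<close> up to a unimodular factor, and the shift identity telescopes.\<close>

lemma boundary_identity:
  assumes z: "cmod z = 1" and \<rho>: "\<rho> \<in> carrier_mat N m" and h: "adj F * \<rho> = 1\<^sub>m m"
    and C: "C \<in> carrier_mat m m" and Q\<rho>: "Q * \<rho> = F * C"
  shows "adj (e_row m n z * \<rho>) * J * (e_row m n z * \<rho>)
    - adj (e_row m n z * (S * \<rho>)) * J * (e_row m n z * (S * \<rho>)) = adj C"
proof -
  have er: "e_row m n z \<in> carrier_mat m N" by (auto simp: e_row_def N_def)
  have zz: "cnj z * z = 1" "z * cnj z = 1" using z by (metis complex_norm_square mult.commute of_real_1 one_power2)+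
  have zn: "z ^ n * cnj z ^ n = 1" "cnj z ^ n * z ^ n = 1" using zz by (simp_all add: power_mult_distrib[symmetric])
  \<comment> \<open>The shift is nilpotent, so the inverse of \<open>1 - cnj z Z\<close> is a finite
    geometric series; these are its blocks applied to \<open>\<rho>\<close>.\<close>
  define \<psi> where "\<psi> = mat N m (\<lambda>(a,b). \<Sum>i\<le>a div m. cnj z ^ (a div m - i) * \<rho> $$ (i * m + a mod m, b))"
  have \<psi>: "\<psi> \<in> carrier_mat N m" by (simp add: \<psi>_def)
  have ZP: "Z * \<psi> = z \<cdot>\<^sub>m (\<psi> - \<rho>)"
  proof (rule eq_matI)
    fix a b assume "a < dim_row (z \<cdot>\<^sub>m (\<psi> - \<rho>))" "b < dim_col (z \<cdot>\<^sub>m (\<psi> - \<rho>))"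
    then have ab: "a < N" "b < m" using \<rho> by auto
    then have m: "m > 0" by auto
    have lz: "(Z * \<psi>) $$ (a,b) = (if m \<le> a \<and> a - m < N then \<psi> $$ (a - m, b) else 0)"
      unfolding Z_def sel_mult[OF \<psi>] using ab by simp
    show "(Z * \<psi>) $$ (a,b) = (z \<cdot>\<^sub>m (\<psi> - \<rho>)) $$ (a,b)"
    proof (cases "m \<le> a")
      case True
      define q where "q = (a - m) div m"
      have aq: "a div m = Suc q" "(a - m) mod m = a mod m" using True m by (auto simp: q_def div_shift mod_shift)
      have "\<psi> $$ (a,b) = (\<Sum>i\<le>Suc q. cnj z ^ (Suc q - i) * \<rho> $$ (i * m + a mod m, b))"
        using ab by (simp add: \<psi>_def aq)
      also have "\<dots> = cnj z * (\<Sum>i\<le>q. cnj z ^ (q - i) * \<rho> $$ (i * m + a mod m, b)) + \<rho> $$ (Suc q * m + a mod m, b)"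
        by (simp add: sum_distrib_left Suc_diff_le mult.assoc)
      also have "Suc q * m + a mod m = a" using aq(1) by (metis div_mult_mod_eq)
      also have "(\<Sum>i\<le>q. cnj z ^ (q - i) * \<rho> $$ (i * m + a mod m, b)) = \<psi> $$ (a - m, b)"
        using ab True by (simp add: \<psi>_def q_def[symmetric] aq(2))
      finally show ?thesis using ab True \<rho> \<psi> lz zz by (simp add: mult.assoc[symmetric])
    next
      case False
      then show ?thesis using ab \<rho> \<psi> lz by (simp add: \<psi>_def)
    qed
  qed (use carriers \<rho> \<psi> in auto)
  have Z\<psi>: "emb Z * emb \<psi> = sc z (emb \<psi> - emb \<rho>)"
    using arg_cong[OF ZP, of emb] carriers \<psi> \<rho> by (simp add: emb_smult emb_minus emb_mult)
  have F\<rho>: "emb (adj F) * emb \<rho> = emb (1\<^sub>m m)" using arg_cong[OF h, of emb] carriers \<rho> by (simp add: emb_mult)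
  have F\<psi>: "emb (adj F) * emb \<psi> = emb (1\<^sub>m m)"
  proof -
    have "emb (adj F) * (sc (cnj z) (emb Z * emb \<psi>)) = emb (adj F) * (emb \<psi> - emb \<rho>)"
      unfolding Z\<psi> by (simp add: sc_sc zz sc_one)
    moreover have "emb (adj F) * (sc (cnj z) (emb Z * emb \<psi>)) = 0"
      using arg_cong[OF shift(3), of "\<lambda>y. y * emb \<psi>"] by (simp add: sc_mult_right mult.assoc sc_zero')
    ultimately show ?thesis using F\<rho> by (simp add: right_diff_distrib)
  qed
  \<comment> \<open>Used for \<open>Y\<close> the identity and for \<open>Y\<close> the Toeplitz
    matrix \<open>S\<close>, both of which commute with the shift. Values at \<open>z\<close> are
    thereby read off the last blocks of \<open>\<psi>\<close> and \<open>S * \<psi>\<close>.\<close>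
  have key: "emb (e_row m n z) * (Y * emb \<rho>) = sc (z ^ n) (emb (adj E) * (Y * emb \<psi>))"
    if "emb Z * Y = Y * emb Z" for Y
  proof -
    have "emb (e_row m n z) * (Y * emb \<rho>) = emb (e_row m n z) * (Y * (emb \<psi> - sc (cnj z) (emb Z * emb \<psi>)))"
      unfolding Z\<psi> by (simp add: sc_sc zz sc_one)
    also have "\<dots> = (emb (e_row m n z) - sc (cnj z) (emb (e_row m n z) * emb Z)) * (Y * emb \<psi>)"
      using arg_cong[OF that, of "\<lambda>y. y * emb \<psi>"]
      by (simp add: left_diff_distrib right_diff_distrib mult.assoc sc_mult_left sc_mult_right)
    finally show ?thesis unfolding e_row_shift[OF z] by (simp add: sc_mult_left mult.assoc)
  qed
  have k1: "emb (e_row m n z) * emb \<rho> = sc (z ^ n) (emb (adj E) * emb \<psi>)"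
    using key[of "emb (1\<^sub>m N)"] carriers \<rho> \<psi> by (simp add: emb_ring)
  have k2: "emb (e_row m n z) * (emb S * emb \<rho>) = sc (z ^ n) (emb (adj E) * (emb S * emb \<psi>))"
    using key[of "emb S"] shift(2) by simp
  have r1: "e_row m n z * \<rho> = z ^ n \<cdot>\<^sub>m (adj E * \<psi>)"
    by (rule emb_eqD) (use er \<rho> carriers \<psi> k1 in \<open>auto simp: emb_mult emb_smult\<close>)
  have r2: "e_row m n z * (S * \<rho>) = z ^ n \<cdot>\<^sub>m (adj E * (S * \<psi>))"
    by (rule emb_eqD) (use er \<rho> carriers \<psi> k2 in \<open>auto simp: emb_mult emb_smult\<close>)
  have Q\<rho>e: "emb Q * emb \<rho> = emb F * emb C" using arg_cong[OF Q\<rho>, of emb] carriers \<rho> C by (simp add: emb_mult)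
  have \<rho>Qe: "emb (adj \<rho>) * (emb Q * X) = emb (adj C) * (emb (adj F) * X)" for X
    using arg_cong[OF Q\<rho>, of "\<lambda>Y. emb (adj Y) * X"] carriers \<rho> C by (simp add: adj_mult emb_mult Q_adj mult.assoc)
  have a\<psi>F: "emb (adj \<psi>) * (emb F * X) = emb (1\<^sub>m m) * X" "emb (adj \<rho>) * (emb F * X) = emb (1\<^sub>m m) * X" for X
  proof -
    have "adj F * \<psi> = 1\<^sub>m m" by (rule emb_eqD) (use carriers \<psi> F\<psi> in \<open>auto simp: emb_mult\<close>)
    from arg_cong[OF this, of "\<lambda>Y. emb (adj Y) * X"] arg_cong[OF h, of "\<lambda>Y. emb (adj Y) * X"]
    show "emb (adj \<psi>) * (emb F * X) = emb (1\<^sub>m m) * X" "emb (adj \<rho>) * (emb F * X) = emb (1\<^sub>m m) * X"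
      using carriers \<psi> \<rho> by (simp_all add: adj_mult emb_mult adj_one mult.assoc)
  qed
  have tele: "emb (adj \<psi>) * (emb E * (emb J * (emb (adj E) * emb \<psi>)))
      - emb (adj \<psi>) * (emb (adj S) * (emb E * (emb J * (emb (adj E) * (emb S * emb \<psi>))))) = emb (adj C)"
  proof -
    have aZ\<psi>: "emb (adj \<psi>) * (emb (adj Z) * X) = sc (cnj z) (emb (adj \<psi>) * X - emb (adj \<rho>) * X)" for X
      using arg_cong[OF ZP, of "\<lambda>Y. emb (adj Y) * X"] carriers \<psi> \<rho>
      by (simp add: adj_simps emb_smult emb_minus emb_mult mult.assoc left_diff_distrib sc_mult_left)
    \<comment> \<open>Because \<open>Z * \<psi> = z (\<psi> - \<rho>)\<close> with
      \<open>cmod z = 1\<close>, the form of \<open>Q\<close> at \<open>\<psi>\<close> cancels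
      against the shifted one. Every remaining term contains \<open>Q * \<rho> = F * C\<close> or
      its adjoint, and the heads of \<open>\<psi>\<close> and \<open>\<rho>\<close> are the
      identity.\<close>
    have "emb (adj \<psi>) * (emb E * (emb J * (emb (adj E) * emb \<psi>)))
      - emb (adj \<psi>) * (emb (adj S) * (emb E * (emb J * (emb (adj E) * (emb S * emb \<psi>)))))
      = emb (adj \<psi>) * ((emb Q - emb (adj Z) * (emb Q * emb Z)) * emb \<psi>)"
      unfolding shift_Q by (simp add: algebra_simps mult.assoc)
    also have "\<dots> = emb (adj \<psi>) * (emb Q * emb \<psi>) - (emb (adj \<psi>) * (emb Q * (emb \<psi> - emb \<rho>)) - emb (adj \<rho>) * (emb Q * (emb \<psi> - emb \<rho>)))"
      by (simp add: left_diff_distrib right_diff_distrib mult.assoc Z\<psi> aZ\<psi> sc_mult_right sc_sc sc_diff zz sc_one)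
    also have "\<dots> = emb (adj \<psi>) * (emb Q * emb \<rho>) + emb (adj \<rho>) * (emb Q * emb \<psi>) - emb (adj \<rho>) * (emb Q * emb \<rho>)"
      by (simp add: right_diff_distrib)
    also have "\<dots> = emb (adj C)"
      unfolding Q\<rho>e using C by (simp add: \<rho>Qe a\<psi>F F\<psi> emb_ring)
    finally show ?thesis .
  qed
  show ?thesis unfolding r1 r2
  proof (rule emb_eqD)
    show "emb (adj (z ^ n \<cdot>\<^sub>m (adj E * \<psi>)) * J * (z ^ n \<cdot>\<^sub>m (adj E * \<psi>)) -
      adj (z ^ n \<cdot>\<^sub>m (adj E * (S * \<psi>))) * J * (z ^ n \<cdot>\<^sub>m (adj E * (S * \<psi>)))) = emb (adj C)"
      using carriers \<psi> tele by (simp add: adj_simps emb_mult emb_minus emb_smult mult.assoc sc_mult_left sc_mult_right sc_sc zn sc_one)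
  qed (use carriers \<psi> C in auto)
qed

end

lemma rho_poly_eq_rhohat:
  assumes V: "V \<in> carrier_mat (n*m) m"
  shows "rho_poly m n V w = e_row m n w * rhohat m n V"
proof -
  have er: "e_row m n w \<in> carrier_mat m ((n+1)*m)" by (auto simp: e_row_def)
  have 1: "e_row m n w * sel ((n+1)*m) m 0 = 1\<^sub>m m"
    unfolding mult_sel[OF er] by (auto simp: e_row_def intro!: eq_matI)
  have eq: "e_row m n w * rhohat m n V = 1\<^sub>m m + e_row m n w * sel ((n+1)*m) (n*m) m * V"
    unfolding rhohat_def 1[symmetric] by (rule emb_eqD) (use er V in \<open>auto simp: emb_ring\<close>)
  show ?thesis
  proof (cases n)
    case 0
    then show ?thesis unfolding eq using V er by (auto simp: rho_poly_def scalar_prod_def intro!: eq_matI)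
  next
    case (Suc j)
    have "e_row m n w * sel ((n+1)*m) (n*m) m = w \<cdot>\<^sub>m e_row m j w"
      unfolding mult_sel[OF er] by (rule eq_matI) (auto simp: e_row_def Suc)
    then have "e_row m n w * sel ((n+1)*m) (n*m) m * V = w \<cdot>\<^sub>m (e_row m j w * V)"
    proof -
      have erj: "e_row m j w \<in> carrier_mat m (n*m)" by (auto simp: e_row_def Suc)
      assume "e_row m n w * sel ((n+1)*m) (n*m) m = w \<cdot>\<^sub>m e_row m j w"
      then show ?thesis using mult_smult_assoc_mat[OF erj V, of w] by simp
    qed
    then show ?thesis unfolding eq by (simp add: rho_poly_def Suc)
  qed
qed

section \<open>Uniqueness in the degenerate case\<close>

lemma S_blk_cong: "(\<And>j. j \<le> k \<Longrightarrow> A j = A' j) \<Longrightarrow> S_blk m A k = S_blk m A' k"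
proof -
  assume h: "\<And>j. j \<le> k \<Longrightarrow> A j = A' j"
  show "S_blk m A k = S_blk m A' k"
  proof (rule eq_matI)
    fix a b assume "a < dim_row (S_blk m A' k)" "b < dim_col (S_blk m A' k)"
    then have ab: "a < Suc k * m" "b < Suc k * m" by (auto simp: S_blk_dim)
    then show "S_blk m A k $$ (a,b) = S_blk m A' k $$ (a,b)"
      using h[of "a div m - b div m"] div_mod_lt(1)[OF ab(1)] by (simp add: S_blk_def)
  qed (auto simp: S_blk_dim)
qed

text \<open>The kernel column survives every step of both sequences. As long as they agree, their
  rows \<open>z\<close> differ only in the newest coefficient, which multiplies the identity head of
  the column; both products are 0, so the coefficients coincide.\<close>

lemma degenerate_unique:
  assumes sig: "signature_mat m J"
    and A: "\<And>j. A j \<in> carrier_mat m m" "\<And>k. psd (Q_mat m J A k)"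
    and A': "\<And>j. A' j \<in> carrier_mat m m" "\<And>k. psd (Q_mat m J A' k)"
    and eq: "\<And>j. j \<le> n \<Longrightarrow> A j = A' j"
    and \<rho>: "\<rho> \<in> carrier_mat ((n+1)*m) m" "adj (sel ((n+1)*m) m 0) * \<rho> = 1\<^sub>m m"
    and Q\<rho>: "Q_mat m J A n * \<rho> = 0\<^sub>m ((n+1)*m) m"
  shows "A k = A' k"
proof -
  define r where "r k = sel ((k+1)*m) ((n+1)*m) 0 * \<rho>" for k
  have rc: "r k \<in> carrier_mat ((k+1)*m) m" for k using \<rho> by (auto simp: r_def)
  have "(\<forall>j\<le>k. A j = A' j) \<and> Q_mat m J A k * r k = 0\<^sub>m ((k+1)*m) m" if "k \<ge> n" for k
    using that
  proof (induction k rule: nat_induct_at_least)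
    case base
    then show ?case using eq Q\<rho> \<rho>(1) by (simp add: r_def sel_same)
  next
    case (Suc k)
    interpret T: toeplitz_step m k J A by unfold_locales (use sig A in auto)
    interpret T': toeplitz_step m k J A' by unfold_locales (use sig A' in auto)
    have N: "(k+1)*m = T.M" "(Suc k + 1)*m = T.N" by (simp_all add: T.M_def T.N_def)
    have rk: "r k \<in> carrier_mat T.M m" using rc[of k] N by simp
    have Qr: "Q_mat m J A k * r k = 0\<^sub>m T.M m" using Suc.IH N by simp
    have QQ: "Q_mat m J A k = Q_mat m J A' k" unfolding Q_mat_def using S_blk_cong[of k A A' m] Suc.IH by simp
    note Qr' = Qr[unfolded QQ]
    note s1 = T.isotropic_step[OF A(2) rk Qr]
    note s2 = T'.isotropic_step[OF A'(2) rk Qr']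
    have km: "(n+1)*m \<le> (k+1)*m" using Suc.hyps by (simp add: mult_le_mono1)
    have Fr: "adj (sel T.M m 0) * r k = 1\<^sub>m m"
    proof -
      have "adj (sel T.M m 0) * sel T.M ((n+1)*m) 0 = adj (sel ((n+1)*m) m 0)"
        unfolding adj_sel_sel using km by (auto simp: sel_def T.M_def intro!: eq_matI)
      from emb_prod(2)[OF this] show ?thesis unfolding r_def N(1) \<rho>(2)[symmetric]
        by (intro emb_eqD) (use \<rho>(1) in \<open>auto simp: emb_mult\<close>)
    qed
    \<comment> \<open>All blocks after the first contain earlier coefficients, on which the
      sequences agree already.\<close>
    have zz: "T.z - T'.z = (A (Suc k) - A' (Suc k)) * adj (sel T.M m 0)"
    proof -
      have "adj (T.z - T'.z) = sel T.M m 0 * adj (A (Suc k) - A' (Suc k))"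
        unfolding sel_mult[OF adj_carrier[OF minus_carrier_mat[OF A'(1)]]]
      proof (rule eq_matI)
        fix a b assume "a < dim_row (mat T.M m (\<lambda>(a,b). if 0 \<le> a \<and> a - 0 < m then adj (A (Suc k) - A' (Suc k)) $$ (a - 0, b) else 0))"
          "b < dim_col (mat T.M m (\<lambda>(a,b). if 0 \<le> a \<and> a - 0 < m then adj (A (Suc k) - A' (Suc k)) $$ (a - 0, b) else 0))"
        then have ab: "a < T.M" "b < m" by auto
        have "A (Suc k - a div m) = A' (Suc k - a div m)" if "\<not> a < m"
        proof -
          have "a div m > 0" using that ab by (simp add: div_greater_zero_iff)
          then show ?thesis using Suc.IH by auto
        qed
        then show "adj (T.z - T'.z) $$ (a,b) = mat T.M m (\<lambda>(a,b). if 0 \<le> a \<and> a - 0 < m then adj (A (Suc k) - A' (Suc k)) $$ (a - 0, b) else 0) $$ (a,b)"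
          using ab A(1)[of "Suc k"] A'(1)[of "Suc k"] T.carriers(4) T'.carriers(4)
          by (cases "a < m") (auto simp: T.z_def T'.z_def z_vec_def T.M_def)
      qed (use T.dims T'.dims N in auto)
      from arg_cong[OF this, of adj] show ?thesis using A(1)[of "Suc k"] A'(1)[of "Suc k"] by (simp add: adj_mult)
    qed
    have "(T.z - T'.z) * r k = 0\<^sub>m m m"
    proof (rule emb_eqD)
      show "emb ((T.z - T'.z) * r k) = emb (0\<^sub>m m m)"
        using arg_cong[OF s1(1), of emb] arg_cong[OF s2(1), of emb] rk T.dims T'.dims N by (simp add: emb_ring)
    qed (use rk T.dims T'.dims N in auto)
    moreover have "(T.z - T'.z) * r k = A (Suc k) - A' (Suc k)" unfolding zz
      by (rule emb_eqD) (use emb_prod(1)[OF Fr] rk A(1)[of "Suc k"] A'(1)[of "Suc k"] in \<open>auto simp: emb_ring\<close>)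
    ultimately have d0: "A (Suc k) - A' (Suc k) = 0\<^sub>m m m" by simp
    have "A (Suc k) = A' (Suc k)"
      by (rule emb_eqD) (use arg_cong[OF d0, of emb] A(1)[of "Suc k"] A'(1)[of "Suc k"] in \<open>auto simp: emb_ring\<close>)
    moreover have "T.L * r k = r (Suc k)"
    proof -
      have "T.L * sel T.M ((n+1)*m) 0 = sel T.N ((n+1)*m) 0"
        unfolding T.L_def sel_sel using km unfolding N(1) by (auto simp: sel_def intro!: eq_matI)
      then show ?thesis unfolding r_def N
        using assoc_mult_mat[of T.L T.N T.M "sel T.M ((n+1)*m) 0" "(n+1)*m" \<rho> m] T.carriers \<rho> by simp
    qed
    ultimately show ?case using Suc.IH s1(2) N by (auto simp: le_Suc_eq)
  qed
  from this[of "max k n"] show ?thesis by auto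
qed

section \<open>Interpolation by conservative realisations\<close>

text \<open>The energy balance of the colligation evaluates the defect
  \<open>J - adj f * J * f\<close> as \<open>1 - (cmod z)^2\<close> times the Gram matrix of the
  state \<open>X\<close>.\<close>

lemma colligation_contractive:
  assumes sig: "signature_mat m J" and col: "colligation m J N A B C D" and z: "cmod z < 1"
    and X: "X \<in> carrier_mat N m" and eq: "(1\<^sub>m N - z \<cdot>\<^sub>m A) * X = B"
  shows "J_contractive J (D + z \<cdot>\<^sub>m (C * X))"
proof -
  have c: "A \<in> carrier_mat N N" "B \<in> carrier_mat N m" "C \<in> carrier_mat m N" "D \<in> carrier_mat m m"
    and h1: "adj A * A + adj C * J * C = 1\<^sub>m N" and h2: "adj A * B + adj C * J * D = 0\<^sub>m N m"
    and h3: "adj B * B + adj D * J * D = J" using col by (auto simp: colligation_def)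
  have J: "J \<in> carrier_mat m m" "adj J = J" using sig by (auto simp: signature_mat_def)
  define f where "f = D + z \<cdot>\<^sub>m (C * X)"
  have f: "f \<in> carrier_mat m m" using c X by (auto simp: f_def)
  have H1: "emb (adj A) * (emb A * Y) + emb (adj C) * (emb J * (emb C * Y)) = emb (1\<^sub>m N) * Y" for Y
    using arg_cong[OF arg_cong[OF h1, of emb], of "\<lambda>y. y * Y"] c J by (simp add: emb_ring)
  have H2: "emb (adj A) * emb B + emb (adj C) * (emb J * emb D) = 0"
    using arg_cong[OF h2, of emb] c J by (simp add: emb_ring)
  have H2': "emb (adj B) * (emb A * Y) + emb (adj D) * (emb J * (emb C * Y)) = 0" for Y
  proof -
    have "adj B * A + adj D * J * C = adj (adj A * B + adj C * J * D)"
      by (rule emb_eqD) (use c J in \<open>auto simp: adj_simps emb_ring\<close>)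
    also have "\<dots> = 0\<^sub>m m N" unfolding h2 by (simp add: adj_zero)
    finally have h2': "adj B * A + adj D * J * C = 0\<^sub>m m N" .
    show ?thesis using arg_cong[OF h2', of "\<lambda>M. emb M * Y"] c J by (simp add: emb_ring)
  qed
  have H3: "emb (adj B) * emb B + emb (adj D) * (emb J * emb D) = emb J"
    using arg_cong[OF h3, of emb] c J by (simp add: emb_ring)
  have X1: "X = B + z \<cdot>\<^sub>m (A * X)"
    by (rule emb_eqD) (use arg_cong[OF eq, of emb] c X in \<open>auto simp: emb_ring algebra_simps\<close>)
  have eX: "emb X = emb B + sc z (emb A * emb X)" "emb (adj X) = emb (adj B) + sc (cnj z) (emb (adj X) * emb (adj A))"
    using arg_cong[OF X1, of emb] arg_cong[OF X1, of "\<lambda>Y. emb (adj Y)"] c X by (simp_all add: adj_simps emb_ring)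
  have "J - adj f * J * f = of_real (1 - (cmod z)\<^sup>2) \<cdot>\<^sub>m (adj X * X)"
  proof (rule emb_eqD)
    define T where "T = emb (adj X) * (emb (adj A) * (emb A * emb X)) + emb (adj X) * (emb (adj C) * (emb J * (emb C * emb X)))"
    have T: "T = emb (adj X) * emb X" unfolding T_def distrib_left[symmetric] H1 using X by (simp add: emb_ring)
    have g: "emb (adj A) * emb B = - (emb (adj C) * (emb J * emb D))" using H2 by (simp add: eq_neg_iff_add_eq_0)
    have g': "emb (adj B) * (emb A * emb X) = - (emb (adj D) * (emb J * (emb C * emb X)))" using H2' by (simp add: eq_neg_iff_add_eq_0)
    have g3: "emb (adj B) * emb B = emb J - emb (adj D) * (emb J * emb D)" using H3 by (simp add: eq_diff_eq)
    have "emb (adj X) * emb X = (emb (adj B) + sc (cnj z) (emb (adj X) * emb (adj A))) * (emb B + sc z (emb A * emb X))"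
      using eX by simp
    also have "\<dots> = emb J - emb (adj f) * (emb J * emb f) + sc (cnj z * z) T"
      unfolding T_def f_def using c X J
      by (simp add: adj_simps emb_ring g g' g3 mult.commute)
    finally have "emb J - emb (adj f) * (emb J * emb f) = sc (1 - cnj z * z) (emb (adj X) * emb X)"
      unfolding T by (simp add: sc_minus sc_one algebra_simps)
    then show "emb (J - adj f * J * f) = emb (of_real (1 - (cmod z)\<^sup>2) \<cdot>\<^sub>m (adj X * X))"
      using f J X by (simp add: emb_mult emb_minus emb_smult mult.assoc complex_norm_square mult.commute del: of_real_power)
  qed (use f J X in auto)
  moreover have "psd (of_real (1 - (cmod z)\<^sup>2) \<cdot>\<^sub>m (adj X * X))"
  proof -
    have c1: "of_real (1 - (cmod z)\<^sup>2) \<cdot>\<^sub>m (adj X * X) \<in> carrier_mat m m" using X by auto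
    have "qf (of_real (1 - (cmod z)\<^sup>2) \<cdot>\<^sub>m (adj X * X)) v = of_real ((1 - (cmod z)\<^sup>2) * nrm (X * v))" if v: "v \<in> carrier_mat m 1" for v
    proof -
      have "adj v * (of_real (1 - (cmod z)\<^sup>2) \<cdot>\<^sub>m (adj X * X)) * v = of_real (1 - (cmod z)\<^sup>2) \<cdot>\<^sub>m (adj (X * v) * (X * v))"
        by (rule emb_eqD) (use X v in \<open>auto simp: adj_simps emb_ring\<close>)
      moreover have "adj (X * v) * (X * v) = of_real (nrm (X * v)) \<cdot>\<^sub>m 1\<^sub>m 1" by (rule adj_mult_self) (use X v in auto)
      ultimately show ?thesis by (simp add: qf_def)
    qed
    moreover have "(cmod z)\<^sup>2 \<le> 1" using z by (simp add: power_le_one)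
    ultimately show ?thesis unfolding psd_iff[OF c1] by (auto simp: nrm_ge_0)
  qed
  ultimately show ?thesis by (simp add: J_contractive_def f_def)
qed

context toeplitz_shift
begin

text \<open>A lurking isometry: the map from (past state, input) to (next state, output) along all
  input sequences of length \<open>n + 1\<close>, with state \<open>T u\<close> where \<open>adj T * T = Q\<close>, preserves
  the indefinite energy and extends to a colligation.\<close>

lemma interpolating_colligation:
  assumes psd: "psd Q"
  shows "\<exists>A' B C D Kn. colligation m J N A' B C D \<and> Kn \<in> carrier_mat m N \<and>
    (\<forall>z X. X \<in> carrier_mat N m \<longrightarrow> (1\<^sub>m N - z \<cdot>\<^sub>m A') * X = B \<longrightarrow>
      (\<forall>i<m. \<forall>l<m. (D + z \<cdot>\<^sub>m (C * X)) $$ (i,l) = (\<Sum>k\<le>n. z ^ k * A k $$ (i,l)) + z ^ Suc n * (Kn * X) $$ (i,l)))"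
proof -
  obtain T where T: "T \<in> carrier_mat N N" "adj T * T = Q" using psd_sqrt_exists[OF carriers(6) psd] by blast
  define K where "K = N + m"
  define i1 where "i1 = sel K N 0"
  define i2 where "i2 = sel K m N"
  have ic: "i1 \<in> carrier_mat K N" "i2 \<in> carrier_mat K m" by (auto simp: i1_def i2_def)
  note I = sel_split_emb[OF K_def, folded i1_def i2_def]
  have J: "J \<in> carrier_mat m m" "adj J = J" "J * J = 1\<^sub>m m" using sig by (auto simp: signature_mat_def)
  have JJ: "emb J * (emb J * X) = emb (1\<^sub>m m) * X" for X by (rule emb_prod(2)[OF J(3)]) (use J in auto)
  \<comment> \<open>The form that a colligation preserves: definite on the state component,
    \<open>J\<close> on the input or output component.\<close>
  define Jt where "Jt = i1 * adj i1 + i2 * J * adj i2"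
  have sigt: "signature_mat K Jt" unfolding signature_mat_def
  proof (intro conjI)
    show c: "Jt \<in> carrier_mat K K" using ic J by (auto simp: Jt_def)
    show "adj Jt = Jt" by (rule emb_eqD) (use ic J in \<open>auto simp: Jt_def adj_simps emb_ring\<close>)
    show "Jt * Jt = 1\<^sub>m K"
    proof (rule emb_eqD)
      have "emb (Jt * Jt) = emb i1 * emb (adj i1) + emb i2 * emb (adj i2)"
        using ic J(1) by (simp add: Jt_def emb_ring I(1-8) JJ)
      then show "emb (Jt * Jt) = emb (1\<^sub>m K)" unfolding I(9) .
    qed (use c in auto)
  qed
  note cc = carriers T(1) ic J(1)
  define M1 where "M1 = i1 * (T * Z) + i2 * adj E"
  define M2 where "M2 = i1 * T + i2 * (adj E * S)"
  \<comment> \<open>The negative subspace of \<open>Jt\<close> lies in the input component. An input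
    concentrated in the last block has past state 0, as \<open>Z * E = 0\<close>, so the domain
    \<open>M1\<close> contains that whole component; \<open>G\<close> picks the preimages.\<close>
  define G where "G = E * (neg_proj m J * adj i2)"
  have nJ: "neg_proj m J \<in> carrier_mat m m" using signature_projs[OF sig] by simp
  have Mc: "M1 \<in> carrier_mat K N" "M2 \<in> carrier_mat K N" "G \<in> carrier_mat N K"
    using cc nJ by (auto simp: M1_def M2_def G_def)
  have TT: "emb (adj T) * (emb T * X) = emb Q * X" for X by (rule emb_prod(2)[OF T(2)]) (use T in auto)
  have TT0: "emb (adj T) * emb T = emb Q" by (rule emb_prod(1)[OF T(2)]) (use T in auto)
  have "adj M1 * Jt * M1 = adj M2 * Jt * M2"
  proof (rule emb_eqD)
    have "emb (adj M1 * Jt * M1) = emb (adj Z) * (emb Q * emb Z) + emb E * (emb J * emb (adj E))"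
      using cc by (simp add: M1_def Jt_def adj_simps emb_ring I(1-8) TT)
    also have "\<dots> = emb (adj M2 * Jt * M2)" unfolding shift_Q
      using cc by (simp add: M2_def Jt_def adj_simps emb_ring I(1-8) TT0)
    finally show "emb (adj M1 * Jt * M1) = emb (adj M2 * Jt * M2)" .
  qed (use Mc sigt in \<open>auto simp: signature_mat_def\<close>)
  moreover have "M1 * G = neg_proj K Jt"
  proof (rule emb_eqD)
    have ZE: "emb Z * (emb E * X) = 0" for X using arg_cong[OF shift(4), of "\<lambda>y. y * X"] by (simp add: mult.assoc)
    have l: "emb (M1 * G) = emb i2 * (emb (neg_proj m J) * emb (adj i2))"
      using cc nJ by (simp add: M1_def G_def emb_ring ZE shift(6))
    have "emb (neg_proj m J) = sc (1/2) (emb (1\<^sub>m m) - emb J)" using J by (simp add: neg_proj_def emb_smult emb_minus)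
    then have "emb (M1 * G) = sc (1/2) (emb i2 * emb (adj i2) - emb i2 * (emb J * emb (adj i2)))"
      unfolding l using cc by (simp add: emb_ring)
    moreover have "emb (neg_proj K Jt) = sc (1/2) (emb i1 * emb (adj i1) + emb i2 * emb (adj i2) - emb Jt)"
      unfolding I(9) using cc by (simp add: neg_proj_def emb_smult emb_minus Jt_def)
    moreover have "emb Jt = emb i1 * emb (adj i1) + emb i2 * (emb J * emb (adj i2))" using cc by (simp add: Jt_def emb_ring)
    ultimately show "emb (M1 * G) = emb (neg_proj K Jt)" by simp
  qed (use Mc ic in \<open>auto simp: neg_proj_def Jt_def\<close>)
  ultimately obtain \<Theta> where \<Theta>: "\<Theta> \<in> carrier_mat K K" "adj \<Theta> * Jt * \<Theta> = Jt" "\<Theta> * M1 = M2"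
    using signature_isometry_extension[OF sigt Mc] by blast
  define A' where "A' = adj i1 * \<Theta> * i1"
  define B where "B = adj i1 * \<Theta> * i2"
  define C where "C = adj i2 * \<Theta> * i1"
  define D where "D = adj i2 * \<Theta> * i2"
  have dc: "A' \<in> carrier_mat N N" "B \<in> carrier_mat N m" "C \<in> carrier_mat m N" "D \<in> carrier_mat m m"
    using cc \<Theta>(1) by (auto simp: A'_def B_def C_def D_def)
  have \<Theta>J: "emb (adj \<Theta>) * (emb i1 * (emb (adj i1) * (emb \<Theta> * X))) + emb (adj \<Theta>) * (emb i2 * (emb J * (emb (adj i2) * (emb \<Theta> * X))))
     = emb i1 * (emb (adj i1) * X) + emb i2 * (emb J * (emb (adj i2) * X))" for X
    using arg_cong[OF \<Theta>(2), of "\<lambda>Y. emb Y * X"] \<Theta>(1) cc by (simp add: Jt_def emb_ring)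
  have block: "emb Y * (emb (adj \<Theta>) * (emb i1 * (emb (adj i1) * (emb \<Theta> * X)))) + emb Y * (emb (adj \<Theta>) * (emb i2 * (emb J * (emb (adj i2) * (emb \<Theta> * X)))))
     = emb Y * (emb i1 * (emb (adj i1) * X)) + emb Y * (emb i2 * (emb J * (emb (adj i2) * X)))" for X Y
    using arg_cong[OF \<Theta>J[of X], of "\<lambda>y. emb Y * y"] by (simp add: distrib_left)
  have col: "colligation m J N A' B C D" unfolding colligation_def
  proof (intro conjI dc)
    show "adj A' * A' + adj C * J * C = 1\<^sub>m N"
      by (rule emb_eqD) (use cc dc \<Theta>(1) block[of "adj i1" "emb i1"] in \<open>auto simp: A'_def C_def adj_simps emb_ring I(1-8)\<close>)
    show "adj A' * B + adj C * J * D = 0\<^sub>m N m"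
      by (rule emb_eqD) (use cc dc \<Theta>(1) block[of "adj i1" "emb i2"] in \<open>auto simp: A'_def B_def C_def D_def adj_simps emb_ring I(1-8)\<close>)
    show "adj B * B + adj D * J * D = J"
      by (rule emb_eqD) (use cc dc \<Theta>(1) block[of "adj i2" "emb i2"] in \<open>auto simp: B_def D_def adj_simps emb_ring I(1-8)\<close>)
  qed
  have \<Theta>M: "emb \<Theta> * (emb i1 * (emb T * (emb Z * X))) + emb \<Theta> * (emb i2 * (emb (adj E) * X))
      = emb i1 * (emb T * X) + emb i2 * (emb (adj E) * (emb S * X))" for X
    using arg_cong[OF \<Theta>(3), of "\<lambda>Y. emb Y * X"] \<Theta>(1) cc by (simp add: M1_def M2_def emb_ring)
  have stA: "emb A' * (emb T * (emb Z * X)) + emb B * (emb (adj E) * X) = emb T * X"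
    and stC: "emb C * (emb T * (emb Z * X)) + emb D * (emb (adj E) * X) = emb (adj E) * (emb S * X)" if "X = emb X' \<and> dim_row X' = N" for X X'
    using arg_cong[OF \<Theta>M[of X], of "\<lambda>y. emb (adj i1) * y"] arg_cong[OF \<Theta>M[of X], of "\<lambda>y. emb (adj i2) * y"] \<Theta>(1) cc that
    by (simp_all add: A'_def B_def C_def D_def emb_ring I(1-8))
  \<comment> \<open>Unit pulses in block \<open>j\<close>. For \<open>j < n\<close> one time step
    moves the state \<open>T * e (Suc j)\<close> to \<open>T * e j\<close> and emits
    \<open>A (n - j)\<close>, and an input pulse creates the state \<open>T * e n\<close>. Hence
    \<open>C * A'^k * B\<close> is the coefficient \<open>A (Suc k)\<close> for
    \<open>k < n\<close>.\<close>
  define e where "e j = sel N m (j*m)" for j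
  have ec: "e j \<in> carrier_mat N m" for j by (simp add: e_def)
  have en: "e n = E" by (simp add: e_def E_def)
  have Ze: "emb Z * emb (e j) = emb (e (Suc j))" and Ee: "emb (adj E) * emb (e j) = 0" if "j < n" for j
  proof -
    have jn: "Suc j * m \<le> n * m" using that by (intro mult_le_mono1) simp
    have "Z * e j = e (Suc j)" unfolding Z_def e_def sel_sel using jn by (auto simp: sel_def N_def add_ac intro!: eq_matI)
    from arg_cong[OF this, of emb] show "emb Z * emb (e j) = emb (e (Suc j))" using cc ec[of j] by (simp add: emb_mult)
    have "adj E * e j = 0\<^sub>m m m" unfolding E_def e_def adj_sel_sel using jn by (auto intro!: eq_matI)
    from arg_cong[OF this, of emb] show "emb (adj E) * emb (e j) = 0" using cc ec[of j] by (simp add: emb_mult emb_zero)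
  qed
  have ES: "emb (adj E) * (emb S * emb (e j)) = emb (A (n - j))" if "j \<le> n" for j
  proof -
    have jn: "j * m \<le> n * m" using that by (rule mult_le_mono1)
    have A1: "A (n - j) \<in> carrier_mat m m" using A by simp
    have Se: "S * e j \<in> carrier_mat N m" using cc ec[of j] by auto
    have "adj E * (S * e j) = A (n - j)" unfolding E_def adj_sel_mult[OF Se]
    proof (rule eq_matI)
      fix a b assume "a < dim_row (A (n - j))" "b < dim_col (A (n - j))"
      then have ab: "a < m" "b < m" using A1 by auto
      then have lt: "a + n * m < N" "b + j * m < N"
      proof -
        have "N = m + n * m" by (simp add: N_def)
        then show "a + n * m < N" "b + j * m < N" using ab jn by linarith+
      qed
      have "(a + n * m) div m = n" "(a + n * m) mod m = a" "(b + j * m) div m = j" "(b + j * m) mod m = b" using ab by auto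
      then have "S $$ (a + n * m, b + j * m) = A (n - j) $$ (a,b)" using lt that by (simp add: S_def S_blk_def N_def)
      then show "mat m m (\<lambda>(a,b). if a + n * m < N then (S * e j) $$ (a + n * m, b) else 0) $$ (a,b) = A (n - j) $$ (a,b)"
        using ab lt unfolding e_def mult_sel[OF carriers(1)] by simp
    qed (use A1 in auto)
    from arg_cong[OF this, of emb] show ?thesis using cc ec[of j] by (simp add: emb_mult)
  qed
  have BT: "emb B = emb T * emb (e n)"
    using stA[of "emb (e n)" "e n"] ec[of n] en shift(4) shift(5) dc by (simp add: emb_ring dims)
  have DA: "emb D = emb (A 0)"
    using stC[of "emb (e n)" "e n"] ES[of n] ec[of n] en shift(4) shift(5) dc by (simp add: emb_ring dims)
  have AT: "emb A' * (emb T * emb (e (Suc j))) = emb T * emb (e j)" and CT: "emb C * (emb T * emb (e (Suc j))) = emb (A (n - j))" if "j < n" for j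
    using stA[of "emb (e j)" "e j"] stC[of "emb (e j)" "e j"] ES[of j] Ze[OF that] Ee[OF that] ec[of j] that by simp_all
  define Pw where "Pw k = A' ^\<^sub>m k" for k
  have Pc: "Pw k \<in> carrier_mat N N" for k using dc by (simp add: Pw_def)
  have PS: "emb (Pw (Suc k)) = emb (Pw k) * emb A'" for k using dc Pc[of k] by (simp add: Pw_def emb_mult)
  have Pcomm: "emb (Pw k) * emb A' = emb A' * emb (Pw k)" for k
  proof (induction k)
    case 0
    then show ?case using dc by (simp add: Pw_def emb_ring)
  next
    case (Suc k)
    then show ?case unfolding PS by (simp add: mult.assoc)
  qed
  have PB: "emb (Pw k) * emb B = emb T * emb (e (n - k))" if "k \<le> n" for k
    using that
  proof (induction k)
    case 0
    then show ?case using dc by (simp add: Pw_def BT[symmetric] emb_ring)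
  next
    case (Suc k)
    have nk: "n - k = Suc (n - Suc k)" using Suc.prems by simp
    have "emb (Pw (Suc k)) = emb A' * emb (Pw k)" using Pcomm PS by simp
    then have "emb (Pw (Suc k)) * emb B = emb A' * (emb T * emb (e (Suc (n - Suc k))))" using Suc by (simp add: mult.assoc nk)
    then show ?case using AT[of "n - Suc k"] Suc.prems by simp
  qed
  have CPB: "C * (Pw k * B) = A (Suc k)" if "k < n" for k
  proof (rule emb_eqD)
    have nk: "n - k = Suc (n - Suc k)" "n - (n - Suc k) = Suc k" using that by auto
    have "emb C * (emb (Pw k) * emb B) = emb (A (Suc k))" using PB[of k] CT[of "n - Suc k"] that nk by simp
    then show "emb (C * (Pw k * B)) = emb (A (Suc k))" using dc Pc[of k] by (simp add: emb_mult)
  qed (use dc that A[of "Suc k"] in auto)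
  have main: "(D + z \<cdot>\<^sub>m (C * X)) $$ (i,l) = (\<Sum>k\<le>n. z ^ k * A k $$ (i,l)) + z ^ Suc n * (C * Pw n * X) $$ (i,l)"
    if X: "X \<in> carrier_mat N m" and eq: "(1\<^sub>m N - z \<cdot>\<^sub>m A') * X = B" and il: "i < m" "l < m" for z X i l
  proof -
    have X1: "emb X = emb B + sc z (emb A' * emb X)"
      using arg_cong[OF eq, of emb] dc X by (simp add: emb_ring algebra_simps)
    have st: "(C * (Pw k * X)) $$ (i,l) = (C * (Pw k * B)) $$ (i,l) + z * (C * (Pw (Suc k) * X)) $$ (i,l)" for k
    proof -
      have "C * (Pw k * X) = C * (Pw k * B) + z \<cdot>\<^sub>m (C * (Pw (Suc k) * X))"
        using dc Pc[of k] Pc[of "Suc k"] X arg_cong[OF X1, of "\<lambda>y. emb C * (emb (Pw k) * y)"]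
        by (intro emb_eqD) (auto simp: emb_ring PS)
      from arg_cong[OF this, of "\<lambda>M. M $$ (i,l)"] show ?thesis using dc Pc[of "Suc k"] X il by (simp del: index_mult_mat(1))
    qed
    \<comment> \<open>The Neumann expansion stopped after finitely many terms. Its remainder is
      exact and contains \<open>X\<close> itself, so no convergence is involved.\<close>
    have "(C * X) $$ (i,l) = (\<Sum>j<k. z ^ j * A (Suc j) $$ (i,l)) + z ^ k * (C * (Pw k * X)) $$ (i,l)" if "k \<le> n" for k
      using that
    proof (induction k)
      case 0
      then show ?case using dc X by (simp add: Pw_def)
    next
      case (Suc k)
      then show ?case using st[of k] CPB[of k] by (simp add: algebra_simps)
    qed
    from this[of n] have CX: "(C * X) $$ (i,l) = (\<Sum>j<n. z ^ j * A (Suc j) $$ (i,l)) + z ^ n * (C * (Pw n * X)) $$ (i,l)" by simp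
    have D: "D = A 0" by (rule emb_eqD) (use DA dc A[of 0] in auto)
    have "(D + z \<cdot>\<^sub>m (C * X)) $$ (i,l) = A 0 $$ (i,l) + z * (C * X) $$ (i,l)"
      using il dc X A[of 0] by (simp add: D del: index_mult_mat(1))
    also have "\<dots> = (\<Sum>k\<le>n. z ^ k * A k $$ (i,l)) + z ^ Suc n * (C * (Pw n * X)) $$ (i,l)"
      unfolding CX sum.atMost_shift by (simp add: sum_distrib_left algebra_simps del: index_mult_mat(1))
    also have "C * (Pw n * X) = C * Pw n * X" using dc Pc[of n] X by (simp add: assoc_mult_mat[of _ m N _ N _ m])
    finally show ?thesis .
  qed
  show ?thesis
  proof (intro exI conjI allI impI)
    show "colligation m J N A' B C D" by (rule col)
    show "C * Pw n \<in> carrier_mat m N" using dc Pc[of n] by auto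
    fix z X i l
    assume "X \<in> carrier_mat N m" "(1\<^sub>m N - z \<cdot>\<^sub>m A') * X = B" "i < m" "l < m"
    then show "(D + z \<cdot>\<^sub>m (C * X)) $$ (i,l) = (\<Sum>k\<le>n. z ^ k * A k $$ (i,l)) + z ^ Suc n * (C * Pw n * X) $$ (i,l)"
      by (rule main)
  qed
qed

end

section \<open>A Bessel inequality on the disc\<close>

lemma block_sum:
  fixes f :: "nat \<Rightarrow> 'a::comm_monoid_add"
  shows "(\<Sum>a<N*m. f a) = (\<Sum>t<N. \<Sum>i<m. f (i + t*m))"
proof -
  have "(\<Sum>a<N*m. f a) = (\<Sum>t<N. sum f {t*m..<t*m+m})" by (rule sum.nat_group[symmetric])
  also have "\<dots> = (\<Sum>t<N. \<Sum>i<m. f (i + t*m))"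
  proof (rule sum.cong[OF refl])
    fix t show "sum f {t*m..<t*m+m} = (\<Sum>i<m. f (i + t*m))"
      using sum.shift_bounds_nat_ivl[of f 0 "t*m" m] by (simp add: atLeast0LessThan add.commute)
  qed
  finally show ?thesis .
qed

text \<open>Sampling at the \<open>N\<close>-th roots of unity replaces an integral over the circle,
  and it is exact for polynomials of degree below \<open>N\<close>.\<close>

lemma roots_of_unity_parseval:
  fixes b :: "nat \<Rightarrow> complex"
  assumes "N > 0" "r \<ge> 0"
  shows "(\<Sum>k<N. (cmod (\<Sum>t<N. b t * (of_real r * cis (2 * pi * real k / real N)) ^ t))\<^sup>2) = N * (\<Sum>t<N. (cmod (b t))\<^sup>2 * r ^ (2*t))"
proof -
  define c where "c s t = b s * cnj (b t) * of_real r ^ (s + t)" for s t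
  define \<omega> where "\<omega> s t = cis (2 * pi * (real s - real t) / real N)" for s t
  have orth: "(\<Sum>k<N. \<omega> s t ^ k) = (if s = t then of_nat N else 0)" if st: "s < N" "t < N" for s t
  proof (cases "s = t")
    case False
    have "\<omega> s t \<noteq> 1"
    proof
      assume "\<omega> s t = 1"
      then have "cos (2 * pi * (real s - real t) / N) = 1" unfolding \<omega>_def by (simp add: complex_eq_iff)
      then obtain x :: int where "2 * pi * (real s - real t) / N = of_int x * 2 * pi"
        unfolding cos_one_2pi_int by blast
      then have "2 * pi * (real s - real t) = 2 * pi * (x * N)" using assms by (simp add: field_simps)
      then have "real s - real t = x * N" unfolding mult_cancel_left by simp
      then have "int s - int t = x * int N" by (metis of_int_diff of_int_eq_iff of_int_mult of_int_of_nat_eq)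
      moreover have "\<bar>int s - int t\<bar> < int N" using st by auto
      ultimately have "\<bar>x\<bar> * int N < 1 * int N" by (simp add: abs_mult)
      then have "x = 0" unfolding mult_less_cancel_right by auto
      then show False using \<open>int s - int t = x * int N\<close> False by simp
    qed
    moreover have "\<omega> s t ^ N = 1"
    proof -
      have e: "real N * (2 * pi * (real s - real t) / real N) = 2 * pi * (real s - real t)" using assms by simp
      have "\<omega> s t ^ N = cis (real N * (2 * pi * (real s - real t) / real N))" unfolding \<omega>_def by (rule Complex.DeMoivre)
      also have "\<dots> = 1" unfolding e by (rule cis_multiple_2pi) auto
      finally show ?thesis .
    qed
    ultimately show ?thesis using False by (simp add: geometric_sum)
  qed (simp add: \<omega>_def)
  have "complex_of_real (\<Sum>k<N. (cmod (\<Sum>t<N. b t * (of_real r * cis (2 * pi * real k / real N)) ^ t))\<^sup>2)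
     = (\<Sum>k<N. \<Sum>s<N. \<Sum>t<N. c s t * \<omega> s t ^ k)"
    unfolding of_real_sum
  proof (intro sum.cong refl)
    fix k assume "k \<in> {..<N}"
    have e: "b s * (of_real r * cis (2 * pi * real k / real N)) ^ s * cnj (b t * (of_real r * cis (2 * pi * real k / real N)) ^ t) = c s t * \<omega> s t ^ k" for s t
    proof -
      have "cis (2 * pi * real k / real N) ^ s * cnj (cis (2 * pi * real k / real N) ^ t) = \<omega> s t ^ k"
      proof -
        have "cis x ^ s * cnj (cis x ^ t) = cis (real s * x - real t * x)" for x
          by (simp only: Complex.DeMoivre cis_cnj cis_mult) simp
        moreover have "real s * (2 * pi * real k / real N) - real t * (2 * pi * real k / real N) = real k * (2 * pi * (real s - real t) / real N)"
          by (simp add: algebra_simps diff_divide_distrib)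
        moreover have "\<omega> s t ^ k = cis (real k * (2 * pi * (real s - real t) / real N))" unfolding \<omega>_def by (rule Complex.DeMoivre)
        ultimately show ?thesis by (metis complex_cnj_power)
      qed
      then show ?thesis by (simp add: c_def power_mult_distrib power_add mult_ac)
    qed
    show "complex_of_real ((cmod (\<Sum>t<N. b t * (of_real r * cis (2 * pi * real k / real N)) ^ t))\<^sup>2) = (\<Sum>s<N. \<Sum>t<N. c s t * \<omega> s t ^ k)"
      unfolding complex_norm_square cnj_sum sum_product e ..
  qed
  also have "\<dots> = (\<Sum>s<N. \<Sum>t<N. c s t * (\<Sum>k<N. \<omega> s t ^ k))"
    unfolding sum_distrib_left by (rule trans[OF sum.swap], rule sum.cong[OF refl], rule sum.swap)
  also have "\<dots> = (\<Sum>s<N. \<Sum>t<N. if t = s then c s s * of_nat N else 0)"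
    by (intro sum.cong refl) (simp add: orth)
  also have "\<dots> = (\<Sum>s<N. c s s * of_nat N)" by (simp add: sum.delta)
  also have "\<dots> = complex_of_real (N * (\<Sum>t<N. (cmod (b t))\<^sup>2 * r ^ (2*t)))"
  proof -
    have "c s s = complex_of_real ((cmod (b s))\<^sup>2 * r ^ (2 * s))" for s
      by (simp only: c_def complex_norm_square[symmetric] of_real_mult of_real_power mult_2)
    then show ?thesis by (simp add: sum_distrib_left mult.commute)
  qed
  finally show ?thesis using of_real_eq_iff by blast
qed

text \<open>Averaging the pointwise bound over a circle of radius \<open>r\<close> compares the
  squared coefficients of both sides. The right side is a polynomial, so the discrete average is
  exact there once \<open>N > K\<close>; on the left \<open>F\<close> is replaced by its Taylor
  polynomial of degree below \<open>N\<close>, with an error that vanishes as \<open>N\<close>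
  grows.\<close>

lemma bessel_disc_aux:
  fixes F :: "nat \<Rightarrow> complex \<Rightarrow> complex" and g :: "nat \<Rightarrow> nat \<Rightarrow> complex"
  assumes r: "0 < r" "r < R" and F: "\<And>i. i < m \<Longrightarrow> F i holomorphic_on ball 0 R"
    and le: "\<And>w. cmod w < R \<Longrightarrow> (\<Sum>i<m. (cmod (F i w))\<^sup>2) \<le> (\<Sum>i<m. (cmod (\<Sum>t\<le>K. g i t * w ^ t))\<^sup>2)"
  shows "(\<Sum>i<m. \<Sum>t\<le>K. (cmod ((deriv ^^ t) (F i) 0 / fact t))\<^sup>2 * r ^ (2*t)) \<le> (\<Sum>i<m. \<Sum>t\<le>K. (cmod (g i t))\<^sup>2 * r ^ (2*t))"
proof -
  define a where "a i t = (deriv ^^ t) (F i) 0 / fact t" for i t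
  have ser: "(\<lambda>t. a i t * w ^ t) sums F i w" if "i < m" "cmod w < R" for i w
    using holomorphic_power_series[OF F[OF that(1)], of w] that(2) by (simp add: a_def)
  have summ: "summable (\<lambda>t. cmod (a i t) * r ^ t)" if i: "i < m" for i
  proof -
    obtain x where x: "r < x" "x < R" using r dense by blast
    have "summable (\<lambda>t. a i t * (of_real x) ^ t)" using ser[OF i, of "of_real x"] x r by (auto simp: sums_iff)
    from powser_insidea[OF this, of "of_real r"] x r show ?thesis by (simp add: norm_mult norm_power)
  qed
  define \<epsilon> where "\<epsilon> i N = (\<Sum>t. cmod (a i (t + N)) * r ^ (t + N))" for i N
  have \<epsilon>0: "\<epsilon> i \<longlonglongrightarrow> 0" if "i < m" for i
    unfolding \<epsilon>_def using suminf_exist_split2[OF summ[OF that]] .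
  have \<epsilon>nn: "\<epsilon> i N \<ge> 0" if "i < m" for i N
    unfolding \<epsilon>_def using summ[OF that] r by (intro suminf_nonneg summable_ignore_initial_segment) auto
  define T where "T i N w = (\<Sum>t<N. a i t * w ^ t)" for i N w
  have tail: "cmod (T i N w) \<le> cmod (F i w) + \<epsilon> i N" if "i < m" "cmod w = r" for i N w
  proof -
    have s: "summable (\<lambda>t. a i t * w ^ t)" "F i w = (\<Sum>t. a i t * w ^ t)" using ser[of i w] that r by (auto simp: sums_iff)
    have "F i w = (\<Sum>t. a i (t + N) * w ^ (t + N)) + T i N w"
      unfolding T_def s(2) by (rule suminf_split_initial_segment[OF s(1)])
    moreover have "cmod (\<Sum>t. a i (t + N) * w ^ (t + N)) \<le> \<epsilon> i N"
    proof -
      have n: "(\<lambda>t. norm (a i (t + N) * w ^ (t + N))) = (\<lambda>t. cmod (a i (t + N)) * r ^ (t + N))"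
        using that by (simp add: norm_mult norm_power)
      have "summable (\<lambda>t. norm (a i (t + N) * w ^ (t + N)))"
        unfolding n using summable_ignore_initial_segment[OF summ[OF that(1)]] .
      from summable_norm[OF this] show ?thesis unfolding n \<epsilon>_def .
    qed
    ultimately show ?thesis
      using norm_triangle_ineq4[of "F i w" "\<Sum>t. a i (t + N) * w ^ (t + N)"] by (simp add: algebra_simps)
  qed
  define G where "G = (\<Sum>i<m. (\<Sum>t\<le>K. cmod (g i t) * r ^ t)\<^sup>2)"
  have G0: "G \<ge> 0" by (simp add: G_def sum_nonneg)
  have Fb: "cmod (F i w) \<le> sqrt G" if "i < m" "cmod w = r" for i w
  proof (rule real_le_rsqrt)
    have "(cmod (F i w))\<^sup>2 \<le> (\<Sum>i<m. (cmod (F i w))\<^sup>2)" using that by (intro member_le_sum) auto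
    also have "\<dots> \<le> (\<Sum>i<m. (cmod (\<Sum>t\<le>K. g i t * w ^ t))\<^sup>2)" using le that r by simp
    also have "\<dots> \<le> G" unfolding G_def
    proof (intro sum_mono power_mono norm_ge_zero)
      fix i show "cmod (\<Sum>t\<le>K. g i t * w ^ t) \<le> (\<Sum>t\<le>K. cmod (g i t) * r ^ t)"
        using sum_norm_le[of "{..K}" "\<lambda>t. g i t * w ^ t" "\<lambda>t. cmod (g i t) * r ^ t"] that by (simp add: norm_mult norm_power)
    qed
    finally show "(cmod (F i w))\<^sup>2 \<le> G" .
  qed
  \<comment> \<open>The total error of that replacement in the squares, where
    \<open>\<epsilon> i N\<close> bounds the Taylor tail and \<open>sqrt G\<close> bounds
    \<open>F i\<close> on the circle.\<close>
  define \<delta> where "\<delta> N = (\<Sum>i<m. 2 * sqrt G * \<epsilon> i N + (\<epsilon> i N)\<^sup>2)" for N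
  have "\<delta> \<longlonglongrightarrow> (\<Sum>i<m. 2 * sqrt G * 0 + 0\<^sup>2)" unfolding \<delta>_def
    by (intro tendsto_sum tendsto_intros \<epsilon>0) auto
  then have \<delta>0: "\<delta> \<longlonglongrightarrow> 0" by simp
  have main: "(\<Sum>i<m. \<Sum>t\<le>K. (cmod (a i t))\<^sup>2 * r ^ (2*t)) \<le> (\<Sum>i<m. \<Sum>t\<le>K. (cmod (g i t))\<^sup>2 * r ^ (2*t)) + \<delta> N" if N: "N > K" for N
  proof -
    define w where "w k = of_real r * cis (2 * pi * real k / real N)" for k :: nat
    have wr: "cmod (w k) = r" for k using r by (simp add: w_def norm_mult)
    define g' where "g' i t = (if t \<le> K then g i t else 0)" for i t
    have gA: "(\<Sum>t\<le>K. g i t * x ^ t) = (\<Sum>t<N. g' i t * x ^ t)" for i x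
      using N by (intro sum.mono_neutral_cong_left) (auto simp: g'_def)
    have gB: "(\<Sum>t\<le>K. (cmod (g i t))\<^sup>2 * r ^ (2*t)) = (\<Sum>t<N. (cmod (g' i t))\<^sup>2 * r ^ (2*t))" for i
      using N by (intro sum.mono_neutral_cong_left) (auto simp: g'_def)
    have par: "(\<Sum>k<N. (cmod (\<Sum>t<N. b t * w k ^ t))\<^sup>2) = N * (\<Sum>t<N. (cmod (b t))\<^sup>2 * r ^ (2*t))" for b
      unfolding w_def by (rule roots_of_unity_parseval) (use N r in auto)
    have "N * (\<Sum>i<m. \<Sum>t<N. (cmod (a i t))\<^sup>2 * r ^ (2*t)) = (\<Sum>i<m. \<Sum>k<N. (cmod (T i N (w k)))\<^sup>2)"
      unfolding T_def par sum_distrib_left ..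
    also have "\<dots> \<le> (\<Sum>i<m. \<Sum>k<N. (cmod (F i (w k)))\<^sup>2 + (2 * sqrt G * \<epsilon> i N + (\<epsilon> i N)\<^sup>2))"
    proof (intro sum_mono)
      fix i k assume "i \<in> {..<m}" "k \<in> {..<N}"
      then have i: "i < m" by simp
      have "(cmod (T i N (w k)))\<^sup>2 \<le> (cmod (F i (w k)) + \<epsilon> i N)\<^sup>2" using tail[OF i wr] by (intro power_mono) auto
      also have "\<dots> = (cmod (F i (w k)))\<^sup>2 + (2 * cmod (F i (w k)) * \<epsilon> i N + (\<epsilon> i N)\<^sup>2)" by (simp add: power2_sum)
      also have "\<dots> \<le> (cmod (F i (w k)))\<^sup>2 + (2 * sqrt G * \<epsilon> i N + (\<epsilon> i N)\<^sup>2)"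
        using Fb[OF i wr] \<epsilon>nn[OF i] by (intro add_mono order.refl mult_right_mono) auto
      finally show "(cmod (T i N (w k)))\<^sup>2 \<le> (cmod (F i (w k)))\<^sup>2 + (2 * sqrt G * \<epsilon> i N + (\<epsilon> i N)\<^sup>2)" .
    qed
    also have "\<dots> = (\<Sum>k<N. \<Sum>i<m. (cmod (F i (w k)))\<^sup>2) + N * \<delta> N"
      by (simp add: sum.distrib \<delta>_def sum_distrib_left sum.swap[of _ "{..<N}"] distrib_left)
    also have "\<dots> \<le> (\<Sum>k<N. \<Sum>i<m. (cmod (\<Sum>t\<le>K. g i t * w k ^ t))\<^sup>2) + N * \<delta> N"
      by (rule add_right_mono, rule sum_mono, rule le) (use wr r in simp)
    also have "(\<Sum>k<N. \<Sum>i<m. (cmod (\<Sum>t\<le>K. g i t * w k ^ t))\<^sup>2) = (\<Sum>i<m. \<Sum>k<N. (cmod (\<Sum>t<N. g' i t * w k ^ t))\<^sup>2)"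
      unfolding gA by (rule sum.swap)
    also have "\<dots> = N * (\<Sum>i<m. \<Sum>t<N. (cmod (g' i t))\<^sup>2 * r ^ (2*t))"
      unfolding par sum_distrib_left ..
    finally have "N * (\<Sum>i<m. \<Sum>t<N. (cmod (a i t))\<^sup>2 * r ^ (2*t)) \<le> N * ((\<Sum>i<m. \<Sum>t<N. (cmod (g' i t))\<^sup>2 * r ^ (2*t)) + \<delta> N)"
      by (simp add: distrib_left)
    then have "(\<Sum>i<m. \<Sum>t<N. (cmod (a i t))\<^sup>2 * r ^ (2*t)) \<le> (\<Sum>i<m. \<Sum>t<N. (cmod (g' i t))\<^sup>2 * r ^ (2*t)) + \<delta> N"
      using N by simp
    moreover have "(\<Sum>i<m. \<Sum>t\<le>K. (cmod (a i t))\<^sup>2 * r ^ (2*t)) \<le> (\<Sum>i<m. \<Sum>t<N. (cmod (a i t))\<^sup>2 * r ^ (2*t))"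
      using N r by (intro sum_mono sum_mono2) auto
    ultimately show ?thesis unfolding gB by simp
  qed
  have "(\<lambda>N. (\<Sum>i<m. \<Sum>t\<le>K. (cmod (g i t))\<^sup>2 * r ^ (2*t)) + \<delta> N) \<longlonglongrightarrow> (\<Sum>i<m. \<Sum>t\<le>K. (cmod (g i t))\<^sup>2 * r ^ (2*t)) + 0"
    by (intro tendsto_intros \<delta>0)
  then have "(\<Sum>i<m. \<Sum>t\<le>K. (cmod (a i t))\<^sup>2 * r ^ (2*t)) \<le> (\<Sum>i<m. \<Sum>t\<le>K. (cmod (g i t))\<^sup>2 * r ^ (2*t)) + 0"
    by (rule tendsto_lowerbound) (auto intro!: eventually_at_top_linorderI[of "Suc K"] main)
  then show ?thesis by (simp add: a_def)
qed

section \<open>Determinants of matrix functions\<close>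

text \<open>\<open>Pr\<close> stands for any class of functions that forms an algebra: holomorphic functions,
  polynomials, functions with a limit at a point.\<close>

locale function_algebra =
  fixes Pr :: "(complex \<Rightarrow> complex) \<Rightarrow> bool"
  assumes const: "Pr (\<lambda>_. c)" and add: "Pr f \<Longrightarrow> Pr g \<Longrightarrow> Pr (\<lambda>w. f w + g w)"
    and mult: "Pr f \<Longrightarrow> Pr g \<Longrightarrow> Pr (\<lambda>w. f w * g w)"
begin

lemma sum: "(\<And>i. i \<in> I \<Longrightarrow> Pr (f i)) \<Longrightarrow> Pr (\<lambda>w. \<Sum>i\<in>I. f i w)"
  by (induction I rule: infinite_finite_induct) (auto intro: const add)

lemma prod: "(\<And>i. i \<in> I \<Longrightarrow> Pr (f i)) \<Longrightarrow> Pr (\<lambda>w. \<Prod>i\<in>I. f i w)"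
  by (induction I rule: infinite_finite_induct) (auto intro: const mult)

definition mat_fun :: "nat \<Rightarrow> nat \<Rightarrow> (complex \<Rightarrow> complex mat) \<Rightarrow> bool" where
  "mat_fun n k M \<longleftrightarrow> (\<forall>w. M w \<in> carrier_mat n k) \<and> (\<forall>i<n. \<forall>j<k. Pr (\<lambda>w. M w $$ (i,j)))"

lemma mat_funD: "mat_fun n k M \<Longrightarrow> M w \<in> carrier_mat n k" "mat_fun n k M \<Longrightarrow> i < n \<Longrightarrow> j < k \<Longrightarrow> Pr (\<lambda>w. M w $$ (i,j))"
  by (auto simp: mat_fun_def)

lemma mat_fun_const: "C \<in> carrier_mat n k \<Longrightarrow> mat_fun n k (\<lambda>_. C)"
  by (auto simp: mat_fun_def const)

lemma mat_fun_add:
  assumes "mat_fun n k X" "mat_fun n k Y" shows "mat_fun n k (\<lambda>w. X w + Y w)"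
proof -
  have "(X w + Y w) $$ (i,j) = X w $$ (i,j) + Y w $$ (i,j)" if "i < n" "j < k" for w i j
    using that mat_funD(1)[OF assms(1), of w] mat_funD(1)[OF assms(2), of w] by auto
  then show ?thesis unfolding mat_fun_def using assms mat_funD by (auto intro!: add)
qed

lemma mat_fun_smult:
  assumes "Pr c" "mat_fun n k X" shows "mat_fun n k (\<lambda>w. c w \<cdot>\<^sub>m X w)"
proof -
  have "(c w \<cdot>\<^sub>m X w) $$ (i,j) = c w * X w $$ (i,j)" if "i < n" "j < k" for w i j
    using that mat_funD(1)[OF assms(2), of w] by auto
  then show ?thesis unfolding mat_fun_def using assms mat_funD by (auto intro!: mult)
qed

lemma mat_fun_mult:
  assumes "mat_fun n k X" "mat_fun k l Y" shows "mat_fun n l (\<lambda>w. X w * Y w)"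
proof -
  have "(X w * Y w) $$ (i,j) = (\<Sum>t\<in>{0..<k}. X w $$ (i,t) * Y w $$ (t,j))" if "i < n" "j < l" for w i j
    using that mat_funD(1)[OF assms(1), of w] mat_funD(1)[OF assms(2), of w] by (auto simp: scalar_prod_def)
  then show ?thesis unfolding mat_fun_def using assms mat_funD by (auto intro!: mult sum mult_carrier_mat)
qed

lemma det:
  assumes "mat_fun n n M" shows "Pr (\<lambda>w. det (M w))"
proof -
  have "det (M w) = (\<Sum>p\<in>{p. p permutes {0..<n}}. signof p * (\<Prod>i\<in>{0..<n}. M w $$ (i, p i)))" for w
    using det_def'[OF mat_funD(1)[OF assms]] .
  moreover have "Pr (\<lambda>w. M w $$ (i, p i))" if "p permutes {0..<n}" "i \<in> {0..<n}" for p i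
    using mat_funD(2)[OF assms, of i "p i"] permutes_in_image[OF that(1), of i] that(2) by auto
  ultimately show ?thesis by (auto intro!: sum mult const prod)
qed

lemma mat_fun_adj_mat:
  assumes M: "mat_fun n n M" shows "mat_fun n n (\<lambda>w. adj_mat (M w))"
proof -
  have "Pr (\<lambda>w. adj_mat (M w) $$ (i,j))" if ij: "i < n" "j < n" for i j
  proof -
    have "mat_fun (n - 1) (n - 1) (\<lambda>w. mat_delete (M w) j i)" unfolding mat_fun_def
    proof (intro conjI allI impI)
      fix w show "mat_delete (M w) j i \<in> carrier_mat (n - 1) (n - 1)"
        using mat_delete_carrier[OF mat_funD(1)[OF M]] .
    next
      fix a b assume ab: "a < n - 1" "b < n - 1"
      have "mat_delete (M w) j i $$ (a,b) = M w $$ (if a < j then a else Suc a, if b < i then b else Suc b)" for w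
        using ab mat_funD(1)[OF M, of w] by (auto simp: mat_delete_def)
      then show "Pr (\<lambda>w. mat_delete (M w) j i $$ (a,b))" using mat_funD(2)[OF M] ab by auto
    qed
    from det[OF this] have "Pr (\<lambda>w. cofactor (M w) j i)" unfolding cofactor_def by (intro mult const)
    moreover have "adj_mat (M w) $$ (i,j) = cofactor (M w) j i" for w
      using ij mat_funD(1)[OF M, of w] by (auto simp: adj_mat_def)
    ultimately show ?thesis by simp
  qed
  then show ?thesis unfolding mat_fun_def using adj_mat(1)[OF mat_funD(1)[OF M]] by auto
qed

end

interpretation holo: function_algebra "\<lambda>f. f holomorphic_on U" for U
  by unfold_locales (auto intro!: holomorphic_intros)

interpretation conv: function_algebra "\<lambda>f. \<exists>c. (f \<longlongrightarrow> c) F" for F :: "complex filter"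
  by unfold_locales (auto intro: tendsto_intros)

section \<open>Taylor coefficients of functions of class PJ0\<close>

lemma J_contractive_iff:
  assumes "signature_mat m J" "X \<in> carrier_mat m m"
  shows "J_contractive J X \<longleftrightarrow> (\<forall>v\<in>carrier_mat m 1. Re (qf J v) \<ge> Re (qf J (X * v)))"
  unfolding J_contractive_def using assms by (intro psd_minus_conj_iff) (auto simp: signature_mat_def)

lemma nrm_vec_sum: "v \<in> carrier_mat n 1 \<Longrightarrow> nrm v = (\<Sum>i<n. (cmod (v $$ (i,0)))\<^sup>2)"
  by (auto simp: nrm_def)

text \<open>The exchange of negative parts converts the indefinite balance between \<open>h\<close>
  and \<open>y\<close> into a difference of Hilbert space norms.\<close>

lemma PG_nrm:
  assumes sig: "signature_mat n J" and h: "h \<in> carrier_mat n 1" and y: "y \<in> carrier_mat n 1"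
  shows "nrm (neg_proj n J * y + pos_proj n J * h) - nrm (pos_proj n J * y + neg_proj n J * h) = Re (qf J h) - Re (qf J y)"
proof -
  note S = signature_projs[OF sig]
  let ?P = "pos_proj n J" and ?Q = "neg_proj n J"
  have eP: "emb ?P * (emb ?P * X) = emb ?P * X" "emb ?Q * (emb ?Q * X) = emb ?Q * X"
    "emb ?P * (emb ?Q * X) = 0" "emb ?Q * (emb ?P * X) = 0" for X
    using emb_prod(2)[OF S(8)] emb_prod(2)[OF S(9)] emb_prod(2)[OF S(10)] emb_prod(2)[OF S(11)] S(4,5)
    by (simp_all add: emb_zero)
  have c: "?Q * y + ?P * h \<in> carrier_mat n 1" "?P * y + ?Q * h \<in> carrier_mat n 1" using S(4,5) h y by auto
  have "?P * (?Q * y + ?P * h) = ?P * h" "?Q * (?Q * y + ?P * h) = ?Q * y"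
    "?P * (?P * y + ?Q * h) = ?P * y" "?Q * (?P * y + ?Q * h) = ?Q * h"
    by (rule emb_eqD; use S(4,5) h y in \<open>auto simp: emb_mult emb_add distrib_left eP\<close>)+
  then show ?thesis unfolding qf_signature(2)[OF sig c(1)] qf_signature(2)[OF sig c(2)]
      qf_signature(1)[OF sig h] qf_signature(1)[OF sig y] by simp
qed

lemma qf_J_blk_sum:
  assumes J: "J \<in> carrier_mat m m" and v: "v \<in> carrier_mat ((k+1)*m) 1"
  shows "qf (J_blk m J k) v = (\<Sum>t<k+1. qf J (adj (sel ((k+1)*m) m (t*m)) * v))"
proof -
  define N where "N = (k+1)*m"
  have NN: "N = m + k*m" by (simp add: N_def)
  note v = v[folded N_def]
  have Jc: "J_blk m J k \<in> carrier_mat N N" using J_blk_carrier[of m J k] by (simp add: N_def)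
  have Je: "J_blk m J k $$ (i + t*m, j + s*m) = (if t = s then J $$ (i,j) else 0)"
    if "i < m" "j < m" "t < k+1" "s < k+1" for i j t s
  proof -
    have "t*m \<le> k*m" "s*m \<le> k*m" using that by (simp_all add: mult_le_mono1)
    then have "i + t*m < N" "j + s*m < N" using that NN by linarith+
    then show ?thesis using that by (simp add: J_blk_def N_def)
  qed
  have he: "(adj (sel N m (t*m)) * v) $$ (i,0) = v $$ (i + t*m, 0)" if "i < m" "t < k+1" for i t
  proof -
    have "t*m \<le> k*m" using that by (simp add: mult_le_mono1)
    then have "i + t*m < N" using that NN by linarith
    then show ?thesis unfolding adj_sel_mult[OF v] using that by simp
  qed
  have "qf (J_blk m J k) v = (\<Sum>a<(k+1)*m. \<Sum>b<(k+1)*m. cnj (v $$ (a,0)) * J_blk m J k $$ (a,b) * v $$ (b,0))"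
    using qf_eq_sum[OF Jc v] by (simp add: N_def)
  also have "\<dots> = (\<Sum>t<k+1. \<Sum>i<m. \<Sum>s<k+1. \<Sum>j<m. cnj (v $$ (i + t*m,0)) * J_blk m J k $$ (i + t*m, j + s*m) * v $$ (j + s*m,0))"
    unfolding block_sum ..
  also have "\<dots> = (\<Sum>t<k+1. \<Sum>i<m. \<Sum>s<k+1. if s = t then (\<Sum>j<m. cnj (v $$ (i + t*m,0)) * J $$ (i,j) * v $$ (j + t*m,0)) else 0)"
    by (intro sum.cong refl) (auto simp: Je)
  also have "\<dots> = (\<Sum>t<k+1. \<Sum>i<m. \<Sum>j<m. cnj (v $$ (i + t*m,0)) * J $$ (i,j) * v $$ (j + t*m,0))"
    by (simp add: sum.delta)
  also have "\<dots> = (\<Sum>t<k+1. qf J (adj (sel N m (t*m)) * v))"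
  proof (intro sum.cong refl)
    fix t assume t: "t \<in> {..<k+1}"
    have "adj (sel N m (t*m)) * v \<in> carrier_mat m 1" using v by auto
    from qf_eq_sum[OF J this] show "(\<Sum>i<m. \<Sum>j<m. cnj (v $$ (i + t*m,0)) * J $$ (i,j) * v $$ (j + t*m,0)) = qf J (adj (sel N m (t*m)) * v)"
      using t by (simp add: he)
  qed
  finally show ?thesis unfolding N_def .
qed

lemma S_blk_block_row:
  assumes A: "\<And>j. j \<le> k \<Longrightarrow> A j \<in> carrier_mat m m" and v: "v \<in> carrier_mat ((k+1)*m) l"
    and i: "i < m" and t: "t \<le> k" and c: "c < l"
  shows "(S_blk m A k * v) $$ (i + t*m, c) = (\<Sum>s\<le>t. \<Sum>j<m. A (t - s) $$ (i,j) * v $$ (j + s*m, c))"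
proof -
  define N where "N = (k+1)*m"
  have NN: "N = m + k*m" by (simp add: N_def)
  have Sc: "S_blk m A k \<in> carrier_mat N N" using S_blk_carrier[of m A k] by (simp add: N_def)
  have lt: "j + s*m < N" if "j < m" "s \<le> k" for j s
  proof -
    have "s*m \<le> k*m" using that by (simp add: mult_le_mono1)
    then show ?thesis using that NN by linarith
  qed
  have e: "S_blk m A k $$ (i + t*m, j + s*m) = (if s \<le> t then A (t - s) $$ (i,j) else 0)" if "j < m" "s \<le> k" for j s
    using lt[OF i t] lt[OF that] that i by (simp add: S_blk_def N_def)
  have "(S_blk m A k * v) $$ (i + t*m, c) = (\<Sum>b<(k+1)*m. S_blk m A k $$ (i + t*m, b) * v $$ (b, c))"
    using Sc v lt[OF i t] c by (auto simp: scalar_prod_def N_def atLeast0LessThan)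
  also have "\<dots> = (\<Sum>s<k+1. \<Sum>j<m. S_blk m A k $$ (i + t*m, j + s*m) * v $$ (j + s*m, c))" unfolding block_sum ..
  also have "\<dots> = (\<Sum>s<k+1. if s \<le> t then (\<Sum>j<m. A (t - s) $$ (i,j) * v $$ (j + s*m, c)) else 0)"
    by (intro sum.cong refl) (auto simp: e)
  also have "\<dots> = (\<Sum>s\<le>t. \<Sum>j<m. A (t - s) $$ (i,j) * v $$ (j + s*m, c))"
    using t by (intro sum.mono_neutral_cong_right) auto
  finally show ?thesis .
qed

section \<open>Power series and the Potapov-Ginzburg transform of meromorphic functions\<close>

lemma taylor0_carrier[simp, intro]: "taylor0 m f j \<in> carrier_mat m m"
  by (simp add: taylor0_def)

lemma mero_disc_sparse: "mero_disc m f S \<Longrightarrow> S sparse_in DD"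
  by (simp add: mero_disc_def sparse_in_open)

lemma mero_disc_open: "mero_disc m f S \<Longrightarrow> open (DD - S)"
  using mero_disc_sparse open_diff_sparse_pts by blast

lemma mero_disc_fps:
  assumes "mero_disc m f S" "0 \<notin> S" "i < m" "j < m"
  shows "(\<lambda>w. f w $$ (i,j)) has_fps_expansion fps_expansion (\<lambda>w. f w $$ (i,j)) 0"
    and "fps_nth (fps_expansion (\<lambda>w. f w $$ (i,j)) 0) t = taylor0 m f t $$ (i,j)"
proof -
  have "(\<lambda>w. f w $$ (i,j)) holomorphic_on (DD - S)" using assms by (auto simp: mero_disc_def)
  then have "(\<lambda>w. f w $$ (i,j)) analytic_on {0}"
    using mero_disc_open[OF assms(1)] assms(2) by (auto simp: analytic_at)
  then show "(\<lambda>w. f w $$ (i,j)) has_fps_expansion fps_expansion (\<lambda>w. f w $$ (i,j)) 0"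
    by (rule analytic_at_imp_has_fps_expansion_0)
  show "fps_nth (fps_expansion (\<lambda>w. f w $$ (i,j)) 0) t = taylor0 m f t $$ (i,j)"
    using assms by (simp add: fps_expansion_def taylor0_def)
qed

lemma has_fps_expansion_poly_sum:
  fixes g :: "nat \<Rightarrow> complex"
  shows "(\<lambda>w. \<Sum>t\<le>k. g t * w ^ t) has_fps_expansion Abs_fps (\<lambda>t. if t \<le> k then g t else 0)"
proof -
  have "(\<lambda>w. \<Sum>t\<le>k. g t * w ^ t) has_fps_expansion (\<Sum>t\<le>k. fps_const (g t) * fps_X ^ t)"
    by (intro fps_expansion_intros)
  also have "(\<Sum>t\<le>k. fps_const (g t) * fps_X ^ t) = Abs_fps (\<lambda>t. if t \<le> k then g t else 0)"
    by (rule fps_ext) (simp add: fps_sum_nth fps_X_power_nth if_distrib[where f="\<lambda>x. _ * x"] sum.delta cong: if_cong)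
  finally show ?thesis .
qed

text \<open>The transform is \<open>(P f + Q) (Q f + P)^-1\<close>. Its denominator is invertible by
  \<open>J_contractive_block_inverse\<close>, holomorphy comes from Cramer's rule, and the norm
  bound is \<open>J\<close>-contractivity read through \<open>PG_nrm\<close>.\<close>

lemma PG_function:
  assumes sig: "signature_mat m J" and md: "mero_disc m f S"
    and con: "\<And>w. w \<in> DD - S \<Longrightarrow> J_contractive J (f w)"
  obtains s where "\<And>w. s w \<in> carrier_mat m m"
    "\<And>i j. i < m \<Longrightarrow> j < m \<Longrightarrow> (\<lambda>w. s w $$ (i,j)) holomorphic_on (DD - S)"
    "\<And>w. w \<in> DD - S \<Longrightarrow> s w * (neg_proj m J * f w + pos_proj m J) = pos_proj m J * f w + neg_proj m J"
    "\<And>w v. w \<in> DD - S \<Longrightarrow> v \<in> carrier_mat m 1 \<Longrightarrow> nrm (s w * v) \<le> nrm v"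
proof -
  note sp = signature_projs[OF sig]
  define P Q where "P = pos_proj m J" and "Q = neg_proj m J"
  have PQ: "P \<in> carrier_mat m m" "Q \<in> carrier_mat m m" using sp by (auto simp: P_def Q_def)
  define U where "U = DD - S"
  \<comment> \<open>Outside \<open>DD - S\<close> the values of \<open>f\<close> may have another
    format, while \<open>mat_fun\<close> demands a fixed one everywhere.\<close>
  define fm where "fm w = mat m m (\<lambda>ij. f w $$ ij)" for w
  have fm: "fm w = f w" if "w \<in> U" for w
  proof (rule eq_matI)
    have "f w \<in> carrier_mat m m" using md that unfolding mero_disc_def U_def by auto
    then show "dim_row (fm w) = dim_row (f w)" "dim_col (fm w) = dim_col (f w)"
      "\<And>i j. i < dim_row (f w) \<Longrightarrow> j < dim_col (f w) \<Longrightarrow> fm w $$ (i,j) = f w $$ (i,j)" by (auto simp: fm_def)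
  qed
  have fc: "f w \<in> carrier_mat m m" if "w \<in> U" for w using md that unfolding mero_disc_def U_def by auto
  have mfm: "holo.mat_fun U m m fm" unfolding holo.mat_fun_def using md by (auto simp: fm_def mero_disc_def U_def)
  define K where "K w = Q * fm w + P" for w
  define H where "H w = P * fm w + Q" for w
  have mK: "holo.mat_fun U m m K" and mH: "holo.mat_fun U m m H" unfolding K_def H_def
    using PQ mfm by (auto intro!: holo.mat_fun_add holo.mat_fun_mult holo.mat_fun_const)
  have Kc: "K w \<in> carrier_mat m m" and Hc: "H w \<in> carrier_mat m m" for w
    using holo.mat_funD(1)[OF mK] holo.mat_funD(1)[OF mH] by auto
  have cw: "Re (qf J v) \<ge> Re (qf J (f w * v))" if "w \<in> U" "v \<in> carrier_mat m 1" for w v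
    using con[of w] that J_contractive_iff[OF sig fc[OF that(1)]] by (auto simp: U_def)
  have det0: "det (K w) \<noteq> 0" if w: "w \<in> U" for w
  proof -
    from J_contractive_block_inverse[OF sig fc[OF w] cw[OF w]]
    obtain R where R: "R \<in> carrier_mat m m" "K w * R = 1\<^sub>m m" unfolding K_def fm[OF w] P_def Q_def by blast
    have "det (K w) * det R = 1" using det_mult[OF Kc[of w] R(1)] R(2) by simp
    then show ?thesis by auto
  qed
  define s where "s w = (1 / det (K w)) \<cdot>\<^sub>m (H w * adj_mat (K w))" for w
  have sh: "holo.mat_fun U m m s" unfolding s_def
    by (intro holo.mat_fun_smult holo.mat_fun_mult[of _ _ m] mH holo.mat_fun_adj_mat mK holomorphic_intros holo.det[OF mK])
      (use det0 in auto)
  have KA: "K w * adj_mat (K w) = det (K w) \<cdot>\<^sub>m 1\<^sub>m m" "adj_mat (K w) * K w = det (K w) \<cdot>\<^sub>m 1\<^sub>m m" "adj_mat (K w) \<in> carrier_mat m m" for w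
    using adj_mat[OF Kc[of w]] by auto
  have sK: "s w * K w = H w" if w: "w \<in> U" for w
    by (rule emb_eqD) (use emb_prod(1)[OF KA(2)[of w]] KA(3)[of w] Kc[of w] Hc[of w] det0[OF w] in \<open>auto simp: s_def emb_ring\<close>)
  have sc: "nrm (s w * v) \<le> nrm v" if w: "w \<in> U" and v: "v \<in> carrier_mat m 1" for w v
  proof -
    define u where "u = (1 / det (K w)) \<cdot>\<^sub>m (adj_mat (K w) * v)"
    have u: "u \<in> carrier_mat m 1" using KA(3)[of w] v by (auto simp: u_def)
    have fu: "f w * u \<in> carrier_mat m 1" using fc[OF w] u by auto
    have "K w * u = v"
      by (rule emb_eqD) (use emb_prod(2)[OF KA(1)[of w]] KA(3)[of w] Kc[of w] v det0[OF w] in \<open>auto simp: u_def emb_ring\<close>)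
    moreover have "K w * u = Q * (f w * u) + P * u"
      by (rule emb_eqD) (use PQ fc[OF w] u in \<open>auto simp: K_def fm[OF w] emb_ring\<close>)
    ultimately have 1: "v = Q * (f w * u) + P * u" by simp
    have "s w * v = H w * u"
      by (rule emb_eqD) (use KA(3)[of w] Kc[of w] Hc[of w] v in \<open>auto simp: s_def u_def emb_ring\<close>)
    moreover have "H w * u = P * (f w * u) + Q * u"
      by (rule emb_eqD) (use PQ fc[OF w] u in \<open>auto simp: H_def fm[OF w] emb_ring\<close>)
    ultimately have 2: "s w * v = P * (f w * u) + Q * u" by simp
    show ?thesis unfolding 2 using PG_nrm[OF sig u fu, folded P_def Q_def] cw[OF w u] 1 by simp
  qed
  show thesis
    using that[of s] holo.mat_funD[OF sh] sK sc fm unfolding U_def K_def H_def P_def Q_def by metis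
qed

text \<open>The transform is bounded, so the poles of \<open>f\<close> become removable
  singularities. Shrinking to radius \<open>R\<close> leaves finitely many of them, and the
  conclusion is stated entrywise because it will be expanded into power series.\<close>

lemma PG_function_local:
  assumes sig: "signature_mat m J" and md: "mero_disc m f S" and S0: "0 \<notin> S"
    and con: "\<And>w. w \<in> DD - S \<Longrightarrow> J_contractive J (f w)" and R: "0 < R" "R < 1"
  obtains s where "\<And>i j. i < m \<Longrightarrow> j < m \<Longrightarrow> s i j holomorphic_on ball 0 R"
    "\<And>w c. cmod w < R \<Longrightarrow> (\<Sum>i<m. (cmod (\<Sum>j<m. s i j w * c j))\<^sup>2) \<le> (\<Sum>j<m. (cmod (c j))\<^sup>2)"
    "\<forall>\<^sub>F w in nhds 0. \<forall>i<m. \<forall>l<m. (\<Sum>j<m. s i j w * ((\<Sum>p<m. neg_proj m J $$ (j,p) * f w $$ (p,l)) + pos_proj m J $$ (j,l)))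
       = (\<Sum>p<m. pos_proj m J $$ (i,p) * f w $$ (p,l)) + neg_proj m J $$ (i,l)"
proof -
  obtain s0 where s0: "\<And>w. s0 w \<in> carrier_mat m m"
    "\<And>i j. i < m \<Longrightarrow> j < m \<Longrightarrow> (\<lambda>w. s0 w $$ (i,j)) holomorphic_on (DD - S)"
    "\<And>w. w \<in> DD - S \<Longrightarrow> s0 w * (neg_proj m J * f w + pos_proj m J) = pos_proj m J * f w + neg_proj m J"
    "\<And>w v. w \<in> DD - S \<Longrightarrow> v \<in> carrier_mat m 1 \<Longrightarrow> nrm (s0 w * v) \<le> nrm v"
    using PG_function[OF sig md con] by metis
  define X where "X = S \<inter> ball 0 R"
  have cb: "cball (0::complex) R \<subseteq> DD" using R by auto
  have "finite (cball 0 R \<inter> S)"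
    by (rule sparse_in_compact_finite[OF sparse_in_subset[OF mero_disc_sparse[OF md] cb]]) simp
  then have fX: "finite X" by (rule finite_subset[rotated]) (auto simp: X_def)
  have sub: "ball 0 R - X \<subseteq> DD - S" using R by (auto simp: X_def)
  have vec: "(\<Sum>i<m. (cmod (\<Sum>j<m. s0 w $$ (i,j) * c j))\<^sup>2) \<le> (\<Sum>j<m. (cmod (c j))\<^sup>2)" if w: "w \<in> DD - S" for w c
  proof -
    define v where "v = mat m 1 (\<lambda>(j,_). c j)"
    have v: "v \<in> carrier_mat m 1" by (simp add: v_def)
    have "(s0 w * v) $$ (i,0) = (\<Sum>j<m. s0 w $$ (i,j) * c j)" if "i < m" for i
      using that s0(1)[of w] by (auto simp: v_def scalar_prod_def atLeast0LessThan)
    then show ?thesis using s0(4)[OF w v] s0(1)[of w] by (simp add: nrm_def v_def)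
  qed
  have bnd: "cmod (s0 w $$ (i,j)) \<le> 1" if w: "w \<in> DD - S" and ij: "i < m" "j < m" for w i j
  proof -
    have d: "(\<Sum>l<m. s0 w $$ (a,l) * (if l = j then 1 else 0)) = s0 w $$ (a,j)" for a
      using ij by (simp add: if_distrib[where f="\<lambda>x. _ * x"] sum.delta cong: if_cong)
    have "(cmod (s0 w $$ (i,j)))\<^sup>2 \<le> (\<Sum>a<m. (cmod (s0 w $$ (a,j)))\<^sup>2)"
      using ij by (intro member_le_sum) auto
    also have "\<dots> \<le> (\<Sum>l<m. (cmod (if l = j then 1 else 0))\<^sup>2)" using vec[OF w, of "\<lambda>l. if l = j then 1 else 0"] unfolding d .
    also have "\<dots> = 1" using ij by (simp add: if_distrib[where f=cmod] if_distrib[where f="\<lambda>x. x\<^sup>2"] sum.delta cong: if_cong)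
    finally show ?thesis using abs_square_le_1[of "cmod (s0 w $$ (i,j))"] by simp
  qed
  have evU: "\<forall>\<^sub>F w in at z. w \<in> ball 0 R - X" if "z \<in> ball 0 R" for z
  proof -
    have "\<forall>\<^sub>F w in at z. w \<in> ball 0 R - (X - {z}) - {z}"
      using that fX by (intro eventually_at_in_open) (auto intro!: open_Diff finite_imp_closed)
    then show ?thesis by eventually_elim auto
  qed
  have "\<exists>g. g holomorphic_on ball 0 R \<and> (\<forall>z\<in>ball 0 R - X. g z = s0 z $$ (i,j))" if ij: "i < m" "j < m" for i j
  proof (rule removable_singularities[OF fX])
    show "X \<subseteq> interior (ball 0 R)" by (auto simp: X_def interior_open)
    show "(\<lambda>w. s0 w $$ (i,j)) holomorphic_on ball 0 R - X" using s0(2)[OF ij] sub by (rule holomorphic_on_subset)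
    fix z assume "z \<in> X"
    then have "\<forall>\<^sub>F w in at z. w \<in> ball 0 R - X" using evU by (auto simp: X_def)
    then have "\<forall>\<^sub>F w in at z. norm (s0 w $$ (i,j)) \<le> 1 * norm (1::complex)"
      by eventually_elim (use sub bnd ij in auto)
    then show "(\<lambda>w. s0 w $$ (i,j)) \<in> O[at z](\<lambda>_. 1)" by (rule landau_o.bigI[rotated]) simp
  qed
  then have "\<forall>i j. \<exists>g. i < m \<longrightarrow> j < m \<longrightarrow> g holomorphic_on ball 0 R \<and> (\<forall>z\<in>ball 0 R - X. g z = s0 z $$ (i,j))" by blast
  then obtain s where s: "\<And>i j. i < m \<Longrightarrow> j < m \<Longrightarrow> s i j holomorphic_on ball 0 R"
    "\<And>i j z. i < m \<Longrightarrow> j < m \<Longrightarrow> z \<in> ball 0 R - X \<Longrightarrow> s i j z = s0 z $$ (i,j)" by metis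
  show thesis
  proof (rule that[of s])
    show "s i j holomorphic_on ball 0 R" if "i < m" "j < m" for i j using s(1)[OF that] .
    show "(\<Sum>i<m. (cmod (\<Sum>j<m. s i j w * c j))\<^sup>2) \<le> (\<Sum>j<m. (cmod (c j))\<^sup>2)" if w: "cmod w < R" for w c
    proof -
      have wb: "w \<in> ball 0 R" using w by simp
      have lim: "(s i j \<longlongrightarrow> s i j w) (at w)" if "i < m" "j < m" for i j
        using holomorphic_on_imp_continuous_on[OF s(1)[OF that]] wb continuous_on_eq_continuous_at[OF open_ball] isCont_def by blast
      have "((\<lambda>z. \<Sum>i<m. (cmod (\<Sum>j<m. s i j z * c j))\<^sup>2) \<longlongrightarrow> (\<Sum>i<m. (cmod (\<Sum>j<m. s i j w * c j))\<^sup>2)) (at w)"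
        by (intro tendsto_intros lim) auto
      moreover have "\<forall>\<^sub>F z in at w. (\<Sum>i<m. (cmod (\<Sum>j<m. s i j z * c j))\<^sup>2) \<le> (\<Sum>j<m. (cmod (c j))\<^sup>2)"
        using evU[OF wb]
      proof eventually_elim
        case (elim z)
        have "(\<Sum>i<m. (cmod (\<Sum>j<m. s i j z * c j))\<^sup>2) = (\<Sum>i<m. (cmod (\<Sum>j<m. s0 z $$ (i,j) * c j))\<^sup>2)"
          using s(2) elim by (intro sum.cong refl arg_cong[where f="\<lambda>x. (cmod x)\<^sup>2"]) auto
        then show ?case using vec[of z c] elim sub by auto
      qed
      ultimately show ?thesis by (rule tendsto_upperbound) simp
    qed
    have "\<forall>\<^sub>F w in nhds 0. w \<in> ball 0 R - X"
      using fX S0 R by (intro eventually_nhds_in_open) (auto intro!: open_Diff finite_imp_closed simp: X_def)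
    then show "\<forall>\<^sub>F w in nhds 0. \<forall>i<m. \<forall>l<m. (\<Sum>j<m. s i j w * ((\<Sum>p<m. neg_proj m J $$ (j,p) * f w $$ (p,l)) + pos_proj m J $$ (j,l)))
       = (\<Sum>p<m. pos_proj m J $$ (i,p) * f w $$ (p,l)) + neg_proj m J $$ (i,l)"
    proof eventually_elim
      case (elim w)
      then have w: "w \<in> DD - S" using sub by auto
      have c: "f w \<in> carrier_mat m m" "pos_proj m J \<in> carrier_mat m m" "neg_proj m J \<in> carrier_mat m m"
        using md w signature_projs[OF sig] by (auto simp: mero_disc_def)
      have e: "(\<Sum>p<m. B $$ (i,p) * f w $$ (p,l)) + C $$ (i,l) = (B * f w + C) $$ (i,l)"
        if "B \<in> carrier_mat m m" "C \<in> carrier_mat m m" "i < m" "l < m" for B C i l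
        using that c(1) by (auto simp: scalar_prod_def atLeast0LessThan)
      show ?case
      proof (intro allI impI)
        fix i l assume il: "i < m" "l < m"
        have "(\<Sum>j<m. s i j w * ((\<Sum>p<m. neg_proj m J $$ (j,p) * f w $$ (p,l)) + pos_proj m J $$ (j,l)))
          = (\<Sum>j<m. s0 w $$ (i,j) * (neg_proj m J * f w + pos_proj m J) $$ (j,l))"
          using il elim s(2) by (intro sum.cong refl) (simp add: e[OF c(3,2)] del: index_mult_mat index_add_mat)
        also have "\<dots> = (s0 w * (neg_proj m J * f w + pos_proj m J)) $$ (i,l)"
          by (subst index_mult_mat(1)) (use il c s0(1)[of w] in \<open>auto simp: scalar_prod_def atLeast0LessThan simp del: index_mult_mat(1) index_add_mat(1) intro!: sum.cong\<close>)
        also have "\<dots> = (\<Sum>p<m. pos_proj m J $$ (i,p) * f w $$ (p,l)) + neg_proj m J $$ (i,l)"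
          unfolding s0(3)[OF w] e[OF c(2,3) il] ..
        finally show "(\<Sum>j<m. s i j w * ((\<Sum>p<m. neg_proj m J $$ (j,p) * f w $$ (p,l)) + pos_proj m J $$ (j,l)))
          = (\<Sum>p<m. pos_proj m J $$ (i,p) * f w $$ (p,l)) + neg_proj m J $$ (i,l)" .
      qed
    qed
  qed
qed

text \<open>The Potapov--Ginzburg transform of \<open>f\<close> is a Schur function, and the Bessel inequality for
  it reads as positivity of the Toeplitz forms of \<open>f\<close>.\<close>

theorem PJ0_toeplitz_psd:
  assumes sig: "signature_mat m J" and f: "PJ0 m J f"
  shows "psd (Q_mat m J (taylor0 m f) k)"
proof -
  obtain S where md: "mero_disc m f S" and S0: "0 \<notin> S" and con: "\<And>w. w \<in> DD - S \<Longrightarrow> J_contractive J (f w)"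
    using f unfolding PJ0_def by blast
  define A where "A = taylor0 m f"
  have A: "A j \<in> carrier_mat m m" for j by (simp add: A_def)
  define N where "N = (k+1)*m"
  have NN: "N = m + k*m" by (simp add: N_def)
  have Jc: "J \<in> carrier_mat m m" using sig by (simp add: signature_mat_def)
  note sgN = J_blk_signature[OF sig, of k, folded N_def]
  have JN: "J_blk m J k \<in> carrier_mat N N" "adj (J_blk m J k) = J_blk m J k" using sgN by (auto simp: signature_mat_def)
  have Sc: "S_blk m A k \<in> carrier_mat N N" using S_blk_carrier[of m A k] by (simp add: N_def)
  define P Q where "P = pos_proj m J" and "Q = neg_proj m J"
  have PQ: "P \<in> carrier_mat m m" "Q \<in> carrier_mat m m" using signature_projs[OF sig] by (auto simp: P_def Q_def)
  have "Re (qf (J_blk m J k) v) \<ge> Re (qf (J_blk m J k) (S_blk m A k * v))" if v: "v \<in> carrier_mat N 1" for v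
  proof -
    define h where "h t = adj (sel N m (t*m)) * v" for t
    define y where "y t = adj (sel N m (t*m)) * (S_blk m A k * v)" for t
    have Sv: "S_blk m A k * v \<in> carrier_mat N 1" using Sc v by auto
    have hc: "h t \<in> carrier_mat m 1" and yc: "y t \<in> carrier_mat m 1" for t using v Sv by (auto simp: h_def y_def)
    have lt: "i + t*m < N" if "i < m" "t \<le> k" for i t
    proof -
      have "t*m \<le> k*m" using that by (simp add: mult_le_mono1)
      then show ?thesis using that NN by linarith
    qed
    have he: "h t $$ (i,0) = v $$ (i + t*m, 0)" if "i < m" "t \<le> k" for i t
      unfolding h_def adj_sel_mult[OF v] using lt[OF that] that by simp
    have ye: "y t $$ (i,0) = (\<Sum>s\<le>t. \<Sum>j<m. A (t - s) $$ (i,j) * h s $$ (j,0))" if "i < m" "t \<le> k" for i t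
    proof -
      have "y t $$ (i,0) = (S_blk m A k * v) $$ (i + t*m, 0)"
        unfolding y_def adj_sel_mult[OF Sv] using lt[OF that] that by simp
      also have "\<dots> = (\<Sum>s\<le>t. \<Sum>j<m. A (t - s) $$ (i,j) * v $$ (j + s*m, 0))"
        by (rule S_blk_block_row[of k A m v 1]) (use A v that in \<open>auto simp: N_def\<close>)
      finally show ?thesis using that he by simp
    qed
    \<comment> \<open>The exchanged pair for the input \<open>h\<close> and the output
      \<open>y\<close>: the transform of \<open>f\<close> takes the series with coefficients
      \<open>g\<close> to the one with coefficients \<open>u\<close>.\<close>
    define g where "g t = Q * y t + P * h t" for t
    define u where "u t = P * y t + Q * h t" for t
    have ge: "g t $$ (i,0) = (\<Sum>p<m. Q $$ (i,p) * y t $$ (p,0)) + (\<Sum>l<m. P $$ (i,l) * h t $$ (l,0))"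
      and ue: "u t $$ (i,0) = (\<Sum>p<m. P $$ (i,p) * y t $$ (p,0)) + (\<Sum>l<m. Q $$ (i,l) * h t $$ (l,0))" if "i < m" for i t
      using that PQ hc[of t] yc[of t] by (auto simp: g_def u_def scalar_prod_def atLeast0LessThan)
    have gu: "g t \<in> carrier_mat m 1" "u t \<in> carrier_mat m 1" for t using PQ hc[of t] yc[of t] by (auto simp: g_def u_def)
    define Af where "Af i j = fps_expansion (\<lambda>w. f w $$ (i,j)) 0" for i j
    note Afx = mero_disc_fps[OF md S0, folded Af_def A_def]
    \<comment> \<open>Only coefficients up to \<open>k\<close> matter, so the input is cut to a
      polynomial. Its image \<open>Yf\<close> under \<open>f\<close>, and with it \<open>Gf\<close>
      and \<open>Uf\<close>, are full power series.\<close>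
    define Hf where "Hf l = Abs_fps (\<lambda>t. if t \<le> k then h t $$ (l,0) else 0)" for l
    define Yf where "Yf p = (\<Sum>l<m. Hf l * Af p l)" for p
    define Gf where "Gf j = (\<Sum>p<m. fps_const (Q $$ (j,p)) * Yf p) + (\<Sum>l<m. fps_const (P $$ (j,l)) * Hf l)" for j
    define Uf where "Uf j = (\<Sum>p<m. fps_const (P $$ (j,p)) * Yf p) + (\<Sum>l<m. fps_const (Q $$ (j,l)) * Hf l)" for j
    have Yn: "fps_nth (Yf p) t = y t $$ (p,0)" if p: "p < m" and t: "t \<le> k" for p t
    proof -
      have "fps_nth (Yf p) t = (\<Sum>l<m. \<Sum>s=0..t. h s $$ (l,0) * A (t - s) $$ (p,l))"
        unfolding Yf_def fps_sum_nth fps_mult_nth using t p Afx(2) by (intro sum.cong refl) (auto simp: Hf_def)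
      also have "\<dots> = (\<Sum>s\<le>t. \<Sum>l<m. A (t - s) $$ (p,l) * h s $$ (l,0))"
        by (subst sum.swap) (simp add: atLeast0AtMost mult.commute)
      finally show ?thesis using ye[OF p t] by simp
    qed
    have Gn: "fps_nth (Gf j) t = g t $$ (j,0)" and Un: "fps_nth (Uf j) t = u t $$ (j,0)" if "j < m" "t \<le> k" for j t
      using that by (simp_all add: Gf_def Uf_def ge ue fps_sum_nth Yn Hf_def)
    have dist: "(\<Sum>p<m. fps_const (B $$ (j,p)) * Yf p) + (\<Sum>l<m. fps_const (C $$ (j,l)) * Hf l)
       = (\<Sum>l<m. ((\<Sum>p<m. fps_const (B $$ (j,p)) * Af p l) + fps_const (C $$ (j,l))) * Hf l)" for B C j
    proof -
      have "(\<Sum>p<m. fps_const (B $$ (j,p)) * Yf p) = (\<Sum>l<m. (\<Sum>p<m. fps_const (B $$ (j,p)) * Af p l) * Hf l)"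
        unfolding Yf_def sum_distrib_left sum_distrib_right by (subst sum.swap) (simp add: mult_ac)
      then show ?thesis by (simp add: distrib_right sum.distrib)
    qed
    have ineq: "(\<Sum>i<m. \<Sum>t\<le>k. (cmod (u t $$ (i,0)))\<^sup>2 * r ^ (2*t)) \<le> (\<Sum>i<m. \<Sum>t\<le>k. (cmod (g t $$ (i,0)))\<^sup>2 * r ^ (2*t))"
      if r: "0 < r" "r < 1" for r
    proof -
      obtain R where R: "r < R" "R < 1" using r dense by blast
      have R0: "0 < R" using r R by simp
      obtain s where s: "\<And>i j. i < m \<Longrightarrow> j < m \<Longrightarrow> s i j holomorphic_on ball 0 R"
        "\<And>w c. cmod w < R \<Longrightarrow> (\<Sum>i<m. (cmod (\<Sum>j<m. s i j w * c j))\<^sup>2) \<le> (\<Sum>j<m. (cmod (c j))\<^sup>2)"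
        and sev: "\<forall>\<^sub>F w in nhds 0. \<forall>i<m. \<forall>l<m. (\<Sum>j<m. s i j w * ((\<Sum>p<m. Q $$ (j,p) * f w $$ (p,l)) + P $$ (j,l)))
           = (\<Sum>p<m. P $$ (i,p) * f w $$ (p,l)) + Q $$ (i,l)"
      proof (rule PG_function_local[OF sig md S0 con R0 R(2)], assumption)
        fix s assume "\<And>i j. i < m \<Longrightarrow> j < m \<Longrightarrow> s i j holomorphic_on ball 0 R"
        "\<And>w c. cmod w < R \<Longrightarrow> (\<Sum>i<m. (cmod (\<Sum>j<m. s i j w * c j))\<^sup>2) \<le> (\<Sum>j<m. (cmod (c j))\<^sup>2)"
        "\<forall>\<^sub>F w in nhds 0. \<forall>i<m. \<forall>l<m. (\<Sum>j<m. s i j w * ((\<Sum>p<m. neg_proj m J $$ (j,p) * f w $$ (p,l)) + pos_proj m J $$ (j,l)))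
           = (\<Sum>p<m. pos_proj m J $$ (i,p) * f w $$ (p,l)) + neg_proj m J $$ (i,l)"
        then show thesis by (rule that[unfolded P_def Q_def])
      qed
      define Sf where "Sf i j = fps_expansion (s i j) 0" for i j
      have Sx: "s i j has_fps_expansion Sf i j" if "i < m" "j < m" for i j
        unfolding Sf_def by (rule analytic_at_imp_has_fps_expansion_0)
          (use s(1)[OF that] R0 in \<open>auto simp: analytic_at intro!: exI[of _ "ball 0 R"]\<close>)
      \<comment> \<open>The functional equation of the transform holds near 0 and is read as an
        identity of formal power series.\<close>
      have SK: "(\<Sum>j<m. Sf i j * ((\<Sum>p<m. fps_const (Q $$ (j,p)) * Af p l) + fps_const (P $$ (j,l))))
          = (\<Sum>p<m. fps_const (P $$ (i,p)) * Af p l) + fps_const (Q $$ (i,l))" if il: "i < m" "l < m" for i l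
      proof (rule fps_expansion_unique_complex)
        show "(\<lambda>w. (\<Sum>p<m. P $$ (i,p) * f w $$ (p,l)) + Q $$ (i,l)) has_fps_expansion (\<Sum>p<m. fps_const (P $$ (i,p)) * Af p l) + fps_const (Q $$ (i,l))"
          using il by (intro fps_expansion_intros Afx(1)) auto
        have "(\<lambda>w. \<Sum>j<m. s i j w * ((\<Sum>p<m. Q $$ (j,p) * f w $$ (p,l)) + P $$ (j,l))) has_fps_expansion
          (\<Sum>j<m. Sf i j * ((\<Sum>p<m. fps_const (Q $$ (j,p)) * Af p l) + fps_const (P $$ (j,l))))"
          using il by (intro fps_expansion_intros Afx(1) Sx) auto
        also have "?this \<longleftrightarrow> (\<lambda>w. (\<Sum>p<m. P $$ (i,p) * f w $$ (p,l)) + Q $$ (i,l)) has_fps_expansion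
          (\<Sum>j<m. Sf i j * ((\<Sum>p<m. fps_const (Q $$ (j,p)) * Af p l) + fps_const (P $$ (j,l))))"
          by (rule has_fps_expansion_cong[OF _ refl]) (use sev il in \<open>auto elim: eventually_mono\<close>)
        finally show "(\<lambda>w. (\<Sum>p<m. P $$ (i,p) * f w $$ (p,l)) + Q $$ (i,l)) has_fps_expansion
          (\<Sum>j<m. Sf i j * ((\<Sum>p<m. fps_const (Q $$ (j,p)) * Af p l) + fps_const (P $$ (j,l))))" .
      qed
      have SG: "(\<Sum>j<m. Sf i j * Gf j) = Uf i" if i: "i < m" for i
      proof -
        have "(\<Sum>j<m. Sf i j * Gf j) = (\<Sum>l<m. (\<Sum>j<m. Sf i j * ((\<Sum>p<m. fps_const (Q $$ (j,p)) * Af p l) + fps_const (P $$ (j,l)))) * Hf l)"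
          unfolding Gf_def dist sum_distrib_left[of "Sf _ _"] sum_distrib_right[of _ _ "Hf _"]
          by (subst sum.swap) (simp add: mult.assoc)
        also have "\<dots> = Uf i" unfolding Uf_def dist using SK i by (intro sum.cong refl) auto
        finally show ?thesis .
      qed
      \<comment> \<open>The Bessel inequality wants a polynomial on its right side, so
        \<open>Gf\<close> is cut at degree \<open>k\<close>. This changes no coefficient of the
        image up to degree \<open>k\<close>.\<close>
      define F where "F i w = (\<Sum>j<m. s i j w * (\<Sum>t\<le>k. g t $$ (j,0) * w ^ t))" for i w
      define Gt where "Gt j = Abs_fps (\<lambda>t. if t \<le> k then g t $$ (j,0) else 0)" for j
      have coeff: "(deriv ^^ t) (F i) 0 / fact t = u t $$ (i,0)" if i: "i < m" and t: "t \<le> k" for i t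
      proof -
        have "F i has_fps_expansion (\<Sum>j<m. Sf i j * Gt j)" unfolding F_def Gt_def
          using i by (intro fps_expansion_intros Sx has_fps_expansion_poly_sum) auto
        then have "(deriv ^^ t) (F i) 0 / fact t = fps_nth (\<Sum>j<m. Sf i j * Gt j) t"
          by (simp add: fps_nth_fps_expansion)
        also have "\<dots> = fps_nth (\<Sum>j<m. Sf i j * Gf j) t"
          unfolding fps_sum_nth fps_mult_nth using t Gn by (intro sum.cong refl) (auto simp: Gt_def)
        finally show ?thesis unfolding SG[OF i] using Un[OF i t] by simp
      qed
      have "(\<Sum>i<m. \<Sum>t\<le>k. (cmod ((deriv ^^ t) (F i) 0 / fact t))\<^sup>2 * r ^ (2*t)) \<le> (\<Sum>i<m. \<Sum>t\<le>k. (cmod (g t $$ (i,0)))\<^sup>2 * r ^ (2*t))"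
      proof (rule bessel_disc_aux[where g="\<lambda>i t. g t $$ (i,0)", OF r(1) R(1)])
        show "F i holomorphic_on ball 0 R" if "i < m" for i
          unfolding F_def using that by (intro holomorphic_intros s(1)) auto
        show "(\<Sum>i<m. (cmod (F i w))\<^sup>2) \<le> (\<Sum>i<m. (cmod (\<Sum>t\<le>k. g t $$ (i,0) * w ^ t))\<^sup>2)" if "cmod w < R" for w
          unfolding F_def by (rule s(2)[OF that])
      qed
      then show ?thesis using coeff by simp
    qed
    have "(\<Sum>i<m. \<Sum>t\<le>k. (cmod (u t $$ (i,0)))\<^sup>2 * 1 ^ (2*t)) \<le> (\<Sum>i<m. \<Sum>t\<le>k. (cmod (g t $$ (i,0)))\<^sup>2 * 1 ^ (2*t))"
    \<comment> \<open>The weights \<open>r ^ (2*t)\<close> disappear as the radius tends to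
      1.\<close>
    proof (rule tendsto_le[of "at_left (1::real)"])
      show "((\<lambda>r. \<Sum>i<m. \<Sum>t\<le>k. (cmod (g t $$ (i,0)))\<^sup>2 * r ^ (2*t)) \<longlongrightarrow> (\<Sum>i<m. \<Sum>t\<le>k. (cmod (g t $$ (i,0)))\<^sup>2 * 1 ^ (2*t))) (at_left 1)"
        "((\<lambda>r. \<Sum>i<m. \<Sum>t\<le>k. (cmod (u t $$ (i,0)))\<^sup>2 * r ^ (2*t)) \<longlongrightarrow> (\<Sum>i<m. \<Sum>t\<le>k. (cmod (u t $$ (i,0)))\<^sup>2 * 1 ^ (2*t))) (at_left 1)"
        by (intro tendsto_intros)+
      show "\<forall>\<^sub>F r in at_left 1. (\<Sum>i<m. \<Sum>t\<le>k. (cmod (u t $$ (i,0)))\<^sup>2 * r ^ (2*t)) \<le> (\<Sum>i<m. \<Sum>t\<le>k. (cmod (g t $$ (i,0)))\<^sup>2 * r ^ (2*t))"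
        using eventually_at_left_real[of 0 1] by (auto elim!: eventually_mono intro!: ineq)
    qed simp
    then have "(\<Sum>t\<le>k. nrm (u t)) \<le> (\<Sum>t\<le>k. nrm (g t))"
      unfolding nrm_vec_sum[OF gu(1)] nrm_vec_sum[OF gu(2)] by (subst (1 2) sum.swap) simp
    moreover have "nrm (g t) - nrm (u t) = Re (qf J (h t)) - Re (qf J (y t))" for t
      unfolding g_def u_def P_def Q_def by (rule PG_nrm[OF sig hc yc])
    then have "(\<Sum>t\<le>k. nrm (g t)) - (\<Sum>t\<le>k. nrm (u t)) = (\<Sum>t\<le>k. Re (qf J (h t))) - (\<Sum>t\<le>k. Re (qf J (y t)))"
      by (simp flip: sum_subtractf)
    moreover have "Re (qf (J_blk m J k) v) = (\<Sum>t\<le>k. Re (qf J (h t)))" "Re (qf (J_blk m J k) (S_blk m A k * v)) = (\<Sum>t\<le>k. Re (qf J (y t)))"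
      using qf_J_blk_sum[OF Jc, of v k] qf_J_blk_sum[OF Jc, of "S_blk m A k * v" k] v Sv
      by (simp_all add: h_def y_def N_def lessThan_Suc_atMost)
    ultimately show ?thesis by linarith
  qed
  then show ?thesis unfolding Q_mat_def A_def[symmetric] psd_minus_conj_iff[OF JN Sc] by blast
qed

text \<open>Removing a sparse set keeps the disc connected, so the Taylor coefficients at 0
  determine a function off its poles.\<close>

lemma PJ0_identity:
  assumes f: "PJ0 m J f" and g: "PJ0 m J g" and eq: "\<And>k. taylor0 m f k = taylor0 m g k"
  shows "mero_eq f g"
proof -
  obtain S where S: "mero_disc m f S" "0 \<notin> S" using f unfolding PJ0_def by blast
  obtain S' where S': "mero_disc m g S'" "0 \<notin> S'" using g unfolding PJ0_def by blast
  have sp: "S \<union> S' sparse_in DD" using sparse_in_union'[OF mero_disc_sparse[OF S(1)] mero_disc_sparse[OF S'(1)]] .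
  have op: "open (DD - (S \<union> S'))" using open_diff_sparse_pts[OF open_ball sp] .
  have cn: "connected (DD - (S \<union> S'))" by (rule sparse_imp_connected[OF _ connected_ball open_ball sp]) simp
  have "f w $$ (i,j) = g w $$ (i,j)" if w: "w \<in> DD - (S \<union> S')" and ij: "i < m" "j < m" for w i j
  proof (rule holomorphic_fun_eq_on_connected[OF _ _ op cn _ _ w])
    show "(\<lambda>w. f w $$ (i,j)) holomorphic_on (DD - (S \<union> S'))" "(\<lambda>w. g w $$ (i,j)) holomorphic_on (DD - (S \<union> S'))"
      using S S' ij unfolding mero_disc_def by (auto elim!: holomorphic_on_subset)
    show "(0::complex) \<in> DD - (S \<union> S')" using S S' by simp
    fix n show "(deriv ^^ n) (\<lambda>w. f w $$ (i,j)) 0 = (deriv ^^ n) (\<lambda>w. g w $$ (i,j)) 0"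
      using arg_cong[OF eq[of n], of "\<lambda>X. X $$ (i,j)"] ij by (simp add: taylor0_def)
  qed
  moreover have "f w \<in> carrier_mat m m" "g w \<in> carrier_mat m m" if "w \<in> DD - (S \<union> S')" for w
    using S S' that by (auto simp: mero_disc_def)
  ultimately have "\<forall>w\<in>DD - (S \<union> S'). f w = g w" by (metis carrier_matD eq_matI)
  moreover have "\<forall>z\<in>DD. \<not> z islimpt (S \<union> S')" using S S' by (simp add: mero_disc_def islimpt_Un)
  ultimately show ?thesis unfolding mero_eq_def by blast
qed

section \<open>Boundary values of Blaschke--Potapov products\<close>

lemma adj_J_mult_index:
  assumes "X \<in> carrier_mat m m" "J \<in> carrier_mat m m" "i < m" "j < m"
  shows "(adj X * J * X) $$ (i,j) = (\<Sum>b<m. (\<Sum>a<m. cnj (X $$ (a,i)) * J $$ (a,b)) * X $$ (b,j))"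
proof -
  have "(adj X * J * X) $$ (i,j) = (\<Sum>b<m. (adj X * J) $$ (i,b) * X $$ (b,j))"
    using assms by (simp add: scalar_prod_def atLeast0LessThan adj_def)
  also have "\<dots> = (\<Sum>b<m. (\<Sum>a<m. cnj (X $$ (a,i)) * J $$ (a,b)) * X $$ (b,j))"
    using assms by (intro sum.cong refl arg_cong2[where f="(*)"]) (auto simp: scalar_prod_def atLeast0LessThan adj_def)
  finally show ?thesis .
qed

lemma adj_J_mult_tendsto:
  assumes J: "J \<in> carrier_mat m m" and X: "\<forall>\<^sub>F w in F. X w \<in> carrier_mat m m" and L: "L \<in> carrier_mat m m"
    and lim: "\<And>i j. i < m \<Longrightarrow> j < m \<Longrightarrow> ((\<lambda>w. X w $$ (i,j)) \<longlongrightarrow> L $$ (i,j)) F" and ij: "i < m" "j < m"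
  shows "((\<lambda>w. (adj (X w) * J * X w) $$ (i,j)) \<longlongrightarrow> (adj L * J * L) $$ (i,j)) F"
proof -
  have "((\<lambda>w. \<Sum>b<m. (\<Sum>a<m. cnj (X w $$ (a,i)) * J $$ (a,b)) * X w $$ (b,j))
      \<longlongrightarrow> (\<Sum>b<m. (\<Sum>a<m. cnj (L $$ (a,i)) * J $$ (a,b)) * L $$ (b,j))) F"
    using ij by (intro tendsto_intros lim) auto
  moreover have "\<forall>\<^sub>F w in F. (\<Sum>b<m. (\<Sum>a<m. cnj (X w $$ (a,i)) * J $$ (a,b)) * X w $$ (b,j)) = (adj (X w) * J * X w) $$ (i,j)"
    using X by eventually_elim (simp add: adj_J_mult_index[OF _ J ij])
  ultimately show ?thesis unfolding adj_J_mult_index[OF L J ij] by (rule Lim_transform_eventually)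
qed

text \<open>Contractivity is a closed condition. This gives it at points where a function is
  recovered as a limit.\<close>

lemma J_contractive_limit:
  assumes J: "J \<in> carrier_mat m m" and X: "\<forall>\<^sub>F w in F. X w \<in> carrier_mat m m" and L: "L \<in> carrier_mat m m"
    and lim: "\<And>i j. i < m \<Longrightarrow> j < m \<Longrightarrow> ((\<lambda>w. X w $$ (i,j)) \<longlongrightarrow> L $$ (i,j)) F"
    and con: "\<forall>\<^sub>F w in F. J_contractive J (X w)" and F: "F \<noteq> bot"
  shows "J_contractive J L"
proof -
  have dm: "dim_row (J - adj Y * J * Y) = m" "dim_col (J - adj Y * J * Y) = m" if "Y \<in> carrier_mat m m" for Y
    using that J by (auto simp: adj_def)
  have ix: "(J - adj Y * J * Y) $$ (i,j) = J $$ (i,j) - (adj Y * J * Y) $$ (i,j)" if "Y \<in> carrier_mat m m" "i < m" "j < m" for Y i j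
    using that J by (subst index_minus_mat(1)) (auto simp: adj_def)
  show ?thesis unfolding J_contractive_def psd_def Let_def dm[OF L]
  proof (intro conjI allI refl)
    fix v :: "nat \<Rightarrow> complex"
    define q where "q Y = (\<Sum>i<m. \<Sum>j<m. cnj (v i) * (J $$ (i,j) - (adj Y * J * Y) $$ (i,j)) * v j)" for Y
    have qe: "(\<Sum>i<m. \<Sum>j<m. cnj (v i) * (J - adj Y * J * Y) $$ (i,j) * v j) = q Y" if "Y \<in> carrier_mat m m" for Y
      unfolding q_def
    proof (intro sum.cong refl)
      fix i j assume "i \<in> {..<m}" "j \<in> {..<m}"
      then show "cnj (v i) * (J - adj Y * J * Y) $$ (i,j) * v j = cnj (v i) * (J $$ (i,j) - (adj Y * J * Y) $$ (i,j)) * v j"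
        using ix[OF that, of i j] by (metis lessThan_iff)
    qed
    have lq: "((\<lambda>w. q (X w)) \<longlongrightarrow> q L) F" unfolding q_def
    proof (intro tendsto_sum)
      fix i j assume "i \<in> {..<m}" "j \<in> {..<m}"
      then have "((\<lambda>w. (adj (X w) * J * X w) $$ (i,j)) \<longlongrightarrow> (adj L * J * L) $$ (i,j)) F"
        by (intro adj_J_mult_tendsto[OF J X L lim]) auto
      then show "((\<lambda>w. cnj (v i) * (J $$ (i,j) - (adj (X w) * J * X w) $$ (i,j)) * v j)
          \<longlongrightarrow> cnj (v i) * (J $$ (i,j) - (adj L * J * L) $$ (i,j)) * v j) F"
        by (rule tendsto_mult_right[OF tendsto_mult_left[OF tendsto_diff[OF tendsto_const]]])
    qed
    have ev: "\<forall>\<^sub>F w in F. Im (q (X w)) = 0 \<and> Re (q (X w)) \<ge> 0"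
      using X con
    proof eventually_elim
      case (elim w)
      then have "psd (J - adj (X w) * J * X w)" by (simp add: J_contractive_def)
      from this[unfolded psd_def Let_def dm[OF elim(1)], THEN conjunct2, rule_format, of v]
      show ?case unfolding qe[OF elim(1)] .
    qed
    have "((\<lambda>w. Im (q (X w))) \<longlongrightarrow> 0) F"
      by (rule tendsto_eventually) (use ev in \<open>eventually_elim, simp\<close>)
    then show "Im (\<Sum>i<m. \<Sum>j<m. cnj (v i) * (J - adj L * J * L) $$ (i,j) * v j) = 0"
      unfolding qe[OF L] using tendsto_unique[OF F tendsto_Im[OF lq]] by blast
    show "Re (\<Sum>i<m. \<Sum>j<m. cnj (v i) * (J - adj L * J * L) $$ (i,j) * v j) \<ge> 0"
      unfolding qe[OF L] by (rule tendsto_lowerbound[OF tendsto_Re[OF lq] _ F]) (use ev in \<open>eventually_elim, simp\<close>)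
  qed
qed

lemma J_unitary_mult:
  assumes "J \<in> carrier_mat m m" "X \<in> carrier_mat m m" "Y \<in> carrier_mat m m" "J_unitary J X" "J_unitary J Y"
  shows "J_unitary J (X * Y)"
proof -
  have "emb (adj X) * (emb J * (emb X * Z)) = emb J * Z" for Z
    using assms(4) unfolding J_unitary_iff_emb[OF assms(1,2)] by (metis mult.assoc)
  then show ?thesis using assms(5) unfolding J_unitary_iff_emb[OF assms(1,3)]
      J_unitary_iff_emb[OF assms(1) mult_carrier_mat[OF assms(2,3)]]
    using assms(1-3) by (simp add: adj_simps emb_ring mult.assoc)
qed

text \<open>Covers all elementary factors at once: \<open>d = 1\<close> for the idempotents of the
  first two kinds, where the condition on \<open>c\<close> reads \<open>cmod (1 + c) = 1\<close>,
  and \<open>d = 0\<close> for the nilpotents of the third kind, where it says that \<open>c\<close>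
  is imaginary.\<close>

lemma J_unitary_rank_perturbation:
  assumes sig: "signature_mat m J" and P: "P \<in> carrier_mat m m" and herm: "adj (J * P) = J * P"
    and PP: "P * P = d \<cdot>\<^sub>m P" and c: "c + cnj c + c * cnj c * d = 0"
  shows "J_unitary J (1\<^sub>m m + c \<cdot>\<^sub>m P)"
proof -
  have J: "J \<in> carrier_mat m m" "adj J = J" using sig by (auto simp: signature_mat_def)
  have PJ: "adj P * J = J * P" using herm J P by (simp add: adj_simps)
  have "adj P * J * P = J * (P * P)" unfolding PJ using J P by simp
  then have PJP: "adj P * J * P = d \<cdot>\<^sub>m (J * P)" unfolding PP mult_smult_distrib[OF J(1) P] .
  have aB: "adj (1\<^sub>m m + c \<cdot>\<^sub>m P) = 1\<^sub>m m + cnj c \<cdot>\<^sub>m adj P" using P by (auto simp: adj_def intro!: eq_matI)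
  have "adj (1\<^sub>m m + c \<cdot>\<^sub>m P) * J * (1\<^sub>m m + c \<cdot>\<^sub>m P) = J + (c + cnj c + c * cnj c * d) \<cdot>\<^sub>m (J * P)"
  proof -
    have aP: "adj P \<in> carrier_mat m m" using P by (auto simp: adj_def)
    have "(1\<^sub>m m + cnj c \<cdot>\<^sub>m adj P) * J = J + cnj c \<cdot>\<^sub>m (J * P)"
    proof -
      have "(1\<^sub>m m + cnj c \<cdot>\<^sub>m adj P) * J = 1\<^sub>m m * J + cnj c \<cdot>\<^sub>m adj P * J"
        using J aP by (intro add_mult_distrib_mat[of _ m m]) auto
      also have "cnj c \<cdot>\<^sub>m adj P * J = cnj c \<cdot>\<^sub>m (adj P * J)" using J aP by (intro mult_smult_assoc_mat[of _ m m])
      finally show ?thesis unfolding PJ using J by simp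
    qed
    moreover have "(J + cnj c \<cdot>\<^sub>m (J * P)) * (1\<^sub>m m + c \<cdot>\<^sub>m P) = (J + cnj c \<cdot>\<^sub>m (J * P)) + c \<cdot>\<^sub>m ((J + cnj c \<cdot>\<^sub>m (J * P)) * P)"
      using J P by (subst mult_add_distrib_mat[of _ m m]) auto
    moreover have "(J + cnj c \<cdot>\<^sub>m (J * P)) * P = J * P + (cnj c * d) \<cdot>\<^sub>m (J * P)"
    proof -
      have "(J + cnj c \<cdot>\<^sub>m (J * P)) * P = J * P + cnj c \<cdot>\<^sub>m (J * P) * P"
        using J P by (intro add_mult_distrib_mat[of _ m m]) auto
      also have "cnj c \<cdot>\<^sub>m (J * P) * P = cnj c \<cdot>\<^sub>m (J * P * P)" using J P by (intro mult_smult_assoc_mat[of _ m m]) auto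
      also have "\<dots> = (cnj c * d) \<cdot>\<^sub>m (J * P)" using PJP[unfolded PJ] by (auto intro!: eq_matI)
      finally show ?thesis .
    qed
    moreover have "(J + cnj c \<cdot>\<^sub>m (J * P)) + c \<cdot>\<^sub>m (J * P + (cnj c * d) \<cdot>\<^sub>m (J * P)) = J + (c + cnj c + c * cnj c * d) \<cdot>\<^sub>m (J * P)"
      using J P by (intro eq_matI) (auto simp: algebra_simps)
    ultimately show ?thesis unfolding aB by presburger
  qed
  also have "\<dots> = J" unfolding c using J P by (intro eq_matI) auto
  finally show ?thesis unfolding J_unitary_def .
qed

lemma cmod_b_fac_circle:
  assumes "cmod \<alpha> < 1" "cmod w = 1" shows "cmod (b_fac \<alpha> w) = 1"
proof -
  have w: "w * cnj w = 1" using assms(2) by (simp add: complex_norm_square[symmetric])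
  have "cmod (\<alpha> - w) = cmod (w * cnj (\<alpha> - w))" unfolding norm_mult complex_mod_cnj using assms by simp
  also have "w * cnj (\<alpha> - w) = - (1 - cnj \<alpha> * w)" using w by (simp add: algebra_simps)
  finally have e: "cmod (\<alpha> - w) = cmod (1 - cnj \<alpha> * w)" by (simp only: norm_minus_cancel)
  have "cnj \<alpha> * w \<noteq> 1" using assms by (metis complex_mod_cnj mult.right_neutral norm_mult norm_one order_less_irrefl)
  then show ?thesis using e assms by (auto simp: b_fac_def norm_mult norm_divide)
qed

lemma BP_factor_circle:
  assumes sig: "signature_mat m J" and b: "BP_factor m J b"
  shows "\<exists>E. finite E \<and> (\<forall>z. cmod z = 1 \<longrightarrow> z \<notin> E \<longrightarrow> J_unitary J (b z))"
proof -
  have J: "J \<in> carrier_mat m m" "adj J = J" using sig by (auto simp: signature_mat_def)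
  obtain U V Bt where UV: "U \<in> carrier_mat m m" "V \<in> carrier_mat m m" "J_unitary J U" "J_unitary J V"
    and el: "elem_factor m J Bt" and be: "b = (\<lambda>w. U * Bt w * V)" using b unfolding BP_factor_def by blast
  have "\<exists>E. finite E \<and> (\<forall>z. cmod z = 1 \<longrightarrow> z \<notin> E \<longrightarrow> Bt z \<in> carrier_mat m m \<and> J_unitary J (Bt z))"
    using el unfolding elem_factor_def
  proof (elim disjE exE conjE)
    fix \<alpha> P assume a: "cmod \<alpha> < 1" and P: "P \<in> carrier_mat m m" "psd (J * P)" "P * P = P"
      and Bt: "Bt = (\<lambda>w. 1\<^sub>m m + (b_fac \<alpha> w - 1) \<cdot>\<^sub>m P)"
    have h: "adj (J * P) = J * P" using psd_imp_hermitian[OF mult_carrier_mat[OF J(1) P(1)] P(2)] .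
    have "J_unitary J (Bt z)" if "cmod z = 1" for z unfolding Bt
    proof (rule J_unitary_rank_perturbation[OF sig P(1) h, of 1])
      have "b_fac \<alpha> z * cnj (b_fac \<alpha> z) = 1" using cmod_b_fac_circle[OF a that] by (simp add: complex_norm_square[symmetric])
      then show "b_fac \<alpha> z - 1 + cnj (b_fac \<alpha> z - 1) + (b_fac \<alpha> z - 1) * cnj (b_fac \<alpha> z - 1) * 1 = 0" by (simp add: algebra_simps)
    qed (use P in \<open>auto intro!: eq_matI\<close>)
    then show ?thesis using P Bt by (intro exI[of _ "{}"]) auto
  next
    fix \<alpha> P assume a: "cmod \<alpha> < 1" and P: "P \<in> carrier_mat m m" "psd (- (J * P))" "P * P = P"
      and Bt: "Bt = (\<lambda>w. 1\<^sub>m m + (1 / b_fac \<alpha> w - 1) \<cdot>\<^sub>m P)"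
    have "adj (- (J * P)) = - (J * P)" by (rule psd_imp_hermitian[OF _ P(2)]) (use J P in auto)
    then have "- adj (J * P) = - (J * P)" by (simp add: adj_simps)
    then have h: "adj (J * P) = J * P" by (metis uminus_uminus_mat)
    have "J_unitary J (Bt z)" if "cmod z = 1" for z unfolding Bt
    proof (rule J_unitary_rank_perturbation[OF sig P(1) h, of 1])
      have "cmod (1 / b_fac \<alpha> z) = 1" using cmod_b_fac_circle[OF a that] by (simp add: norm_divide)
      then have "1 / b_fac \<alpha> z * cnj (1 / b_fac \<alpha> z) = 1" unfolding complex_norm_square[symmetric] by simp
      then show "1 / b_fac \<alpha> z - 1 + cnj (1 / b_fac \<alpha> z - 1) + (1 / b_fac \<alpha> z - 1) * cnj (1 / b_fac \<alpha> z - 1) * 1 = 0"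
        by (simp add: algebra_simps)
    qed (use P in \<open>auto intro!: eq_matI\<close>)
    then show ?thesis using P Bt by (intro exI[of _ "{}"]) auto
  next
    fix u R assume u: "cmod u = 1" and R: "R \<in> carrier_mat m m" "psd (J * R)" "R * R = 0\<^sub>m m m"
      and Bt: "Bt = (\<lambda>w. 1\<^sub>m m - ((u + w) / (u - w)) \<cdot>\<^sub>m R)"
    have h: "adj (J * R) = J * R" using psd_imp_hermitian[OF mult_carrier_mat[OF J(1) R(1)] R(2)] .
    have "J_unitary J (Bt z)" if z: "cmod z = 1" "z \<noteq> u" for z
    proof -
      have Be: "Bt z = 1\<^sub>m m + (- ((u + z) / (u - z))) \<cdot>\<^sub>m R" unfolding Bt using R by (intro eq_matI) auto
      have uu: "u * cnj u = 1" "z * cnj z = 1" using z u by (simp_all add: complex_norm_square[symmetric])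
      have ne: "u - z \<noteq> 0" "cnj u - cnj z \<noteq> 0" using z by auto
      have "(u + z) * (cnj u - cnj z) + (cnj u + cnj z) * (u - z) = 0" using uu by (simp add: algebra_simps)
      then have sn: "(u + z) / (u - z) + (cnj u + cnj z) / (cnj u - cnj z) = 0" using ne by (simp add: add_frac_eq)
      define s where "s = (u + z) / (u - z)"
      have "s + cnj s = 0" using sn by (simp add: s_def)
      then have s0: "- s + cnj (- s) + (- s) * cnj (- s) * 0 = 0" by (simp add: add_eq_0_iff)
      have "R * R = 0 \<cdot>\<^sub>m R" using R by (auto intro!: eq_matI)
      then show ?thesis unfolding Be s_def[symmetric] by (rule J_unitary_rank_perturbation[OF sig R(1) h _ s0])
    qed
    then show ?thesis using R Bt by (intro exI[of _ "{u}"]) auto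
  qed
  then obtain E where E: "finite E" "\<And>z. cmod z = 1 \<Longrightarrow> z \<notin> E \<Longrightarrow> Bt z \<in> carrier_mat m m \<and> J_unitary J (Bt z)" by blast
  show ?thesis unfolding be using E UV J by (intro exI[of _ E]) (auto intro!: J_unitary_mult mult_carrier_mat)
qed

lemma BP_product_circle:
  assumes sig: "signature_mat m J" and F: "BP_product m J F"
  shows "\<exists>E. finite E \<and> (\<forall>z. cmod z = 1 \<longrightarrow> z \<notin> E \<longrightarrow> J_unitary J (F z))"
proof -
  have J: "J \<in> carrier_mat m m" "adj J = J" using sig by (auto simp: signature_mat_def)
  have "\<exists>E. finite E \<and> (\<forall>z. cmod z = 1 \<longrightarrow> z \<notin> E \<longrightarrow> foldr (\<lambda>b M. b z * M) Bs (1\<^sub>m m) \<in> carrier_mat m m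
      \<and> J_unitary J (foldr (\<lambda>b M. b z * M) Bs (1\<^sub>m m)))" if "\<forall>b\<in>set Bs. BP_factor m J b" for Bs
    using that
  proof (induction Bs)
    case Nil
    have "adj (1\<^sub>m m) * J * 1\<^sub>m m = J" using J by (simp add: adj_simps)
    then show ?case by (intro exI[of _ "{}"]) (auto simp: J_unitary_def)
  next
    case (Cons b Bs)
    obtain E1 where E1: "finite E1" "\<And>z. cmod z = 1 \<Longrightarrow> z \<notin> E1 \<Longrightarrow> foldr (\<lambda>b M. b z * M) Bs (1\<^sub>m m) \<in> carrier_mat m m
      \<and> J_unitary J (foldr (\<lambda>b M. b z * M) Bs (1\<^sub>m m))" using Cons by auto
    obtain E2 where E2: "finite E2" "\<And>z. cmod z = 1 \<Longrightarrow> z \<notin> E2 \<Longrightarrow> J_unitary J (b z)"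
      using BP_factor_circle[OF sig, of b] Cons.prems by auto
    have bc: "b z \<in> carrier_mat m m" for z using Cons.prems by (auto intro: BP_factor_carrier)
    show ?case using E1 E2 bc J by (intro exI[of _ "E1 \<union> E2"]) (auto intro!: J_unitary_mult mult_carrier_mat)
  qed
  note L = this
  show ?thesis using F unfolding BP_product_def
  proof (elim disjE exE conjE)
    fix Bs assume "\<forall>b\<in>set Bs. BP_factor m J b" "F = (\<lambda>w. foldr (\<lambda>b M. b w * M) Bs (1\<^sub>m m))"
    then show ?thesis using L[of Bs] by auto
  qed (auto intro: exI[of _ "{}"])
qed

section \<open>Rational functions of class PJ0\<close>

interpretation polyfun: function_algebra "\<lambda>f. \<exists>p. \<forall>w. f w = poly p w"
proof
  show "\<exists>p. \<forall>w::complex. c = poly p w" for c by (rule exI[of _ "[:c:]"]) simp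
  show "\<exists>p. \<forall>w. f w + g w = poly p w" if "\<exists>p. \<forall>w. f w = poly p w" "\<exists>p. \<forall>w. g w = poly p w" for f g :: "complex \<Rightarrow> complex"
    using that by (metis poly_add)
  show "\<exists>p. \<forall>w. f w * g w = poly p w" if "\<exists>p. \<forall>w. f w = poly p w" "\<exists>p. \<forall>w. g w = poly p w" for f g :: "complex \<Rightarrow> complex"
    using that by (metis poly_mult)
qed

text \<open>\<open>mero_disc\<close> admits only genuine poles as exceptional points, so zeros
  common to numerator and denominator have to be cancelled first.\<close>

lemma poly_fraction_reduce:
  fixes p q :: "'a::field poly"
  assumes "q \<noteq> 0"
  shows "\<exists>p' q'. q' \<noteq> 0 \<and> (\<forall>z. \<not> (poly p' z = 0 \<and> poly q' z = 0)) \<and> p * q' = p' * q"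
  using assms
proof (induction "degree q" arbitrary: p q rule: less_induct)
  case less
  show ?case
  proof (cases "\<exists>z. poly p z = 0 \<and> poly q z = 0")
    case True
    then obtain a p1 q1 where d: "p = [:-a, 1:] * p1" "q = [:-a, 1:] * q1" by (metis dvdE poly_eq_0_iff_dvd)
    have "q1 \<noteq> 0" using d less.prems by auto
    then have "degree q1 < degree q" unfolding d(2) by (subst degree_mult_eq) auto
    from less.hyps[OF this \<open>q1 \<noteq> 0\<close>] obtain p' q' where
      "q' \<noteq> 0" "\<forall>z. \<not> (poly p' z = 0 \<and> poly q' z = 0)" "p1 * q' = p' * q1" by blast
    moreover from this(3) have "[:-a, 1:] * p1 * q' = p' * ([:-a, 1:] * q1)" by (metis mult.assoc mult.left_commute)
    ultimately show ?thesis unfolding d by blast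
  next
    case False
    then show ?thesis using less.prems by blast
  qed
qed

lemma poly_fraction_bounded:
  fixes p q :: "complex poly"
  assumes "q \<noteq> 0"
  shows "\<exists>k B. \<forall>\<^sub>F w in at s. cmod ((w - s) ^ k * (poly p w / poly q w)) \<le> B"
proof -
  obtain r where r: "q = [:-s, 1:] ^ order s q * r" and rs: "\<not> [:-s, 1:] dvd r"
    using order_decomp[OF assms] by blast
  have "poly r s \<noteq> 0" using rs by (simp add: poly_eq_0_iff_dvd)
  then have "((\<lambda>w. poly p w / poly r w) \<longlongrightarrow> poly p s / poly r s) (at s)" by (intro tendsto_intros)
  then have "((\<lambda>w. cmod (poly p w / poly r w)) \<longlongrightarrow> cmod (poly p s / poly r s)) (at s)" by (rule tendsto_norm)
  then have "\<forall>\<^sub>F w in at s. cmod (poly p w / poly r w) < cmod (poly p s / poly r s) + 1"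
    by (rule order_tendstoD) simp
  moreover have "\<forall>\<^sub>F w in at s. w \<noteq> s" by (simp add: eventually_at_filter)
  ultimately have "\<forall>\<^sub>F w in at s. cmod ((w - s) ^ order s q * (poly p w / poly q w)) \<le> cmod (poly p s / poly r s) + 1"
  proof eventually_elim
    case (elim w)
    have "poly q w = (w - s) ^ order s q * poly r w" by (subst r) (simp add: poly_power)
    then have "(w - s) ^ order s q * (poly p w / poly q w) = poly p w / poly r w" using elim by simp
    then show ?case using elim by simp
  qed
  then show ?thesis by blast
qed

lemma poly_fraction_pole:
  fixes p q :: "complex poly"
  assumes "q \<noteq> 0" "poly q s = 0" "poly p s \<noteq> 0"
  shows "filterlim (\<lambda>w. cmod (poly p w / poly q w)) at_top (at s)"
proof -
  have "\<forall>\<^sub>F w in at s. w \<notin> {w. poly q w = 0}"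
    using poly_roots_finite[OF assms(1)] islimpt_finite islimpt_iff_eventually by blast
  then have "filterlim (poly q) (at 0) (at s)"
    using assms(2) by (auto simp: filterlim_at intro: tendsto_eq_intros)
  moreover have "(poly p \<longlongrightarrow> poly p s) (at s)" by (intro tendsto_intros)
  ultimately have "filterlim (\<lambda>w. poly p w / poly q w) at_infinity (at s)"
    using assms(3) by (intro filterlim_divide_at_infinity)
  then show ?thesis by (rule filterlim_at_infinity_imp_norm_at_top)
qed

lemma mat_norm1_entry: "X \<in> carrier_mat m m \<Longrightarrow> i < m \<Longrightarrow> j < m \<Longrightarrow> cmod (X $$ (i,j)) \<le> mat_norm1 X"
proof -
  assume X: "X \<in> carrier_mat m m" "i < m" "j < m"
  have "cmod (X $$ (i,j)) \<le> (\<Sum>j<m. cmod (X $$ (i,j)))"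
    using X by (intro member_le_sum[of j "{..<m}" "\<lambda>j. cmod (X $$ (i,j))"]) auto
  also have "\<dots> \<le> (\<Sum>i<m. \<Sum>j<m. cmod (X $$ (i,j)))"
    using X by (intro member_le_sum[of i "{..<m}" "\<lambda>i. \<Sum>j<m. cmod (X $$ (i,j))"]) (auto intro: sum_nonneg)
  finally show ?thesis using X by (simp add: mat_norm1_def)
qed

text \<open>The given set \<open>E\<close> may contain removable points, at which
  \<open>mero_disc\<close> would fail. After reduction of the entries the exceptional set shrinks to
  the zeros of the denominators, and contractivity at the recovered points follows by
  continuity.\<close>

lemma rational_contractive_PJ0:
  assumes sig: "signature_mat m J" and E: "finite E"
    and f0: "\<And>w. w \<notin> E \<Longrightarrow> f0 w \<in> carrier_mat m m"
    and rat: "\<And>i j. i < m \<Longrightarrow> j < m \<Longrightarrow> \<exists>p q :: complex poly. q \<noteq> 0 \<and> (\<forall>w. w \<notin> E \<longrightarrow> poly q w \<noteq> 0 \<and> f0 w $$ (i,j) = poly p w / poly q w)"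
    and con: "\<And>w. w \<in> DD - E \<Longrightarrow> J_contractive J (f0 w)" and E0: "0 \<notin> E"
  shows "\<exists>f. PJ0 m J f \<and> (\<forall>w. w \<notin> E \<longrightarrow> f w = f0 w) \<and>
    (\<forall>i<m. \<forall>j<m. \<exists>p q :: complex poly. q \<noteq> 0 \<and> (\<forall>w. f w $$ (i,j) = poly p w / poly q w))"
proof -
  have J: "J \<in> carrier_mat m m" using sig by (simp add: signature_mat_def)
  have ex: "\<exists>p q :: complex poly. q \<noteq> 0 \<and> (\<forall>z. \<not> (poly p z = 0 \<and> poly q z = 0)) \<and>
      (\<forall>w. w \<notin> E \<longrightarrow> poly q w \<noteq> 0 \<and> f0 w $$ (i,j) = poly p w / poly q w)" if ij: "i < m" "j < m" for i j
  proof -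
    obtain p q :: "complex poly" where pq: "q \<noteq> 0" "\<And>w. w \<notin> E \<Longrightarrow> poly q w \<noteq> 0" "\<And>w. w \<notin> E \<Longrightarrow> f0 w $$ (i,j) = poly p w / poly q w"
      using rat[OF ij] by blast
    obtain p' q' where r: "q' \<noteq> 0" "\<And>z. \<not> (poly p' z = 0 \<and> poly q' z = 0)" "p * q' = p' * q"
      using poly_fraction_reduce[OF pq(1)] by blast
    have e: "poly p w * poly q' w = poly p' w * poly q w" for w using r(3) by (metis poly_mult)
    have "poly q' w \<noteq> 0" if "w \<notin> E" for w using pq(2)[OF that] r(2)[of w] e[of w] by auto
    then show ?thesis using r pq e by (intro exI[of _ p'] exI[of _ q']) (auto simp: frac_eq_eq)
  qed
  obtain p q :: "nat \<Rightarrow> nat \<Rightarrow> complex poly" where q0: "\<And>i j. i < m \<Longrightarrow> j < m \<Longrightarrow> q i j \<noteq> 0"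
    and cop: "\<And>i j z. i < m \<Longrightarrow> j < m \<Longrightarrow> poly (q i j) z = 0 \<Longrightarrow> poly (p i j) z \<noteq> 0"
    and qE: "\<And>i j w. i < m \<Longrightarrow> j < m \<Longrightarrow> w \<notin> E \<Longrightarrow> poly (q i j) w \<noteq> 0"
    and f0e: "\<And>i j w. i < m \<Longrightarrow> j < m \<Longrightarrow> w \<notin> E \<Longrightarrow> f0 w $$ (i,j) = poly (p i j) w / poly (q i j) w"
  proof -
    assume *: "\<And>q p. (\<And>i j. i < m \<Longrightarrow> j < m \<Longrightarrow> q i j \<noteq> 0) \<Longrightarrow>
      (\<And>i j z. i < m \<Longrightarrow> j < m \<Longrightarrow> poly (q i j) z = 0 \<Longrightarrow> poly (p i j) z \<noteq> 0) \<Longrightarrow>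
      (\<And>i j w. i < m \<Longrightarrow> j < m \<Longrightarrow> w \<notin> E \<Longrightarrow> poly (q i j) w \<noteq> 0) \<Longrightarrow>
      (\<And>i j w. i < m \<Longrightarrow> j < m \<Longrightarrow> w \<notin> E \<Longrightarrow> f0 w $$ (i,j) = poly (p i j) w / poly (q i j) w) \<Longrightarrow> thesis"
    define R where "R i j p q \<longleftrightarrow> q \<noteq> 0 \<and> (\<forall>z. \<not> (poly p z = 0 \<and> poly q z = 0)) \<and>
      (\<forall>w. w \<notin> E \<longrightarrow> poly q w \<noteq> 0 \<and> f0 w $$ (i,j) = poly p w / poly q w)" for i j and p q :: "complex poly"
    have "\<forall>i j. \<exists>p q. i < m \<longrightarrow> j < m \<longrightarrow> R i j p q" using ex unfolding R_def by blast
    then obtain p q where "\<forall>i j. i < m \<longrightarrow> j < m \<longrightarrow> R i j (p i j) (q i j)" by metis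
    then show thesis unfolding R_def by (intro *[of q p]) blast+
  qed
  define f where "f w = mat m m (\<lambda>(i,j). poly (p i j) w / poly (q i j) w)" for w
  have fi: "f w $$ (i,j) = poly (p i j) w / poly (q i j) w" if "i < m" "j < m" for w i j using that by (simp add: f_def)
  have fc: "f w \<in> carrier_mat m m" for w by (simp add: f_def)
  have ff0: "f w = f0 w" if "w \<notin> E" for w
    using f0[OF that] f0e[OF _ _ that] fi fc[of w] by (intro eq_matI) auto
  define S where "S = {z\<in>DD. \<exists>i<m. \<exists>j<m. poly (q i j) z = 0}"
  have "S \<subseteq> E" using qE by (auto simp: S_def)
  then have Sf: "finite S" and S0: "0 \<notin> S" using E E0 finite_subset by auto
  have "PJ0 m J f" unfolding PJ0_def
  proof (intro exI[of _ S] conjI ballI S0)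
    show "mero_disc m f S" unfolding mero_disc_def
    proof (intro conjI ballI allI impI)
      show "S \<subseteq> DD" by (auto simp: S_def)
      show "\<not> z islimpt S" for z using Sf by (rule islimpt_finite)
      show "f w \<in> carrier_mat m m" for w by (rule fc)
      show "(\<lambda>w. f w $$ (i,j)) holomorphic_on (DD - S)" if "i < m" "j < m" for i j
        unfolding fi[OF that] using that by (intro holomorphic_intros) (auto simp: S_def)
      show "\<exists>k B. \<forall>\<^sub>F w in at s. cmod ((w - s) ^ k * f w $$ (i,j)) \<le> B" if "i < m" "j < m" for i j s
        unfolding fi[OF that] by (rule poly_fraction_bounded[OF q0[OF that]])
      fix s assume "s \<in> S"
      then obtain i j where ij: "i < m" "j < m" "poly (q i j) s = 0" by (auto simp: S_def)
      have "filterlim (\<lambda>w. cmod (f w $$ (i,j))) at_top (at s)" unfolding fi[OF ij(1,2)]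
        by (rule poly_fraction_pole[OF q0[OF ij(1,2)] ij(3) cop[OF ij]])
      then show "filterlim (\<lambda>w. mat_norm1 (f w)) at_top (at s)"
        by (rule filterlim_at_top_mono) (auto intro!: always_eventually mat_norm1_entry[OF fc ij(1,2)])
    qed
    fix w assume w: "w \<in> DD - S"
    have near: "\<forall>\<^sub>F z in at w. z \<in> DD - E"
    proof -
      have "\<forall>\<^sub>F z in at w. z \<in> DD" using w by (intro eventually_at_in_open') auto
      moreover have "\<forall>\<^sub>F z in at w. z \<notin> E" using islimpt_finite[OF E] islimpt_iff_eventually by blast
      ultimately show ?thesis by eventually_elim auto
    qed
    show "J_contractive J (f w)"
    proof (rule J_contractive_limit[OF J _ fc])
      show "\<forall>\<^sub>F z in at w. f z \<in> carrier_mat m m" by (simp add: fc)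
      show "((\<lambda>z. f z $$ (i,j)) \<longlongrightarrow> f w $$ (i,j)) (at w)" if "i < m" "j < m" for i j
        unfolding fi[OF that] using w that by (intro tendsto_intros) (auto simp: S_def)
      show "\<forall>\<^sub>F z in at w. J_contractive J (f z)" using near by eventually_elim (use ff0 con in auto)
    qed simp
  qed
  moreover have "\<exists>p q :: complex poly. q \<noteq> 0 \<and> (\<forall>w. f w $$ (i,j) = poly p w / poly q w)" if "i < m" "j < m" for i j
    using fi[OF that] q0[OF that] by blast
  ultimately show ?thesis using ff0 by blast
qed

text \<open>Cramer's rule for the state equation: all entries share the denominator
  \<open>det (1 - w A)\<close>, which is 1 at the origin.\<close>

lemma colligation_rational:
  assumes "colligation m J N A B C D"
  shows "\<exists>(q :: complex poly) X. q \<noteq> 0 \<and> poly q 0 \<noteq> 0 \<and> (\<forall>w. X w \<in> carrier_mat N m) \<and>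
    (\<forall>w. poly q w \<noteq> 0 \<longrightarrow> (1\<^sub>m N - w \<cdot>\<^sub>m A) * X w = B) \<and>
    (\<forall>i<N. \<forall>j<m. \<exists>p. \<forall>w. X w $$ (i,j) = poly p w / poly q w) \<and>
    (\<forall>i<m. \<forall>j<m. \<exists>p. \<forall>w. poly q w \<noteq> 0 \<longrightarrow> (D + w \<cdot>\<^sub>m (C * X w)) $$ (i,j) = poly p w / poly q w)"
proof -
  have c: "A \<in> carrier_mat N N" "B \<in> carrier_mat N m" "C \<in> carrier_mat m N" "D \<in> carrier_mat m m"
    using assms by (auto simp: colligation_def)
  define M where "M w = 1\<^sub>m N + (- w) \<cdot>\<^sub>m A" for w
  have Me: "1\<^sub>m N - w \<cdot>\<^sub>m A = M w" for w unfolding M_def using c by (intro eq_matI) auto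
  have negw: "\<exists>p. \<forall>w::complex. - w = poly p w" by (rule exI[of _ "[:0, -1:]"]) simp
  have idw: "\<exists>p. \<forall>w::complex. w = poly p w" by (rule exI[of _ "[:0, 1:]"]) simp
  have MM: "polyfun.mat_fun N N M" unfolding M_def
    by (intro polyfun.mat_fun_add polyfun.mat_fun_smult polyfun.mat_fun_const c negw) auto
  obtain q where q: "\<And>w. det (M w) = poly q w" using polyfun.det[OF MM] by blast
  have "M 0 = 1\<^sub>m N" unfolding M_def using c by (intro eq_matI) auto
  then have q0: "poly q 0 \<noteq> 0" using q[of 0] by simp
  define X where "X w = (1 / poly q w) \<cdot>\<^sub>m (adj_mat (M w) * B)" for w
  have Mc: "M w \<in> carrier_mat N N" for w by (rule polyfun.mat_funD(1)[OF MM])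
  note ad = adj_mat[OF Mc]
  have AB: "polyfun.mat_fun N m (\<lambda>w. adj_mat (M w) * B)"
    by (rule polyfun.mat_fun_mult[OF polyfun.mat_fun_adj_mat[OF MM] polyfun.mat_fun_const[OF c(2)]])
  have CAB: "polyfun.mat_fun m m (\<lambda>w. C * (adj_mat (M w) * B))"
    by (rule polyfun.mat_fun_mult[OF polyfun.mat_fun_const[OF c(3)] AB])
  have QQ: "polyfun.mat_fun m m (\<lambda>w. poly q w \<cdot>\<^sub>m D + w \<cdot>\<^sub>m (C * (adj_mat (M w) * B)))"
    by (intro polyfun.mat_fun_add polyfun.mat_fun_smult CAB polyfun.mat_fun_const c idw) auto
  show ?thesis
  proof (rule exI[of _ q], rule exI[of _ X], intro conjI allI impI)
    show "q \<noteq> 0" "poly q 0 \<noteq> 0" using q0 by auto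
    show "X w \<in> carrier_mat N m" for w unfolding X_def using polyfun.mat_funD(1)[OF AB, of w] by simp
    show "(1\<^sub>m N - w \<cdot>\<^sub>m A) * X w = B" if "poly q w \<noteq> 0" for w
    proof -
      have "M w * X w = (1 / poly q w) \<cdot>\<^sub>m (M w * (adj_mat (M w) * B))"
        unfolding X_def by (rule mult_smult_distrib[OF Mc polyfun.mat_funD(1)[OF AB]])
      also have "M w * (adj_mat (M w) * B) = (M w * adj_mat (M w)) * B"
        using Mc ad c by (intro assoc_mult_mat[symmetric, of _ N N _ N]) auto
      also have "\<dots> = poly q w \<cdot>\<^sub>m B" unfolding ad(2) q using c by (simp add: mult_smult_assoc_mat[of _ N N])
      finally show ?thesis unfolding Me using that c by (auto intro!: eq_matI)
    qed
    show "\<exists>p. \<forall>w. X w $$ (i,j) = poly p w / poly q w" if ij: "i < N" "j < m" for i j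
    proof -
      obtain p where "\<And>w. (adj_mat (M w) * B) $$ (i,j) = poly p w" using polyfun.mat_funD(2)[OF AB ij] by blast
      moreover have "X w $$ (i,j) = (adj_mat (M w) * B) $$ (i,j) / poly q w" for w
        unfolding X_def using polyfun.mat_funD(1)[OF AB, of w] ij by (subst index_smult_mat(1)) auto
      ultimately show ?thesis by auto
    qed
    show "\<exists>p. \<forall>w. poly q w \<noteq> 0 \<longrightarrow> (D + w \<cdot>\<^sub>m (C * X w)) $$ (i,j) = poly p w / poly q w" if ij: "i < m" "j < m" for i j
    proof -
      obtain p where p: "\<And>w. (poly q w \<cdot>\<^sub>m D + w \<cdot>\<^sub>m (C * (adj_mat (M w) * B))) $$ (i,j) = poly p w"
        using polyfun.mat_funD(2)[OF QQ ij] by blast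
      have "(D + w \<cdot>\<^sub>m (C * X w)) $$ (i,j) = poly p w / poly q w" if w: "poly q w \<noteq> 0" for w
      proof -
        define Y where "Y = C * (adj_mat (M w) * B)"
        have Y: "Y \<in> carrier_mat m m" using polyfun.mat_funD(1)[OF CAB, of w] by (simp add: Y_def)
        have "C * X w = (1 / poly q w) \<cdot>\<^sub>m Y"
          unfolding X_def Y_def by (rule mult_smult_distrib[OF c(3) polyfun.mat_funD(1)[OF AB]])
        then have "(D + w \<cdot>\<^sub>m (C * X w)) $$ (i,j) = D $$ (i,j) + w * (1 / poly q w * Y $$ (i,j))"
          using Y c \<open>i < m\<close> \<open>j < m\<close> by simp
        moreover have "poly p w = poly q w * D $$ (i,j) + w * Y $$ (i,j)"
          unfolding p[symmetric] Y_def[symmetric] using Y c \<open>i < m\<close> \<open>j < m\<close> by simp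
        ultimately show ?thesis using w by (simp add: field_simps)
      qed
      then show ?thesis by blast
    qed
  qed
qed

lemma eventually_not_in_finite: "finite E \<Longrightarrow> \<forall>\<^sub>F w in at (z::complex). w \<notin> E"
  using islimpt_finite islimpt_iff_eventually by blast

text \<open>A single realisation provides the membership in \<open>PJ0\<close>, the factorisation
  and the Taylor data. Rationality is recorded so that identities in the disc can be carried to the
  plane.\<close>

lemma rational_interpolant:
  assumes sig: "signature_mat m J" and A: "\<And>j. j \<le> n \<Longrightarrow> A j \<in> carrier_mat m m" and psd: "psd (Q_mat m J A n)"
  shows "\<exists>f F E. PJ0 m J f \<and> (\<forall>j\<le>n. taylor0 m f j = A j) \<and> BP_product m J F \<and> finite E \<and>
    (\<forall>w. w \<notin> E \<longrightarrow> F w = f w) \<and>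
    (\<forall>i<m. \<forall>j<m. \<exists>p q :: complex poly. q \<noteq> 0 \<and> (\<forall>w. f w $$ (i,j) = poly p w / poly q w))"
proof -
  interpret ts: toeplitz_shift m n J A by unfold_locales (use sig A in auto)
  obtain A' B C D Kn where col: "colligation m J ts.N A' B C D" and Kn: "Kn \<in> carrier_mat m ts.N"
    and tay: "\<And>z X i l. X \<in> carrier_mat ts.N m \<Longrightarrow> (1\<^sub>m ts.N - z \<cdot>\<^sub>m A') * X = B \<Longrightarrow> i < m \<Longrightarrow> l < m \<Longrightarrow>
      (D + z \<cdot>\<^sub>m (C * X)) $$ (i,l) = (\<Sum>k\<le>n. z ^ k * A k $$ (i,l)) + z ^ Suc n * (Kn * X) $$ (i,l)"
    using ts.interpolating_colligation[unfolded ts.Q_def, OF psd] by blast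
  have c: "C \<in> carrier_mat m ts.N" "D \<in> carrier_mat m m" using col by (auto simp: colligation_def)
  obtain q X where qX: "q \<noteq> 0 \<and> poly q 0 \<noteq> 0 \<and> (\<forall>w. X w \<in> carrier_mat ts.N m) \<and>
    (\<forall>w. poly q w \<noteq> 0 \<longrightarrow> (1\<^sub>m ts.N - w \<cdot>\<^sub>m A') * X w = B) \<and>
    (\<forall>i<ts.N. \<forall>j<m. \<exists>p. \<forall>w. X w $$ (i,j) = poly p w / poly q w) \<and>
    (\<forall>i<m. \<forall>j<m. \<exists>p. \<forall>w. poly q w \<noteq> 0 \<longrightarrow> (D + w \<cdot>\<^sub>m (C * X w)) $$ (i,j) = poly p w / poly q w)"
    using colligation_rational[OF col] by (elim exE) (rule that)
  then have q: "q \<noteq> 0" "poly q 0 \<noteq> 0" and X: "\<And>w. X w \<in> carrier_mat ts.N m"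
    and eq: "\<And>w. poly q w \<noteq> 0 \<Longrightarrow> (1\<^sub>m ts.N - w \<cdot>\<^sub>m A') * X w = B"
    and Xr: "\<And>i j. i < ts.N \<Longrightarrow> j < m \<Longrightarrow> \<exists>p. \<forall>w. X w $$ (i,j) = poly p w / poly q w"
    and rat: "\<And>i j. i < m \<Longrightarrow> j < m \<Longrightarrow> \<exists>p. \<forall>w. poly q w \<noteq> 0 \<longrightarrow> (D + w \<cdot>\<^sub>m (C * X w)) $$ (i,j) = poly p w / poly q w"
    by blast+
  define E where "E = {w. poly q w = 0}"
  have E: "finite E" "0 \<notin> E" using poly_roots_finite[OF q(1)] q(2) by (auto simp: E_def)
  define f0 where "f0 w = D + w \<cdot>\<^sub>m (C * X w)" for w
  have f0c: "f0 w \<in> carrier_mat m m" for w using c X[of w] by (auto simp: f0_def)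
  have R: "\<exists>p q :: complex poly. q \<noteq> 0 \<and> (\<forall>w. w \<notin> E \<longrightarrow> poly q w \<noteq> 0 \<and> f0 w $$ (i,j) = poly p w / poly q w)" if "i < m" "j < m" for i j
    using rat[OF that] q(1) unfolding E_def f0_def by blast
  have Jc: "J_contractive J (f0 w)" if "w \<in> DD - E" for w unfolding f0_def
    by (rule colligation_contractive[OF sig col _ X eq]) (use that in \<open>auto simp: E_def\<close>)
  have "\<exists>f. PJ0 m J f \<and> (\<forall>w. w \<notin> E \<longrightarrow> f w = f0 w) \<and>
    (\<forall>i<m. \<forall>j<m. \<exists>p q :: complex poly. q \<noteq> 0 \<and> (\<forall>w. f w $$ (i,j) = poly p w / poly q w))" (is "\<exists>f. ?P f")
    by (rule rational_contractive_PJ0[OF sig E(1) f0c R Jc E(2)])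
  then obtain f where fp: "?P f" ..
  then have f: "PJ0 m J f" and ff: "\<And>w. w \<notin> E \<Longrightarrow> f w = f0 w"
    and fr: "\<And>i j. i < m \<Longrightarrow> j < m \<Longrightarrow> \<exists>p q :: complex poly. q \<noteq> 0 \<and> (\<forall>w. f w $$ (i,j) = poly p w / poly q w)"
    by blast+
  obtain F E2 where F: "BP_product m J F" "finite E2"
    and Fe: "\<And>z X. z \<notin> E2 \<Longrightarrow> X \<in> carrier_mat ts.N m \<Longrightarrow> (1\<^sub>m ts.N - z \<cdot>\<^sub>m A') * X = B \<Longrightarrow> F z = D + z \<cdot>\<^sub>m (C * X)"
    using colligation_BP_product[OF sig col] by blast
  have "taylor0 m f j = A j" if j: "j \<le> n" for j
  proof (rule eq_matI)
    fix i l assume "i < dim_row (A j)" "l < dim_col (A j)"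
    then have il: "i < m" "l < m" using A[OF j] by auto
    have "\<exists>P. \<forall>w. (Kn * X w) $$ (i,l) = poly P w / poly q w"
    proof -
      have "\<forall>p. \<exists>P. p < ts.N \<longrightarrow> (\<forall>w. X w $$ (p,l) = poly P w / poly q w)" using Xr il by blast
      then obtain P where P: "\<And>p w. p < ts.N \<Longrightarrow> X w $$ (p,l) = poly (P p) w / poly q w" by metis
      have "(Kn * X w) $$ (i,l) = poly (\<Sum>p<ts.N. [:Kn $$ (i,p):] * P p) w / poly q w" for w
      proof -
        have "(Kn * X w) $$ (i,l) = (\<Sum>p<ts.N. Kn $$ (i,p) * X w $$ (p,l))"
          using il Kn X[of w] by (simp add: scalar_prod_def atLeast0LessThan)
        also have "\<dots> = (\<Sum>p<ts.N. Kn $$ (i,p) * (poly (P p) w / poly q w))" by (intro sum.cong refl) (simp add: P)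
        also have "\<dots> = poly (\<Sum>p<ts.N. [:Kn $$ (i,p):] * P p) w / poly q w" by (simp add: poly_sum sum_divide_distrib)
        finally show ?thesis .
      qed
      then show ?thesis by blast
    qed
    then obtain P where P: "\<And>w. (Kn * X w) $$ (i,l) = poly P w / poly q w" by blast
    have op: "open (- E)" using E finite_imp_closed by auto
    have "(\<lambda>w. poly P w / poly q w) holomorphic_on (- E)" by (intro holomorphic_intros) (auto simp: E_def)
    then have "(\<lambda>w. poly P w / poly q w) analytic_on {0}" using op E by (auto simp: analytic_at)
    then have G: "(\<lambda>w. poly P w / poly q w) has_fps_expansion fps_expansion (\<lambda>w. poly P w / poly q w) 0" (is "_ has_fps_expansion ?G")
      by (rule analytic_at_imp_has_fps_expansion_0)
    \<comment> \<open>The remainder \<open>Kn * X\<close> is analytic at 0, and its prefactor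
      \<open>w ^ Suc n\<close> keeps it out of the first \<open>n + 1\<close> coefficients.\<close>
    have h0: "(\<lambda>w. (\<Sum>k\<le>n. A k $$ (i,l) * w ^ k) + w ^ Suc n * (poly P w / poly q w))
        has_fps_expansion Abs_fps (\<lambda>t. if t \<le> n then A t $$ (i,l) else 0) + fps_X ^ Suc n * ?G"
      by (intro fps_expansion_intros has_fps_expansion_poly_sum G)
    have ev: "\<forall>\<^sub>F w in nhds 0. (\<Sum>k\<le>n. A k $$ (i,l) * w ^ k) + w ^ Suc n * (poly P w / poly q w) = f w $$ (i,l)"
    proof (rule eventually_mono)
      show "\<forall>\<^sub>F w in nhds 0. w \<in> - E" using op E by (intro eventually_nhds_in_open) auto
      fix w assume w: "w \<in> - E"
      then have "f w $$ (i,l) = (D + w \<cdot>\<^sub>m (C * X w)) $$ (i,l)" using ff[of w] by (simp add: f0_def)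
      also have "\<dots> = (\<Sum>k\<le>n. w ^ k * A k $$ (i,l)) + w ^ Suc n * (Kn * X w) $$ (i,l)"
        by (rule tay[OF X eq il]) (use w in \<open>auto simp: E_def\<close>)
      finally show "(\<Sum>k\<le>n. A k $$ (i,l) * w ^ k) + w ^ Suc n * (poly P w / poly q w) = f w $$ (i,l)"
        unfolding P by (simp add: mult.commute)
    qed
    have hx: "(\<lambda>w. f w $$ (i,l)) has_fps_expansion Abs_fps (\<lambda>t. if t \<le> n then A t $$ (i,l) else 0) + fps_X ^ Suc n * ?G"
      using h0 has_fps_expansion_cong[OF ev refl] by simp
    have nj: "fps_nth (Abs_fps (\<lambda>t. if t \<le> n then A t $$ (i,l) else 0) + fps_X ^ Suc n * ?G) j = A j $$ (i,l)"
      using j by (simp add: fps_X_power_mult_nth del: power_Suc)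
    show "taylor0 m f j $$ (i,l) = A j $$ (i,l)"
      using fps_nth_fps_expansion[OF hx, of j, unfolded nj] il by (simp add: taylor0_def)
  qed (use A[OF j] in \<open>auto simp: taylor0_def\<close>)
  then have ty: "\<forall>j\<le>n. taylor0 m f j = A j" by blast
  have "F w = f w" if w: "w \<notin> E \<union> E2" for w
  proof -
    have w': "w \<notin> E2" "w \<notin> E" "poly q w \<noteq> 0" using w by (auto simp: E_def)
    show ?thesis unfolding Fe[OF w'(1) X eq[OF w'(3)]] ff[OF w'(2)] f0_def ..
  qed
  then have Ff: "\<forall>w. w \<notin> E \<union> E2 \<longrightarrow> F w = f w" by blast
  have fin: "finite (E \<union> E2)" using E F by simp
  show ?thesis using f ty F(1) fin Ff fp[THEN conjunct2, THEN conjunct2]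
    by (rule_tac x=f in exI, rule_tac x=F in exI, rule_tac x="E \<union> E2" in exI) (intro conjI)
qed

text \<open>Cross-multiplying numerators and denominators gives a polynomial \<open>d\<close> that
  vanishes at all points near 0 off the exceptional sets, hence identically.\<close>

lemma rational_eq_off_finite:
  assumes S: "\<not> 0 islimpt S" and E: "finite E"
    and f: "\<exists>p q :: complex poly. q \<noteq> 0 \<and> (\<forall>w. f w = poly p w / poly q w)"
    and g: "\<exists>p q :: complex poly. q \<noteq> 0 \<and> (\<forall>w. w \<notin> E \<longrightarrow> g w = poly p w / poly q w)"
    and eq: "\<And>w. w \<in> DD - S - E \<Longrightarrow> f w = g w"
  shows "\<exists>E'. finite E' \<and> (\<forall>w. w \<notin> E' \<longrightarrow> f w = g w)"
proof -
  obtain p q where f: "q \<noteq> 0" "\<And>w. f w = poly p w / poly q w" using f by blast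
  obtain p' q' where g: "q' \<noteq> 0" "\<And>w. w \<notin> E \<Longrightarrow> g w = poly p' w / poly q' w" using g by blast
  define d where "d = p * q' - p' * q"
  have fin: "finite {w. poly q w = 0}" "finite {w. poly q' w = 0}" using poly_roots_finite f g by auto
  have dd: "\<forall>\<^sub>F w in at (0::complex). w \<in> DD" by (rule eventually_at_in_open') auto
  have "\<forall>\<^sub>F w in at 0. poly d w = 0"
    using eventually_not_in_finite[OF fin(1)] eventually_not_in_finite[OF fin(2)] eventually_not_in_finite[OF E]
      S[unfolded islimpt_iff_eventually not_not] dd
  proof eventually_elim
    case (elim w)
    then have "poly p w / poly q w = poly p' w / poly q' w" using f(2)[of w] g(2)[of w] eq[of w] by auto
    then show ?case using elim by (simp add: d_def frac_eq_eq)
  qed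
  moreover have "\<forall>\<^sub>F w in at 0. poly d w \<noteq> 0" if "d \<noteq> 0"
    using eventually_not_in_finite[OF poly_roots_finite[OF that]] by simp
  ultimately have "d = 0"
  proof (rule_tac ccontr)
    assume ne: "\<forall>\<^sub>F w in at 0. poly d w = 0" "d \<noteq> 0 \<Longrightarrow> \<forall>\<^sub>F w in at 0. poly d w \<noteq> 0" "d \<noteq> 0"
    from ne(1) ne(2)[OF ne(3)] have "\<forall>\<^sub>F w in at (0::complex). False" by eventually_elim simp
    then show False by simp
  qed
  have "f w = g w" if "w \<notin> E \<union> {w. poly q w = 0} \<union> {w. poly q' w = 0}" for w
  proof -
    have "poly p w * poly q' w = poly p' w * poly q w"
      using arg_cong[OF \<open>d = 0\<close>, of "\<lambda>x. poly x w"] by (simp add: d_def)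
    then show ?thesis using that f(2)[of w] g(2)[of w] by (auto simp: frac_eq_eq)
  qed
  then show ?thesis using E fin by (intro exI[of _ "E \<union> {w. poly q w = 0} \<union> {w. poly q' w = 0}"]) auto
qed

section \<open>The rational extension on the unit circle\<close>

text \<open>\<open>rational_ext\<close> with its set of poles as a parameter.\<close>

definition rational_ext_on :: "nat \<Rightarrow> (complex \<Rightarrow> complex mat) \<Rightarrow> (complex \<Rightarrow> complex mat) \<Rightarrow> complex set \<Rightarrow> bool" where
  "rational_ext_on m f F E \<longleftrightarrow> finite E \<and>
     (\<forall>w. w \<notin> E \<longrightarrow> F w \<in> carrier_mat m m) \<and>
     (\<forall>i<m. \<forall>j<m. (\<lambda>w. F w $$ (i,j)) holomorphic_on (- E)) \<and>
     (\<forall>i<m. \<forall>j<m. \<exists>p q :: complex poly. q \<noteq> 0 \<and>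
         (\<forall>w. w \<notin> E \<longrightarrow> F w $$ (i,j) = poly p w / poly q w)) \<and>
     (\<forall>e\<in>E. filterlim (\<lambda>w. mat_norm1 (F w)) at_top (at e)) \<and>
     (\<forall>w\<in>DD - E. F w = f w)"

lemma rational_ext_iff: "rational_ext m f F \<longleftrightarrow> (\<exists>E. rational_ext_on m f F E)"
  unfolding rational_ext_def rational_ext_on_def ..

lemma rational_ext_onD:
  assumes "rational_ext_on m f F E"
  shows "finite E" "w \<notin> E \<Longrightarrow> F w \<in> carrier_mat m m"
    "i < m \<Longrightarrow> j < m \<Longrightarrow> (\<lambda>w. F w $$ (i,j)) holomorphic_on (- E)"
    "i < m \<Longrightarrow> j < m \<Longrightarrow> \<exists>p q :: complex poly. q \<noteq> 0 \<and> (\<forall>w. w \<notin> E \<longrightarrow> F w $$ (i,j) = poly p w / poly q w)"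
    "e \<in> E \<Longrightarrow> filterlim (\<lambda>w. mat_norm1 (F w)) at_top (at e)"
    "w \<in> DD - E \<Longrightarrow> F w = f w"
  using assms unfolding rational_ext_on_def by simp_all

text \<open>A Blaschke--Potapov interpolant always exists. Uniqueness identifies it with
  \<open>fc\<close> in the disc, and rationality extends the identity to the plane up to finitely
  many points.\<close>

lemma uniqueness_imp_BP:
  assumes sig: "signature_mat m J" and pot: "J_Potapov_seq m J A n" and ext: "rational_ext m fc fd"
    and uniq: "\<And>f. PJ0 m J f \<Longrightarrow> (\<And>j. j \<le> n \<Longrightarrow> taylor0 m f j = A j) \<Longrightarrow> mero_eq f fc"
  shows "\<exists>B E. BP_product m J B \<and> finite E \<and> (\<forall>w. w \<notin> E \<longrightarrow> B w = fd w)"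
proof -
  have A: "A j \<in> carrier_mat m m" if "j \<le> n" for j using pot that by (simp add: J_Potapov_seq_def)
  have psd: "psd (Q_mat m J A n)" using pot by (simp add: J_Potapov_seq_def Q_mat_def)
  have "\<exists>f F E. PJ0 m J f \<and> (\<forall>j\<le>n. taylor0 m f j = A j) \<and> BP_product m J F \<and> finite E \<and>
    (\<forall>w. w \<notin> E \<longrightarrow> F w = f w) \<and>
    (\<forall>i<m. \<forall>j<m. \<exists>p q :: complex poly. q \<noteq> 0 \<and> (\<forall>w. f w $$ (i,j) = poly p w / poly q w))" (is "\<exists>f F E. ?P f F E")
    by (rule rational_interpolant[OF sig A psd])
  then obtain f F E where "?P f F E" by (elim exE) (rule that)
  then have f: "PJ0 m J f" "\<And>j. j \<le> n \<Longrightarrow> taylor0 m f j = A j" and F: "BP_product m J F" "finite E"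
    "\<And>w. w \<notin> E \<Longrightarrow> F w = f w"
    and rat: "\<And>i j. i < m \<Longrightarrow> j < m \<Longrightarrow> \<exists>p q :: complex poly. q \<noteq> 0 \<and> (\<forall>w. f w $$ (i,j) = poly p w / poly q w)"
    by blast+
  obtain S where S: "\<forall>z\<in>DD. \<not> z islimpt S" "\<forall>w\<in>DD - S. f w = fc w" using uniq[OF f] unfolding mero_eq_def by blast
  obtain E1 where "rational_ext_on m fc fd E1" using ext unfolding rational_ext_iff ..
  note E1 = rational_ext_onD(1,2,4,6)[OF this]
  have "\<exists>E'. finite E' \<and> (\<forall>w. w \<notin> E' \<longrightarrow> f w $$ (i,j) = fd w $$ (i,j))" if "i < m" "j < m" for i j
    by (rule rational_eq_off_finite[OF _ E1(1) rat[OF that] E1(3)[OF that]]) (use S E1(4) in auto)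
  then have "\<forall>i j. \<exists>E'. i < m \<longrightarrow> j < m \<longrightarrow> finite E' \<and> (\<forall>w. w \<notin> E' \<longrightarrow> f w $$ (i,j) = fd w $$ (i,j))" by blast
  then obtain E' where E': "\<And>i j. i < m \<Longrightarrow> j < m \<Longrightarrow> finite (E' i j)"
    "\<And>i j w. i < m \<Longrightarrow> j < m \<Longrightarrow> w \<notin> E' i j \<Longrightarrow> f w $$ (i,j) = fd w $$ (i,j)" by metis
  define T where "T = E \<union> E1 \<union> (\<Union>i<m. \<Union>j<m. E' i j)"
  have "F w = fd w" if w: "w \<notin> T" for w
  proof (rule eq_matI)
    have "F w \<in> carrier_mat m m" "fd w \<in> carrier_mat m m" using BP_product_carrier[OF F(1)] E1(2) w by (auto simp: T_def)
    then show "dim_row (F w) = dim_row (fd w)" "dim_col (F w) = dim_col (fd w)" by auto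
    fix i j assume "i < dim_row (fd w)" "j < dim_col (fd w)"
    then have ij: "i < m" "j < m" using \<open>fd w \<in> _\<close> by auto
    then have "w \<notin> E' i j" using w by (auto simp: T_def)
    then show "F w $$ (i,j) = fd w $$ (i,j)" using E'(2)[OF ij] F(3)[of w] w by (simp add: T_def)
  qed
  moreover have "finite T" unfolding T_def using F E1 E' by auto
  ultimately show ?thesis using F(1) by blast
qed

section \<open>Radial limits and null sets of angles\<close>

lemma countable_cis_eq: "countable {t. cis t \<in> E}" if "finite E"
proof -
  have c: "countable {t. cis t = z}" for z
  proof (cases "\<exists>t. cis t = z")
    case True
    then obtain s where s: "cis s = z" by blast
    have "\<exists>k::int. t = s + 2 * pi * of_int k" if "cis t = z" for t
    proof -
      have "sin t = sin s \<and> cos t = cos s" using that s by (metis cis.simps)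
      then show ?thesis unfolding sin_cos_eq_iff .
    qed
    then have "{t. cis t = z} \<subseteq> range (\<lambda>k::int. s + 2 * pi * of_int k)" by blast
    then show ?thesis by (rule countable_subset) simp
  next
    case False
    then have "{t. cis t = z} = {}" by blast
    then show ?thesis by simp
  qed
  have "countable (\<Union>z\<in>E. {t. cis t = z})" by (rule countable_UN[OF countable_finite[OF that] c])
  moreover have "(\<Union>z\<in>E. {t. cis t = z}) = {t. cis t \<in> E}" by auto
  ultimately show ?thesis by simp
qed

lemma radial_limit:
  assumes E: "finite E" and hol: "g holomorphic_on (- E)" and eq: "\<And>w. w \<in> DD - E \<Longrightarrow> f w = g w" and t: "cis t \<notin> E"
  shows "((\<lambda>r::real. f (of_real r * cis t)) \<longlongrightarrow> g (cis t)) (at_left 1)"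
proof -
  have op: "open (- E)" using E finite_imp_closed by auto
  have lim: "((\<lambda>r::real. of_real r * cis t) \<longlongrightarrow> cis t) (at_left 1)"
    by (rule tendsto_eq_intros refl | simp)+
  have "continuous (at (cis t)) g" using holomorphic_on_imp_continuous_on[OF hol] op t by (simp add: continuous_on_eq_continuous_at)
  from isCont_tendsto_compose[OF this lim]
  have 1: "((\<lambda>r::real. g (of_real r * cis t)) \<longlongrightarrow> g (cis t)) (at_left 1)" .
  have "\<forall>\<^sub>F r in at_left (1::real). of_real r * cis t \<in> - E" using lim op t by (intro topological_tendstoD) auto
  moreover have "\<forall>\<^sub>F r in at_left (1::real). r \<in> {0<..<1}" by (rule eventually_at_left_real) simp
  ultimately have "\<forall>\<^sub>F r in at_left (1::real). g (of_real r * cis t) = f (of_real r * cis t)"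
    by eventually_elim (auto intro!: eq[symmetric] simp: norm_mult)
  then show ?thesis using 1 by (rule Lim_transform_eventually[rotated])
qed

lemma BP_imp_inner:
  assumes sig: "signature_mat m J" and PJ0: "PJ0 m J fc" and ext: "rational_ext m fc fd"
    and B: "BP_product m J B" "finite E" "\<And>w. w \<notin> E \<Longrightarrow> B w = fd w"
  shows "J_inner m J fc"
proof -
  obtain E1 where "rational_ext_on m fc fd E1" using ext unfolding rational_ext_iff ..
  note E1 = rational_ext_onD(1,2,3,6)[OF this]
  obtain E2 where E2: "finite E2" "\<And>z. cmod z = 1 \<Longrightarrow> z \<notin> E2 \<Longrightarrow> J_unitary J (B z)"
    using BP_product_circle[OF sig B(1)] by blast
  define N where "N = {t. cis t \<in> E \<union> E1 \<union> E2}"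
  have "N \<in> null_sets lborel" unfolding N_def using B E1 E2 by (intro countable_imp_null_set_lborel countable_cis_eq) auto
  moreover have "\<exists>L\<in>carrier_mat m m. J_unitary J L \<and>
      (\<forall>i<m. \<forall>j<m. ((\<lambda>r::real. fc (of_real r * cis t) $$ (i,j)) \<longlongrightarrow> L $$ (i,j)) (at_left 1))" if t: "t \<notin> N" for t
  proof (intro bexI[of _ "fd (cis t)"] conjI allI impI)
    show "fd (cis t) \<in> carrier_mat m m" using E1 t by (auto simp: N_def)
    show "J_unitary J (fd (cis t))" using B(3)[of "cis t"] E2(2)[of "cis t"] t by (simp add: N_def)
    show "((\<lambda>r::real. fc (of_real r * cis t) $$ (i,j)) \<longlongrightarrow> fd (cis t) $$ (i,j)) (at_left 1)" if "i < m" "j < m" for i j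
      by (rule radial_limit[OF E1(1) E1(3)[OF that]]) (use E1(4) t in \<open>auto simp: N_def\<close>)
  qed
  moreover have "PJ m J fc" using PJ0 unfolding PJ_def PJ0_def by blast
  ultimately show ?thesis unfolding J_inner_def by blast
qed

lemma inner_imp_unitary_point:
  assumes J: "J \<in> carrier_mat m m" and inn: "J_inner m J fc" and ext: "rational_ext m fc fd" and E: "finite E"
  shows "\<exists>z. cmod z = 1 \<and> z \<notin> E \<and> J_unitary J (fd z)"
proof -
  obtain E1 where "rational_ext_on m fc fd E1" using ext unfolding rational_ext_iff ..
  note E1 = rational_ext_onD(1,2,3,6)[OF this]
  obtain N where N: "N \<in> null_sets lborel" "\<And>t. t \<notin> N \<Longrightarrow> \<exists>L\<in>carrier_mat m m. J_unitary J L \<and>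
           (\<forall>i<m. \<forall>j<m. ((\<lambda>r::real. fc (of_real r * cis t) $$ (i,j)) \<longlongrightarrow> L $$ (i,j)) (at_left 1))"
    using inn unfolding J_inner_def by blast
  have "N \<union> {t. cis t \<in> E \<union> E1} \<in> null_sets lborel"
    using countable_imp_null_set_lborel[OF countable_cis_eq[of "E \<union> E1"]] N(1) E E1(1) by (intro null_sets.Un) auto
  \<comment> \<open>Angles run through the whole line, which has positive measure, so some angle
    avoids the null set of bad limits together with the countable set of excluded points.\<close>
  moreover have "(UNIV :: real set) \<notin> null_sets lborel" by (auto simp: null_sets_def)
  ultimately have "N \<union> {t. cis t \<in> E \<union> E1} \<noteq> UNIV" by metis
  then obtain t where t: "t \<notin> N" "cis t \<notin> E" "cis t \<notin> E1" by blast
  obtain L where L: "L \<in> carrier_mat m m" "J_unitary J L"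
    "\<And>i j. i < m \<Longrightarrow> j < m \<Longrightarrow> ((\<lambda>r::real. fc (of_real r * cis t) $$ (i,j)) \<longlongrightarrow> L $$ (i,j)) (at_left 1)"
    using N(2)[OF t(1)] by blast
  have "fd (cis t) = L"
  proof (rule eq_matI)
    fix i j assume "i < dim_row L" "j < dim_col L"
    then have ij: "i < m" "j < m" using L by auto
    have "((\<lambda>r::real. fc (of_real r * cis t) $$ (i,j)) \<longlongrightarrow> fd (cis t) $$ (i,j)) (at_left 1)"
      by (rule radial_limit[OF E1(1) E1(3)[OF ij]]) (use E1(4) t in auto)
    then show "fd (cis t) $$ (i,j) = L $$ (i,j)" using L(3)[OF ij] tendsto_unique trivial_limit_at_left_real by blast
  qed (use E1(2)[OF t(3)] L in auto)
  then show ?thesis using L t by (intro exI[of _ "cis t"]) auto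
qed

section \<open>The associated polynomials\<close>

text \<open>Exceptional points of a rational extension are poles in norm. Writing the function near
  \<open>z\<close> as a matrix whose entries converge therefore shows that \<open>z\<close> is
  regular.\<close>

lemma not_pole_of_convergent:
  assumes Y: "conv.mat_fun (at z) m m Y" and eq: "\<forall>\<^sub>F w in at z. f w = Y w"
  shows "\<not> filterlim (\<lambda>w. mat_norm1 (f w)) at_top (at z)"
proof
  assume top: "filterlim (\<lambda>w. mat_norm1 (f w)) at_top (at z)"
  have "\<forall>i j. \<exists>c. i < m \<longrightarrow> j < m \<longrightarrow> ((\<lambda>w. Y w $$ (i,j)) \<longlongrightarrow> c) (at z)" using conv.mat_funD(2)[OF Y] by blast
  then obtain c where c: "\<And>i j. i < m \<Longrightarrow> j < m \<Longrightarrow> ((\<lambda>w. Y w $$ (i,j)) \<longlongrightarrow> c i j) (at z)" by metis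
  define s where "s = (\<Sum>i<m. \<Sum>j<m. cmod (c i j))"
  have "((\<lambda>w. \<Sum>i<m. \<Sum>j<m. cmod (Y w $$ (i,j))) \<longlongrightarrow> s) (at z)"
    unfolding s_def by (intro tendsto_intros c) auto
  moreover have "(\<Sum>i<m. \<Sum>j<m. cmod (Y w $$ (i,j))) = mat_norm1 (Y w)" for w
    using conv.mat_funD(1)[OF Y, of w] by (simp add: mat_norm1_def)
  ultimately have "((\<lambda>w. mat_norm1 (Y w)) \<longlongrightarrow> s) (at z)" by simp
  then have "\<forall>\<^sub>F w in at z. mat_norm1 (Y w) < s + 1" by (rule order_tendstoD) simp
  moreover have "\<forall>\<^sub>F w in at z. s + 1 < mat_norm1 (f w)" using top by (simp add: filterlim_at_top_dense)
  ultimately have "\<forall>\<^sub>F w in at z. False" using eq by eventually_elim simp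
  then show False by simp
qed

lemma polyfun_mat_conv: "polyfun.mat_fun n k M \<Longrightarrow> conv.mat_fun (at z) n k M"
proof -
  assume M: "polyfun.mat_fun n k M"
  have "\<exists>c. ((\<lambda>w. M w $$ (i,j)) \<longlongrightarrow> c) (at z)" if ij: "i < n" "j < k" for i j
  proof -
    obtain p where "\<And>w. M w $$ (i,j) = poly p w" using polyfun.mat_funD(2)[OF M ij] by blast
    moreover have "((\<lambda>w. poly p w) \<longlongrightarrow> poly p z) (at z)" by (intro tendsto_intros)
    ultimately show ?thesis by auto
  qed
  then show ?thesis unfolding conv.mat_fun_def using polyfun.mat_funD(1)[OF M] by blast
qed

lemma polyfun_power: "\<exists>p. \<forall>w::complex. w ^ k = poly p w"
  by (rule exI[of _ "monom 1 k"]) (simp add: poly_monom)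

lemma polyfun_e_row: "polyfun.mat_fun m ((n+1)*m) (e_row m n)"
proof -
  have "\<exists>p. \<forall>w. e_row m n w $$ (a,b) = poly p w" if "a < m" "b < (n+1)*m" for a b
  proof (cases "a = b mod m")
    case True
    then show ?thesis using that polyfun_power[of "b div m"] by (simp add: e_row_def)
  next
    case False
    then show ?thesis using that by (intro exI[of _ 0]) (simp add: e_row_def)
  qed
  then show ?thesis unfolding polyfun.mat_fun_def by (auto simp: e_row_def)
qed

lemma e_row_mult_index:
  assumes X: "X \<in> carrier_mat ((n+1)*m) k" and i: "i < m" and j: "j < k"
  shows "(e_row m n w * X) $$ (i,j) = (\<Sum>t\<le>n. X $$ (i + t*m, j) * w ^ t)"
proof -
  define N where "N = (n+1)*m"
  have X: "X \<in> carrier_mat N k" using X by (simp add: N_def)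
  have er: "e_row m n w \<in> carrier_mat m N" by (simp add: e_row_def N_def)
  have "(e_row m n w * X) $$ (i,j) = (\<Sum>b<N. e_row m n w $$ (i,b) * X $$ (b,j))"
    using X er i j by (simp add: scalar_prod_def atLeast0LessThan)
  also have "\<dots> = (\<Sum>b<N. (if i = b mod m then w ^ (b div m) else 0) * X $$ (b,j))"
    using i by (intro sum.cong refl) (simp add: e_row_def N_def)
  also have "\<dots> = (\<Sum>t<n+1. \<Sum>p<m. (if i = (p + t*m) mod m then w ^ ((p + t*m) div m) else 0) * X $$ (p + t*m, j))"
    unfolding N_def by (rule block_sum)
  also have "\<dots> = (\<Sum>t<n+1. \<Sum>p<m. if p = i then X $$ (p + t*m, j) * w ^ t else 0)"
    by (intro sum.cong refl) auto
  also have "\<dots> = (\<Sum>t<n+1. X $$ (i + t*m, j) * w ^ t)" using i by (simp add: sum.delta)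
  finally show ?thesis by (simp add: lessThan_Suc_atMost)
qed

lemma rhohat_index:
  assumes "V \<in> carrier_mat (n*m) m" "a < (n+1)*m" "l < m"
  shows "rhohat m n V $$ (a,l) = (if a = l then 1 else 0) + (if m \<le> a \<and> a - m < n*m then V $$ (a - m, l) else 0)"
proof -
  have "sel ((n+1)*m) (n*m) m * V \<in> carrier_mat ((n+1)*m) m" using assms(1) by (intro mult_carrier_mat[OF sel_carrier])
  then have "rhohat m n V $$ (a,l) = sel ((n+1)*m) m 0 $$ (a,l) + (sel ((n+1)*m) (n*m) m * V) $$ (a,l)"
    unfolding rhohat_def using assms(2,3) by (subst index_add_mat(1)) auto
  moreover have "sel ((n+1)*m) m 0 $$ (a,l) = (if a = l then 1 else 0)"
    unfolding sel_def using assms(2,3) by (subst index_mat(1)) auto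
  moreover have "(sel ((n+1)*m) (n*m) m * V) $$ (a,l) = (if m \<le> a \<and> a - m < n*m then V $$ (a - m, l) else 0)"
    unfolding sel_mult[OF assms(1)] using assms(2,3) by (subst index_mat(1)) auto
  ultimately show ?thesis by simp
qed

lemma tau_poly_index:
  assumes W: "W \<in> carrier_mat m (n*m)" and i: "i < m" and p: "p < m"
  shows "tau_poly m n W w $$ (i,p) = (if i = p then 1 else 0) + (\<Sum>c<n. W $$ (i, p + c*m) * w ^ (n - c))"
proof (cases n)
  case 0
  then show ?thesis using i p by (simp add: tau_poly_def)
next
  case (Suc j)
  define N where "N = n*m"
  have W: "W \<in> carrier_mat m N" using W by (simp add: N_def)
  have ec: "eps_col m (n - 1) w \<in> carrier_mat N m" by (simp add: eps_col_def N_def Suc)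
  have "(W * (w \<cdot>\<^sub>m eps_col m (n - 1) w)) $$ (i,p) = (\<Sum>a<N. W $$ (i,a) * (w * eps_col m (n - 1) w $$ (a,p)))"
    using W ec i p by (simp add: scalar_prod_def atLeast0LessThan)
  also have "\<dots> = (\<Sum>a<N. W $$ (i,a) * (w * (if a mod m = p then w ^ (j - a div m) else 0)))"
    using p by (intro sum.cong refl) (simp add: eps_col_def N_def Suc)
  also have "\<dots> = (\<Sum>c<n. \<Sum>q<m. W $$ (i, q + c*m) * (w * (if (q + c*m) mod m = p then w ^ (j - (q + c*m) div m) else 0)))"
    unfolding N_def by (rule block_sum)
  also have "\<dots> = (\<Sum>c<n. \<Sum>q<m. if q = p then W $$ (i, q + c*m) * (w * w ^ (j - c)) else 0)"
    by (intro sum.cong refl) auto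
  also have "\<dots> = (\<Sum>c<n. W $$ (i, p + c*m) * (w * w ^ (j - c)))" using p by (simp add: sum.delta)
  also have "\<dots> = (\<Sum>c<n. W $$ (i, p + c*m) * w ^ (n - c))"
    by (intro sum.cong refl) (simp add: Suc Suc_diff_le)
  finally show ?thesis using W ec i p Suc by (simp add: tau_poly_def)
qed

lemma polyfun_tau: "polyfun.mat_fun m m (tau_poly m n W)" if W: "W \<in> carrier_mat m (n*m)"
  unfolding polyfun.mat_fun_def
proof (intro conjI allI impI)
  show "tau_poly m n W w \<in> carrier_mat m m" for w by (simp add: tau_poly_def)
  show "\<exists>P. \<forall>w. tau_poly m n W w $$ (i,p) = poly P w" if "i < m" "p < m" for i p
    unfolding tau_poly_index[OF W that] by (intro polyfun.add polyfun.sum polyfun.mult polyfun.const polyfun_power)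
qed

lemma fps_expansion_polynomial:
  fixes f :: "complex \<Rightarrow> complex"
  assumes f: "f has_fps_expansion F" and z: "\<And>t. t > n \<Longrightarrow> fps_nth F t = 0"
  shows "\<forall>\<^sub>F w in nhds 0. f w = (\<Sum>t\<le>n. fps_nth F t * w ^ t)"
proof -
  have "Abs_fps (\<lambda>t. if t \<le> n then fps_nth F t else 0) = F" by (rule fps_ext) (use z in auto)
  then have "(\<lambda>w. \<Sum>t\<le>n. fps_nth F t * w ^ t) has_fps_expansion F" using has_fps_expansion_poly_sum[of "fps_nth F" n] by simp
  then have "\<forall>\<^sub>F w in nhds 0. eval_fps F w = (\<Sum>t\<le>n. fps_nth F t * w ^ t)" by (simp add: has_fps_expansion_def)
  moreover have "\<forall>\<^sub>F w in nhds 0. eval_fps F w = f w" using f by (simp add: has_fps_expansion_def)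
  ultimately show ?thesis by eventually_elim simp
qed

text \<open>A coefficient of the product of order \<open>t \<le> n\<close> is a block of the
  Toeplitz matrix applied to \<open>rhohat\<close>. One of order \<open>t > n\<close> is the
  difference of the two sides of the recursion through \<open>V\<close>, hence 0, and the product is
  a polynomial near 0.\<close>

lemma central_rho_expansion:
  fixes A :: "nat \<Rightarrow> complex mat"
  assumes A: "\<And>j. A j \<in> carrier_mat m m" and V: "V \<in> carrier_mat (n*m) m"
    and rec: "\<And>k. k \<ge> n \<Longrightarrow> A (Suc k) = - (z_vec m A k * (sel (k*m) (n*m) 0 * V))"
    and il: "i < m" "l < m"
    and f: "\<And>p. p < m \<Longrightarrow> f p has_fps_expansion Af p" "\<And>p t. p < m \<Longrightarrow> fps_nth (Af p) t = A t $$ (i,p)"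
  shows "\<forall>\<^sub>F w in nhds 0. (\<Sum>p<m. f p w * rho_poly m n V w $$ (p,l)) = (e_row m n w * (S_blk m A n * rhohat m n V)) $$ (i,l)"
proof -
  define R where "R = rhohat m n V"
  have Rc: "R \<in> carrier_mat ((n+1)*m) m" unfolding R_def by (rule rhohat_carrier[OF V])
  have lt: "p + s*m < (n+1)*m" if "p < m" "s \<le> n" for p s
  proof -
    have "s*m \<le> n*m" using that by (simp add: mult_le_mono1)
    moreover have "(n+1)*m = m + n*m" by simp
    ultimately show ?thesis using that(1) by linarith
  qed
  define B where "B p = Abs_fps (\<lambda>s. if s \<le> n then R $$ (p + s*m, l) else 0)" for p
  define G where "G = (\<Sum>p<m. B p * Af p)"
  have "(\<lambda>w. \<Sum>p<m. (\<Sum>t\<le>n. R $$ (p + t*m, l) * w ^ t) * f p w) has_fps_expansion G"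
    unfolding G_def B_def by (intro fps_expansion_intros has_fps_expansion_poly_sum f(1)) auto
  moreover have "(\<Sum>t\<le>n. R $$ (p + t*m, l) * w ^ t) = rho_poly m n V w $$ (p,l)" if "p < m" for p w
    unfolding rho_poly_eq_rhohat[OF V] R_def[symmetric] e_row_mult_index[OF Rc that il(2)] ..
  ultimately have hG: "(\<lambda>w. \<Sum>p<m. f p w * rho_poly m n V w $$ (p,l)) has_fps_expansion G" by (simp add: mult.commute)
  define H where "H t s = (\<Sum>p<m. R $$ (p + s*m, l) * A (t - s) $$ (i,p))" for t s
  have Gn: "fps_nth G t = (\<Sum>s\<le>t. if s \<le> n then H t s else 0)" for t
  proof -
    have "fps_nth G t = (\<Sum>p<m. \<Sum>s=0..t. (if s \<le> n then R $$ (p + s*m, l) else 0) * A (t - s) $$ (i,p))"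
      unfolding G_def fps_sum_nth fps_mult_nth B_def by (intro sum.cong refl) (simp add: f(2))
    also have "\<dots> = (\<Sum>s=0..t. \<Sum>p<m. (if s \<le> n then R $$ (p + s*m, l) else 0) * A (t - s) $$ (i,p))" by (rule sum.swap)
    also have "\<dots> = (\<Sum>s=0..t. if s \<le> n then H t s else 0)" by (intro sum.cong refl) (auto simp: H_def)
    finally show ?thesis by (simp only: atLeast0AtMost)
  qed
  have low: "fps_nth G t = (S_blk m A n * R) $$ (i + t*m, l)" if t: "t \<le> n" for t
  proof -
    have "(S_blk m A n * R) $$ (i + t*m, l) = (\<Sum>s\<le>t. H t s)"
      unfolding S_blk_block_row[OF A Rc il(1) t il(2)] H_def by (intro sum.cong refl) (simp add: mult.commute)
    then show ?thesis unfolding Gn using t by simp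
  qed
  have high: "fps_nth G t = 0" if t: "t > n" for t
  proof -
    obtain k where k: "t = Suc k" "k \<ge> n" using t by (cases t) auto
    have "fps_nth G t = (\<Sum>s\<le>n. H t s)" unfolding Gn
      by (rule sum.mono_neutral_cong_right) (use t in auto)
    also have "\<dots> = H t 0 + (\<Sum>c<n. H t (Suc c))" by (rule sum.atMost_shift)
    \<comment> \<open>The identity head of \<open>R\<close> contributes the newest coefficient
      \<open>A t\<close>; the remaining blocks give \<open>z_vec * V\<close>, and the recursion
      makes the two cancel.\<close>
    also have "H t 0 = (\<Sum>p<m. if p = l then A t $$ (i,p) else 0)" unfolding H_def
    proof (intro sum.cong refl)
      fix p assume "p \<in> {..<m}"
      then show "R $$ (p + 0*m, l) * A (t - 0) $$ (i,p) = (if p = l then A t $$ (i,p) else 0)"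
        using rhohat_index[OF V, of p l] il by (simp add: R_def)
    qed
    also have "\<dots> = A t $$ (i,l)" using il by (simp add: sum.delta)
    also have "(\<Sum>c<n. H t (Suc c)) = (\<Sum>c<n. \<Sum>p<m. A (k - c) $$ (i,p) * V $$ (p + c*m, l))" unfolding H_def
    proof (intro sum.cong refl)
      fix c p assume cp: "c \<in> {..<n}" "p \<in> {..<m}"
      have "Suc c * m \<le> n * m" using cp by (intro mult_le_mono1) auto
      then have "p + c*m < n*m" using cp mult_Suc[of c m] by (metis add.commute add_less_mono1 lessThan_iff less_le_trans)
      moreover have "p + Suc c * m < (n+1)*m" using lt[of p "Suc c"] cp by auto
      ultimately have "R $$ (p + Suc c * m, l) = V $$ (p + c*m, l)"
        using rhohat_index[OF V, of "p + Suc c * m" l] il by (simp add: R_def)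
      then show "R $$ (p + Suc c * m, l) * A (t - Suc c) $$ (i,p) = A (k - c) $$ (i,p) * V $$ (p + c*m, l)" using k by simp
    qed
    also have "\<dots> = - A t $$ (i,l)"
    proof -
      define Y where "Y = sel (k*m) (n*m) 0 * V"
      define M where "M = k*m"
      have Yc: "Y \<in> carrier_mat M m" using V by (auto simp: Y_def M_def)
      have zc: "z_vec m A k \<in> carrier_mat m M" by (simp add: z_vec_def M_def)
      have "(z_vec m A k * Y) $$ (i,l) = (\<Sum>b<M. z_vec m A k $$ (i,b) * Y $$ (b,l))"
        using zc Yc il by (simp add: scalar_prod_def atLeast0LessThan)
      also have "\<dots> = (\<Sum>b<M. A (k - b div m) $$ (i, b mod m) * (if b < n*m then V $$ (b,l) else 0))"
        unfolding Y_def sel_mult[OF V] using il by (intro sum.cong refl) (simp add: z_vec_def M_def)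
      also have "\<dots> = (\<Sum>c<k. \<Sum>p<m. A (k - (p + c*m) div m) $$ (i, (p + c*m) mod m) * (if p + c*m < n*m then V $$ (p + c*m, l) else 0))"
        unfolding M_def by (rule block_sum)
      also have "\<dots> = (\<Sum>c<k. if c < n then \<Sum>p<m. A (k - c) $$ (i,p) * V $$ (p + c*m, l) else 0)"
      proof (intro sum.cong refl)
        fix c
        have "p + c*m < n*m \<longleftrightarrow> c < n" if "p < m" for p
        proof
          assume "p + c*m < n*m" then have "c*m < n*m" by linarith
          then show "c < n" by simp
        next
          assume "c < n" then have "Suc c * m \<le> n * m" by (intro mult_le_mono1) auto
          then show "p + c*m < n*m" using that mult_Suc[of c m] by linarith
        qed
        then show "(\<Sum>p<m. A (k - (p + c*m) div m) $$ (i, (p + c*m) mod m) * (if p + c*m < n*m then V $$ (p + c*m, l) else 0))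
          = (if c < n then \<Sum>p<m. A (k - c) $$ (i,p) * V $$ (p + c*m, l) else 0)" by simp
      qed
      also have "\<dots> = (\<Sum>c<n. \<Sum>p<m. A (k - c) $$ (i,p) * V $$ (p + c*m, l))"
        by (rule sum.mono_neutral_cong_right) (use k in auto)
      finally have e: "(z_vec m A k * Y) $$ (i,l) = (\<Sum>c<n. \<Sum>p<m. A (k - c) $$ (i,p) * V $$ (p + c*m, l))" .
      have "A t $$ (i,l) = - (z_vec m A k * Y) $$ (i,l)"
        unfolding k(1) rec[OF k(2)] Y_def[symmetric] using zc Yc il by (subst index_uminus_mat(1)) auto
      then show ?thesis unfolding e by simp
    qed
    finally show ?thesis by simp
  qed
  have SR: "S_blk m A n * R \<in> carrier_mat ((n+1)*m) m" by (rule mult_carrier_mat[OF S_blk_carrier Rc])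
  have "(\<Sum>t\<le>n. fps_nth G t * w ^ t) = (e_row m n w * (S_blk m A n * R)) $$ (i,l)" for w
    unfolding e_row_mult_index[OF SR il] using low by (intro sum.cong refl) auto
  then show ?thesis using fps_expansion_polynomial[of _ G n, OF hG] high by (simp add: R_def)
qed

text \<open>The mirror image of \<open>central_rho_expansion\<close>, with the recursion through
  \<open>W\<close>. Polynomiality is all that is recorded, since the purpose is to exclude a pole
  where \<open>tau_poly\<close> is invertible.\<close>

lemma central_tau_expansion:
  fixes A :: "nat \<Rightarrow> complex mat"
  assumes A: "\<And>j. A j \<in> carrier_mat m m" and W: "W \<in> carrier_mat m (n*m)"
    and rec: "\<And>k. k \<ge> n \<Longrightarrow> A (Suc k) = - (W * adj (sel (k*m) (n*m) ((k-n)*m)) * y_vec m A k)"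
    and il: "i < m" "l < m"
    and f: "\<And>p. p < m \<Longrightarrow> f p has_fps_expansion Af p" "\<And>p t. p < m \<Longrightarrow> fps_nth (Af p) t = A t $$ (p,l)"
  shows "\<exists>P. \<forall>\<^sub>F w in nhds 0. (\<Sum>p<m. tau_poly m n W w $$ (i,p) * f p w) = poly P w"
proof -
  define G where "G = (\<Sum>p<m. (fps_const (if i = p then 1 else 0) + (\<Sum>c<n. fps_const (W $$ (i, p + c*m)) * fps_X ^ (n - c))) * Af p)"
  have "(\<lambda>w. \<Sum>p<m. ((if i = p then 1 else 0) + (\<Sum>c<n. W $$ (i, p + c*m) * w ^ (n - c))) * f p w) has_fps_expansion G"
    unfolding G_def by (intro fps_expansion_intros f(1)) auto
  then have hG: "(\<lambda>w. \<Sum>p<m. tau_poly m n W w $$ (i,p) * f p w) has_fps_expansion G"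
    by (simp add: tau_poly_index[OF W il(1)])
  have high: "fps_nth G t = 0" if t: "t > n" for t
  proof -
    obtain k where k: "t = Suc k" "k \<ge> n" using t by (cases t) auto
    have "fps_nth G t = (\<Sum>p<m. (if i = p then A t $$ (p,l) else 0) + (\<Sum>c<n. W $$ (i, p + c*m) * A (c + (k-n) + 1) $$ (p,l)))"
      unfolding G_def fps_sum_nth
    proof (intro sum.cong refl)
      fix p assume p: "p \<in> {..<m}"
      have "fps_nth (\<Sum>c<n. fps_const (W $$ (i, p + c*m)) * (fps_X ^ (n - c) * Af p)) t
          = (\<Sum>c<n. W $$ (i, p + c*m) * A (c + (k-n) + 1) $$ (p,l))" unfolding fps_sum_nth
      proof (intro sum.cong refl)
        fix c assume c: "c \<in> {..<n}"
        have "t - (n - c) = c + (k-n) + 1" "\<not> t < n - c" using c k by auto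
        then show "fps_nth (fps_const (W $$ (i, p + c*m)) * (fps_X ^ (n - c) * Af p)) t = W $$ (i, p + c*m) * A (c + (k-n) + 1) $$ (p,l)"
          using f(2)[of p] p by (simp add: fps_X_power_mult_nth)
      qed
      then show "fps_nth ((fps_const (if i = p then 1 else 0) + (\<Sum>c<n. fps_const (W $$ (i, p + c*m)) * fps_X ^ (n - c))) * Af p) t
          = (if i = p then A t $$ (p,l) else 0) + (\<Sum>c<n. W $$ (i, p + c*m) * A (c + (k-n) + 1) $$ (p,l))"
        using f(2)[of p] p by (simp add: distrib_right sum_distrib_right mult.assoc)
    qed
    also have "\<dots> = A t $$ (i,l) + (\<Sum>c<n. \<Sum>p<m. W $$ (i, p + c*m) * A (c + (k-n) + 1) $$ (p,l))"
      unfolding sum.distrib using il by (subst (2) sum.swap) (simp add: sum.delta)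
    also have "(\<Sum>c<n. \<Sum>p<m. W $$ (i, p + c*m) * A (c + (k-n) + 1) $$ (p,l)) = - A t $$ (i,l)"
    proof -
      define M where "M = k*m"
      define L where "L = n*m"
      define Y where "Y = adj (sel M L ((k-n)*m)) * y_vec m A k"
      have yc: "y_vec m A k \<in> carrier_mat M m" by (simp add: y_vec_def M_def)
      have Wc: "W \<in> carrier_mat m L" using W by (simp add: L_def)
      have ac: "adj (sel M L ((k-n)*m)) \<in> carrier_mat L M" by (simp add: adj_def)
      have Yc: "Y \<in> carrier_mat L m" unfolding Y_def by (rule mult_carrier_mat[OF ac yc])
      have Ye: "Y $$ (p + c*m, l) = A (c + (k-n) + 1) $$ (p,l)" if "p < m" "c < n" for p c
      proof -
        have b: "p + c*m < L"
        proof -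
          have "Suc c * m \<le> n * m" using that by (intro mult_le_mono1) auto
          then show ?thesis unfolding L_def using that(1) mult_Suc[of c m] by linarith
        qed
        have s: "p + c*m + (k-n)*m = p + (c + (k-n))*m" by (simp add: distrib_right)
        have "Suc (c + (k-n)) * m \<le> k*m" using that k by (intro mult_le_mono1) auto
        then have b2: "p + (c + (k-n))*m < M" unfolding M_def using that(1) mult_Suc[of "c + (k-n)" m] by linarith
        have "Y $$ (p + c*m, l) = y_vec m A k $$ (p + (c + (k-n))*m, l)"
          unfolding Y_def adj_sel_mult[OF yc] using b b2 il by (simp add: s)
        also have "\<dots> = A ((p + (c + (k-n))*m) div m + 1) $$ ((p + (c + (k-n))*m) mod m, l)"
          unfolding y_vec_def using b2 il by (subst index_mat(1)) (auto simp: M_def)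
        finally show ?thesis using that(1) by simp
      qed
      have "(W * Y) $$ (i,l) = (\<Sum>a<L. W $$ (i,a) * Y $$ (a,l))" using Wc Yc il by (simp add: scalar_prod_def atLeast0LessThan)
      also have "\<dots> = (\<Sum>c<n. \<Sum>p<m. W $$ (i, p + c*m) * Y $$ (p + c*m, l))" unfolding L_def by (rule block_sum)
      also have "\<dots> = (\<Sum>c<n. \<Sum>p<m. W $$ (i, p + c*m) * A (c + (k-n) + 1) $$ (p,l))" by (intro sum.cong refl) (simp add: Ye)
      finally have e: "(W * Y) $$ (i,l) = (\<Sum>c<n. \<Sum>p<m. W $$ (i, p + c*m) * A (c + (k-n) + 1) $$ (p,l))" .
      have "W * adj (sel (k*m) (n*m) ((k-n)*m)) * y_vec m A k = W * Y"
        unfolding Y_def M_def[symmetric] L_def[symmetric] by (rule assoc_mult_mat[OF Wc ac yc])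
      then have "A t $$ (i,l) = - (W * Y) $$ (i,l)"
        unfolding k(1) rec[OF k(2)] using Wc Yc il by simp
      then show ?thesis unfolding e by simp
    qed
    finally show ?thesis by simp
  qed
  have "(\<Sum>t\<le>n. fps_nth G t * w ^ t) = poly (\<Sum>t\<le>n. monom (fps_nth G t) t) w" for w by (simp add: poly_sum poly_monom)
  then show ?thesis using fps_expansion_polynomial[of _ G n, OF hG] high by (intro exI[of _ "\<Sum>t\<le>n. monom (fps_nth G t) t"]) simp
qed

section \<open>Continuation of the local identities to the rational extension\<close>

lemma identity_off_finite:
  assumes E: "finite E" "0 \<notin> E" and g: "g holomorphic_on (- E)" and h: "h holomorphic_on UNIV"
    and ev: "\<forall>\<^sub>F w in nhds 0. g w = h w" and w: "w \<notin> E"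
  shows "g w = h w"
proof -
  obtain U where U: "open U" "0 \<in> U" "\<And>w. w \<in> U \<Longrightarrow> g w = h w" using ev unfolding eventually_nhds by blast
  have op: "open (- E)" using E finite_imp_closed by auto
  have "connected (UNIV - E)" by (rule connected_open_delete_finite) (use E in auto)
  then have cn: "connected (- E)" by (simp add: Compl_eq_Diff_UNIV)
  show ?thesis
  proof (rule analytic_continuation_open[of "U \<inter> - E" "- E" g h])
    show "open (U \<inter> - E)" "open (- E)" using U op by auto
    show "U \<inter> - E \<noteq> {}" using U E by blast
    show "h holomorphic_on (- E)" using h holomorphic_on_subset by blast
  qed (use cn g U w in auto)
qed

lemma adj_mat_solve:
  fixes X R :: "complex mat"
  assumes "X \<in> carrier_mat m m" "R \<in> carrier_mat m m" "det R \<noteq> 0"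
  shows "X = (1 / det R) \<cdot>\<^sub>m ((X * R) * adj_mat R)" "X = (1 / det R) \<cdot>\<^sub>m (adj_mat R * (R * X))"
proof -
  note ad = adj_mat[OF assms(2)]
  have "(X * R) * adj_mat R = X * (det R \<cdot>\<^sub>m 1\<^sub>m m)" unfolding ad(2)[symmetric] by (rule assoc_mult_mat[OF assms(1,2) ad(1)])
  also have "\<dots> = det R \<cdot>\<^sub>m X" using assms(1) by (simp add: mult_smult_distrib[OF assms(1) one_carrier_mat])
  finally show "X = (1 / det R) \<cdot>\<^sub>m ((X * R) * adj_mat R)" using assms by (auto intro!: eq_matI simp: field_simps)
  have "adj_mat R * (R * X) = (det R \<cdot>\<^sub>m 1\<^sub>m m) * X" unfolding ad(3)[symmetric] by (rule assoc_mult_mat[symmetric, OF ad(1) assms(2,1)])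
  also have "\<dots> = det R \<cdot>\<^sub>m X" using assms(1) by (simp add: mult_smult_assoc_mat[OF one_carrier_mat assms(1)])
  finally show "X = (1 / det R) \<cdot>\<^sub>m (adj_mat R * (R * X))" using assms by (auto intro!: eq_matI simp: field_simps)
qed

lemma polyfun_inverse_det_conv:
  assumes R: "polyfun.mat_fun m m R" and d: "det (R z) \<noteq> 0"
  shows "\<exists>c. ((\<lambda>w. 1 / det (R w)) \<longlongrightarrow> c) (at z)" "\<forall>\<^sub>F w in at z. det (R w) \<noteq> 0"
proof -
  obtain q where q: "\<And>w. det (R w) = poly q w" using polyfun.det[OF R] by blast
  have l: "((\<lambda>w. poly q w) \<longlongrightarrow> poly q z) (at z)" by (intro tendsto_intros)
  show "\<exists>c. ((\<lambda>w. 1 / det (R w)) \<longlongrightarrow> c) (at z)" unfolding q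
    by (rule exI, rule tendsto_divide[OF tendsto_const l]) (use d q in simp)
  show "\<forall>\<^sub>F w in at z. det (R w) \<noteq> 0" unfolding q using tendsto_imp_eventually_ne[OF l] d q by simp
qed

lemma y_vec_cong: "(\<And>j. j \<le> n \<Longrightarrow> A j = A' j) \<Longrightarrow> y_vec m A n = y_vec m A' n"
  unfolding y_vec_def by (rule cong_mat) (auto simp: Suc_le_eq less_mult_imp_div_less)

lemma z_vec_cong: "(\<And>j. j \<le> n \<Longrightarrow> A j = A' j) \<Longrightarrow> z_vec m A n = z_vec m A' n"
  unfolding z_vec_def by (rule cong_mat) auto

lemma polyfun_holomorphic:
  assumes "polyfun.mat_fun n k M" "i < n" "j < k"
  shows "(\<lambda>w. M w $$ (i,j)) holomorphic_on U"
proof -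
  obtain p where "\<And>w. M w $$ (i,j) = poly p w" using polyfun.mat_funD(2)[OF assms] by blast
  then show ?thesis by (simp add: holomorphic_intros)
qed

text \<open>The condition on \<open>z\<close> allows either polynomial to be singular there;
  regularity of \<open>fd\<close> comes from whichever one is invertible. The defect argument then
  runs through \<open>rho_poly\<close> by way of the product \<open>fd z * X\<close> with
  \<open>X\<close> the value of \<open>rho_poly\<close> at \<open>z\<close>, which works even if
  \<open>X\<close> is singular: \<open>J\<close>-unitarity of \<open>fd z\<close> kills the defect
  for every \<open>X\<close>.\<close>

lemma unitary_point_imp_uniqueness:
  fixes A :: "nat \<Rightarrow> complex mat"
  assumes sig: "signature_mat m J" and cen: "J_central_fun m J A n fc" and rext: "rational_ext m fc fd"
    and VW: "n \<ge> 1 \<Longrightarrow> V \<in> Y_set m J A n \<and> W \<in> Z_set m J A n"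
    and z: "cmod z = 1" and nz: "\<not> (det (rho_poly m n V z) = 0 \<and> det (tau_poly m n W z) = 0)"
    and un: "J_unitary J (fd z)"
    and f: "PJ0 m J f" "\<And>j. j \<le> n \<Longrightarrow> taylor0 m f j = A j"
  shows "mero_eq f fc"
proof -
  have J: "J \<in> carrier_mat m m" using sig by (simp add: signature_mat_def)
  define A' where "A' = taylor0 m fc"
  have pf: "PJ0 m J fc" and agr: "\<And>j. j \<le> n \<Longrightarrow> A j = A' j" and cenA: "\<And>k. k > n \<Longrightarrow> A' k = M_mat m J A' k"
    using cen unfolding J_central_fun_def A'_def by auto
  have Ac: "A' j \<in> carrier_mat m m" for j by (simp add: A'_def)
  have psdA: "psd (Q_mat m J A' k)" for k unfolding A'_def by (rule PJ0_toeplitz_psd[OF sig pf])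
  \<comment> \<open>For \<open>n = 0\<close> the assumptions leave the formats of \<open>V\<close>
    and \<open>W\<close> open, while the recursion lemmas ask for definite ones; both polynomials
    are constant in that case.\<close>
  define V' where "V' = (if n = 0 then 0\<^sub>m (n*m) m else V)"
  define W' where "W' = (if n = 0 then 0\<^sub>m m (n*m) else W)"
  have Sc: "S_blk m A (n-1) = S_blk m A' (n-1)" by (rule S_blk_cong) (use agr in auto)
  have yc: "y_vec m A n = y_vec m A' n" by (rule y_vec_cong) (rule agr)
  have zc: "z_vec m A n = z_vec m A' n" by (rule z_vec_cong) (rule agr)
  have YZ: "V' \<in> Y_set m J A' n \<and> W' \<in> Z_set m J A' n" if n: "n \<ge> 1"
    using VW[OF n] n unfolding V'_def W'_def Y_set_def Z_set_def Q_mat_def P_mat_def Sc yc zc by simp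
  have VWc: "V' \<in> carrier_mat (n*m) m \<and> W' \<in> carrier_mat m (n*m)"
  proof (cases "n = 0")
    case True
    then show ?thesis by (simp add: V'_def W'_def)
  next
    case False
    then show ?thesis using YZ by (simp add: Y_set_def Z_set_def)
  qed
  then have Vc: "V' \<in> carrier_mat (n*m) m" and Wc: "W' \<in> carrier_mat m (n*m)" by auto
  have rt: "rho_poly m n V = rho_poly m n V'" "tau_poly m n W = tau_poly m n W'"
    by (rule ext, simp add: rho_poly_def tau_poly_def V'_def W'_def)+
  have rec1: "A' (Suc k) = - (z_vec m A' k * (sel (k*m) (n*m) 0 * V'))" if "k \<ge> n" for k
    by (rule central_recursion(1)[OF sig Ac psdA _ Vc Wc _ that]) (rule cenA, assumption, rule YZ, assumption)
  have rec2: "A' (Suc k) = - (W' * adj (sel (k*m) (n*m) ((k-n)*m)) * y_vec m A' k)" if "k \<ge> n" for k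
    by (rule central_recursion(2)[OF sig Ac psdA _ Vc Wc _ that]) (rule cenA, assumption, rule YZ, assumption)
  obtain S0 where md: "mero_disc m fc S0" "0 \<notin> S0" using pf unfolding PJ0_def by blast
  obtain E where "rational_ext_on m fc fd E" using rext unfolding rational_ext_iff ..
  note Ed = rational_ext_onD[OF this]
  define Af where "Af i j = fps_expansion (\<lambda>w. fc w $$ (i,j)) 0" for i j
  note Afx = mero_disc_fps[OF md, folded Af_def A'_def]
  have op: "open (- E)" using Ed(1) finite_imp_closed by auto
  have opS: "open (DD - S0)" by (rule mero_disc_open[OF md(1)])
  \<comment> \<open>\<open>fc\<close> is holomorphic at 0 and agrees with \<open>fd\<close> nearby,
    so \<open>fd\<close> has no pole there. Identities of germs at 0 can then be continued over the
    connected complement of \<open>E\<close>.\<close>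
  have E0: "0 \<notin> E"
  proof
    assume 0: "0 \<in> E"
    define Y where "Y w = mat m m (\<lambda>ij. fc w $$ ij)" for w
    have "\<exists>c. ((\<lambda>w. fc w $$ (i,j)) \<longlongrightarrow> c) (at 0)" if "i < m" "j < m" for i j
    proof -
      have h: "(\<lambda>w. fc w $$ (i,j)) holomorphic_on (DD - S0)" using md that by (auto simp: mero_disc_def)
      have "isCont (\<lambda>w. fc w $$ (i,j)) 0"
        using holomorphic_on_imp_continuous_on[OF h] opS md(2) by (simp add: continuous_on_eq_continuous_at)
      then show ?thesis unfolding isCont_def by blast
    qed
    then have Yc: "conv.mat_fun (at 0) m m Y" unfolding conv.mat_fun_def Y_def by simp
    have "\<forall>\<^sub>F w in at 0. w \<in> DD - S0" by (rule eventually_at_in_open'[OF opS]) (use md(2) in simp)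
    then have "\<forall>\<^sub>F w in at 0. fd w = Y w" using eventually_not_in_finite[OF Ed(1)]
    proof eventually_elim
      case (elim w)
      then have "fd w = fc w" using Ed(6)[of w] by simp
      moreover have "fc w \<in> carrier_mat m m" using md(1) elim(1) unfolding mero_disc_def by blast
      ultimately show ?case by (auto simp: Y_def intro!: eq_matI)
    qed
    then show False using not_pole_of_convergent[OF Yc] Ed(5)[OF 0] by blast
  qed
  have "\<forall>\<^sub>F w in nhds 0. w \<in> DD \<inter> - E" by (rule eventually_nhds_in_open) (use op E0 in auto)
  then have near: "\<forall>\<^sub>F w in nhds 0. fd w = fc w" by eventually_elim (simp add: Ed(6))
  define R where "R = rhohat m n V'"
  define Sn where "Sn = S_blk m A' n"
  have Rc: "R \<in> carrier_mat ((n+1)*m) m" unfolding R_def by (rule rhohat_carrier[OF Vc])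
  have SRc: "Sn * R \<in> carrier_mat ((n+1)*m) m" unfolding Sn_def by (rule mult_carrier_mat[OF S_blk_carrier Rc])
  have re: "rho_poly m n V' = (\<lambda>w. e_row m n w * R)" by (rule ext) (simp only: rho_poly_eq_rhohat[OF Vc] R_def)
  have rhop: "polyfun.mat_fun m m (rho_poly m n V')" unfolding re
    by (rule polyfun.mat_fun_mult[OF polyfun_e_row polyfun.mat_fun_const[OF Rc]])
  have Np: "polyfun.mat_fun m m (\<lambda>w. e_row m n w * (Sn * R))"
    by (rule polyfun.mat_fun_mult[OF polyfun_e_row polyfun.mat_fun_const[OF SRc]])
  have taup: "polyfun.mat_fun m m (tau_poly m n W')" by (rule polyfun_tau[OF Wc])
  note rc = polyfun.mat_funD(1)[OF rhop] and Nc = polyfun.mat_funD(1)[OF Np] and tc = polyfun.mat_funD(1)[OF taup]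
  have rhoe: "fd w * rho_poly m n V' w = e_row m n w * (Sn * R)" if w: "w \<notin> E" for w
  proof (rule eq_matI)
    show "dim_row (fd w * rho_poly m n V' w) = dim_row (e_row m n w * (Sn * R))"
      "dim_col (fd w * rho_poly m n V' w) = dim_col (e_row m n w * (Sn * R))"
      using Ed(2)[OF w] rc[of w] Nc[of w] by auto
    fix i l assume "i < dim_row (e_row m n w * (Sn * R))" "l < dim_col (e_row m n w * (Sn * R))"
    then have il: "i < m" "l < m" using Nc[of w] by auto
    have ev1: "\<forall>\<^sub>F w in nhds 0. (\<Sum>p<m. fc w $$ (i,p) * rho_poly m n V' w $$ (p,l)) = (e_row m n w * (Sn * R)) $$ (i,l)"
      unfolding Sn_def R_def by (rule central_rho_expansion[OF Ac Vc rec1 il Afx(1)[OF il(1)] Afx(2)[OF il(1)]])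
    have ev: "\<forall>\<^sub>F w in nhds 0. (\<Sum>p<m. fd w $$ (i,p) * rho_poly m n V' w $$ (p,l)) = (e_row m n w * (Sn * R)) $$ (i,l)"
      using near ev1 by eventually_elim simp
    have "(fd w * rho_poly m n V' w) $$ (i,l) = (\<Sum>p<m. fd w $$ (i,p) * rho_poly m n V' w $$ (p,l))"
      using Ed(2)[OF w] rc[of w] il by (simp add: scalar_prod_def atLeast0LessThan)
    also have "\<dots> = (e_row m n w * (Sn * R)) $$ (i,l)"
    proof (rule identity_off_finite[OF Ed(1) E0 _ _ ev w])
      show "(\<lambda>w. \<Sum>p<m. fd w $$ (i,p) * rho_poly m n V' w $$ (p,l)) holomorphic_on - E"
        using il by (intro holomorphic_intros Ed(3) polyfun_holomorphic[OF rhop]) auto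
      show "(\<lambda>w. (e_row m n w * (Sn * R)) $$ (i,l)) holomorphic_on UNIV" by (rule polyfun_holomorphic[OF Np il])
    qed
    finally show "(fd w * rho_poly m n V' w) $$ (i,l) = (e_row m n w * (Sn * R)) $$ (i,l)" .
  qed
  have zE: "z \<notin> E"
  proof
    assume zE: "z \<in> E"
    have ev0: "\<forall>\<^sub>F w in at z. w \<notin> E" by (rule eventually_not_in_finite[OF Ed(1)])
    consider "det (rho_poly m n V' z) \<noteq> 0" | "det (tau_poly m n W' z) \<noteq> 0" using nz unfolding rt by blast
    then show False
    proof cases
      case 1
      note d = polyfun_inverse_det_conv[OF rhop 1]
      define Y where "Y w = (1 / det (rho_poly m n V' w)) \<cdot>\<^sub>m ((e_row m n w * (Sn * R)) * adj_mat (rho_poly m n V' w))" for w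
      have Yc: "conv.mat_fun (at z) m m Y" unfolding Y_def
        by (rule conv.mat_fun_smult[OF d(1) conv.mat_fun_mult[OF polyfun_mat_conv[OF Np] polyfun_mat_conv[OF polyfun.mat_fun_adj_mat[OF rhop]]]])
      have "\<forall>\<^sub>F w in at z. fd w = Y w" using ev0 d(2)
      proof eventually_elim
        case (elim w)
        show ?case unfolding Y_def rhoe[OF elim(1), symmetric] by (rule adj_mat_solve(1)[OF Ed(2)[OF elim(1)] rc elim(2)])
      qed
      then show False using not_pole_of_convergent[OF Yc] Ed(5)[OF zE] by blast
    next
      case 2
      note d = polyfun_inverse_det_conv[OF taup 2]
      define T where "T i l w = (\<Sum>p<m. tau_poly m n W' w $$ (i,p) * fd w $$ (p,l))" for i l w
      have "\<exists>P. \<forall>w. w \<notin> E \<longrightarrow> T i l w = poly P w" if il: "i < m" "l < m" for i l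
      proof -
        obtain P where P: "\<forall>\<^sub>F w in nhds 0. (\<Sum>p<m. tau_poly m n W' w $$ (i,p) * fc w $$ (p,l)) = poly P w"
          using central_tau_expansion[OF Ac Wc rec2 il, of "\<lambda>p w. fc w $$ (p,l)" "\<lambda>p. Af p l", OF _ Afx(1)[OF _ il(2)] Afx(2)[OF _ il(2)]] by blast
        have ev: "\<forall>\<^sub>F w in nhds 0. T i l w = poly P w" using near P by eventually_elim (simp add: T_def)
        have "T i l w = poly P w" if w: "w \<notin> E" for w
        proof (rule identity_off_finite[OF Ed(1) E0 _ _ ev w])
          show "T i l holomorphic_on - E" unfolding T_def
            using il by (intro holomorphic_intros Ed(3) polyfun_holomorphic[OF taup]) auto
          show "poly P holomorphic_on UNIV" by (intro holomorphic_intros)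
        qed
        then show ?thesis by blast
      qed
      then have "\<forall>i l. \<exists>P. i < m \<longrightarrow> l < m \<longrightarrow> (\<forall>w. w \<notin> E \<longrightarrow> T i l w = poly P w)" by blast
      then obtain P where P: "\<And>i l w. i < m \<Longrightarrow> l < m \<Longrightarrow> w \<notin> E \<Longrightarrow> T i l w = poly (P i l) w" by metis
      define Tm where "Tm w = mat m m (\<lambda>(i,l). poly (P i l) w)" for w
      have Tp: "polyfun.mat_fun m m Tm" unfolding polyfun.mat_fun_def Tm_def by auto
      have taue: "tau_poly m n W' w * fd w = Tm w" if w: "w \<notin> E" for w
      proof (rule eq_matI)
        fix i l assume "i < dim_row (Tm w)" "l < dim_col (Tm w)"
        then have il: "i < m" "l < m" by (auto simp: Tm_def)
        have "(tau_poly m n W' w * fd w) $$ (i,l) = T i l w"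
          using Ed(2)[OF w] tc[of w] il by (simp add: T_def scalar_prod_def atLeast0LessThan)
        then show "(tau_poly m n W' w * fd w) $$ (i,l) = Tm w $$ (i,l)" using P[OF il w] il by (simp add: Tm_def)
      qed (use Ed(2)[OF w] tc[of w] in \<open>auto simp: Tm_def\<close>)
      define Y where "Y w = (1 / det (tau_poly m n W' w)) \<cdot>\<^sub>m (adj_mat (tau_poly m n W' w) * Tm w)" for w
      have Yc: "conv.mat_fun (at z) m m Y" unfolding Y_def
        by (rule conv.mat_fun_smult[OF d(1) conv.mat_fun_mult[OF polyfun_mat_conv[OF polyfun.mat_fun_adj_mat[OF taup]] polyfun_mat_conv[OF Tp]]])
      have "\<forall>\<^sub>F w in at z. fd w = Y w" using ev0 d(2)
      proof eventually_elim
        case (elim w)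
        show ?case unfolding Y_def taue[OF elim(1), symmetric] by (rule adj_mat_solve(2)[OF Ed(2)[OF elim(1)] tc elim(2)])
      qed
      then show False using not_pole_of_convergent[OF Yc] Ed(5)[OF zE] by blast
    qed
  qed
  interpret ts: toeplitz_shift m n J A' by unfold_locales (use sig Ac in auto)
  have head: "adj (sel ((n+1)*m) m 0) * R = 1\<^sub>m m" unfolding R_def by (rule rhohat_head[OF Vc])
  have "\<exists>C\<in>carrier_mat m m. Q_mat m J A' n * rhohat m n V' = sel ((n+1)*m) m 0 * C"
    by (rule Q_rhohat[OF sig Ac Vc]) (use YZ in blast)
  then obtain C where C: "C \<in> carrier_mat m m" "Q_mat m J A' n * R = sel ((n+1)*m) m 0 * C" unfolding R_def ..
  define X where "X = e_row m n z * R"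
  have Xc: "X \<in> carrier_mat m m" using rc[of z] unfolding re X_def .
  have fc: "fd z \<in> carrier_mat m m" by (rule Ed(2)[OF zE])
  have FX: "e_row m n z * (Sn * R) = fd z * X" using rhoe[OF zE] unfolding re X_def by simp
  have "adj X * J * X - adj (fd z * X) * J * (fd z * X) = adj C"
    unfolding FX[symmetric] unfolding X_def Sn_def
    by (rule ts.boundary_identity[unfolded ts.N_def ts.F_def ts.Q_def ts.S_def, OF z Rc head C])
  moreover have "adj (fd z * X) * J * (fd z * X) = adj X * J * X"
  proof (rule emb_eqD)
    have "emb (adj (fd z)) * (emb J * (emb (fd z) * Y)) = emb J * Y" for Y
      using un unfolding J_unitary_iff_emb[OF J fc] by (metis mult.assoc)
    then show "emb (adj (fd z * X) * J * (fd z * X)) = emb (adj X * J * X)"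
      using J Xc fc by (simp add: adj_simps emb_ring mult.assoc)
  qed (use J Xc fc in auto)
  moreover have "adj X * J * X - adj X * J * X = 0\<^sub>m m m"
    by (rule minus_r_inv_mat) (use J Xc in \<open>auto simp: adj_def\<close>)
  ultimately have "adj C = 0\<^sub>m m m" by metis
  then have "C = 0\<^sub>m m m" using adj_adj[of C] by (metis adj_simps(7))
  then have QR: "Q_mat m J A' n * R = 0\<^sub>m ((n+1)*m) m" using C by simp
  have "taylor0 m f k = A' k" for k
  proof (rule degenerate_unique[OF sig Ac psdA _ _ _ Rc head QR, symmetric])
    show "taylor0 m f j \<in> carrier_mat m m" for j by simp
    show "psd (Q_mat m J (taylor0 m f) j)" for j by (rule PJ0_toeplitz_psd[OF sig f(1)])
    show "A' j = taylor0 m f j" if "j \<le> n" for j using f(2)[OF that] agr[OF that] by simp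
  qed
  then show ?thesis unfolding A'_def by (rule PJ0_identity[OF f(1) pf])
qed

text \<open>The value of \<open>rho_poly\<close> at 0 is the identity, so its determinant is a
  nonzero polynomial. A point of the circle taken from almost everywhere statements can therefore
  avoid its zeros.\<close>

lemma finite_det_rho_zeros:
  assumes V: "n \<ge> 1 \<Longrightarrow> V \<in> carrier_mat (n*m) m"
  shows "finite {z. det (rho_poly m n V z) = 0}"
proof (cases "n = 0")
  case True
  then show ?thesis by (simp add: rho_poly_def)
next
  case False
  then have Vc: "V \<in> carrier_mat (n*m) m" using V by simp
  have re: "rho_poly m n V = (\<lambda>w. e_row m n w * rhohat m n V)" by (rule ext) (rule rho_poly_eq_rhohat[OF Vc])
  have "polyfun.mat_fun m m (rho_poly m n V)" unfolding re
    by (rule polyfun.mat_fun_mult[OF polyfun_e_row polyfun.mat_fun_const[OF rhohat_carrier[OF Vc]]])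
  from polyfun.det[OF this] obtain p where p: "\<And>w. det (rho_poly m n V w) = poly p w" by blast
  have "rho_poly m n V 0 = 1\<^sub>m m" using False Vc by (auto simp: rho_poly_def e_row_def intro!: eq_matI)
  then have "poly p 0 \<noteq> 0" using p[of 0] by simp
  then have "p \<noteq> 0" by auto
  then show ?thesis unfolding p by (rule poly_roots_finite)
qed

text \<open>\<open>V\<close> and \<open>W\<close> are arbitrary admissible solutions, so the
  equivalence is obtained for every choice of them and the last condition does not depend on that
  choice.\<close>

theorem theorem4p10:
  fixes m n :: nat and J :: "complex mat" and A :: "nat \<Rightarrow> complex mat"
    and fc fd :: "complex \<Rightarrow> complex mat" and V W :: "complex mat"
  assumes "signature_mat m J"
    and "J_Potapov_seq m J A n"
    and "J_central_fun m J A n fc"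
    and "rational_ext m fc fd"
    and "n \<ge> 1 \<Longrightarrow> V \<in> Y_set m J A n \<and> W \<in> Z_set m J A n"
  shows "((\<forall>f. PJ0 m J f \<and> (\<forall>j\<le>n. taylor0 m f j = A j) \<longrightarrow> mero_eq f fc)
          \<longleftrightarrow> (\<exists>B E. BP_product m J B \<and> finite E \<and> (\<forall>w. w \<notin> E \<longrightarrow> B w = fd w)))
       \<and> ((\<exists>B E. BP_product m J B \<and> finite E \<and> (\<forall>w. w \<notin> E \<longrightarrow> B w = fd w))
          \<longleftrightarrow> J_inner m J fc)
       \<and> (J_inner m J fc
          \<longleftrightarrow> (\<exists>z. cmod z = 1 \<and>
                 \<not> (det (rho_poly m n V z) = 0 \<and> det (tau_poly m n W z) = 0) \<and>
                 J_unitary J (fd z)))"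
proof (intro conjI iffI)
  note sig = assms(1) and pot = assms(2) and cen = assms(3) and ext = assms(4)
  have J: "J \<in> carrier_mat m m" using sig by (simp add: signature_mat_def)
  have PJ0: "PJ0 m J fc" using cen by (simp add: J_central_fun_def)
  let ?i = "\<forall>f. PJ0 m J f \<and> (\<forall>j\<le>n. taylor0 m f j = A j) \<longrightarrow> mero_eq f fc"
  let ?ii = "\<exists>B E. BP_product m J B \<and> finite E \<and> (\<forall>w. w \<notin> E \<longrightarrow> B w = fd w)"
  let ?iii = "J_inner m J fc"
  let ?iv = "\<exists>z. cmod z = 1 \<and> \<not> (det (rho_poly m n V z) = 0 \<and> det (tau_poly m n W z) = 0) \<and> J_unitary J (fd z)"
  \<comment> \<open>The four conditions form one cycle, (i) to (ii) to (iii) to (iv) and back to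
    (i); every other direction goes around it.\<close>
  have 12: ?ii if ?i by (rule uniqueness_imp_BP[OF sig pot ext]) (use that in blast)
  have 23: ?iii if h: ?ii
  proof -
    obtain B E where "BP_product m J B" "finite E" "\<And>w. w \<notin> E \<Longrightarrow> B w = fd w" using h by blast
    then show ?thesis by (rule BP_imp_inner[OF sig PJ0 ext])
  qed
  have 34: ?iv if ?iii
  proof -
    have "finite {z. det (rho_poly m n V z) = 0}"
      by (rule finite_det_rho_zeros) (use assms(5) in \<open>simp add: Y_set_def\<close>)
    from inner_imp_unitary_point[OF J that ext this] show ?thesis by blast
  qed
  have 41: ?i if h: ?iv
  proof -
    obtain z where z: "cmod z = 1" "\<not> (det (rho_poly m n V z) = 0 \<and> det (tau_poly m n W z) = 0)" "J_unitary J (fd z)"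
      using h by blast
    have "mero_eq f fc" if "PJ0 m J f" "\<forall>j\<le>n. taylor0 m f j = A j" for f
      by (rule unitary_point_imp_uniqueness[OF sig cen ext assms(5) z that(1)]) (use that(2) in blast)+
    then show ?thesis by blast
  qed
  show ?ii if ?i using 12[OF that] .
  show ?i if ?ii using 41[OF 34[OF 23[OF that]]] .
  show ?iii if ?ii using 23[OF that] .
  show ?ii if ?iii using 12[OF 41[OF 34[OF that]]] .
  show ?iv if ?iii using 34[OF that] .
  show ?iii if ?iv using 23[OF 12[OF 41[OF that]]] .
qed

end
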